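(* Let $V_h^0=\prod_KV_h^0(K)$ and $V_h^1=\prod_KV_h^1(K)$ be the discontinuous Lagrange and Nédélec spaces described in the context. There exists a subspace $\widehat V_h^1\subset H(\operatorname{curl};\Omega)$ such that solutions $A_h$ of Nédélec's method (N) are equivalent to solutions $(A_h,\widehat H_h)$ of the hybrid method (Hy), i.e., $A_h$ solves (N) if and only if there is $\widehat H_h$ such that $(A_h,\widehat H_h)$ solves (Hy). Consequently, given a solution $A_h$ of Nédélec's method (N), there exist $\widehat H_h$ such that $(A_h,\widehat H_h)$ solves (Hy) and $\widehat D_h(t)\in H(\operatorname{div};\Omega)$ satisfying $$\dot{\widehat D}_h+J=\operatorname{curl}\widehat H_h,$$ which preserves the charge-conservation constraints $$\int_K(\operatorname{grad}\varphi_h'\cdot D_h+\varphi_h'\rho)-\int_{\partial K}\varphi_h'\,\widehat D_h\cdot\mathbf{n}=0\quad\forall\varphi_h'\in V_h^0(K),\ \forall K\in\mathcal{T}_h,\qquad\text{and}\qquad\operatorname{div}\widehat D_h=\rho,$$ in the sense that each constraint holds for all time if it holds at the initial time; and if the initial value of $D_h$ satisfies $\int_\Omega(\operatorname{grad}\xi_h\cdot D_h+\xi_h\rho)=0$ for all $\xi_h\in V_h^0\cap\mathring{H}^1(\Omega)$, then $\widehat D_h$ can be chosen so that both constraints hold at the initial time and hence for all time.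
   Context: Setting. $\Omega\subset\mathbb{R}^3$ is a bounded polyhedral Lipschitz domain with a triangulation $\mathcal{T}_h$ by tetrahedra $K$; $\mathbf{n}$ denotes outer unit normals. $H^1$, $H(\operatorname{curl})$, $H(\operatorname{div})$ are the usual spaces of $L^2$ functions/fields with $L^2$ gradient, curl, divergence; $\mathring{H}^1(\Omega)$ and $\mathring{H}(\operatorname{curl};\Omega)$ are the subspaces with $u|_{\partial\Omega}=0$, respectively $u\times\mathbf{n}|_{\partial\Omega}=0$, in the trace sense; $H^1(\mathcal{T}_h)$, $H(\operatorname{curl};\mathcal{T}_h)$ are the spaces of $L^2$ functions/fields whose restriction to each $K$ is in $H^1(K)$, respectively $H(\operatorname{curl};K)$. Time $t$ ranges over an interval containing an initial time, and a dot denotes $\partial_t$. The tensors $\epsilon=\epsilon_{ij}(x,t)$ and $\mu=\mu_{ij}(x,t)$ are $L^\infty$, symmetric and uniformly elliptic. The current density $J$ is a given $C^0$ curve in $H(\operatorname{div};\Omega)$ and the charge density $\rho$ is a given $C^1$ curve in $L^2(\Omega)$, with $\dot\rho+\operatorname{div}J=0$. Finite element spaces. $V_h^0(K)=P_r(K)$, polynomials of degree at most $r$ on $K$. $V_h^1(K)$ is one of the following (the same choice for all $K$): degree-$r$ Nédélec edge elements of the first kind, $\{p+x\times q: p,q\in P_{r-1}(K)^3\}$ with $r\ge1$; or degree-$(r-1)$ Nédélec edge elements of the second kind, $P_{r-1}(K)^3$ with $r\ge2$. $V_h^0=\prod_KV_h^0(K)\subset H^1(\mathcal{T}_h)$ and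 $V_h^1=\prod_KV_h^1(K)\subset H(\operatorname{curl};\mathcal{T}_h)$. The conforming Nédélec space is $V_h^1\cap\mathring{H}(\operatorname{curl};\Omega)$. Given a $C^1$ curve $A_h$ in $V_h^1$, set (curl elementwise) $E_h=-\dot A_h$, $B_h=\operatorname{curl}A_h$, $D_h=\epsilon E_h$, $H_h=\mu^{-1}B_h$; only $A_h$ for which $D_h$ is a $C^1$ curve and $H_h$ is a $C^0$ curve in $L^2(\Omega,\mathbb{R}^3)$ are considered. Nédélec's method (N): $A_h$ is a $C^1$ curve in $V_h^1\cap\mathring{H}(\operatorname{curl};\Omega)$ such that at all times $$\int_\Omega\bigl(A_h'\cdot(\dot D_h+J)-\operatorname{curl}A_h'\cdot H_h\bigr)=0\quad\forall A_h'\in V_h^1\cap\mathring{H}(\operatorname{curl};\Omega).$$ Hybrid method (Hy), for a subspace $\widehat V_h^1\subset H(\operatorname{curl};\Omega)$: $A_h$ is a $C^1$ curve in $V_h^1$ and $\widehat H_h$ is a $C^0$ curve in $\widehat V_h^1$ such that at all times $$\int_K\bigl(A_h'\cdot(\dot D_h+J)-\operatorname{curl}A_h'\cdot H_h\bigr)+\int_{\partial K}(A_h'\times\widehat H_h)\cdot\mathbf{n}=0\quad\forall A_h'\in V_h^1(K),\ \forall K\in\mathcal{T}_h,$$ $$\sum_{K\in\mathcal{T}_h}\int_{\partial K}(A_h\times\widehat H_h')\cdot\mathbf{n}=0\quad\forall\widehat H_h'\in\widehat V_h^1.$$ Boundary integrals are in the trace (duality) sense: $\int_{\partial K}(u\times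 v)\cdot\mathbf{n}=\int_K(\operatorname{curl}u\cdot v-u\cdot\operatorname{curl}v)$ for $u,v\in H(\operatorname{curl};K)$, and $\int_{\partial K}\psi\,w\cdot\mathbf{n}=\int_K(\operatorname{grad}\psi\cdot w+\psi\operatorname{div}w)$ for $\psi\in H^1(K)$, $w\in H(\operatorname{div};K)$. *)

theory Defs
  imports "HOL-Analysis.Analysis"
begin

section \<open>Domains and meshes\<close>

definition lipschitz_domain :: "(real^3) set \<Rightarrow> bool" where
  "lipschitz_domain \<Omega> \<longleftrightarrow> open \<Omega> \<and> connected \<Omega> \<and> \<Omega> \<noteq> {} \<and>
     (\<forall>p \<in> frontier \<Omega>. \<exists>\<nu> g L U. norm \<nu> = 1 \<and> lipschitz_on L UNIV (g :: real^3 \<Rightarrow> real) \<and>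
        open U \<and> p \<in> U \<and> \<Omega> \<inter> U = {x \<in> U. g (x - (x \<bullet> \<nu>) *\<^sub>R \<nu>) < x \<bullet> \<nu>})"

text \<open>
  Mesh elements are closed tetrahedra; function spaces on an element K live on \<open>interior K\<close>.
  A bounded domain that admits such a mesh is polyhedral.
\<close>

definition tetrahedral_mesh :: "(real^3) set \<Rightarrow> (real^3) set set \<Rightarrow> bool" where
  "tetrahedral_mesh \<Omega> \<T> \<longleftrightarrow>
     triangulation \<T> \<and> (\<forall>K \<in> \<T>. 3 simplex K) \<and> \<Union>\<T> = closure \<Omega>"


section \<open>Classical operators and test functions\<close>

definition partial :: "3 \<Rightarrow> (real^3 \<Rightarrow> 'b::real_normed_vector) \<Rightarrow> real^3 \<Rightarrow> 'b" where
  "partial k f x = frechet_derivative f (at x) (axis k 1)"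

definition cl_grad :: "(real^3 \<Rightarrow> real) \<Rightarrow> real^3 \<Rightarrow> real^3" where
  "cl_grad f x = (\<chi> k. partial k f x)"

definition cl_curl :: "(real^3 \<Rightarrow> real^3) \<Rightarrow> real^3 \<Rightarrow> real^3" where
  "cl_curl f x = vector [partial 2 f x $ 3 - partial 3 f x $ 2,
                         partial 3 f x $ 1 - partial 1 f x $ 3,
                         partial 1 f x $ 2 - partial 2 f x $ 1]"

definition cl_div :: "(real^3 \<Rightarrow> real^3) \<Rightarrow> real^3 \<Rightarrow> real" where
  "cl_div f x = (\<Sum>k\<in>UNIV. partial k f x $ k)"

primrec Ck :: "nat \<Rightarrow> ('a::euclidean_space \<Rightarrow> 'b::real_normed_vector) \<Rightarrow> bool" where
  "Ck 0 f \<longleftrightarrow> continuous_on UNIV f"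
| "Ck (Suc k) f \<longleftrightarrow> (\<forall>x. f differentiable at x) \<and>
     (\<forall>b\<in>Basis. Ck k (\<lambda>x. frechet_derivative f (at x) b))"

definition test_functions :: "'a::euclidean_space set \<Rightarrow> ('a \<Rightarrow> 'b::real_normed_vector) set" where
  "test_functions S = {\<phi>. (\<forall>k. Ck k \<phi>) \<and> compact (closure {x. \<phi> x \<noteq> 0}) \<and>
                            closure {x. \<phi> x \<noteq> 0} \<subseteq> S}"


section \<open>Square integrable functions and weak derivatives\<close>

text \<open>
  Elements of the spaces below are represented by functions on the whole space of which only
  the values on S matter, up to null sets.  Equality of such elements is equality almost
  everywhere on S, and the norms are seminorms on representatives.
\<close>

definition L2 :: "'a::euclidean_space set \<Rightarrow> ('a \<Rightarrow> 'b::euclidean_space) set" where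
  "L2 S = {f. f \<in> borel_measurable (lebesgue_on S) \<and>
              integrable (lebesgue_on S) (\<lambda>x. (norm (f x))\<^sup>2)}"

definition L2norm :: "'a::euclidean_space set \<Rightarrow> ('a \<Rightarrow> 'b::euclidean_space) \<Rightarrow> real" where
  "L2norm S f = sqrt (LINT x|lebesgue_on S. (norm (f x))\<^sup>2)"

definition has_weak_grad :: "(real^3) set \<Rightarrow> (real^3 \<Rightarrow> real) \<Rightarrow> (real^3 \<Rightarrow> real^3) \<Rightarrow> bool" where
  "has_weak_grad S \<psi> g \<longleftrightarrow> \<psi> \<in> L2 S \<and> g \<in> L2 S \<and>
     (\<forall>\<phi> \<in> test_functions S.
        (LINT x|lebesgue_on S. \<psi> x * cl_div \<phi> x) = - (LINT x|lebesgue_on S. g x \<bullet> \<phi> x))"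

definition has_weak_curl :: "(real^3) set \<Rightarrow> (real^3 \<Rightarrow> real^3) \<Rightarrow> (real^3 \<Rightarrow> real^3) \<Rightarrow> bool" where
  "has_weak_curl S u c \<longleftrightarrow> u \<in> L2 S \<and> c \<in> L2 S \<and>
     (\<forall>\<phi> \<in> test_functions S.
        (LINT x|lebesgue_on S. u x \<bullet> cl_curl \<phi> x) = (LINT x|lebesgue_on S. c x \<bullet> \<phi> x))"

definition has_weak_div :: "(real^3) set \<Rightarrow> (real^3 \<Rightarrow> real^3) \<Rightarrow> (real^3 \<Rightarrow> real) \<Rightarrow> bool" where
  "has_weak_div S w d \<longleftrightarrow> w \<in> L2 S \<and> d \<in> L2 S \<and>
     (\<forall>\<phi> \<in> test_functions S.
        (LINT x|lebesgue_on S. w x \<bullet> cl_grad \<phi> x) = - (LINT x|lebesgue_on S. d x * \<phi> x))"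

text \<open>
  On an open S the choices below are unique up to null sets; they carry no information
  outside the corresponding spaces \<open>H1\<close>, \<open>Hcurl\<close>, \<open>Hdiv\<close>.
\<close>

definition weak_grad :: "(real^3) set \<Rightarrow> (real^3 \<Rightarrow> real) \<Rightarrow> real^3 \<Rightarrow> real^3" where
  "weak_grad S \<psi> = (SOME g. has_weak_grad S \<psi> g)"

definition weak_curl :: "(real^3) set \<Rightarrow> (real^3 \<Rightarrow> real^3) \<Rightarrow> real^3 \<Rightarrow> real^3" where
  "weak_curl S u = (SOME c. has_weak_curl S u c)"

definition weak_div :: "(real^3) set \<Rightarrow> (real^3 \<Rightarrow> real^3) \<Rightarrow> real^3 \<Rightarrow> real" where
  "weak_div S w = (SOME d. has_weak_div S w d)"

definition H1 :: "(real^3) set \<Rightarrow> (real^3 \<Rightarrow> real) set" where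
  "H1 S = {\<psi>. \<exists>g. has_weak_grad S \<psi> g}"

definition Hcurl :: "(real^3) set \<Rightarrow> (real^3 \<Rightarrow> real^3) set" where
  "Hcurl S = {u. \<exists>c. has_weak_curl S u c}"

definition Hdiv :: "(real^3) set \<Rightarrow> (real^3 \<Rightarrow> real^3) set" where
  "Hdiv S = {w. \<exists>d. has_weak_div S w d}"

definition Hcurl_norm :: "(real^3) set \<Rightarrow> (real^3 \<Rightarrow> real^3) \<Rightarrow> real" where
  "Hcurl_norm S u = sqrt ((L2norm S u)\<^sup>2 + (L2norm S (weak_curl S u))\<^sup>2)"

definition Hdiv_norm :: "(real^3) set \<Rightarrow> (real^3 \<Rightarrow> real^3) \<Rightarrow> real" where
  "Hdiv_norm S w = sqrt ((L2norm S w)\<^sup>2 + (L2norm S (weak_div S w))\<^sup>2)"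


section \<open>Traces\<close>

text \<open>
  For open S, \<open>bdry_cross S u v\<close> is the integral of \<open>(u \<times> v) \<cdot> n\<close> and \<open>bdry_flux S \<psi> w\<close> the
  integral of \<open>\<psi> (w \<cdot> n)\<close> over the boundary of S, in the sense of duality.  The trace
  \<open>u \<times> n\<close> is the functional \<open>bdry_cross S u\<close> on \<open>Hcurl S\<close>, and the trace of a scalar \<open>\<psi>\<close> is
  the functional \<open>bdry_flux S \<psi>\<close> on \<open>Hdiv S\<close>, that is, on normal traces.
\<close>

definition bdry_cross :: "(real^3) set \<Rightarrow> (real^3 \<Rightarrow> real^3) \<Rightarrow> (real^3 \<Rightarrow> real^3) \<Rightarrow> real" where
  "bdry_cross S u v = (LINT x|lebesgue_on S. weak_curl S u x \<bullet> v x - u x \<bullet> weak_curl S v x)"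

definition bdry_flux :: "(real^3) set \<Rightarrow> (real^3 \<Rightarrow> real) \<Rightarrow> (real^3 \<Rightarrow> real^3) \<Rightarrow> real" where
  "bdry_flux S \<psi> w = (LINT x|lebesgue_on S. weak_grad S \<psi> x \<bullet> w x + \<psi> x * weak_div S w x)"

definition H1_0 :: "(real^3) set \<Rightarrow> (real^3 \<Rightarrow> real) set" where
  "H1_0 S = {\<psi> \<in> H1 S. \<forall>w \<in> Hdiv S. bdry_flux S \<psi> w = 0}"

definition Hcurl_0 :: "(real^3) set \<Rightarrow> (real^3 \<Rightarrow> real^3) set" where
  "Hcurl_0 S = {u \<in> Hcurl S. \<forall>v \<in> Hcurl S. bdry_cross S u v = 0}"


section \<open>Curves in function spaces\<close>

text \<open>
  \<open>N\<close> is the seminorm and \<open>X\<close> the space in which the curve takes its values; \<open>T\<close> is the time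
  interval (derivatives at its end points are one-sided).
\<close>

definition C0_curve ::
  "(('a \<Rightarrow> 'b::real_normed_vector) \<Rightarrow> real) \<Rightarrow> ('a \<Rightarrow> 'b) set \<Rightarrow> real set \<Rightarrow> (real \<Rightarrow> 'a \<Rightarrow> 'b) \<Rightarrow> bool"
  where "C0_curve N X T u \<longleftrightarrow> (\<forall>t\<in>T. u t \<in> X) \<and>
     (\<forall>t\<in>T. ((\<lambda>s. N (\<lambda>x. u s x - u t x)) \<longlongrightarrow> 0) (at t within T))"

definition has_curve_derivative ::
  "(('a \<Rightarrow> 'b::real_normed_vector) \<Rightarrow> real) \<Rightarrow> ('a \<Rightarrow> 'b) set \<Rightarrow> real set \<Rightarrow>
   (real \<Rightarrow> 'a \<Rightarrow> 'b) \<Rightarrow> (real \<Rightarrow> 'a \<Rightarrow> 'b) \<Rightarrow> bool"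
  where "has_curve_derivative N X T u u' \<longleftrightarrow> (\<forall>t\<in>T. u t \<in> X \<and> u' t \<in> X) \<and>
     (\<forall>t\<in>T. ((\<lambda>s. N (\<lambda>x. (u s x - u t x) /\<^sub>R (s - t) - u' t x)) \<longlongrightarrow> 0) (at t within T))"

definition C1_curve ::
  "(('a \<Rightarrow> 'b::real_normed_vector) \<Rightarrow> real) \<Rightarrow> ('a \<Rightarrow> 'b) set \<Rightarrow> real set \<Rightarrow> (real \<Rightarrow> 'a \<Rightarrow> 'b) \<Rightarrow> bool"
  where "C1_curve N X T u \<longleftrightarrow> (\<exists>u'. has_curve_derivative N X T u u' \<and> C0_curve N X T u')"

definition curve_derivative ::
  "(('a \<Rightarrow> 'b::real_normed_vector) \<Rightarrow> real) \<Rightarrow> ('a \<Rightarrow> 'b) set \<Rightarrow> real set \<Rightarrow>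
   (real \<Rightarrow> 'a \<Rightarrow> 'b) \<Rightarrow> real \<Rightarrow> 'a \<Rightarrow> 'b"
  where "curve_derivative N X T u = (SOME u'. has_curve_derivative N X T u u')"

definition linear_subspace :: "('a \<Rightarrow> 'b::real_vector) set \<Rightarrow> bool" where
  "linear_subspace V \<longleftrightarrow> (\<lambda>x. 0) \<in> V \<and> (\<forall>u\<in>V. \<forall>v\<in>V. (\<lambda>x. u x + v x) \<in> V) \<and>
     (\<forall>c. \<forall>u\<in>V. (\<lambda>x. c *\<^sub>R u x) \<in> V)"


section \<open>Finite element spaces\<close>

definition poly_le :: "nat \<Rightarrow> (real^3 \<Rightarrow> real) set" where
  "poly_le r = {p. \<exists>c :: nat \<Rightarrow> nat \<Rightarrow> nat \<Rightarrow> real. \<forall>x.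
     p x = (\<Sum>(i, j, k) \<in> {(i, j, k). i + j + k \<le> r}. c i j k * x$1 ^ i * x$2 ^ j * x$3 ^ k)}"

definition vpoly_le :: "nat \<Rightarrow> (real^3 \<Rightarrow> real^3) set" where
  "vpoly_le r = {p. \<forall>i. (\<lambda>x. p x $ i) \<in> poly_le r}"

datatype nedelec_kind = First_Kind | Second_Kind

text \<open>In both cases the order \<open>r\<close> is the degree of the Lagrange space paired with it.\<close>

fun admissible_order :: "nedelec_kind \<Rightarrow> nat \<Rightarrow> bool" where
  "admissible_order First_Kind r \<longleftrightarrow> r \<ge> 1"
| "admissible_order Second_Kind r \<longleftrightarrow> r \<ge> 2"

fun nedelec :: "nedelec_kind \<Rightarrow> nat \<Rightarrow> (real^3 \<Rightarrow> real^3) set" where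
  "nedelec First_Kind r =
     {\<lambda>x. p x + cross3 x (q x) | p q. p \<in> vpoly_le (r - 1) \<and> q \<in> vpoly_le (r - 1)}"
| "nedelec Second_Kind r = vpoly_le (r - 1)"

text \<open>The product space over the elements; values on the element faces are irrelevant.\<close>

definition broken :: "('a::topological_space) set set \<Rightarrow> ('a \<Rightarrow> 'b) set \<Rightarrow> ('a \<Rightarrow> 'b) set" where
  "broken \<T> P = {u. \<forall>K\<in>\<T>. \<exists>p\<in>P. \<forall>x\<in>interior K. u x = p x}"

definition Vh0 :: "(real^3) set set \<Rightarrow> nat \<Rightarrow> (real^3 \<Rightarrow> real) set" where
  "Vh0 \<T> r = broken \<T> (poly_le r)"

definition Vh1 :: "(real^3) set set \<Rightarrow> nedelec_kind \<Rightarrow> nat \<Rightarrow> (real^3 \<Rightarrow> real^3) set" where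
  "Vh1 \<T> k r = broken \<T> (nedelec k r)"

definition broken_curl :: "(real^3) set set \<Rightarrow> (real^3 \<Rightarrow> real^3) \<Rightarrow> real^3 \<Rightarrow> real^3" where
  "broken_curl \<T> u x = (\<Sum>K\<in>\<T>. indicator (interior K) x *\<^sub>R weak_curl (interior K) u x)"

definition broken_Hcurl_norm :: "(real^3) set set \<Rightarrow> (real^3 \<Rightarrow> real^3) \<Rightarrow> real" where
  "broken_Hcurl_norm \<T> u = sqrt (\<Sum>K\<in>\<T>. (Hcurl_norm (interior K) u)\<^sup>2)"


section \<open>Maxwell data\<close>

definition material_tensor :: "(real^3) set \<Rightarrow> real set \<Rightarrow> (real \<Rightarrow> real^3 \<Rightarrow> real^3^3) \<Rightarrow> bool" where
  "material_tensor \<Omega> T a \<longleftrightarrow>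
     (\<forall>t\<in>T. a t \<in> borel_measurable (lebesgue_on \<Omega>)) \<and>
     (\<exists>C. \<forall>t\<in>T. AE x in lebesgue_on \<Omega>. norm (a t x) \<le> C) \<and>
     (\<forall>t\<in>T. AE x in lebesgue_on \<Omega>. transpose (a t x) = a t x) \<and>
     (\<exists>c>0. \<forall>t\<in>T. AE x in lebesgue_on \<Omega>. \<forall>\<xi>. c * (norm \<xi>)\<^sup>2 \<le> \<xi> \<bullet> (a t x *v \<xi>))"

definition maxwell_data ::
  "(real^3) set \<Rightarrow> real set \<Rightarrow> real \<Rightarrow> (real \<Rightarrow> real^3 \<Rightarrow> real^3^3) \<Rightarrow> (real \<Rightarrow> real^3 \<Rightarrow> real^3^3) \<Rightarrow>
   (real \<Rightarrow> real^3 \<Rightarrow> real^3) \<Rightarrow> (real \<Rightarrow> real^3 \<Rightarrow> real) \<Rightarrow> bool" where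
  "maxwell_data \<Omega> T t0 \<epsilon> \<mu> J \<rho> \<longleftrightarrow>
     is_interval T \<and> interior T \<noteq> {} \<and> t0 \<in> T \<and>
     material_tensor \<Omega> T \<epsilon> \<and> material_tensor \<Omega> T \<mu> \<and>
     C0_curve (Hdiv_norm \<Omega>) (Hdiv \<Omega>) T J \<and>
     C1_curve (L2norm \<Omega>) (L2 \<Omega>) T \<rho> \<and>
     (\<forall>t\<in>T. AE x in lebesgue_on \<Omega>.
        curve_derivative (L2norm \<Omega>) (L2 \<Omega>) T \<rho> t x + weak_div \<Omega> (J t) x = 0)"


section \<open>Semidiscrete fields\<close>

definition Eh ::
  "(real^3) set set \<Rightarrow> nedelec_kind \<Rightarrow> nat \<Rightarrow> real set \<Rightarrow> (real \<Rightarrow> real^3 \<Rightarrow> real^3) \<Rightarrow>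
   real \<Rightarrow> real^3 \<Rightarrow> real^3" where
  "Eh \<T> k r T A t x = - curve_derivative (broken_Hcurl_norm \<T>) (Vh1 \<T> k r) T A t x"

definition Dh ::
  "(real^3) set set \<Rightarrow> nedelec_kind \<Rightarrow> nat \<Rightarrow> real set \<Rightarrow> (real \<Rightarrow> real^3 \<Rightarrow> real^3^3) \<Rightarrow>
   (real \<Rightarrow> real^3 \<Rightarrow> real^3) \<Rightarrow> real \<Rightarrow> real^3 \<Rightarrow> real^3" where
  "Dh \<T> k r T \<epsilon> A t x = \<epsilon> t x *v Eh \<T> k r T A t x"

definition Hh ::
  "(real^3) set set \<Rightarrow> (real \<Rightarrow> real^3 \<Rightarrow> real^3^3) \<Rightarrow> (real \<Rightarrow> real^3 \<Rightarrow> real^3) \<Rightarrow>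
   real \<Rightarrow> real^3 \<Rightarrow> real^3" where
  "Hh \<T> \<mu> A t x = matrix_inv (\<mu> t x) *v broken_curl \<T> (A t) x"

definition Dh_dot ::
  "(real^3) set \<Rightarrow> (real^3) set set \<Rightarrow> nedelec_kind \<Rightarrow> nat \<Rightarrow> real set \<Rightarrow>
   (real \<Rightarrow> real^3 \<Rightarrow> real^3^3) \<Rightarrow> (real \<Rightarrow> real^3 \<Rightarrow> real^3) \<Rightarrow> real \<Rightarrow> real^3 \<Rightarrow> real^3" where
  "Dh_dot \<Omega> \<T> k r T \<epsilon> A = curve_derivative (L2norm \<Omega>) (L2 \<Omega>) T (Dh \<T> k r T \<epsilon> A)"

definition regular_fields ::
  "(real^3) set \<Rightarrow> (real^3) set set \<Rightarrow> nedelec_kind \<Rightarrow> nat \<Rightarrow> real set \<Rightarrow>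
   (real \<Rightarrow> real^3 \<Rightarrow> real^3^3) \<Rightarrow> (real \<Rightarrow> real^3 \<Rightarrow> real^3^3) \<Rightarrow>
   (real \<Rightarrow> real^3 \<Rightarrow> real^3) \<Rightarrow> bool" where
  "regular_fields \<Omega> \<T> k r T \<epsilon> \<mu> A \<longleftrightarrow>
     C1_curve (L2norm \<Omega>) (L2 \<Omega>) T (Dh \<T> k r T \<epsilon> A) \<and>
     C0_curve (L2norm \<Omega>) (L2 \<Omega>) T (Hh \<T> \<mu> A)"


section \<open>The two methods\<close>

definition nedelec_solution ::
  "(real^3) set \<Rightarrow> (real^3) set set \<Rightarrow> nedelec_kind \<Rightarrow> nat \<Rightarrow> real set \<Rightarrow>
   (real \<Rightarrow> real^3 \<Rightarrow> real^3^3) \<Rightarrow> (real \<Rightarrow> real^3 \<Rightarrow> real^3^3) \<Rightarrow> (real \<Rightarrow> real^3 \<Rightarrow> real^3) \<Rightarrow>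
   (real \<Rightarrow> real^3 \<Rightarrow> real^3) \<Rightarrow> bool" where
  "nedelec_solution \<Omega> \<T> k r T \<epsilon> \<mu> J A \<longleftrightarrow>
     C1_curve (broken_Hcurl_norm \<T>) (Vh1 \<T> k r \<inter> Hcurl_0 \<Omega>) T A \<and>
     regular_fields \<Omega> \<T> k r T \<epsilon> \<mu> A \<and>
     (\<forall>t\<in>T. \<forall>A' \<in> Vh1 \<T> k r \<inter> Hcurl_0 \<Omega>.
        (LINT x|lebesgue_on \<Omega>. A' x \<bullet> (Dh_dot \<Omega> \<T> k r T \<epsilon> A t x + J t x)
                              - weak_curl \<Omega> A' x \<bullet> Hh \<T> \<mu> A t x) = 0)"

definition hybrid_solution ::
  "(real^3) set \<Rightarrow> (real^3) set set \<Rightarrow> nedelec_kind \<Rightarrow> nat \<Rightarrow> real set \<Rightarrow>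
   (real \<Rightarrow> real^3 \<Rightarrow> real^3^3) \<Rightarrow> (real \<Rightarrow> real^3 \<Rightarrow> real^3^3) \<Rightarrow> (real \<Rightarrow> real^3 \<Rightarrow> real^3) \<Rightarrow>
   (real^3 \<Rightarrow> real^3) set \<Rightarrow>
   (real \<Rightarrow> real^3 \<Rightarrow> real^3) \<Rightarrow> (real \<Rightarrow> real^3 \<Rightarrow> real^3) \<Rightarrow> bool" where
  "hybrid_solution \<Omega> \<T> k r T \<epsilon> \<mu> J V A Hhat \<longleftrightarrow>
     C1_curve (broken_Hcurl_norm \<T>) (Vh1 \<T> k r) T A \<and>
     regular_fields \<Omega> \<T> k r T \<epsilon> \<mu> A \<and>
     C0_curve (Hcurl_norm \<Omega>) V T Hhat \<and>
     (\<forall>t\<in>T. \<forall>K\<in>\<T>. \<forall>A' \<in> nedelec k r.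
        (LINT x|lebesgue_on (interior K). A' x \<bullet> (Dh_dot \<Omega> \<T> k r T \<epsilon> A t x + J t x)
                              - weak_curl (interior K) A' x \<bullet> Hh \<T> \<mu> A t x)
        + bdry_cross (interior K) A' (Hhat t) = 0) \<and>
     (\<forall>t\<in>T. \<forall>H' \<in> V. (\<Sum>K\<in>\<T>. bdry_cross (interior K) (A t) H') = 0)"


section \<open>Charge conservation\<close>

definition ampere_flux ::
  "(real^3) set \<Rightarrow> real set \<Rightarrow> (real \<Rightarrow> real^3 \<Rightarrow> real^3) \<Rightarrow> (real \<Rightarrow> real^3 \<Rightarrow> real^3) \<Rightarrow>
   (real \<Rightarrow> real^3 \<Rightarrow> real^3) \<Rightarrow> bool" where
  "ampere_flux \<Omega> T J Hhat Dhat \<longleftrightarrow>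
     C1_curve (Hdiv_norm \<Omega>) (Hdiv \<Omega>) T Dhat \<and>
     (\<forall>t\<in>T. AE x in lebesgue_on \<Omega>.
        curve_derivative (Hdiv_norm \<Omega>) (Hdiv \<Omega>) T Dhat t x + J t x = weak_curl \<Omega> (Hhat t) x)"

text \<open>The following constraints concern the fields \<open>D\<close>, \<open>Dhat\<close>, \<open>\<rho>\<close> at a single time.\<close>

definition element_charge_constraint ::
  "(real^3) set set \<Rightarrow> nat \<Rightarrow> (real^3 \<Rightarrow> real^3) \<Rightarrow> (real^3 \<Rightarrow> real^3) \<Rightarrow> (real^3 \<Rightarrow> real) \<Rightarrow> bool" where
  "element_charge_constraint \<T> r D Dhat \<rho> \<longleftrightarrow>
     (\<forall>K\<in>\<T>. \<forall>\<phi> \<in> poly_le r.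
        (LINT x|lebesgue_on (interior K). weak_grad (interior K) \<phi> x \<bullet> D x + \<phi> x * \<rho> x)
        - bdry_flux (interior K) \<phi> Dhat = 0)"

definition div_charge_constraint ::
  "(real^3) set \<Rightarrow> (real^3 \<Rightarrow> real^3) \<Rightarrow> (real^3 \<Rightarrow> real) \<Rightarrow> bool" where
  "div_charge_constraint \<Omega> Dhat \<rho> \<longleftrightarrow> (AE x in lebesgue_on \<Omega>. weak_div \<Omega> Dhat x = \<rho> x)"

definition conforming_charge_constraint ::
  "(real^3) set \<Rightarrow> (real^3) set set \<Rightarrow> nat \<Rightarrow> (real^3 \<Rightarrow> real^3) \<Rightarrow> (real^3 \<Rightarrow> real) \<Rightarrow> bool" where
  "conforming_charge_constraint \<Omega> \<T> r D \<rho> \<longleftrightarrow>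
     (\<forall>\<xi> \<in> Vh0 \<T> r \<inter> H1_0 \<Omega>.
        (LINT x|lebesgue_on \<Omega>. weak_grad \<Omega> \<xi> x \<bullet> D x + \<xi> x * \<rho> x) = 0)"

end

theory Submission
  imports Defs
begin

text \<open>The hybrid space is all of \<open>H(curl; \<Omega>)\<close>: a broken field that is annihilated by every element
  boundary pairing with it has a weak curl on \<open>\<Omega>\<close> and zero tangential trace, so it is conforming.
  Hence the residual of a solution of Nedelec's method vanishes on the left kernel of the boundary
  pairing. Since the finite element space is finite dimensional, such a functional is represented by
  a combination of finitely many fixed fields in \<open>H(curl; \<Omega>)\<close> with coefficients that are values of
  the functional; this gives \<open>Hhat\<close>, continuous in time.

  The flux \<open>Dhat\<close> is obtained by integrating Ampere's law in time in \<open>H(div; \<Omega>)\<close>. The time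
  derivative of the element constraint is the hybrid equation tested with the gradient of a polynomial,
  and that of the divergence constraint is conservation of charge.

  For the initial value, the Friedrichs inequality and the Riesz representation theorem give a gradient
  field with divergence \<open>\<rho>\<close>. A divergence free correction has to match finitely many moments
  against gradients of piecewise polynomials; this is solvable as soon as the compatibility condition
  holds for those piecewise gradients that are limits of gradients of test functions. On each
  element such a limit potential differs from a polynomial by a constant, so it lies in
  \<open>V_h^0 \<inter> H1_0\<close> and the condition is the conforming charge constraint.\<close>

section \<open>Square integrable functions\<close>

text \<open>Fields in the statement are representatives, determined up to null sets, and their weak
  derivatives are arbitrary choices. Limits, time integrals and orthogonality are therefore taken in
  one Hilbert space \<open>l2\<close> of classes, which a function on any set enters by extension by
  zero. Fields on different elements then have the same type and are orthogonal.

  Taking all of \<open>Hcurl \<Omega>\<close> as hybrid space makes the conformity equation exact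
  but leaves \<open>Hhat\<close> far from unique, and choosing it anew at each time would lose
  continuity. Hence the solvability argument uses vectors that do not depend on the functional.

  The degrees of the two finite element spaces are matched so that gradients of scalar polynomials
  are hybrid test fields. Being curl free, they see \<open>Hhat\<close> only through its curl.

  For the initial flux the question is which piecewise gradients are orthogonal to all divergence
  free fields. Orthogonal projection places them in the closure of the gradients of test functions,
  and the Friedrichs inequality turns convergence of gradients into convergence of
  potentials.\<close>

lemma L2_measurable: "f \<in> L2 S \<Longrightarrow> f \<in> borel_measurable (lebesgue_on S)"
  by (simp add: L2_def)

lemma L2_zero [simp]: "(\<lambda>x. 0) \<in> L2 S"
  by (simp add: L2_def)

lemma L2_add:
  assumes "f \<in> L2 S" "g \<in> L2 S"
  shows "(\<lambda>x. f x + g x) \<in> L2 S"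
proof -
  have "integrable (lebesgue_on S) (\<lambda>x. (norm (f x + g x))\<^sup>2)"
  proof (rule Bochner_Integration.integrable_bound)
    show "integrable (lebesgue_on S) (\<lambda>x. 2 * (norm (f x))\<^sup>2 + 2 * (norm (g x))\<^sup>2)"
      using assms by (auto simp: L2_def)
    have "(norm (f x + g x))\<^sup>2 \<le> 2 * (norm (f x))\<^sup>2 + 2 * (norm (g x))\<^sup>2" for x
    proof -
      have "(norm (f x + g x))\<^sup>2 \<le> (norm (f x) + norm (g x))\<^sup>2"
        by (intro power_mono norm_triangle_ineq) auto
      also have "\<dots> \<le> 2 * (norm (f x))\<^sup>2 + 2 * (norm (g x))\<^sup>2"
        using zero_le_power2[of "norm (f x) - norm (g x)"] by (simp add: power2_eq_square algebra_simps)
      finally show ?thesis .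
    qed
    then show "AE x in lebesgue_on S. norm ((norm (f x + g x))\<^sup>2)
        \<le> norm (2 * (norm (f x))\<^sup>2 + 2 * (norm (g x))\<^sup>2)"
      by (simp add: abs_of_nonneg)
  qed (use assms in \<open>auto simp: L2_def\<close>)
  then show ?thesis using assms by (auto simp: L2_def)
qed

lemma L2_scaleR: "f \<in> L2 S \<Longrightarrow> (\<lambda>x. c *\<^sub>R f x) \<in> L2 S"
  by (auto simp: L2_def power_mult_distrib)

lemma L2_uminus: "f \<in> L2 S \<Longrightarrow> (\<lambda>x. - f x) \<in> L2 S"
  using L2_scaleR[of f S "-1"] by simp

lemma L2_diff: "f \<in> L2 S \<Longrightarrow> g \<in> L2 S \<Longrightarrow> (\<lambda>x. f x - g x) \<in> L2 S"
  using L2_add[of f S "\<lambda>x. - g x"] L2_uminus[of g S] by simp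

lemma L2_sum: "(\<And>i. i \<in> I \<Longrightarrow> f i \<in> L2 S) \<Longrightarrow> (\<lambda>x. \<Sum>i\<in>I. f i x) \<in> L2 S"
  by (induction I rule: infinite_finite_induct) (auto intro: L2_add)

lemma L2_inner_integrable:
  assumes "f \<in> L2 S" "g \<in> L2 S"
  shows "integrable (lebesgue_on S) (\<lambda>x. f x \<bullet> g x)"
proof (rule Bochner_Integration.integrable_bound)
  show "integrable (lebesgue_on S) (\<lambda>x. (norm (f x))\<^sup>2 + (norm (g x))\<^sup>2)"
    using assms by (auto simp: L2_def)
  have "\<bar>f x \<bullet> g x\<bar> \<le> (norm (f x))\<^sup>2 + (norm (g x))\<^sup>2" for x
  proof -
    have "\<bar>f x \<bullet> g x\<bar> \<le> norm (f x) * norm (g x)" by (rule Cauchy_Schwarz_ineq2)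
    also have "\<dots> \<le> (norm (f x))\<^sup>2 + (norm (g x))\<^sup>2"
    proof -
      have "0 \<le> norm (f x) * norm (g x)" by simp
      moreover have "2 * (norm (f x) * norm (g x)) \<le> (norm (f x))\<^sup>2 + (norm (g x))\<^sup>2"
        using zero_le_power2[of "norm (f x) - norm (g x)"] by (simp add: power2_diff)
      ultimately show ?thesis by linarith
    qed
    finally show ?thesis .
  qed
  then show "AE x in lebesgue_on S. norm (f x \<bullet> g x) \<le> norm ((norm (f x))\<^sup>2 + (norm (g x))\<^sup>2)"
    by (simp add: abs_of_nonneg)
qed (use assms in \<open>auto simp: L2_def\<close>)

lemma L2_mult_integrable:
  fixes f g :: "'a::euclidean_space \<Rightarrow> real"
  shows "f \<in> L2 S \<Longrightarrow> g \<in> L2 S \<Longrightarrow> integrable (lebesgue_on S) (\<lambda>x. f x * g x)"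
  using L2_inner_integrable[of f S g] by simp

text \<open>Membership over any measurable set is reduced to the whole space, where all classes will
  live; subsets and mesh decompositions are handled through this form.\<close>

lemma L2_iff_extend:
  assumes "S \<in> sets lebesgue"
  shows "f \<in> L2 S \<longleftrightarrow> (\<lambda>x. if x \<in> S then f x else 0) \<in> L2 UNIV"
proof -
  have "(\<lambda>x. (norm (if x \<in> S then f x else 0))\<^sup>2) = (\<lambda>x. if x \<in> S then (norm (f x))\<^sup>2 else 0)"
    by auto
  with assms show ?thesis
    by (simp add: L2_def lebesgue_on_UNIV_eq borel_measurable_if
        Lebesgue_Measure.integrable_restrict_UNIV)
qed

lemma L2_subset:
  assumes "f \<in> L2 S" and S: "S \<in> sets lebesgue" "S' \<in> sets lebesgue" "S' \<subseteq> S"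
  shows "f \<in> L2 S'"
proof -
  have f: "(\<lambda>x. if x \<in> S then f x else 0) \<in> L2 UNIV"
    using assms L2_iff_extend by blast
  have eq: "(\<lambda>x. if x \<in> S' then f x else 0) = (\<lambda>x. indicator S' x *\<^sub>R (if x \<in> S then f x else 0))"
    by (rule ext) (use S(3) in \<open>simp add: indicator_def subset_iff\<close>)
  have "(\<lambda>x. indicator S' x *\<^sub>R (if x \<in> S then f x else 0)) \<in> L2 UNIV"
    unfolding L2_def lebesgue_on_UNIV_eq
  proof (intro CollectI conjI)
    show m: "(\<lambda>x. indicator S' x *\<^sub>R (if x \<in> S then f x else 0)) \<in> borel_measurable lebesgue"
      using f S by (intro borel_measurable_scaleR) (auto simp: L2_def lebesgue_on_UNIV_eq)
    show "integrable lebesgue (\<lambda>x. (norm (indicator S' x *\<^sub>R (if x \<in> S then f x else 0)))\<^sup>2)"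
    proof (rule Bochner_Integration.integrable_bound)
      show "integrable lebesgue (\<lambda>x. (norm (if x \<in> S then f x else 0))\<^sup>2)"
        using f by (simp add: L2_def lebesgue_on_UNIV_eq)
      show "(\<lambda>x. (norm (indicator S' x *\<^sub>R (if x \<in> S then f x else 0)))\<^sup>2) \<in> borel_measurable lebesgue"
        using m by measurable
    qed (auto simp: indicator_def)
  qed
  then show ?thesis using S L2_iff_extend eq by metis
qed

\<comment> \<open>The Hilbert space of square integrable classes\<close>
quotient_type (overloaded) ('a, 'b) l2 = "'a::euclidean_space \<Rightarrow> 'b::euclidean_space" /
  partial: "\<lambda>f g. f \<in> L2 UNIV \<and> g \<in> L2 UNIV \<and> (AE x in lebesgue. f x = g x)"
proof (rule part_equivpI)
  show "\<exists>f. f \<in> L2 UNIV \<and> f \<in> L2 UNIV \<and> (AE x in lebesgue. f x = (f x :: 'b))"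
    by (intro exI[of _ "\<lambda>x. 0"]) simp
  show "symp (\<lambda>f g :: 'a \<Rightarrow> 'b. f \<in> L2 UNIV \<and> g \<in> L2 UNIV \<and> (AE x in lebesgue. f x = g x))"
    by (auto simp: symp_def elim: eventually_mono)
  show "transp (\<lambda>f g :: 'a \<Rightarrow> 'b. f \<in> L2 UNIV \<and> g \<in> L2 UNIV \<and> (AE x in lebesgue. f x = g x))"
    by (auto simp: transp_def elim: eventually_elim2)
qed

instantiation l2 :: (euclidean_space, euclidean_space) real_vector
begin

lift_definition zero_l2 :: "('a, 'b) l2" is "\<lambda>x. 0" by simp

lift_definition plus_l2 :: "('a, 'b) l2 \<Rightarrow> ('a, 'b) l2 \<Rightarrow> ('a, 'b) l2" is "\<lambda>f g x. f x + g x"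
  by (auto intro: L2_add elim: eventually_elim2)

lift_definition minus_l2 :: "('a, 'b) l2 \<Rightarrow> ('a, 'b) l2 \<Rightarrow> ('a, 'b) l2" is "\<lambda>f g x. f x - g x"
  by (auto intro: L2_diff elim: eventually_elim2)

lift_definition uminus_l2 :: "('a, 'b) l2 \<Rightarrow> ('a, 'b) l2" is "\<lambda>f x. - f x"
  by (auto intro: L2_uminus elim: eventually_mono)

lift_definition scaleR_l2 :: "real \<Rightarrow> ('a, 'b) l2 \<Rightarrow> ('a, 'b) l2" is "\<lambda>c f x. c *\<^sub>R f x"
  by (auto intro: L2_scaleR elim: eventually_mono)

instance
  by standard
    (transfer; auto intro!: L2_add L2_diff L2_uminus L2_scaleR L2_zero simp: algebra_simps)+

end

instantiation l2 :: (euclidean_space, euclidean_space) real_inner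
begin

lift_definition inner_l2 :: "('a, 'b) l2 \<Rightarrow> ('a, 'b) l2 \<Rightarrow> real"
  is "\<lambda>f g. LINT x|lebesgue. f x \<bullet> g x"
  by (rule integral_cong_AE) (auto simp: L2_def lebesgue_on_UNIV_eq elim: eventually_elim2)

definition norm_l2 :: "('a, 'b) l2 \<Rightarrow> real" where "norm_l2 x = sqrt (inner x x)"

definition dist_l2 :: "('a, 'b) l2 \<Rightarrow> ('a, 'b) l2 \<Rightarrow> real" where "dist_l2 x y = norm (x - y)"

definition sgn_l2 :: "('a, 'b) l2 \<Rightarrow> ('a, 'b) l2" where "sgn_l2 x = x /\<^sub>R norm x"

definition uniformity_l2 :: "(('a, 'b) l2 \<times> ('a, 'b) l2) filter" where
  "uniformity_l2 = (INF e\<in>{0 <..}. principal {(x, y). dist x y < e})"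

definition open_l2 :: "('a, 'b) l2 set \<Rightarrow> bool" where
  "open_l2 U \<longleftrightarrow> (\<forall>x\<in>U. eventually (\<lambda>(x', y). x' = x \<longrightarrow> y \<in> U) uniformity)"

instance
proof
  fix x y z :: "('a, 'b) l2" and c :: real
  show "inner x y = inner y x" by transfer (simp add: inner_commute)
  show "inner (x + y) z = inner x z + inner y z"
    by transfer (simp add: inner_add_left Bochner_Integration.integral_add
        L2_inner_integrable[where S = UNIV, unfolded lebesgue_on_UNIV_eq])
  show "inner (c *\<^sub>R x) y = c * inner x y" by transfer simp
  show "0 \<le> inner x x" by transfer (simp add: Bochner_Integration.integral_nonneg)
  show "inner x x = 0 \<longleftrightarrow> x = 0"
  proof transfer
    fix f :: "'a \<Rightarrow> 'b"
    assume f: "f \<in> L2 UNIV \<and> f \<in> L2 UNIV \<and> (AE x in lebesgue. f x = f x)"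
    then have "integrable lebesgue (\<lambda>x. f x \<bullet> f x)"
      using L2_inner_integrable[where S = UNIV] by (simp add: lebesgue_on_UNIV_eq)
    then have "(LINT x|lebesgue. f x \<bullet> f x) = 0 \<longleftrightarrow> (AE x in lebesgue. f x \<bullet> f x = 0)"
      by (rule integral_nonneg_eq_0_iff_AE) simp
    with f show "(LINT x|lebesgue. f x \<bullet> f x) = 0 \<longleftrightarrow>
        f \<in> L2 UNIV \<and> (\<lambda>x. 0) \<in> L2 UNIV \<and> (AE x in lebesgue. f x = 0)"
      by simp
  qed
qed (simp_all add: norm_l2_def dist_l2_def sgn_l2_def uniformity_l2_def open_l2_def)

end

text \<open>Extension by zero puts functions on different sets into the same type, so that classes
  on elements can be added and paired with classes on the domain. The value 0 for a non-measurable
  \<open>S\<close> or a function outside \<open>L2 S\<close> makes the map total.\<close>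

lift_definition l2_of :: "'a set \<Rightarrow> ('a::euclidean_space \<Rightarrow> 'b::euclidean_space) \<Rightarrow> ('a, 'b) l2"
  is "\<lambda>S f. if S \<in> sets lebesgue \<and> f \<in> L2 S then (\<lambda>x. if x \<in> S then f x else 0) else (\<lambda>x. 0)"
  using L2_iff_extend by auto

lemma l2_of_eq_iff:
  assumes [simp]: "S \<in> sets lebesgue" "f \<in> L2 S" "g \<in> L2 S"
  shows "l2_of S f = l2_of S g \<longleftrightarrow> (AE x in lebesgue_on S. f x = g x)"
proof -
  have "(\<lambda>x. if x \<in> S then f x else 0) \<in> L2 UNIV" "(\<lambda>x. if x \<in> S then g x else 0) \<in> L2 UNIV"
    using assms L2_iff_extend by blast+
  with assms have "l2_of S f = l2_of S g \<longleftrightarrow>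
      (AE x in lebesgue. (if x \<in> S then f x else 0) = (if x \<in> S then g x else 0))"
    by transfer simp
  also have "\<dots> \<longleftrightarrow> (AE x in lebesgue_on S. f x = g x)"
    by (subst AE_restrict_space_iff) (auto intro!: AE_cong)
  finally show ?thesis .
qed

lemma inner_l2_of:
  assumes [simp]: "S \<in> sets lebesgue" "f \<in> L2 S" "g \<in> L2 S"
  shows "inner (l2_of S f) (l2_of S g) = (LINT x|lebesgue_on S. f x \<bullet> g x)"
proof -
  have "inner (l2_of S f) (l2_of S g) =
      (LINT x|lebesgue. (if x \<in> S then f x else 0) \<bullet> (if x \<in> S then g x else 0))"
    using assms by transfer simp
  also have "\<dots> = (LINT x|lebesgue. (if x \<in> S then f x \<bullet> g x else 0))"
    by (intro Bochner_Integration.integral_cong) auto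
  finally show ?thesis by (simp add: Lebesgue_Measure.integral_restrict_UNIV)
qed

lemma norm_l2_of: "S \<in> sets lebesgue \<Longrightarrow> f \<in> L2 S \<Longrightarrow> norm (l2_of S f) = L2norm S f"
  by (simp add: norm_eq_sqrt_inner inner_l2_of L2norm_def power2_norm_eq_inner)

lemma l2_of_add:
  assumes "S \<in> sets lebesgue" "f \<in> L2 S" "g \<in> L2 S"
  shows "l2_of S (\<lambda>x. f x + g x) = l2_of S f + l2_of S g"
proof -
  have *: "(\<lambda>x. if x \<in> S then f x else 0) \<in> L2 UNIV" "(\<lambda>x. if x \<in> S then g x else 0) \<in> L2 UNIV"
      "(\<lambda>x. if x \<in> S then f x + g x else 0) \<in> L2 UNIV"
    using assms by (simp_all flip: L2_iff_extend add: L2_add)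
  have "l2_of S f + l2_of S g =
      abs_l2 (\<lambda>x. (if x \<in> S then f x else 0) + (if x \<in> S then g x else 0))"
    using assms * by (simp add: l2_of_def plus_l2.abs_eq id_def)
  also have "(\<lambda>x. (if x \<in> S then f x else 0) + (if x \<in> S then g x else 0)) =
      (\<lambda>x. if x \<in> S then f x + g x else 0)"
    by auto
  finally show ?thesis using assms L2_add[OF assms(2,3)] by (simp add: l2_of_def id_def)
qed

lemma l2_of_scaleR:
  assumes "S \<in> sets lebesgue" "f \<in> L2 S"
  shows "l2_of S (\<lambda>x. c *\<^sub>R f x) = c *\<^sub>R l2_of S f"
proof -
  have *: "(\<lambda>x. if x \<in> S then f x else 0) \<in> L2 UNIV" "(\<lambda>x. if x \<in> S then c *\<^sub>R f x else 0) \<in> L2 UNIV"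
    using assms by (simp_all flip: L2_iff_extend add: L2_scaleR)
  have "c *\<^sub>R l2_of S f = abs_l2 (\<lambda>x. c *\<^sub>R (if x \<in> S then f x else 0))"
    using assms * by (simp add: l2_of_def scaleR_l2.abs_eq id_def)
  also have "(\<lambda>x. c *\<^sub>R (if x \<in> S then f x else 0)) = (\<lambda>x. if x \<in> S then c *\<^sub>R f x else 0)"
    by auto
  finally show ?thesis using assms L2_scaleR[OF assms(2)] by (simp add: l2_of_def id_def)
qed

lemma l2_of_uminus:
  "S \<in> sets lebesgue \<Longrightarrow> f \<in> L2 S \<Longrightarrow> l2_of S (\<lambda>x. - f x) = - l2_of S f"
  using l2_of_scaleR[of S f "-1"] by simp

lemma l2_of_diff:
  "S \<in> sets lebesgue \<Longrightarrow> f \<in> L2 S \<Longrightarrow> g \<in> L2 S \<Longrightarrow> l2_of S (\<lambda>x. f x - g x) = l2_of S f - l2_of S g"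
  using l2_of_add[of S f "\<lambda>x. - g x"] by (simp add: l2_of_uminus L2_uminus)

lemma l2_of_zero [simp]: "l2_of S (\<lambda>x. 0) = 0"
  by (simp add: l2_of_def zero_l2_def cong: if_cong)

lemma l2_of_sum:
  assumes "S \<in> sets lebesgue" "\<And>i. i \<in> I \<Longrightarrow> f i \<in> L2 S"
  shows "l2_of S (\<lambda>x. \<Sum>i\<in>I. f i x) = (\<Sum>i\<in>I. l2_of S (f i))"
  using assms(2)
  by (induction I rule: infinite_finite_induct) (simp_all add: l2_of_add assms(1) L2_sum)

lemma l2_representative:
  fixes X :: "('a::euclidean_space, 'b::euclidean_space) l2"
  obtains f where "f \<in> L2 UNIV" "X = l2_of UNIV f"
proof -
  have "rep_l2 X \<in> L2 UNIV" using Quotient_rep_reflp[OF Quotient_l2, of X] by simp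
  moreover have "l2_of UNIV (rep_l2 X) = X"
    using \<open>rep_l2 X \<in> L2 UNIV\<close> Quotient_abs_rep[OF Quotient_l2, of X] by (simp add: l2_of_def id_def)
  ultimately show thesis using that by metis
qed

lemma inner_l2_of_restrict:
  assumes "S \<in> sets lebesgue" "f \<in> L2 UNIV" "g \<in> L2 S"
  shows "inner (l2_of UNIV f) (l2_of S g) = inner (l2_of S f) (l2_of S g)"
proof -
  have f: "f \<in> L2 S" using assms(1,2) by (intro L2_subset[of f UNIV S]) auto
  have "inner (l2_of UNIV f) (l2_of S g) = (LINT x|lebesgue. f x \<bullet> (if x \<in> S then g x else 0))"
    using assms by transfer simp
  also have "\<dots> = (LINT x|lebesgue. (if x \<in> S then f x \<bullet> g x else 0))"
    by (intro Bochner_Integration.integral_cong) auto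
  finally show ?thesis
    using assms f by (simp add: Lebesgue_Measure.integral_restrict_UNIV inner_l2_of)
qed

text \<open>Riesz-Fischer: a rapidly Cauchy subsequence converges almost everywhere, Fatou's lemma
  shows that the pointwise limit is also the limit in norm, and a Cauchy sequence follows its
  convergent subsequence.\<close>

instance l2 :: (euclidean_space, euclidean_space) complete_space
proof
  fix X :: "nat \<Rightarrow> ('a, 'b) l2"
  assume X: "Cauchy X"
  then have "\<exists>N. \<forall>m\<ge>N. \<forall>k\<ge>N. dist (X m) (X k) < (1/2) ^ n" for n
    unfolding Cauchy_def by simp
  then obtain N where N: "\<And>n m k. m \<ge> N n \<Longrightarrow> k \<ge> N n \<Longrightarrow> dist (X m) (X k) < (1/2) ^ n"
    by metis
  \<comment> \<open>The sum dominates every \<open>N i\<close> with \<open>i \<le> n\<close>; the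
    summand \<open>n\<close> makes \<open>r\<close> strictly increasing.\<close>
  define r where "r n = n + (\<Sum>i\<le>n. N i)" for n
  have r: "strict_mono r" by (rule strict_monoI_Suc) (simp add: r_def)
  have rN: "N n \<le> r m" if "n \<le> m" for n m
  proof -
    have "N n \<le> (\<Sum>i\<le>m. N i)" by (rule member_le_sum) (use that in auto)
    then show ?thesis by (simp add: r_def)
  qed
  have "\<forall>n. \<exists>f. f \<in> L2 UNIV \<and> X (r n) = l2_of UNIV f" by (metis l2_representative)
  then obtain f where f: "\<And>n. f n \<in> L2 UNIV" "\<And>n. X (r n) = l2_of UNIV (f n)"
    by metis
  have f_meas [measurable]: "f n \<in> borel_measurable lebesgue" for n
    using f(1)[of n] by (simp add: L2_def lebesgue_on_UNIV_eq)
  have dist_f: "(\<integral>\<^sup>+x. ennreal ((norm (f m x - f n x))\<^sup>2) \<partial>lebesgue) \<le> ennreal ((1/4) ^ n)"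
    if "n \<le> m" for m n
  proof -
    have d: "(\<lambda>x. f m x - f n x) \<in> L2 UNIV" using f by (intro L2_diff)
    have "(LINT x|lebesgue. (norm (f m x - f n x))\<^sup>2) = (dist (X (r m)) (X (r n)))\<^sup>2"
      using inner_l2_of[OF _ d d] f
      by (simp add: dist_norm l2_of_diff power2_norm_eq_inner lebesgue_on_UNIV_eq)
    also have "\<dots> \<le> ((1/2) ^ n)\<^sup>2"
      using N[OF rN[OF that] rN[OF order_refl]] by (intro power_mono) auto
    also have "\<dots> = (1/4) ^ n" by (simp add: power2_eq_square flip: power_mult_distrib)
    finally have "(LINT x|lebesgue. (norm (f m x - f n x))\<^sup>2) \<le> (1/4) ^ n" .
    moreover have "integrable lebesgue (\<lambda>x. (norm (f m x - f n x))\<^sup>2)"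
      using d by (simp add: L2_def lebesgue_on_UNIV_eq)
    ultimately show ?thesis by (simp add: nn_integral_eq_integral ennreal_leI)
  qed
  \<comment> \<open>The squared increments have integral at most \<open>(1/4) ^ n\<close>, so even
    after weighting with \<open>2 ^ n\<close> their sum is integrable, hence finite almost
    everywhere.\<close>
  define d where "d n x = f (Suc n) x - f n x" for n x
  have "(\<integral>\<^sup>+x. (\<Sum>n. ennreal (2 ^ n * (norm (d n x))\<^sup>2)) \<partial>lebesgue)
      = (\<Sum>n. \<integral>\<^sup>+x. ennreal (2 ^ n * (norm (d n x))\<^sup>2) \<partial>lebesgue)"
    by (rule nn_integral_suminf) (simp add: d_def)
  also have "\<dots> \<le> (\<Sum>n. ennreal ((1/2) ^ n))"
  proof (rule suminf_le)
    fix n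
    have "(\<integral>\<^sup>+x. ennreal (2 ^ n * (norm (d n x))\<^sup>2) \<partial>lebesgue)
        = ennreal (2 ^ n) * (\<integral>\<^sup>+x. ennreal ((norm (d n x))\<^sup>2) \<partial>lebesgue)"
      by (simp add: ennreal_mult d_def nn_integral_cmult)
    also have "\<dots> \<le> ennreal (2 ^ n) * ennreal ((1/4) ^ n)"
      unfolding d_def by (intro mult_left_mono dist_f) auto
    also have "\<dots> = ennreal ((1/2) ^ n)"
      by (simp flip: ennreal_mult power_mult_distrib)
    finally show "(\<integral>\<^sup>+x. ennreal (2 ^ n * (norm (d n x))\<^sup>2) \<partial>lebesgue) \<le> ennreal ((1/2) ^ n)" .
  qed auto
  also have "\<dots> < \<infinity>" by (simp add: suminf_ennreal2 summable_geometric)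
  finally have "AE x in lebesgue. (\<Sum>n. ennreal (2 ^ n * (norm (d n x))\<^sup>2)) \<noteq> \<infinity>"
    by (intro nn_integral_PInf_AE) (auto simp: d_def)
  then have lim: "AE x in lebesgue. (\<lambda>n. f n x) \<longlonglongrightarrow> lim (\<lambda>n. f n x)"
  proof eventually_elim
    case (elim x)
    then have "summable (\<lambda>n. 2 ^ n * (norm (d n x))\<^sup>2)"
      by (intro summable_suminf_not_top) auto
    then have s: "summable (\<lambda>n. 2 ^ n * (norm (d n x))\<^sup>2 + (1/2) ^ n)"
      by (intro summable_add) auto
    \<comment> \<open>Completing a square bounds the increment itself by its weighted square plus
      \<open>(1/2) ^ n\<close>; this converts summability of the weighted squares into absolute
      convergence.\<close>
    have "norm (d n x) \<le> 2 ^ n * (norm (d n x))\<^sup>2 + (1/2) ^ n" for n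
    proof -
      have "0 \<le> (2 ^ n * norm (d n x) - 1)\<^sup>2 + 2 ^ n * norm (d n x)" by simp
      also have "\<dots> = 2 ^ n * (2 ^ n * (norm (d n x))\<^sup>2 + (1/2) ^ n - norm (d n x))"
        by (simp add: power2_eq_square algebra_simps flip: power_mult_distrib)
      finally show ?thesis
        using zero_less_power[of "2::real" n] unfolding zero_le_mult_iff by linarith
    qed
    then have "summable (\<lambda>n. d n x)"
      by (intro summable_comparison_test[OF _ s]) auto
    then have "convergent (\<lambda>n. \<Sum>i<n. d i x)"
      by (simp add: summable_iff_convergent)
    moreover have "(\<Sum>i<n. d i x) = f n x - f 0 x" for n
      unfolding d_def by (rule sum_lessThan_telescope)
    ultimately have "convergent (\<lambda>n. f n x - f 0 x)" by simp
    then have "convergent (\<lambda>n. (f n x - f 0 x) + f 0 x)"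
      by (intro convergent_add convergent_const)
    then show ?case by (simp add: convergent_LIMSEQ_iff)
  qed
  define g where "g x = lim (\<lambda>n. f n x)" for x
  have g_meas [measurable]: "g \<in> borel_measurable lebesgue"
    unfolding g_def by measurable
  \<comment> \<open>For fixed \<open>n\<close> the integrand is a pointwise limit over
    \<open>m\<close>, so Fatou's lemma carries the Cauchy estimate to the limit
    \<open>g\<close>.\<close>
  have bound: "(\<integral>\<^sup>+x. ennreal ((norm (g x - f n x))\<^sup>2) \<partial>lebesgue) \<le> ennreal ((1/4) ^ n)" for n
  proof -
    have "(\<integral>\<^sup>+x. ennreal ((norm (g x - f n x))\<^sup>2) \<partial>lebesgue)
        = (\<integral>\<^sup>+x. liminf (\<lambda>m. ennreal ((norm (f m x - f n x))\<^sup>2)) \<partial>lebesgue)"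
    proof (rule nn_integral_cong_AE, use lim in eventually_elim)
      case (elim x)
      then have "(\<lambda>m. ennreal ((norm (f m x - f n x))\<^sup>2)) \<longlonglongrightarrow> ennreal ((norm (g x - f n x))\<^sup>2)"
        unfolding g_def by (intro tendsto_intros)
      then show ?case by (rule lim_imp_Liminf[OF sequentially_bot, symmetric])
    qed
    also have "\<dots> \<le> liminf (\<lambda>m. \<integral>\<^sup>+x. ennreal ((norm (f m x - f n x))\<^sup>2) \<partial>lebesgue)"
      by (rule nn_integral_liminf) simp
    also have "\<dots> \<le> limsup (\<lambda>m. \<integral>\<^sup>+x. ennreal ((norm (f m x - f n x))\<^sup>2) \<partial>lebesgue)"
      by (rule Liminf_le_Limsup) simp
    also have "\<dots> \<le> ennreal ((1/4) ^ n)"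
      by (intro Limsup_bounded eventually_sequentiallyI[of n] dist_f)
    finally show ?thesis .
  qed
  have gf: "(\<lambda>x. g x - f n x) \<in> L2 UNIV" for n
  proof -
    have "integrable lebesgue (\<lambda>x. (norm (g x - f n x))\<^sup>2)"
    proof (rule integrableI_bounded)
      show "(\<integral>\<^sup>+x. ennreal (norm ((norm (g x - f n x))\<^sup>2)) \<partial>lebesgue) < \<infinity>"
        using le_less_trans[OF bound[of n]] by simp
    qed simp
    then show ?thesis by (simp add: L2_def lebesgue_on_UNIV_eq)
  qed
  have g: "g \<in> L2 UNIV" using L2_add[OF gf[of 0] f(1)[of 0]] by simp
  have "dist (X (r n)) (l2_of UNIV g) \<le> (1/2) ^ n" for n
  proof -
    have "ennreal ((norm (l2_of UNIV g - X (r n)))\<^sup>2) \<le> ennreal ((1/4) ^ n)"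
      using bound[of n] gf[of n] g f inner_l2_of[OF _ gf gf, of n n]
      by (simp add: power2_norm_eq_inner lebesgue_on_UNIV_eq nn_integral_eq_integral L2_def l2_of_diff)
    also have "(1/4::real) ^ n = ((1/2) ^ n)\<^sup>2" by (simp add: power2_eq_square flip: power_mult_distrib)
    finally show ?thesis
      by (simp add: dist_norm norm_minus_commute abs_le_square_iff[symmetric])
  qed
  then have "(\<lambda>n. dist (X (r n)) (l2_of UNIV g)) \<longlonglongrightarrow> 0"
    by (intro Lim_null_comparison[OF _ LIMSEQ_power_zero[of "1/2::real"]]) auto
  then have "(X \<circ> r) \<longlonglongrightarrow> l2_of UNIV g"
    unfolding o_def by (rule tendsto_dist_iff[THEN iffD2])
  then show "convergent X"
    using Cauchy_converges_subseq[OF X r] convergentI by blast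
qed

instance l2 :: (euclidean_space, euclidean_space) banach ..

section \<open>Representation on subspaces\<close>

lemma quadratic_nonneg_imp_linear_zero:
  fixes N d :: real
  assumes "N > 0" and quad: "\<And>t. 0 \<le> t\<^sup>2 * N + 2 * t * d"
  shows "d = 0"
proof -
  \<comment> \<open>\<open>- d / N\<close> minimises the quadratic, and the minimum is negative
    unless \<open>d = 0\<close>.\<close>
  have "(- d / N)\<^sup>2 * N + 2 * (- d / N) * d = - (d * d) / N"
    using assms(1) by (simp add: divide_simps power2_eq_square)
  then have "0 \<le> - (d * d) / N" using quad[of "- d / N"] by simp
  then have "d * d \<le> 0" using assms(1) by (simp add: divide_le_0_iff)
  then show ?thesis by (auto simp: mult_le_0_iff)
qed

text \<open>The functional is given only on \<open>Y\<close>, which need not be closed. Its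
  representative is the limit of a minimising sequence of \<open>norm y ^ 2 - 2 * f y\<close> and so
  lies in the closure of \<open>Y\<close>; the bound with \<open>C\<close> keeps this expression
  bounded below.\<close>

lemma riesz_on_subspace:
  fixes Y :: "'a::{real_inner, complete_space} set" and f :: "'a \<Rightarrow> real"
  assumes Y: "subspace Y"
    and add: "\<And>x y. x \<in> Y \<Longrightarrow> y \<in> Y \<Longrightarrow> f (x + y) = f x + f y"
    and scale: "\<And>c x. x \<in> Y \<Longrightarrow> f (c *\<^sub>R x) = c * f x"
    and bound: "\<And>x. x \<in> Y \<Longrightarrow> \<bar>f x\<bar> \<le> C * norm x"
  obtains v where "v \<in> closure Y" "\<And>y. y \<in> Y \<Longrightarrow> inner v y = f y"
proof -
  define Q where "Q y = (norm y)\<^sup>2 - 2 * f y" for y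
  have Q_lower: "- C\<^sup>2 \<le> Q y" if "y \<in> Y" for y
  proof -
    have "f y \<le> C * norm y" using bound[OF that] by linarith
    moreover have "0 \<le> (norm y - C)\<^sup>2" by simp
    ultimately show ?thesis unfolding Q_def by (simp add: power2_eq_square algebra_simps)
  qed
  define m where "m = (INF y\<in>Y. Q y)"
  have ne: "Y \<noteq> {}" using Y subspace_0 by auto
  have bdd: "bdd_below (Q ` Y)" using Q_lower by (auto intro!: bdd_belowI)
  have m_le: "m \<le> Q y" if "y \<in> Y" for y
    unfolding m_def using bdd that by (rule cINF_lower)
  have "\<exists>y\<in>Y. Q y < m + inverse (real (Suc n))" for n
  proof -
    have "m < m + inverse (real (Suc n))" by simp
    then show ?thesis unfolding m_def using cINF_less_iff[OF ne bdd] by blast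
  qed
  then obtain y where y: "\<And>n. y n \<in> Y" "\<And>n. Q (y n) < m + inverse (real (Suc n))"
    by metis
  have diff: "f (u - v) = f u - f v" if "u \<in> Y" "v \<in> Y" for u v
    using add[of u "- 1 *\<^sub>R v"] scale[of v "-1"] that subspace_scale[OF Y, of v "-1"] by simp
  \<comment> \<open>Parallelogram law for \<open>u\<close> and \<open>v\<close>, with their midpoint
    compared to the infimum: near-minimisers are close to each other.\<close>
  have par: "(norm (u - v))\<^sup>2 \<le> 2 * (Q u - m) + 2 * (Q v - m)" if "u \<in> Y" "v \<in> Y" for u v
  proof -
    let ?w = "(1/2) *\<^sub>R (u + v)"
    have uv: "u + v \<in> Y" using that Y by (intro subspace_add)
    then have "?w \<in> Y" using Y by (intro subspace_scale)
    then have "m \<le> Q ?w" by (rule m_le)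
    also have "Q ?w = (norm (u + v))\<^sup>2 / 4 - (f u + f v)"
      unfolding Q_def using scale[OF uv, of "1/2"] add[OF that]
      by (simp add: power_divide)
    finally have "4 * m \<le> (norm (u + v))\<^sup>2 - 4 * (f u + f v)" by simp
    moreover have "(norm (u - v))\<^sup>2 + (norm (u + v))\<^sup>2 = 2 * (norm u)\<^sup>2 + 2 * (norm v)\<^sup>2"
      by (simp add: power2_norm_eq_inner inner_add_left inner_add_right inner_diff_left
          inner_diff_right)
    ultimately show ?thesis unfolding Q_def by simp
  qed
  have "Cauchy y"
  proof (rule metric_CauchyI)
    fix e :: real assume e: "e > 0"
    then obtain N where N: "inverse (real (Suc N)) < e\<^sup>2 / 4"
      using reals_Archimedean[of "e\<^sup>2 / 4"] by auto
    show "\<exists>M. \<forall>i\<ge>M. \<forall>j\<ge>M. dist (y i) (y j) < e"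
    proof (intro exI allI impI)
      fix i j assume "N \<le> i" "N \<le> j"
      then have "inverse (real (Suc i)) \<le> inverse (real (Suc N))"
          "inverse (real (Suc j)) \<le> inverse (real (Suc N))"
        by simp_all
      then have "Q (y i) - m < e\<^sup>2 / 4" "Q (y j) - m < e\<^sup>2 / 4"
        using y(2)[of i] y(2)[of j] N by linarith+
      then have "2 * (Q (y i) - m) + 2 * (Q (y j) - m) < e\<^sup>2" by simp
      with par[of "y i" "y j"] have "(norm (y i - y j))\<^sup>2 < e\<^sup>2"
        using y(1) by (meson le_less_trans)
      then show "dist (y i) (y j) < e"
        using e power2_less_imp_less[of _ e] by (simp add: dist_norm)
    qed
  qed
  then obtain v where v: "y \<longlonglongrightarrow> v" using Cauchy_convergent convergent_def by blast
  have "v \<in> closure Y" using v y(1) by (meson closure_sequential)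
  moreover have "inner v z = f z" if z: "z \<in> Y" for z
  proof -
    \<comment> \<open>Moving from \<open>y n\<close> in direction \<open>z\<close> cannot lead below
      the infimum, which \<open>y n\<close> exceeds by less than \<open>inverse (Suc n)\<close>; in
      the limit this is the minimality of \<open>v\<close>, and its first variation must
      vanish.\<close>
    have quad: "0 \<le> t\<^sup>2 * (norm z)\<^sup>2 + 2 * t * (inner v z - f z)" for t
    proof -
      have "- inverse (real (Suc n)) \<le> t\<^sup>2 * (norm z)\<^sup>2 + 2 * t * (inner (y n) z - f z)" for n
      proof -
        have "y n + t *\<^sub>R z \<in> Y" using y(1) z Y by (intro subspace_add subspace_scale)
        then have "m \<le> Q (y n + t *\<^sub>R z)" by (rule m_le)
        also have "\<dots> = Q (y n) + t\<^sup>2 * (norm z)\<^sup>2 + 2 * t * (inner (y n) z - f z)"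
        proof -
          have "(norm (y n + t *\<^sub>R z))\<^sup>2 = (norm (y n))\<^sup>2 + 2 * t * inner (y n) z + t\<^sup>2 * (norm z)\<^sup>2"
            using dot_norm[of "y n" "t *\<^sub>R z"] by (simp add: power_mult_distrib field_simps)
          moreover have "f (y n + t *\<^sub>R z) = f (y n) + t * f z"
            using add[OF y(1) subspace_scale[OF Y z], of n t] scale[OF z, of t] by simp
          ultimately show ?thesis unfolding Q_def by (simp add: right_diff_distrib)
        qed
        finally show ?thesis using y(2)[of n] by linarith
      qed
      moreover have "(\<lambda>n. - inverse (real (Suc n))) \<longlonglongrightarrow> - 0"
        by (intro tendsto_minus LIMSEQ_inverse_real_of_nat)
      moreover have "(\<lambda>n. t\<^sup>2 * (norm z)\<^sup>2 + 2 * t * (inner (y n) z - f z))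
          \<longlonglongrightarrow> t\<^sup>2 * (norm z)\<^sup>2 + 2 * t * (inner v z - f z)"
        by (intro tendsto_intros v)
      ultimately show ?thesis by (simp add: LIMSEQ_le)
    qed
    show ?thesis
    proof (cases "z = 0")
      case True
      then show ?thesis using scale[OF z, of 0] by simp
    next
      case False
      show ?thesis
        using quadratic_nonneg_imp_linear_zero[of "(norm z)\<^sup>2" "inner v z - f z"] quad False by simp
    qed
  qed
  ultimately show thesis by (rule that)
qed

text \<open>The vectors \<open>b i\<close>, \<open>m i\<close> do not depend on \<open>f\<close>, so the representing vector depends
  continuously on \<open>f\<close>.\<close>

lemma finite_dim_solvability:
  fixes M :: "'a::real_inner set"
  assumes "finite B" and M: "subspace M"
  shows "\<exists>n q m. (\<forall>i<n. q i \<in> span B \<and> m i \<in> M) \<and>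
    (\<forall>f. (\<forall>x\<in>span B. (\<forall>y\<in>M. inner y x = 0) \<longrightarrow> inner f x = 0) \<longrightarrow>
      (\<forall>x\<in>span B. inner f x = (\<Sum>i<(n::nat). inner f (q i) * inner (m i) x)))"
proof -
  let ?ok = "\<lambda>B f. \<forall>x\<in>span B. (\<forall>y\<in>M. inner y x = 0) \<longrightarrow> inner f x = 0"
  \<comment> \<open>Biorthogonality of \<open>m\<close> and \<open>q\<close> is carried along in the
    induction: it makes the coefficients explicit when the next vector is split off.\<close>
  have "\<exists>n q m. (\<forall>i<n. q i \<in> span B \<and> m i \<in> M) \<and>
    (\<forall>i<n. \<forall>j<n. inner (m i) (q j) = (if i = j then 1 else 0)) \<and>
    (\<forall>f. ?ok B f \<longrightarrow> (\<forall>x\<in>span B. inner f x = (\<Sum>i<(n::nat). inner f (q i) * inner (m i) x)))"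
    using assms(1)
  proof (induction B)
    case empty
    show ?case by (rule exI[of _ 0]) simp
  next
    case (insert b B)
    then obtain n q m where IH: "(\<forall>i<n. q i \<in> span B \<and> m i \<in> M) \<and>
      (\<forall>i<n. \<forall>j<n. inner (m i) (q j) = (if i = j then 1 else 0)) \<and>
      (\<forall>f. ?ok B f \<longrightarrow> (\<forall>x\<in>span B. inner f x = (\<Sum>i<(n::nat). inner f (q i) * inner (m i) x)))"
      by blast
    have q: "\<And>i. i < n \<Longrightarrow> q i \<in> span B" and m: "\<And>i. i < n \<Longrightarrow> m i \<in> M"
      and bi: "\<And>i j. i < n \<Longrightarrow> j < n \<Longrightarrow> inner (m i) (q j) = (if i = j then 1 else 0)"
      using IH by blast+
    have rep: "inner f x = (\<Sum>i<n. inner f (q i) * inner (m i) x)" if "?ok B f" "x \<in> span B" for f x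
      using IH that by blast
    have sub: "span B \<subseteq> span (insert b B)" by (intro span_mono) auto
    have ok_mono: "?ok B f" if "?ok (insert b B) f" for f using that sub by blast
    \<comment> \<open>Removing the components along the \<open>q i\<close> makes \<open>b'\<close>
      invisible to all \<open>m i\<close> found so far, by biorthogonality.\<close>
    define b' where "b' = b - (\<Sum>i<n. inner (m i) b *\<^sub>R q i)"
    have b'_span: "b' \<in> span (insert b B)"
      unfolding b'_def
    proof (intro span_diff span_sum span_scale)
      show "b \<in> span (insert b B)" by (simp add: span_base)
      show "q i \<in> span (insert b B)" if "i \<in> {..<n}" for i using q that sub by auto
    qed
    have mb': "inner (m i) b' = 0" if "i < n" for i
      using that by (simp add: b'_def inner_diff_right inner_sum_right bi if_distrib cong: if_cong)
    have decomp: "\<exists>c y. x = c *\<^sub>R b' + y \<and> y \<in> span B" if "x \<in> span (insert b B)" for x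
    proof -
      have "\<exists>c. x - c *\<^sub>R b \<in> span B" using that by (simp only: span_breakdown_eq)
      then obtain c where "x - c *\<^sub>R b \<in> span B" ..
      moreover have "c *\<^sub>R (\<Sum>i<n. inner (m i) b *\<^sub>R q i) \<in> span B"
        by (intro span_scale span_sum) (simp add: q span_scale)
      ultimately have "x - c *\<^sub>R b + c *\<^sub>R (\<Sum>i<n. inner (m i) b *\<^sub>R q i) \<in> span B"
        by (rule span_add)
      moreover have "x - c *\<^sub>R b + c *\<^sub>R (\<Sum>i<n. inner (m i) b *\<^sub>R q i) = x - c *\<^sub>R b'"
        unfolding b'_def scaleR_right_diff_distrib by simp
      ultimately have "x = c *\<^sub>R b' + (x - c *\<^sub>R b') \<and> x - c *\<^sub>R b' \<in> span B" by simp
      then show ?thesis by blast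
    qed
    show ?case
    proof (cases "\<forall>y\<in>M. inner y b' = 0")
      \<comment> \<open>Here \<open>b'\<close> is annihilated by all of \<open>M\<close>, so every
        admissible \<open>f\<close> vanishes on it and the previous system still suffices.\<close>
      case True
      have "inner f x = (\<Sum>i<n. inner f (q i) * inner (m i) x)"
        if ok: "?ok (insert b B) f" and x: "x \<in> span (insert b B)" for f x
      proof -
        obtain c y where x: "x = c *\<^sub>R b' + y" "y \<in> span B" using decomp[OF x] by blast
        have "inner f b' = 0" using ok True b'_span by blast
        then have "inner f x = inner f y" by (simp add: x inner_add_right)
        also have "\<dots> = (\<Sum>i<n. inner f (q i) * inner (m i) y)"
          using rep[OF ok_mono[OF ok] x(2)] .
        also have "\<dots> = (\<Sum>i<n. inner f (q i) * inner (m i) x)"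
          by (intro sum.cong) (auto simp: x inner_add_right mb')
        finally show ?thesis .
      qed
      then have "\<forall>f. ?ok (insert b B) f \<longrightarrow>
          (\<forall>x\<in>span (insert b B). inner f x = (\<Sum>i<n. inner f (q i) * inner (m i) x))"
        by blast
      moreover have "\<forall>i<n. q i \<in> span (insert b B) \<and> m i \<in> M" using q m sub by blast
      moreover have "\<forall>i<n. \<forall>j<n. inner (m i) (q j) = (if i = j then 1 else 0)" using bi by blast
      ultimately show ?thesis by blast
    next
      case False
      then obtain y0 where y0: "y0 \<in> M" "inner y0 b' \<noteq> 0" by blast
      \<comment> \<open>Gram-Schmidt on the side of \<open>M\<close>: subtracting the
        \<open>m i\<close> makes the functional vanish on all earlier \<open>q j\<close> without
        changing its value at \<open>b'\<close>.\<close>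
      define y1 where "y1 = y0 - (\<Sum>i<n. inner y0 (q i) *\<^sub>R m i)"
      have y1: "y1 \<in> M" unfolding y1_def using y0 m M
        by (intro subspace_diff subspace_sum subspace_scale) auto
      have y1q: "inner y1 (q j) = 0" if "j < n" for j
        using that by (simp add: y1_def inner_diff_left inner_sum_left bi if_distrib cong: if_cong)
      have y1b: "inner y1 b' = inner y0 b'"
        by (simp add: y1_def inner_diff_left inner_sum_left mb')
      define m' where "m' = y1 /\<^sub>R inner y0 b'"
      have m': "m' \<in> M" "inner m' b' = 1" "\<And>j. j < n \<Longrightarrow> inner m' (q j) = 0"
        using y1 M y0 by (auto simp: m'_def y1b y1q subspace_scale)
      \<comment> \<open>An element of \<open>M\<close> trivially satisfies the solvability
        condition, so the induction hypothesis represents \<open>m'\<close> itself by its values at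
        the \<open>q i\<close>, which are zero.\<close>
      have m'_span: "inner m' x = 0" if "x \<in> span B" for x
        using rep[of m' x] that m' by auto
      let ?q = "q(n := b')" and ?m = "m(n := m')"
      have "inner f x = (\<Sum>i<Suc n. inner f (?q i) * inner (?m i) x)"
        if ok: "?ok (insert b B) f" and x: "x \<in> span (insert b B)" for f x
      proof -
        obtain c y where x: "x = c *\<^sub>R b' + y" "y \<in> span B" using decomp[OF x] by blast
        have "inner f x = c * inner f b' + inner f y" by (simp add: x inner_add_right)
        also have "inner f y = (\<Sum>i<n. inner f (q i) * inner (m i) y)"
          using rep[OF ok_mono[OF ok] x(2)] .
        also have "\<dots> = (\<Sum>i<n. inner f (q i) * inner (m i) x)"
          by (intro sum.cong) (auto simp: x inner_add_right mb')
        also have "c = inner m' x" using m'_span[OF x(2)] m' by (simp add: x inner_add_right)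
        finally show ?thesis by (simp add: mult.commute)
      qed
      then have "\<forall>f. ?ok (insert b B) f \<longrightarrow>
          (\<forall>x\<in>span (insert b B). inner f x = (\<Sum>i<Suc n. inner f (?q i) * inner (?m i) x))"
        by blast
      moreover have "\<forall>i<Suc n. ?q i \<in> span (insert b B) \<and> ?m i \<in> M"
        using q m m' b'_span sub by (auto simp: less_Suc_eq)
      moreover have "\<forall>i<Suc n. \<forall>j<Suc n. inner (?m i) (?q j) = (if i = j then 1 else 0)"
        using bi m' mb' by (auto simp: less_Suc_eq)
      ultimately show ?thesis by blast
    qed
  qed
  then show ?thesis by (elim exE conjE) (intro exI conjI, assumption+)
qed

lemma subspace_finite_basis:
  fixes Q :: "'a::real_vector set"
  assumes "subspace Q" "Q \<subseteq> span G" "finite G"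
  obtains B where "finite B" "span B = Q"
proof -
  obtain B where B: "B \<subseteq> Q" "independent B" "Q \<subseteq> span B" "card B = dim Q"
    by (rule basis_exists[of Q])
  then have "finite B" 
    using independent_span_bound[of G B] assms(2,3) order_trans[of B Q "span G"] by simp
  moreover have "span B = Q" using span_subspace[OF B(1,3) assms(1)] .
  ultimately show thesis by (rule that)
qed

section \<open>Smooth functions\<close>

lemma Ck_SucI:
  assumes "\<And>x. (f has_derivative f' x) (at x)" "\<And>b. b \<in> Basis \<Longrightarrow> Ck k (\<lambda>x. f' x b)"
  shows "Ck (Suc k) f"
proof -
  have "frechet_derivative f (at x) = f' x" for x
    using frechet_derivative_at[OF assms(1)] by simp
  then show ?thesis using assms unfolding Ck.simps differentiable_def by auto
qed

lemma Ck_has_derivative: "Ck (Suc k) f \<Longrightarrow> (f has_derivative frechet_derivative f (at x)) (at x)"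
  by (simp add: frechet_derivative_works[symmetric])

lemma Ck_derivative: "Ck (Suc k) f \<Longrightarrow> b \<in> Basis \<Longrightarrow> Ck k (\<lambda>x. frechet_derivative f (at x) b)"
  by simp

declare Ck.simps(2) [simp del]

lemma Ck_Suc_imp: "Ck (Suc k) f \<Longrightarrow> Ck k f"
proof (induction k arbitrary: f)
  case 0
  then show ?case
    using has_derivative_continuous[OF Ck_has_derivative[OF 0]]
    by (simp add: continuous_at_imp_continuous_on)
next
  case (Suc k)
  show ?case
    by (rule Ck_SucI[OF Ck_has_derivative[OF Suc.prems]]) (intro Suc.IH Ck_derivative Suc.prems)
qed

lemma Ck_continuous: "Ck k f \<Longrightarrow> continuous_on UNIV f"
  by (induction k) (auto dest: Ck_Suc_imp)

lemma Ck_const: "Ck k (\<lambda>x. c)"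
proof (induction k arbitrary: c)
  case (Suc k)
  show ?case by (rule Ck_SucI[OF has_derivative_const]) (rule Suc)
qed simp

lemma Ck_bounded_linear: "bounded_linear f \<Longrightarrow> Ck k f"
proof (cases k)
  case 0
  then show "bounded_linear f \<Longrightarrow> ?thesis" by (simp add: linear_continuous_on)
next
  case (Suc j)
  then show "bounded_linear f \<Longrightarrow> ?thesis"
    by (auto intro!: Ck_SucI[OF bounded_linear_imp_has_derivative] Ck_const)
qed

lemma Ck_add: "Ck k f \<Longrightarrow> Ck k g \<Longrightarrow> Ck k (\<lambda>x. f x + g x)"
proof (induction k arbitrary: f g)
  case 0
  then show ?case by (simp add: continuous_on_add)
next
  case (Suc k)
  show ?case
    by (rule Ck_SucI[OF has_derivative_add[OF Ck_has_derivative[OF Suc.prems(1)]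
            Ck_has_derivative[OF Suc.prems(2)]]])
      (intro Suc.IH Ck_derivative Suc.prems)
qed

lemma Ck_sum: "(\<And>i. i \<in> I \<Longrightarrow> Ck k (f i)) \<Longrightarrow> Ck k (\<lambda>x. \<Sum>i\<in>I. f i x)"
  by (induction I rule: infinite_finite_induct) (simp_all add: Ck_const Ck_add)

lemma Ck_linear_compose: "bounded_linear L \<Longrightarrow> Ck k f \<Longrightarrow> Ck k (\<lambda>x. L (f x))"
proof (induction k arbitrary: f)
  case 0
  then show ?case by (simp add: linear_continuous_on_compose bounded_linear.continuous_on)
next
  case (Suc k)
  show ?case
    by (rule Ck_SucI[OF bounded_linear.has_derivative[OF Suc.prems(1) Ck_has_derivative[OF Suc.prems(2)]]])
      (intro Suc.IH Ck_derivative Suc.prems)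
qed

lemma Ck_bilinear:
  assumes "bounded_bilinear m"
  shows "Ck k f \<Longrightarrow> Ck k g \<Longrightarrow> Ck k (\<lambda>x. m (f x) (g x))"
proof (induction k arbitrary: f g)
  case 0
  then show ?case by (simp add: bounded_bilinear.continuous_on[OF assms])
next
  case (Suc k)
  show ?case
    by (rule Ck_SucI[OF bounded_bilinear.FDERIV[OF assms Ck_has_derivative[OF Suc.prems(1)]
            Ck_has_derivative[OF Suc.prems(2)]]])
      (intro Ck_add Suc.IH Ck_derivative Suc.prems Ck_Suc_imp[OF Suc.prems(1)]
        Ck_Suc_imp[OF Suc.prems(2)])
qed

lemmas Ck_mult = Ck_bilinear[OF bounded_bilinear_mult]
lemmas Ck_scaleR = Ck_bilinear[OF bounded_bilinear_scaleR]

lemma Ck_prod: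
  fixes f :: "'i \<Rightarrow> 'a::euclidean_space \<Rightarrow> 'b::{real_normed_field}"
  shows "(\<And>i. i \<in> I \<Longrightarrow> Ck k (f i)) \<Longrightarrow> Ck k (\<lambda>x. \<Prod>i\<in>I. f i x)"
  by (induction I rule: infinite_finite_induct) (simp_all add: Ck_const Ck_mult)

lemma Ck_vec_nth: "Ck k f \<Longrightarrow> Ck k (\<lambda>x. f x $ i)"
  by (rule Ck_linear_compose[OF bounded_linear_vec_nth])

lemma vec_eq_sum_axis: "(v :: real^'n) = (\<Sum>i\<in>UNIV. (v $ i) *\<^sub>R axis i 1)"
  using basis_expansion[of v] by (simp add: scalar_mult_eq_scaleR)

lemma Ck_vec:
  fixes f :: "'a::euclidean_space \<Rightarrow> real^'n"
  assumes "\<And>i. Ck k (\<lambda>x. f x $ i)"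
  shows "Ck k f"
proof -
  have "Ck k (\<lambda>x. \<Sum>i\<in>UNIV. (f x $ i) *\<^sub>R axis i (1::real))"
    by (intro Ck_sum Ck_scaleR Ck_const assms)
  moreover have "(\<lambda>x. \<Sum>i\<in>UNIV. (f x $ i) *\<^sub>R axis i (1::real)) = f"
    by (rule ext) (rule vec_eq_sum_axis[symmetric])
  ultimately show ?thesis by simp
qed

lemma has_derivative_translate:
  assumes "(f has_derivative f') (at (x + h))"
  shows "((\<lambda>x. f (x + h)) has_derivative f') (at x)"
proof -
  have "((\<lambda>x. x + h) has_derivative (\<lambda>v. v)) (at x)"
    by (auto intro!: derivative_eq_intros)
  from has_derivative_compose[OF this assms] show ?thesis .
qed

lemma Ck_translate: "Ck k f \<Longrightarrow> Ck k (\<lambda>x. f (x + h))"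
proof (induction k arbitrary: f)
  case 0
  then show ?case by (auto intro!: continuous_intros continuous_on_compose2[of UNIV f])
next
  case (Suc k)
  show ?case
    by (rule Ck_SucI[OF has_derivative_translate[OF Ck_has_derivative[OF Suc.prems]]])
      (rule Suc.IH[OF Ck_derivative[OF Suc.prems]])
qed

text \<open>Differentiation replaces \<open>d j\<close> by \<open>d (Suc j)\<close>, hence the
  induction over the order of smoothness must treat all members of the family at once.\<close>

lemma Ck_ridge:
  fixes v :: "'a::euclidean_space" and d :: "nat \<Rightarrow> real \<Rightarrow> real"
  assumes d: "\<And>j y. (d j has_real_derivative d (Suc j) y) (at y)"
  shows "Ck k (\<lambda>x. d j (inner x v + c))"
proof (induction k arbitrary: j)
  case 0
  have "continuous_on UNIV (d j)"
    using DERIV_continuous[OF d] by (simp add: continuous_at_imp_continuous_on)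
  then show ?case by (auto intro!: continuous_intros continuous_on_compose2[of UNIV "d j"])
next
  case (Suc k)
  have der: "((\<lambda>x. d j (inner x v + c)) has_derivative (\<lambda>w. d (Suc j) (inner x v + c) * inner w v)) (at x)"
    for x
  proof -
    have "((\<lambda>x. inner x v + c) has_derivative (\<lambda>w. inner w v)) (at x)"
      by (auto intro!: derivative_eq_intros)
    from has_derivative_compose[OF this d[of j, unfolded has_field_derivative_def]] show ?thesis
      by simp
  qed
  show ?case
    by (rule Ck_SucI[OF der]) (intro Ck_mult Suc.IH Ck_const)
qed

subsection \<open>Smooth bump functions\<close>

text \<open>With the polynomial factor the class is closed under differentiation, whereas
  \<open>flat\<close> alone, the case \<open>p = 1\<close>, is not.\<close>

definition flat_exp :: "real poly \<Rightarrow> real \<Rightarrow> real" where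
  "flat_exp p y = (if y > 0 then poly p (1 / y) * exp (- (1 / y)) else 0)"

lemma poly_exp_decay: "((\<lambda>z::real. poly p z * exp (- z)) \<longlongrightarrow> 0) at_top"
proof -
  have "((\<lambda>z::real. \<Sum>i\<le>degree p. coeff p i * (z ^ i / exp z)) \<longlongrightarrow> (\<Sum>i\<le>degree p. coeff p i * 0)) at_top"
    by (intro tendsto_sum tendsto_mult tendsto_const tendsto_power_div_exp_0)
  moreover have "(\<Sum>i\<le>degree p. coeff p i * (z ^ i / exp z)) = poly p z * exp (- z)" for z
    by (simp add: poly_altdef sum_distrib_right exp_minus divide_inverse mult.assoc)
  ultimately show ?thesis by simp
qed

text \<open>With \<open>z = 1 / y\<close> the chain rule contributes \<open>- z ^ 2\<close>, which
  gives the new polynomial \<open>z ^ 2 * (p - p')\<close>; at the origin exponential decay beats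
  every polynomial.\<close>

lemma flat_exp_derivative:
  "(flat_exp p has_real_derivative flat_exp ([:0, 0, 1:] * (p - pderiv p)) y) (at y)"
proof (cases y "0::real" rule: linorder_cases)
  case less
  have "((\<lambda>y. 0) has_real_derivative 0) (at y)" by simp
  then have "(flat_exp p has_real_derivative 0) (at y)"
    by (rule DERIV_cong_ev[THEN iffD1, rotated -1])
      (use less eventually_nhds_in_open[of "{..<0}" y] in
        \<open>auto simp: flat_exp_def elim!: eventually_mono\<close>)
  then show ?thesis using less by (simp add: flat_exp_def)
next
  case greater
  have "((\<lambda>y. poly p (1 / y) * exp (- (1 / y))) has_real_derivative
      poly ([:0, 0, 1:] * (p - pderiv p)) (1 / y) * exp (- (1 / y))) (at y)"
    using greater
    by (auto intro!: derivative_eq_intros DERIV_chain2[OF poly_DERIV]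
        simp: field_simps power2_eq_square)
  then have "(flat_exp p has_real_derivative
      poly ([:0, 0, 1:] * (p - pderiv p)) (1 / y) * exp (- (1 / y))) (at y)"
    by (rule DERIV_cong_ev[THEN iffD1, rotated -1])
      (use greater eventually_nhds_in_open[of "{0<..}" y] in
        \<open>auto simp: flat_exp_def elim!: eventually_mono\<close>)
  then show ?thesis using greater by (simp add: flat_exp_def)
next
  case equal
  have "((\<lambda>h. flat_exp p h / h) \<longlongrightarrow> 0) (at_right 0)"
  proof -
    \<comment> \<open>With \<open>z = 1 / h\<close> the difference quotient at 0 is
      \<open>z * p(z) * exp (- z)\<close>; this is where the factor \<open>[:0, 1:]\<close> comes
      from.\<close>
    have "((\<lambda>h::real. poly ([:0, 1:] * p) (inverse h) * exp (- inverse h)) \<longlongrightarrow> 0) (at_right 0)"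
      by (rule filterlim_compose[OF poly_exp_decay filterlim_inverse_at_top_right])
    moreover have "\<forall>\<^sub>F h in at_right 0. poly ([:0, 1:] * p) (inverse h) * exp (- inverse h) = flat_exp p h / h"
      by (auto simp: eventually_at_right_field flat_exp_def divide_inverse intro!: exI[of _ 1])
    ultimately show ?thesis by (rule Lim_transform_eventually)
  qed
  moreover have "((\<lambda>h. flat_exp p h / h) \<longlongrightarrow> 0) (at_left 0)"
    by (rule tendsto_eventually) (auto simp: eventually_at_left_field flat_exp_def intro!: exI[of _ "-1"])
  ultimately have "((\<lambda>h. flat_exp p h / h) \<longlongrightarrow> 0) (at 0)"
    using filterlim_split_at by blast
  then show ?thesis unfolding equal DERIV_def by (simp add: flat_exp_def)
qed

definition flat :: "real \<Rightarrow> real" where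
  "flat y = (if y > 0 then exp (- (1 / y)) else 0)"

lemma Ck_flat: "Ck k (\<lambda>x::'a::euclidean_space. flat (inner x v + c))"
proof -
  \<comment> \<open>\<open>q j\<close> is the polynomial belonging to the j-th derivative of
    \<open>flat\<close>, starting from the constant 1.\<close>
  define q where "q = rec_nat 1 (\<lambda>j p. [:0, 0, 1:] * (p - pderiv p :: real poly))"
  have "(flat_exp (q j) has_real_derivative flat_exp (q (Suc j)) y) (at y)" for j y
    unfolding q_def using flat_exp_derivative by simp
  from Ck_ridge[where d = "\<lambda>j. flat_exp (q j)", OF this, of k 0 v c]
  show ?thesis by (simp add: q_def flat_exp_def flat_def[abs_def] cong: if_cong)
qed

lemma flat_bounds: "0 \<le> flat y" "flat y \<le> 1"
  by (auto simp: flat_def)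

lemma flat_eq_0_iff: "flat y = 0 \<longleftrightarrow> y \<le> 0"
  by (auto simp: flat_def)

lemma flat_tendsto:
  assumes "y > 0"
  shows "(\<lambda>n. flat (real (Suc n) * y)) \<longlonglongrightarrow> 1"
proof -
  have "(\<lambda>n. exp (- (inverse (real (Suc n)) * (1 / y)))) \<longlonglongrightarrow> exp (- (0 * (1 / y)))"
    by (intro tendsto_intros LIMSEQ_inverse_real_of_nat)
  moreover have "exp (- (inverse (real (Suc n)) * (1 / y))) = flat (real (Suc n) * y)" for n
    using assms by (simp add: flat_def field_simps add_pos_nonneg)
  ultimately show ?thesis by simp
qed

text \<open>Positive exactly on the open box for every \<open>n\<close>; as \<open>n\<close> grows
  the flanks steepen and the function tends to the indicator.\<close>

definition box_bump :: "'a::euclidean_space \<Rightarrow> 'a \<Rightarrow> nat \<Rightarrow> 'a \<Rightarrow> real" where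
  "box_bump a b n x = (\<Prod>i\<in>Basis. flat (real (Suc n) * (inner x i - inner a i)) *
     flat (real (Suc n) * (inner b i - inner x i)))"

lemma Ck_box_bump: "Ck k (box_bump a b n)"
proof -
  have "flat (real (Suc n) * (inner x i - inner a i)) =
        flat (inner x (real (Suc n) *\<^sub>R i) + - (real (Suc n) * inner a i))"
    "flat (real (Suc n) * (inner b i - inner x i)) =
        flat (inner x (- real (Suc n) *\<^sub>R i) + real (Suc n) * inner b i)" for x i :: 'a
    by (simp_all add: algebra_simps)
  then show ?thesis
    unfolding box_bump_def[abs_def] by (simp only:) (intro Ck_prod Ck_mult Ck_flat)
qed

lemma box_bump_bounds: "0 \<le> box_bump a b n x" "box_bump a b n x \<le> 1"
  unfolding box_bump_def by (auto intro!: prod_nonneg prod_le_1 mult_le_one simp: flat_bounds)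

lemma box_bump_eq_0_iff: "box_bump a b n x = 0 \<longleftrightarrow> x \<notin> box a b"
proof -
  have "box_bump a b n x = 0 \<longleftrightarrow> (\<exists>i\<in>Basis. x \<bullet> i \<le> a \<bullet> i \<or> b \<bullet> i \<le> x \<bullet> i)"
    by (auto simp: box_bump_def flat_eq_0_iff mult_le_0_iff)
  then show ?thesis unfolding mem_box by (meson not_le)
qed

lemma box_bump_tendsto: "(\<lambda>n. box_bump a b n x) \<longlonglongrightarrow> indicator (box a b) x"
proof (cases "x \<in> box a b")
  case True
  then have "(\<lambda>n. box_bump a b n x) \<longlonglongrightarrow> (\<Prod>i\<in>(Basis::'a set). 1 * 1)"
    unfolding box_bump_def
    by (intro tendsto_prod tendsto_mult flat_tendsto) (auto simp: mem_box)
  then show ?thesis using True by simp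
next
  case False
  then have "box_bump a b n x = 0" for n by (simp add: box_bump_eq_0_iff)
  then show ?thesis using False by simp
qed

subsection \<open>Test functions\<close>

lemma frechet_derivative_eq_0_outside:
  assumes "closed C" "\<And>y. y \<notin> C \<Longrightarrow> f y = 0" "x \<notin> C"
  shows "frechet_derivative f (at x) = (\<lambda>_. 0)"
proof -
  have "((\<lambda>_. 0) has_derivative (\<lambda>_. 0)) (at x)" by (rule has_derivative_const)
  then have "(f has_derivative (\<lambda>_. 0)) (at x)"
    by (rule has_derivative_transform_within_open[OF _ open_Compl[OF assms(1)]]) (use assms in auto)
  then show ?thesis by (rule frechet_derivative_at[symmetric])
qed

lemma test_functionI:
  assumes "\<And>k. Ck k \<phi>" "compact C" "C \<subseteq> S" "\<And>x. x \<notin> C \<Longrightarrow> \<phi> x = 0"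
  shows "\<phi> \<in> test_functions S"
proof -
  have "closure {x. \<phi> x \<noteq> 0} \<subseteq> C"
    using assms by (intro closure_minimal compact_imp_closed) auto
  moreover have "bounded (closure {x. \<phi> x \<noteq> 0})"
    using bounded_subset[OF compact_imp_bounded[OF assms(2)] calculation] .
  ultimately show ?thesis
    unfolding test_functions_def using assms(1,3) by (simp add: compact_eq_bounded_closed)
qed

lemma test_function_Ck: "\<phi> \<in> test_functions S \<Longrightarrow> Ck k \<phi>"
  by (simp add: test_functions_def)

lemma test_function_support:
  assumes "\<phi> \<in> test_functions S"
  shows "\<exists>C. compact C \<and> C \<subseteq> S \<and> (\<forall>x. x \<notin> C \<longrightarrow> \<phi> x = 0)"
proof (intro exI conjI allI impI)
  show "compact (closure {x. \<phi> x \<noteq> 0})" "closure {x. \<phi> x \<noteq> 0} \<subseteq> S"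
    using assms by (auto simp: test_functions_def)
  show "\<phi> x = 0" if "x \<notin> closure {x. \<phi> x \<noteq> 0}" for x
    using that closure_subset[of "{x. \<phi> x \<noteq> 0}"] by auto
qed

lemma test_function_eq_0: "\<phi> \<in> test_functions S \<Longrightarrow> x \<notin> S \<Longrightarrow> \<phi> x = 0"
  using test_function_support[of \<phi> S] by blast

lemma test_functions_mono: "\<phi> \<in> test_functions S \<Longrightarrow> S \<subseteq> S' \<Longrightarrow> \<phi> \<in> test_functions S'"
  by (auto simp: test_functions_def)

lemma test_function_zero: "(\<lambda>x. 0) \<in> test_functions S"
  by (rule test_functionI[of _ "{}"]) (auto simp: Ck_const)

lemma test_function_add:
  assumes "\<phi> \<in> test_functions S" "\<psi> \<in> test_functions S"
  shows "(\<lambda>x. \<phi> x + \<psi> x) \<in> test_functions S"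
proof -
  obtain C where C: "compact C" "C \<subseteq> S" "\<And>x. x \<notin> C \<Longrightarrow> \<phi> x = 0"
    using test_function_support[OF assms(1)] by blast
  obtain D where D: "compact D" "D \<subseteq> S" "\<And>x. x \<notin> D \<Longrightarrow> \<psi> x = 0"
    using test_function_support[OF assms(2)] by blast
  show ?thesis using C D
    by (intro test_functionI[of _ "C \<union> D"]
        Ck_add[OF test_function_Ck[OF assms(1)] test_function_Ck[OF assms(2)]]) auto
qed

lemma test_function_linear:
  assumes "\<phi> \<in> test_functions S" "bounded_linear L"
  shows "(\<lambda>x. L (\<phi> x)) \<in> test_functions S"
proof -
  obtain C where "compact C" "C \<subseteq> S" "\<And>x. x \<notin> C \<Longrightarrow> \<phi> x = 0"
    using test_function_support[OF assms(1)] by blast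
  then show ?thesis
    using linear_0[OF bounded_linear.linear[OF assms(2)]]
    by (intro test_functionI[of _ C] Ck_linear_compose[OF assms(2) test_function_Ck[OF assms(1)]]) auto
qed

lemma test_function_scaleR: "\<phi> \<in> test_functions S \<Longrightarrow> (\<lambda>x. c *\<^sub>R \<phi> x) \<in> test_functions S"
  by (rule test_function_linear[OF _ bounded_linear_scaleR_right])

lemma test_function_scaleR_const: "\<phi> \<in> test_functions S \<Longrightarrow> (\<lambda>x. \<phi> x *\<^sub>R c) \<in> test_functions S"
  by (rule test_function_linear[OF _ bounded_linear_scaleR_left])

lemma test_function_nth: "\<phi> \<in> test_functions S \<Longrightarrow> (\<lambda>x. \<phi> x $ i) \<in> test_functions S"
  by (rule test_function_linear[OF _ bounded_linear_vec_nth])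

lemma test_function_diff:
  assumes "\<phi> \<in> test_functions S" "\<psi> \<in> test_functions S"
  shows "(\<lambda>x. \<phi> x - \<psi> x) \<in> test_functions S"
  using test_function_add[OF assms(1) test_function_scaleR[OF assms(2), of "-1"]] by simp

lemma test_function_sum:
  "(\<And>i. i \<in> I \<Longrightarrow> f i \<in> test_functions S) \<Longrightarrow> (\<lambda>x. \<Sum>i\<in>I. f i x) \<in> test_functions S"
  by (induction I rule: infinite_finite_induct) (simp_all add: test_function_zero test_function_add)

lemma test_function_vec:
  fixes \<phi> :: "'a::euclidean_space \<Rightarrow> real^'n"
  assumes "\<And>i. (\<lambda>x. \<phi> x $ i) \<in> test_functions S"
  shows "\<phi> \<in> test_functions S"
proof -
  have "(\<lambda>x. \<Sum>i\<in>UNIV. (\<phi> x $ i) *\<^sub>R axis i (1::real)) \<in> test_functions S"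
    by (intro test_function_sum test_function_scaleR_const assms)
  moreover have "(\<lambda>x. \<Sum>i\<in>UNIV. (\<phi> x $ i) *\<^sub>R axis i 1) = \<phi>"
    by (rule ext) (rule vec_eq_sum_axis[symmetric])
  ultimately show ?thesis by simp
qed

lemma test_function_derivative:
  assumes "\<phi> \<in> test_functions S" "b \<in> Basis"
  shows "(\<lambda>x. frechet_derivative \<phi> (at x) b) \<in> test_functions S"
proof -
  obtain C where C: "compact C" "C \<subseteq> S" "\<And>x. x \<notin> C \<Longrightarrow> \<phi> x = 0"
    using test_function_support[OF assms(1)] by blast
  show ?thesis
  proof (rule test_functionI[OF _ C(1,2)])
    show "Ck k (\<lambda>x. frechet_derivative \<phi> (at x) b)" for k
      by (rule Ck_derivative[OF test_function_Ck[OF assms(1)] assms(2)])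
    show "frechet_derivative \<phi> (at x) b = 0" if "x \<notin> C" for x
      using frechet_derivative_eq_0_outside[OF compact_imp_closed[OF C(1)] C(3) that] by simp
  qed
qed

lemma test_function_translate:
  assumes "\<phi> \<in> test_functions S" "\<And>x. x \<in> S \<Longrightarrow> x - h \<in> S'"
  shows "(\<lambda>x. \<phi> (x + h)) \<in> test_functions S'"
proof -
  obtain C where C: "compact C" "C \<subseteq> S" "\<And>x. x \<notin> C \<Longrightarrow> \<phi> x = 0"
    using test_function_support[OF assms(1)] by blast
  show ?thesis
  proof (rule test_functionI[of _ "(\<lambda>x. - h + x) ` C"])
    show "(\<lambda>x. - h + x) ` C \<subseteq> S'" using C(2) assms(2) by force
    show "\<phi> (x + h) = 0" if "x \<notin> (\<lambda>x. - h + x) ` C" for x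
    proof (rule C(3))
      show "x + h \<notin> C" using that by (auto simp: image_iff dest: bspec[of C _ "x + h"])
    qed
    show "compact ((\<lambda>x. - h + x) ` C)" by (rule compact_translation[OF C(1)])
    show "Ck k (\<lambda>x. \<phi> (x + h))" for k by (rule Ck_translate[OF test_function_Ck[OF assms(1)]])
  qed
qed

lemma box_bump_test_function:
  assumes "cbox a b \<subseteq> S"
  shows "box_bump a b n \<in> test_functions S"
  by (rule test_functionI[OF Ck_box_bump compact_cbox assms])
    (use box_bump_eq_0_iff box_subset_cbox in blast)

lemma integrable_compact_support:
  fixes f :: "'a::euclidean_space \<Rightarrow> 'b::{banach, second_countable_topology}"
  assumes "continuous_on UNIV f" "compact C" "\<And>x. x \<notin> C \<Longrightarrow> f x = 0"
  shows "integrable lborel f"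
proof -
  have "integrable lborel (\<lambda>x. indicator C x *\<^sub>R f x)"
    by (intro borel_integrable_compact assms continuous_on_subset[OF assms(1)]) auto
  moreover have "(\<lambda>x. indicator C x *\<^sub>R f x) = f" using assms(3) by (auto simp: indicator_def)
  ultimately show ?thesis by simp
qed

lemma L2_continuous_on_bounded:
  fixes f :: "'a::euclidean_space \<Rightarrow> 'b::euclidean_space"
  assumes S: "S \<in> sets lebesgue" "bounded S" and f: "continuous_on UNIV f"
  shows "f \<in> L2 S"
proof -
  have fb: "f \<in> borel_measurable lebesgue"
    using borel_measurable_continuous_onI[OF f] by (simp add: measurable_completion)
  obtain a b where ab: "S \<subseteq> cbox a b" using bounded_subset_cbox_symmetric[OF S(2)] by blast
  have i: "integrable lborel (\<lambda>x. indicator (cbox a b) x *\<^sub>R (norm (f x))\<^sup>2)"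
    by (intro borel_integrable_compact continuous_intros continuous_on_subset[OF f]) auto
  have "integrable lebesgue (\<lambda>x. if x \<in> S then (norm (f x))\<^sup>2 else 0)"
  proof (rule Bochner_Integration.integrable_bound)
    show "integrable lebesgue (\<lambda>x. indicator (cbox a b) x *\<^sub>R (norm (f x))\<^sup>2)"
      using i by (rule integrable_completion[THEN iffD2, rotated])
        (rule borel_measurable_integrable[OF i])
    show "(\<lambda>x. if x \<in> S then (norm (f x))\<^sup>2 else 0) \<in> borel_measurable lebesgue"
      using S fb by (intro measurable_If_set borel_measurable_power borel_measurable_norm) auto
    show "AE x in lebesgue. norm (if x \<in> S then (norm (f x))\<^sup>2 else 0)
        \<le> norm (indicator (cbox a b) x *\<^sub>R (norm (f x))\<^sup>2)"
      using ab by (auto simp: indicator_def)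
  qed
  then show ?thesis
    using S fb by (simp add: L2_def Lebesgue_Measure.integrable_restrict_UNIV measurable_restrict_space1)
qed

lemma L2_compact_support:
  fixes f :: "'a::euclidean_space \<Rightarrow> 'b::euclidean_space"
  assumes "S \<in> sets lebesgue" "continuous_on UNIV f" "compact C" "\<And>x. x \<notin> C \<Longrightarrow> f x = 0"
  shows "f \<in> L2 S"
proof -
  have "C \<in> sets lebesgue" using assms(3) by (simp add: borel_compact)
  moreover have "f \<in> L2 C"
    using assms calculation by (intro L2_continuous_on_bounded compact_imp_bounded)
  moreover have "(\<lambda>x. if x \<in> C then f x else 0) = f" using assms(4) by auto
  ultimately have "f \<in> L2 UNIV" using L2_iff_extend[of C f] by simp
  then show ?thesis using assms(1) by (intro L2_subset[of f UNIV S]) auto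
qed

lemma test_function_L2:
  fixes \<phi> :: "'a::euclidean_space \<Rightarrow> 'b::euclidean_space"
  assumes "\<phi> \<in> test_functions S" "S' \<in> sets lebesgue"
  shows "\<phi> \<in> L2 S'"
proof -
  obtain C where C: "compact C" "C \<subseteq> S" "\<And>x. x \<notin> C \<Longrightarrow> \<phi> x = 0"
    using test_function_support[OF assms(1)] by blast
  then show ?thesis
    using assms(2) Ck_continuous[OF test_function_Ck[OF assms(1), of 0]]
    by (intro L2_compact_support[of S' \<phi> C]) auto
qed

subsection \<open>Integration by parts\<close>

lemma integral_lebesgue_on_eq:
  fixes g :: "'a::euclidean_space \<Rightarrow> 'b::euclidean_space"
  assumes "S \<in> sets lebesgue" "\<And>x. x \<notin> S \<Longrightarrow> g x = 0"
  shows "(LINT x|lebesgue_on S. g x) = (LINT x|lebesgue. g x)"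
proof -
  have "(\<lambda>x. if x \<in> S then g x else 0) = g" using assms(2) by auto
  then show ?thesis using Lebesgue_Measure.integral_restrict_UNIV[OF assms(1), of g] by simp
qed

lemma integral_lborel_translate:
  fixes f :: "'a::euclidean_space \<Rightarrow> real"
  assumes "f \<in> borel_measurable borel"
  shows "(LINT x|lborel. f (x + c)) = (LINT x|lborel. f x)"
proof -
  have "(LINT x|lborel. f x) = (LINT x|distr lborel borel ((+) c). f x)"
    by (simp only: lborel_distr_plus)
  also have "\<dots> = (LINT x|lborel. f (c + x))"
    using assms by (intro integral_distr) auto
  finally show ?thesis by (simp add: add.commute)
qed

lemma directional_derivative:
  assumes "(f has_derivative f') (at (x + t *\<^sub>R v))"
  shows "((\<lambda>s. f (x + s *\<^sub>R v)) has_real_derivative f' v) (at t)"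
proof -
  have "((\<lambda>s. x + s *\<^sub>R v) has_derivative (\<lambda>s. s *\<^sub>R v)) (at t)"
    by (auto intro!: derivative_eq_intros)
  from has_derivative_compose[OF this assms]
  have "((\<lambda>s. f (x + s *\<^sub>R v)) has_derivative (\<lambda>s. f' (s *\<^sub>R v))) (at t)" .
  moreover have "(\<lambda>s. f' (s *\<^sub>R v)) = (*) (f' v)"
    using linear_scale[OF has_derivative_linear[OF assms]] by (auto simp: mult.commute)
  ultimately show ?thesis by (simp add: has_field_derivative_def)
qed

text \<open>The integral of the difference quotient \<open>(f (x + h v) - f x) / h\<close> vanishes by
  translation invariance; let \<open>h\<close> tend to 0.\<close>

lemma integral_derivative_compact_support:
  fixes f :: "'a::euclidean_space \<Rightarrow> real"
  assumes f: "Ck (Suc 0) f" and C: "compact C" "\<And>x. x \<notin> C \<Longrightarrow> f x = 0" and v: "v \<in> Basis"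
  shows "(LINT x|lebesgue. frechet_derivative f (at x) v) = 0"
proof -
  define D where "D x = frechet_derivative f (at x) v" for x
  have D_cont: "continuous_on UNIV D"
    unfolding D_def using Ck_derivative[OF f v] by simp
  have f_cont: "continuous_on UNIV f" using Ck_continuous[OF f] .
  have D_0: "D x = 0" if "x \<notin> C" for x
    unfolding D_def using frechet_derivative_eq_0_outside[OF compact_imp_closed[OF C(1)] C(2) that]
    by simp
  have "bounded (D ` C)"
    using C(1) D_cont by (intro compact_imp_bounded compact_continuous_image continuous_on_subset[OF D_cont]) auto
  then obtain B where "\<And>x. x \<in> C \<Longrightarrow> \<bar>D x\<bar> \<le> B" unfolding bounded_iff by auto
  then have B: "\<bar>D x\<bar> \<le> max B 0" for x using D_0[of x] by (cases "x \<in> C") force+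
  obtain R where R: "\<And>x. x \<in> C \<Longrightarrow> norm x \<le> R"
    using compact_imp_bounded[OF C(1)] unfolding bounded_iff by auto
  \<comment> \<open>Steps of length at most 1 keep the supports of all difference quotients in one
    ball, so that a constant on this ball serves as dominating function.\<close>
  define h where "h n = inverse (real (Suc n))" for n
  have h: "0 < h n" "h n \<le> 1" for n by (auto simp: h_def inverse_le_1_iff)
  define q where "q n x = (f (x + h n *\<^sub>R v) - f x) / h n" for n x
  have f_int: "integrable lborel f" by (rule integrable_compact_support[OF f_cont C])
  have ft_cont: "continuous_on UNIV (\<lambda>x. f (x + c))" for c
    by (intro continuous_on_compose2[OF f_cont] continuous_intros) auto
  have ft_int: "integrable lborel (\<lambda>x. f (x + c))" for c
  proof (rule integrable_compact_support[OF ft_cont])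
    show "compact ((\<lambda>x. - c + x) ` C)" using C(1) by (rule compact_translation)
    show "f (x + c) = 0" if "x \<notin> (\<lambda>x. - c + x) ` C" for x
    proof (rule C(2))
      show "x + c \<notin> C" using that by (auto simp: image_iff dest: bspec[of C _ "x + c"])
    qed
  qed
  have "(LINT x|lborel. q n x) = 0" for n
  proof -
    have "(LINT x|lborel. f (x + h n *\<^sub>R v) - f x) = 0"
      using integral_lborel_translate[OF borel_measurable_continuous_onI[OF f_cont], of "h n *\<^sub>R v"]
      by (simp add: Bochner_Integration.integral_diff[OF ft_int f_int])
    then show ?thesis unfolding q_def by simp
  qed
  moreover have "(\<lambda>n. LINT x|lborel. q n x) \<longlonglongrightarrow> (LINT x|lborel. D x)"
  proof (rule integral_dominated_convergence)
    show "D \<in> borel_measurable lborel" using borel_measurable_continuous_onI[OF D_cont] by simp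
    show "q n \<in> borel_measurable lborel" for n
      unfolding q_def[abs_def]
      using borel_measurable_continuous_onI[OF ft_cont] borel_measurable_continuous_onI[OF f_cont]
      by (intro borel_measurable_divide borel_measurable_diff) auto
    show "integrable lborel (\<lambda>x. indicator (cball 0 (R + norm v)) x *\<^sub>R max B 0)"
      by (intro borel_integrable_compact continuous_intros) auto
    show "AE x in lborel. (\<lambda>n. q n x) \<longlonglongrightarrow> D x"
    proof (rule AE_I2)
      fix x
      have "((\<lambda>s. f (x + s *\<^sub>R v)) has_real_derivative D x) (at 0)"
        unfolding D_def using Ck_has_derivative[OF f] by (intro directional_derivative) simp
      then have "((\<lambda>s. (f (x + s *\<^sub>R v) - f x) / s) \<longlongrightarrow> D x) (at 0)"
        by (simp add: DERIV_def)
      moreover have "filterlim h (at 0) sequentially"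
        unfolding filterlim_at h_def using LIMSEQ_inverse_real_of_nat by auto
      ultimately show "(\<lambda>n. q n x) \<longlonglongrightarrow> D x"
        unfolding q_def by (rule filterlim_compose)
    qed
    show "AE x in lborel. norm (q n x) \<le> indicator (cball 0 (R + norm v)) x *\<^sub>R max B 0" for n
    proof (rule AE_I2)
      fix x
      show "norm (q n x) \<le> indicator (cball 0 (R + norm v)) x *\<^sub>R max B 0"
      proof (cases "x \<in> cball 0 (R + norm v)")
        case True
        have "\<exists>z>0. z < h n \<and> f (x + h n *\<^sub>R v) - f (x + 0 *\<^sub>R v) = (h n - 0) * D (x + z *\<^sub>R v)"
        proof (rule MVT2)
          show "0 < h n" by (rule h)
          show "((\<lambda>s. f (x + s *\<^sub>R v)) has_real_derivative D (x + t *\<^sub>R v)) (at t)" for t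
            unfolding D_def using Ck_has_derivative[OF f] by (intro directional_derivative)
        qed
        then obtain z where "f (x + h n *\<^sub>R v) - f x = h n * D (x + z *\<^sub>R v)" by auto
        then have "q n x = D (x + z *\<^sub>R v)" unfolding q_def using h(1)[of n] by simp
        then show ?thesis using B True by simp
      next
        case False
        have "norm x \<le> norm (x + h n *\<^sub>R v) + norm (h n *\<^sub>R v)"
          using norm_triangle_ineq4[of "x + h n *\<^sub>R v" "h n *\<^sub>R v"] by simp
        moreover have "norm (h n *\<^sub>R v) \<le> norm v"
          using h[of n] by (simp add: mult_left_le_one_le)
        moreover have "norm x > R + norm v" using False by simp
        moreover have "norm v \<ge> 0" by simp
        ultimately have "norm (x + h n *\<^sub>R v) > R" "norm x > R" by linarith+
        then have "x + h n *\<^sub>R v \<notin> C" "x \<notin> C"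
          using R[of "x + h n *\<^sub>R v"] R[of x] by linarith+
        then show ?thesis using C(2) False by (simp add: q_def)
      qed
    qed
  qed
  ultimately have "(LINT x|lborel. D x) = 0" by (simp add: LIMSEQ_const_iff)
  then show ?thesis
    using integral_completion[of D lborel] borel_measurable_continuous_onI[OF D_cont]
    unfolding D_def by simp
qed

text \<open>The vanishing integral of a derivative is applied to the product
  \<open>u x * \<phi> x\<close>, for whose compact support that of \<open>\<phi>\<close> is
  enough.\<close>

lemma integration_by_parts:
  fixes u \<phi> :: "'a::euclidean_space \<Rightarrow> real"
  assumes u: "Ck (Suc 0) u" and \<phi>: "\<phi> \<in> test_functions S" and S: "S \<in> sets lebesgue" and b: "b \<in> Basis"
  shows "(LINT x|lebesgue_on S. u x * frechet_derivative \<phi> (at x) b) =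
    - (LINT x|lebesgue_on S. frechet_derivative u (at x) b * \<phi> x)"
proof -
  obtain C where C: "compact C" "C \<subseteq> S" "\<And>x. x \<notin> C \<Longrightarrow> \<phi> x = 0"
    using test_function_support[OF \<phi>] by blast
  let ?p = "\<lambda>x. u x * \<phi> x"
  have ck: "Ck (Suc 0) ?p" by (rule Ck_mult[OF u test_function_Ck[OF \<phi>]])
  have der: "frechet_derivative ?p (at x) b =
      u x * frechet_derivative \<phi> (at x) b + frechet_derivative u (at x) b * \<phi> x" for x
  proof -
    have "(?p has_derivative (\<lambda>h. u x * frechet_derivative \<phi> (at x) h
        + frechet_derivative u (at x) h * \<phi> x)) (at x)"
      by (rule has_derivative_mult[OF Ck_has_derivative[OF u] Ck_has_derivative[OF test_function_Ck[OF \<phi>]]])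
    from frechet_derivative_at[OF this, symmetric] show ?thesis by simp
  qed
  have d\<phi>: "(\<lambda>x. frechet_derivative \<phi> (at x) b) \<in> test_functions S"
    by (rule test_function_derivative[OF \<phi> b])
  have d\<phi>0: "frechet_derivative \<phi> (at x) b = 0" if "x \<notin> C" for x
    using frechet_derivative_eq_0_outside[OF compact_imp_closed[OF C(1)] C(3) that] by simp
  have c: "continuous_on UNIV u" "continuous_on UNIV \<phi>"
      "continuous_on UNIV (\<lambda>x. frechet_derivative u (at x) b)"
      "continuous_on UNIV (\<lambda>x. frechet_derivative \<phi> (at x) b)"
    using Ck_continuous[OF u] Ck_continuous[OF test_function_Ck[OF \<phi>, of 0]]
      Ck_derivative[OF u b] Ck_continuous[OF test_function_Ck[OF d\<phi>, of 0]] by auto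
  have i: "integrable lebesgue (\<lambda>x. u x * frechet_derivative \<phi> (at x) b)"
      "integrable lebesgue (\<lambda>x. frechet_derivative u (at x) b * \<phi> x)"
  proof -
    have *: "integrable lebesgue g" if "continuous_on UNIV g" "\<And>x. x \<notin> C \<Longrightarrow> g x = 0" for g :: "'a \<Rightarrow> real"
      using integrable_compact_support[OF that(1) C(1) that(2)]
        integrable_completion[of g lborel] borel_measurable_continuous_onI[OF that(1)] by simp
    show "integrable lebesgue (\<lambda>x. u x * frechet_derivative \<phi> (at x) b)"
      by (rule *) (use c in \<open>auto intro!: continuous_on_mult simp: d\<phi>0\<close>)
    show "integrable lebesgue (\<lambda>x. frechet_derivative u (at x) b * \<phi> x)"
      by (rule *) (use c in \<open>auto intro!: continuous_on_mult simp: C\<close>)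
  qed
  have "0 = (LINT x|lebesgue. frechet_derivative ?p (at x) b)"
    by (rule integral_derivative_compact_support[OF ck C(1) _ b, symmetric]) (simp add: C)
  also have "\<dots> = (LINT x|lebesgue. u x * frechet_derivative \<phi> (at x) b) +
      (LINT x|lebesgue. frechet_derivative u (at x) b * \<phi> x)"
    unfolding der by (rule Bochner_Integration.integral_add[OF i])
  finally have "(LINT x|lebesgue. u x * frechet_derivative \<phi> (at x) b) =
      - (LINT x|lebesgue. frechet_derivative u (at x) b * \<phi> x)" by simp
  moreover have "(LINT x|lebesgue_on S. u x * frechet_derivative \<phi> (at x) b) =
      (LINT x|lebesgue. u x * frechet_derivative \<phi> (at x) b)"
    by (rule integral_lebesgue_on_eq[OF S]) (use C(2) d\<phi>0 in auto)
  moreover have "(LINT x|lebesgue_on S. frechet_derivative u (at x) b * \<phi> x) =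
      (LINT x|lebesgue. frechet_derivative u (at x) b * \<phi> x)"
    by (rule integral_lebesgue_on_eq[OF S]) (use C(2,3) in auto)
  ultimately show ?thesis by simp
qed

section \<open>Symmetry of second derivatives and the classical vector identities\<close>

lemma second_difference:
  fixes f :: "'a::euclidean_space \<Rightarrow> real"
  assumes f: "Ck (Suc (Suc 0)) f" and ab: "a \<in> Basis" "b \<in> Basis" and h: "h > 0"
  shows "\<exists>s t. 0 < s \<and> s < h \<and> 0 < t \<and> t < h \<and>
    f (x + h *\<^sub>R b + h *\<^sub>R a) - f (x + h *\<^sub>R a) - f (x + h *\<^sub>R b) + f x =
    h * h * frechet_derivative (\<lambda>y. frechet_derivative f (at y) a) (at (x + s *\<^sub>R a + t *\<^sub>R b)) b"
proof -
  define fa where "fa y = frechet_derivative f (at y) a" for y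
  have fa: "Ck (Suc 0) fa" unfolding fa_def by (rule Ck_derivative[OF f ab(1)])
  have "\<exists>s>0. s < h \<and> (f (x + h *\<^sub>R b + h *\<^sub>R a) - f (x + h *\<^sub>R a))
      - (f (x + h *\<^sub>R b + 0 *\<^sub>R a) - f (x + 0 *\<^sub>R a))
      = (h - 0) * (fa (x + h *\<^sub>R b + s *\<^sub>R a) - fa (x + s *\<^sub>R a))"
  proof (rule MVT2[OF h])
    fix s
    have "((\<lambda>s. f (y + s *\<^sub>R a)) has_real_derivative fa (y + s *\<^sub>R a)) (at s)" for y
      unfolding fa_def using Ck_has_derivative[OF f] by (rule directional_derivative)
    then show "((\<lambda>s. f (x + h *\<^sub>R b + s *\<^sub>R a) - f (x + s *\<^sub>R a)) has_real_derivative
        fa (x + h *\<^sub>R b + s *\<^sub>R a) - fa (x + s *\<^sub>R a)) (at s)"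
      by (intro DERIV_diff)
  qed
  then obtain s where s: "0 < s" "s < h" "(f (x + h *\<^sub>R b + h *\<^sub>R a) - f (x + h *\<^sub>R a))
      - (f (x + h *\<^sub>R b) - f x) = h * (fa (x + h *\<^sub>R b + s *\<^sub>R a) - fa (x + s *\<^sub>R a))"
    by auto
  have "\<exists>t>0. t < h \<and> fa (x + s *\<^sub>R a + h *\<^sub>R b) - fa (x + s *\<^sub>R a + 0 *\<^sub>R b)
      = (h - 0) * frechet_derivative fa (at (x + s *\<^sub>R a + t *\<^sub>R b)) b"
  proof (rule MVT2[OF h])
    show "((\<lambda>t. fa (x + s *\<^sub>R a + t *\<^sub>R b)) has_real_derivative
        frechet_derivative fa (at (x + s *\<^sub>R a + t *\<^sub>R b)) b) (at t)" for t
      using Ck_has_derivative[OF fa] by (rule directional_derivative)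
  qed
  then obtain t where t: "0 < t" "t < h" "fa (x + s *\<^sub>R a + h *\<^sub>R b) - fa (x + s *\<^sub>R a)
      = h * frechet_derivative fa (at (x + s *\<^sub>R a + t *\<^sub>R b)) b"
    by auto
  have comm: "x + h *\<^sub>R b + s *\<^sub>R a = x + s *\<^sub>R a + h *\<^sub>R b" by simp
  have "f (x + h *\<^sub>R b + h *\<^sub>R a) - f (x + h *\<^sub>R a) - f (x + h *\<^sub>R b) + f x =
      h * (h * frechet_derivative fa (at (x + s *\<^sub>R a + t *\<^sub>R b)) b)"
    using s(3)[unfolded comm t(3)] by linarith
  then show ?thesis using s t unfolding fa_def by (intro exI[of _ s] exI[of _ t]) simp
qed

text \<open>The second difference is symmetric in the two directions. The mean value theorem, used
  twice in either order, expresses it by each mixed derivative at a point near \<open>x\<close>;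
  continuity lets these points tend to \<open>x\<close>.\<close>

lemma clairaut:
  fixes f :: "'a::euclidean_space \<Rightarrow> real"
  assumes f: "Ck (Suc (Suc 0)) f" and ab: "a \<in> Basis" "b \<in> Basis"
  shows "frechet_derivative (\<lambda>y. frechet_derivative f (at y) a) (at x) b =
    frechet_derivative (\<lambda>y. frechet_derivative f (at y) b) (at x) a"
proof -
  define G where "G y = frechet_derivative (\<lambda>y. frechet_derivative f (at y) a) (at y) b" for y
  define H where "H y = frechet_derivative (\<lambda>y. frechet_derivative f (at y) b) (at y) a" for y
  have "continuous_on UNIV G" "continuous_on UNIV H"
    unfolding G_def H_def
    using Ck_derivative[OF Ck_derivative[OF f ab(1)] ab(2)] Ck_derivative[OF Ck_derivative[OF f ab(2)] ab(1)]
    by simp_all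
  then have cont: "isCont G x" "isCont H x" by (simp_all add: continuous_on_eq_continuous_at)
  have "\<bar>G x - H x\<bar> \<le> e" if e: "e > 0" for e
  proof -
    obtain d1 where d1: "d1 > 0" "\<And>y. dist y x < d1 \<Longrightarrow> dist (G y) (G x) < e / 2"
      using cont(1) e unfolding continuous_at_eps_delta by (meson half_gt_zero)
    obtain d2 where d2: "d2 > 0" "\<And>y. dist y x < d2 \<Longrightarrow> dist (H y) (H x) < e / 2"
      using cont(2) e unfolding continuous_at_eps_delta by (meson half_gt_zero)
    \<comment> \<open>The intermediate points are displaced by less than \<open>h\<close> in each of
      two unit directions, so half of the smaller radius suffices.\<close>
    define h where "h = min d1 d2 / 2"
    have h: "h > 0" "2 * h \<le> d1" "2 * h \<le> d2" using d1 d2 by (auto simp: h_def)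
    have near: "dist (x + s *\<^sub>R u + t *\<^sub>R v) x < 2 * h"
      if "0 < s" "s < h" "0 < t" "t < h" "u \<in> Basis" "v \<in> Basis" for s t and u v :: 'a
    proof -
      have "dist (x + s *\<^sub>R u + t *\<^sub>R v) x \<le> norm (s *\<^sub>R u) + norm (t *\<^sub>R v)"
        unfolding dist_norm using norm_triangle_ineq[of "s *\<^sub>R u" "t *\<^sub>R v"] by simp
      then show ?thesis using that by simp
    qed
    obtain s t where st: "0 < s" "s < h" "0 < t" "t < h"
      "f (x + h *\<^sub>R b + h *\<^sub>R a) - f (x + h *\<^sub>R a) - f (x + h *\<^sub>R b) + f x = h * h * G (x + s *\<^sub>R a + t *\<^sub>R b)"
      using second_difference[OF f ab h(1)] unfolding G_def by blast
    obtain s' t' where st': "0 < s'" "s' < h" "0 < t'" "t' < h"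
      "f (x + h *\<^sub>R a + h *\<^sub>R b) - f (x + h *\<^sub>R b) - f (x + h *\<^sub>R a) + f x = h * h * H (x + s' *\<^sub>R b + t' *\<^sub>R a)"
      using second_difference[OF f ab(2,1) h(1)] unfolding H_def by blast
    have comm: "x + h *\<^sub>R b + h *\<^sub>R a = x + h *\<^sub>R a + h *\<^sub>R b" by simp
    have "h * h * G (x + s *\<^sub>R a + t *\<^sub>R b) = h * h * H (x + s' *\<^sub>R b + t' *\<^sub>R a)"
      using st(5)[unfolded comm] st'(5) by linarith
    then have eq: "G (x + s *\<^sub>R a + t *\<^sub>R b) = H (x + s' *\<^sub>R b + t' *\<^sub>R a)" using h(1) by simp
    have "dist (G (x + s *\<^sub>R a + t *\<^sub>R b)) (G x) < e / 2"
      using near[OF st(1-4) ab] h by (intro d1) linarith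
    moreover have "dist (H (x + s' *\<^sub>R b + t' *\<^sub>R a)) (H x) < e / 2"
      using near[OF st'(1-4) ab(2,1)] h by (intro d2) linarith
    ultimately show ?thesis unfolding dist_real_def eq by linarith
  qed
  then have "\<bar>G x - H x\<bar> \<le> 0" by (rule field_le_epsilon) simp
  then show ?thesis by (simp add: G_def H_def)
qed

lemma axis_Basis: "axis k (1::real) \<in> (Basis :: (real^'n) set)"
  by (rule axis_in_Basis_iff[THEN iffD2]) simp

lemma partial_has_derivative: "(f has_derivative f') (at x) \<Longrightarrow> partial k f x = f' (axis k 1)"
  unfolding partial_def using frechet_derivative_at[of f f' x] by simp

lemma partial_nth:
  assumes "Ck (Suc 0) f"
  shows "partial k f x $ i = partial k (\<lambda>x. f x $ i) x"
  using partial_has_derivative[OF bounded_linear.has_derivative[OF bounded_linear_vec_nth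
        Ck_has_derivative[OF assms]], of k i x]
  by (simp add: partial_def)

lemma partial_diff:
  assumes "Ck (Suc 0) f" "Ck (Suc 0) g"
  shows "partial k (\<lambda>x. f x - g x) x = partial k f x - partial k g x"
  using partial_has_derivative[OF has_derivative_diff[OF Ck_has_derivative[OF assms(1)]
        Ck_has_derivative[OF assms(2)]], of k x]
  by (simp add: partial_def)

lemma Ck_partial: "Ck (Suc m) f \<Longrightarrow> Ck m (\<lambda>x. partial k f x)"
  unfolding partial_def by (rule Ck_derivative[OF _ axis_Basis])

lemma partial_commute:
  assumes "Ck (Suc (Suc 0)) f"
  shows "partial i (\<lambda>x. partial j f x) x = partial j (\<lambda>x. partial i f x :: real) x"
  unfolding partial_def by (rule clairaut[OF assms axis_Basis axis_Basis])

lemma cl_curl_nth: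
  "cl_curl f x $ 1 = partial 2 f x $ 3 - partial 3 f x $ 2"
  "cl_curl f x $ 2 = partial 3 f x $ 1 - partial 1 f x $ 3"
  "cl_curl f x $ 3 = partial 1 f x $ 2 - partial 2 f x $ 1"
  by (simp_all add: cl_curl_def)

lemma Ck_cl_curl:
  assumes "Ck (Suc m) f"
  shows "Ck m (cl_curl f)"
proof (rule Ck_vec)
  have p: "Ck m (\<lambda>x. partial k f x $ l - partial k' f x $ l')" for k l k' l'
    using Ck_add[OF Ck_vec_nth[OF Ck_partial[OF assms]]
        Ck_linear_compose[OF bounded_linear_minus[OF bounded_linear_ident]
          Ck_vec_nth[OF Ck_partial[OF assms]]]] by simp
  show "Ck m (\<lambda>x. cl_curl f x $ i)" for i
    using exhaust_3[of i] p by (auto simp: cl_curl_nth)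
qed

lemma Ck_cl_grad: "Ck (Suc m) f \<Longrightarrow> Ck m (cl_grad f)"
  by (rule Ck_vec) (simp add: cl_grad_def Ck_partial)

lemma cl_div_cl_curl:
  assumes f: "Ck (Suc (Suc 0)) f"
  shows "cl_div (cl_curl f) x = 0"
proof -
  have f1: "Ck (Suc 0) f" using f by (rule Ck_Suc_imp)
  have fi: "Ck (Suc (Suc 0)) (\<lambda>x. f x $ i)" for i by (rule Ck_vec_nth[OF f])
  let ?P = "\<lambda>j k i. partial j (\<lambda>x. partial k (\<lambda>x. f x $ i) x) x"
  have c: "partial j (cl_curl f) x $ i = partial j (\<lambda>x. cl_curl f x $ i) x" for i j
    by (rule partial_nth[OF Ck_cl_curl[OF f]])
  have "partial 1 (cl_curl f) x $ 1 = ?P 1 2 3 - ?P 1 3 2"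
    "partial 2 (cl_curl f) x $ 2 = ?P 2 3 1 - ?P 2 1 3"
    "partial 3 (cl_curl f) x $ 3 = ?P 3 1 2 - ?P 3 2 1"
    unfolding c cl_curl_nth partial_nth[OF f1] by (intro partial_diff Ck_partial fi)+
  moreover have "?P 1 2 3 = ?P 2 1 3" "?P 1 3 2 = ?P 3 1 2" "?P 2 3 1 = ?P 3 2 1"
    by (intro partial_commute fi)+
  ultimately show ?thesis unfolding cl_div_def sum_3 by simp
qed

lemma cl_curl_cl_grad:
  assumes f: "Ck (Suc (Suc 0)) f"
  shows "cl_curl (cl_grad f) x = 0"
proof -
  have "partial j (cl_grad f) x $ i = partial i (cl_grad f) x $ j" for i j
    using partial_commute[OF f, of j i x]
    by (simp add: partial_nth[OF Ck_cl_grad[OF f]] cl_grad_def)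
  then show ?thesis by (simp add: vec_eq_iff forall_3 cl_curl_nth)
qed

lemma test_function_partial:
  "\<phi> \<in> test_functions S \<Longrightarrow> (\<lambda>x. partial k \<phi> x) \<in> test_functions S"
  unfolding partial_def by (rule test_function_derivative[OF _ axis_Basis])

lemma test_function_cl_grad: "\<phi> \<in> test_functions S \<Longrightarrow> cl_grad \<phi> \<in> test_functions S"
  by (rule test_function_vec) (simp add: cl_grad_def test_function_partial)

lemma test_function_cl_div: "\<phi> \<in> test_functions S \<Longrightarrow> cl_div \<phi> \<in> test_functions S"
  unfolding cl_div_def[abs_def]
  by (intro test_function_sum test_function_nth test_function_partial)

lemma test_function_cl_curl:
  assumes "\<phi> \<in> test_functions S"
  shows "cl_curl \<phi> \<in> test_functions S"
proof (rule test_function_vec)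
  have p: "(\<lambda>x. partial k \<phi> x $ l - partial k' \<phi> x $ l') \<in> test_functions S" for k l k' l'
    by (intro test_function_diff test_function_nth test_function_partial assms)
  show "(\<lambda>x. cl_curl \<phi> x $ i) \<in> test_functions S" for i
    using exhaust_3[of i] p by (auto simp: cl_curl_nth)
qed

subsection \<open>The fundamental lemma of the calculus of variations\<close>

text \<open>Open boxes form an intersection-stable generator of the Borel sets, so the integrals
  over all Borel sets vanish as soon as those over boxes do.\<close>

lemma AE_eq_0_if_box_integrals:
  fixes f :: "'a::euclidean_space \<Rightarrow> real"
  assumes f: "integrable lborel f" and supp: "\<And>x. x \<notin> box p q \<Longrightarrow> f x = 0"
    and box: "\<And>a b. (LINT x:box a b|lborel. f x) = 0"
  shows "AE x in lborel. f x = 0"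
proof (rule density_unique_real[OF f])
  have set_int: "set_integrable lborel A f" if "A \<in> sets borel" for A
    unfolding set_integrable_def using f that by (intro integrable_mult_indicator) auto
  \<comment> \<open>Passing to complements needs the integral over the whole space; the support
    condition makes it one of the box integrals.\<close>
  have total: "(LINT x|lborel. f x) = 0"
  proof -
    have "(LINT x|lborel. f x) = (LINT x:box p q|lborel. f x)"
      unfolding set_lebesgue_integral_def
      by (intro Bochner_Integration.integral_cong) (auto simp: indicator_def supp)
    then show ?thesis using box by simp
  qed
  have Int_st: "Int_stable (range (\<lambda>(a, b). box a b :: 'a set))"
    by (auto simp: Int_stable_def box_Int_box)
  have borel: "sets borel = sigma_sets UNIV (range (\<lambda>(a, b). box a b :: 'a set))"
    by (simp add: borel_eq_box)
  fix A :: "'a set" assume "A \<in> sets lborel"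
  then have A: "A \<in> sigma_sets UNIV (range (\<lambda>(a, b). box a b :: 'a set))"
    by (simp flip: borel)
  have "range (\<lambda>(a, b). box a b :: 'a set) \<subseteq> Pow UNIV" by simp
  from Int_st this A have "(LINT x:A|lborel. f x) = 0"
  proof (induction A rule: sigma_sets_induct_disjoint)
    case (basic A)
    then show ?case using box by auto
  next
    case empty
    show ?case by (simp add: set_lebesgue_integral_def)
  next
    case (compl A)
    then have A: "A \<in> sets borel" by (simp only: borel)
    have "(LINT x:UNIV|lborel. f x) = (LINT x:A|lborel. f x) + (LINT x:UNIV - A|lborel. f x)"
      using set_integral_Un[of A "UNIV - A" lborel f] set_int[OF A] set_int[of "UNIV - A"] A by auto
    moreover have "(LINT x:UNIV|lborel. f x) = 0"
      using total by (simp add: set_lebesgue_integral_def)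
    ultimately show ?case using compl by simp
  next
    case (union A)
    then have A: "A i \<in> sets borel" for i by (auto simp only: borel)
    have "(LINT x:(\<Union>i. A i)|lborel. f x) = (\<Sum>i. LINT x:A i|lborel. f x)"
      using A union(1)
      by (intro lebesgue_integral_countable_add set_int) (auto simp: disjoint_family_on_def)
    then show ?case using union by simp
  qed
  then show "(LINT x:A|lborel. f x) = (LINT x:A|lborel. 0)" by simp
qed simp


lemma L2_linear:
  assumes f: "f \<in> L2 S" and L: "bounded_linear L"
  shows "(\<lambda>x. L (f x)) \<in> L2 S"
proof -
  obtain K where K: "\<And>x. norm (L x) \<le> norm x * K" using bounded_linear.bounded[OF L] by blast
  have m: "(\<lambda>x. L (f x)) \<in> borel_measurable (lebesgue_on S)"
    using L2_measurable[OF f] borel_measurable_continuous_onI[OF linear_continuous_on[OF L]]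
    by (rule measurable_compose)
  have "integrable (lebesgue_on S) (\<lambda>x. (norm (L (f x)))\<^sup>2)"
  proof (rule Bochner_Integration.integrable_bound)
    show "integrable (lebesgue_on S) (\<lambda>x. (norm (f x))\<^sup>2 * K\<^sup>2)"
      using f by (simp add: L2_def)
    show "(\<lambda>x. (norm (L (f x)))\<^sup>2) \<in> borel_measurable (lebesgue_on S)" using m by measurable
    show "AE x in lebesgue_on S. norm ((norm (L (f x)))\<^sup>2) \<le> norm ((norm (f x))\<^sup>2 * K\<^sup>2)"
    proof (rule AE_I2)
      fix x
      have "(norm (L (f x)))\<^sup>2 \<le> (norm (f x) * K)\<^sup>2" using K by (intro power_mono) auto
      then show "norm ((norm (L (f x)))\<^sup>2) \<le> norm ((norm (f x))\<^sup>2 * K\<^sup>2)"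
        by (simp add: power_mult_distrib abs_mult)
    qed
  qed
  with m show ?thesis by (simp add: L2_def)
qed

lemma L2_indicator_box: "indicator (box a b) \<in> (L2 UNIV :: ('a::euclidean_space \<Rightarrow> real) set)"
proof -
  have "(\<lambda>x. 1) \<in> (L2 (box a b) :: ('a \<Rightarrow> real) set)"
    by (rule L2_continuous_on_bounded) auto
  moreover have "(\<lambda>x. if x \<in> box a b then 1 else 0) = (indicator (box a b) :: 'a \<Rightarrow> real)"
    by (auto simp: indicator_def)
  ultimately show ?thesis using L2_iff_extend[of "box a b" "\<lambda>x. 1 :: real"] by simp
qed

text \<open>The bumps turn the hypothesis into vanishing integrals over all boxes whose closed
  version lies in \<open>S\<close>. Each such box is treated alone, and countably many closed boxes,
  which differ from open ones by null sets, cover \<open>S\<close>.\<close>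

lemma fundamental_lemma_real:
  fixes g :: "'a::euclidean_space \<Rightarrow> real"
  assumes S: "open S" and g: "g \<in> L2 S"
    and zero: "\<And>\<phi>. \<phi> \<in> test_functions S \<Longrightarrow> (LINT x|lebesgue_on S. g x * \<phi> x) = 0"
  shows "AE x in lebesgue_on S. g x = 0"
proof -
  have Sm: "S \<in> sets lebesgue" using S by simp
  define G where "G x = (if x \<in> S then g x else 0)" for x
  have G: "G \<in> L2 UNIV" unfolding G_def using g Sm by (simp flip: L2_iff_extend)
  have iG: "integrable lebesgue (\<lambda>x. indicator (box a b) x * G x)" for a b
    using L2_mult_integrable[OF L2_indicator_box G] by (simp add: lebesgue_on_UNIV_eq)
  have Gm: "G \<in> borel_measurable lebesgue"
    using L2_measurable[OF G] by (simp add: lebesgue_on_UNIV_eq)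
  have box_int: "(LINT x|lebesgue. indicator (box a b) x * G x) = 0" if ab: "cbox a b \<subseteq> S" for a b
  proof -
    have "(\<lambda>n. LINT x|lebesgue. box_bump a b n x * G x) \<longlonglongrightarrow>
        (LINT x|lebesgue. indicator (box a b) x * G x)"
    proof (rule integral_dominated_convergence)
      show "(\<lambda>x. indicator (box a b) x * G x) \<in> borel_measurable lebesgue"
        using iG by (rule borel_measurable_integrable)
      show "integrable lebesgue (\<lambda>x. norm (indicator (box a b) x * G x))"
        using iG by (rule integrable_norm)
      show "(\<lambda>x. box_bump a b n x * G x) \<in> borel_measurable lebesgue" for n
        using borel_measurable_continuous_onI[OF Ck_continuous[OF Ck_box_bump[of 0 a b n]]] Gm
        by (intro borel_measurable_times) (auto intro: measurable_completion)
      show "AE x in lebesgue. (\<lambda>n. box_bump a b n x * G x) \<longlonglongrightarrow> indicator (box a b) x * G x"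
        by (intro AE_I2 tendsto_intros box_bump_tendsto)
      show "AE x in lebesgue. norm (box_bump a b n x * G x) \<le> norm (indicator (box a b) x * G x)" for n
      proof (rule AE_I2)
        fix x
        show "norm (box_bump a b n x * G x) \<le> norm (indicator (box a b) x * G x)"
          using box_bump_bounds[of a b n x] box_bump_eq_0_iff[of a b n x]
          by (cases "x \<in> box a b") (auto simp: abs_mult mult_left_le_one_le)
      qed
    qed
    moreover have "(LINT x|lebesgue. box_bump a b n x * G x) = 0" for n
    proof -
      have t: "box_bump a b n \<in> test_functions S" by (rule box_bump_test_function[OF ab])
      have "(LINT x|lebesgue_on S. g x * box_bump a b n x)
          = (LINT x|lebesgue_on S. box_bump a b n x * G x)"
        by (intro Bochner_Integration.integral_cong) (auto simp: G_def)
      also have "\<dots> = (LINT x|lebesgue. box_bump a b n x * G x)"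
        by (rule integral_lebesgue_on_eq[OF Sm]) (simp add: G_def)
      finally show ?thesis using zero[OF t] by simp
    qed
    ultimately show ?thesis by (simp add: LIMSEQ_const_iff)
  qed
  have AE_box: "AE x in lebesgue. x \<in> box p q \<longrightarrow> G x = 0" if pq: "cbox p q \<subseteq> S" for p q
  proof -
    let ?f = "\<lambda>x. indicator (box p q) x * G x"
    \<comment> \<open>The generator argument works with Borel functions. A Borel version of the
      integrand may be nonzero on a null set outside the box; multiplication by the indicator
      restores the support.\<close>
    obtain f0 where f0: "f0 \<in> borel_measurable lborel" "AE x in lborel. ?f x = f0 x"
      using completion_ex_borel_measurable_real[OF borel_measurable_integrable[OF iG[of p q]]] by blast
    define F where "F x = indicator (box p q) x * f0 x" for x
    have F_m: "F \<in> borel_measurable lborel" unfolding F_def using f0(1) by measurable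
    have F_eq: "AE x in lebesgue. F x = ?f x"
      using AE_completion[OF f0(2)] by eventually_elim (auto simp: F_def indicator_def)
    have "integrable lebesgue F"
      using iG[of p q] by (rule integrable_cong_AE_imp)
        (use F_m F_eq in \<open>auto intro: measurable_completion elim: eventually_mono\<close>)
    then have F_int: "integrable lborel F" using integrable_completion[OF F_m] by simp
    have "AE x in lborel. F x = 0"
    proof (rule AE_eq_0_if_box_integrals[OF F_int])
      show "F x = 0" if "x \<notin> box p q" for x using that by (simp add: F_def)
      fix a b :: 'a
      \<comment> \<open>The intersection of boxes is again a box, and its closed version stays
        inside \<open>cbox p q\<close>, hence inside \<open>S\<close>.\<close>
      obtain u v where uv: "box a b \<inter> box p q = box u v" "cbox a b \<inter> cbox p q = cbox u v"
        using box_Int_box[of a b p q] Int_interval[of a b p q] by blast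
      have Fm': "(\<lambda>x. indicator (box a b) x * F x) \<in> borel_measurable lborel"
        using F_m by measurable
      have "(LINT x:box a b|lborel. F x) = (LINT x|lebesgue. indicator (box a b) x * F x)"
        using integral_completion[OF Fm'] by (simp add: set_lebesgue_integral_def)
      also have "\<dots> = (LINT x|lebesgue. indicator (box u v) x * G x)"
      proof (rule integral_cong_AE)
        show "(\<lambda>x. indicator (box a b) x * F x) \<in> borel_measurable lebesgue"
          using Fm' by (rule measurable_completion)
        show "(\<lambda>x. indicator (box u v) x * G x) \<in> borel_measurable lebesgue"
          using iG by (rule borel_measurable_integrable)
        show "AE x in lebesgue. indicator (box a b) x * F x = indicator (box u v) x * G x"
          using F_eq by eventually_elim (simp add: indicator_def flip: uv(1))
      qed
      also have "\<dots> = 0" using pq uv by (intro box_int) auto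
      finally show "(LINT x:box a b|lborel. F x) = 0" .
    qed
    from AE_completion[OF this] F_eq show ?thesis
      by eventually_elim (auto simp: indicator_def)
  qed
  obtain D where D: "countable D" "D \<subseteq> Pow S" "\<And>X. X \<in> D \<Longrightarrow> \<exists>a b. X = cbox a b" "\<Union>D = S"
    using open_countable_Union_open_cbox[OF S] by blast
  have "AE x in lebesgue. x \<in> X \<longrightarrow> G x = 0" if X: "X \<in> D" for X
  proof -
    obtain p q where pq: "X = cbox p q" using D(3)[OF X] by blast
    have "AE x in lebesgue. x \<notin> cbox p q - box p q"
      using negligible_frontier_interval[of p q] unfolding negligible_iff_null_sets by (rule AE_not_in)
    moreover have "AE x in lebesgue. x \<in> box p q \<longrightarrow> G x = 0"
      using D(2) X pq by (intro AE_box) auto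
    ultimately show ?thesis by eventually_elim (auto simp: pq)
  qed
  then have "AE x in lebesgue. \<forall>X\<in>D. x \<in> X \<longrightarrow> G x = 0"
    unfolding AE_ball_countable[OF D(1)] by blast
  then have "AE x in lebesgue. x \<in> S \<longrightarrow> g x = 0"
    by eventually_elim (use D(4) in \<open>auto simp: G_def split: if_splits\<close>)
  then show ?thesis using Sm by (simp add: AE_restrict_space_iff)
qed

lemma fundamental_lemma:
  fixes g :: "'a::euclidean_space \<Rightarrow> 'b::euclidean_space"
  assumes S: "open S" and g: "g \<in> L2 S"
    and zero: "\<And>\<phi>. \<phi> \<in> test_functions S \<Longrightarrow> inner (l2_of S g) (l2_of S \<phi>) = 0"
  shows "l2_of S g = 0"
proof -
  have Sm: "S \<in> sets lebesgue" using S by simp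
  have "AE x in lebesgue_on S. g x \<bullet> b = 0" if b: "b \<in> Basis" for b
  proof (rule fundamental_lemma_real[OF S])
    show "(\<lambda>x. g x \<bullet> b) \<in> L2 S" by (rule L2_linear[OF g bounded_linear_inner_left])
    fix \<phi> :: "'a \<Rightarrow> real" assume "\<phi> \<in> test_functions S"
    then have t: "(\<lambda>x. \<phi> x *\<^sub>R b) \<in> test_functions S" by (rule test_function_scaleR_const)
    show "(LINT x|lebesgue_on S. g x \<bullet> b * \<phi> x) = 0"
      using zero[OF t] by (simp add: inner_l2_of[OF Sm g test_function_L2[OF t Sm]] mult.commute)
  qed
  then have "AE x in lebesgue_on S. \<forall>b\<in>Basis. g x \<bullet> b = 0"
    by (rule AE_finite_allI[OF finite_Basis])
  then have "AE x in lebesgue_on S. g x = 0"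
    by eventually_elim (simp add: euclidean_all_zero_iff)
  then show ?thesis using l2_of_eq_iff[OF Sm g L2_zero] by simp
qed

section \<open>Curves\<close>

text \<open>The curves of the statement take values in function spaces with a seminorm. An isometric
  linear map \<open>G\<close> turns them into curves in a Banach space.\<close>

definition seminorm_embedding ::
  "(('a \<Rightarrow> 'b::real_normed_vector) \<Rightarrow> real) \<Rightarrow> ('a \<Rightarrow> 'b) set \<Rightarrow> (('a \<Rightarrow> 'b) \<Rightarrow> 'c::real_normed_vector) \<Rightarrow> bool"
  where "seminorm_embedding N X G \<longleftrightarrow> linear_subspace X \<and> (\<forall>u\<in>X. N u = norm (G u)) \<and>
    (\<forall>u\<in>X. \<forall>v\<in>X. G (\<lambda>x. u x + v x) = G u + G v) \<and> (\<forall>c. \<forall>u\<in>X. G (\<lambda>x. c *\<^sub>R u x) = c *\<^sub>R G u)"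

lemma linear_subspaceD:
  assumes "linear_subspace X"
  shows "(\<lambda>x. 0) \<in> X" "\<And>u v. u \<in> X \<Longrightarrow> v \<in> X \<Longrightarrow> (\<lambda>x. u x + v x) \<in> X"
    "\<And>c u. u \<in> X \<Longrightarrow> (\<lambda>x. c *\<^sub>R u x) \<in> X"
  using assms by (auto simp: linear_subspace_def)

lemma linear_subspace_diff:
  assumes "linear_subspace X" "u \<in> X" "v \<in> X"
  shows "(\<lambda>x. u x - v x) \<in> X"
  using linear_subspaceD(2)[OF assms(1,2) linear_subspaceD(3)[OF assms(1,3), of "-1"]] by simp

lemma linear_subspace_sum:
  assumes "linear_subspace X" "\<And>i. i \<in> I \<Longrightarrow> f i \<in> X"
  shows "(\<lambda>x. \<Sum>i\<in>I. f i x) \<in> X"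
  using assms(2)
  by (induction I rule: infinite_finite_induct) (simp_all add: linear_subspaceD[OF assms(1)])

text \<open>Curve derivatives are defined by quotients with \<open>s - t\<close>, vector derivatives
  by remainders divided by \<open>norm (s - t)\<close>; the two remainders have the same
  norm.\<close>

lemma has_vector_derivative_iff_quotient:
  fixes f :: "real \<Rightarrow> 'a::real_normed_vector"
  shows "(f has_vector_derivative f') (at t within T) \<longleftrightarrow>
    ((\<lambda>s. (f s - f t) /\<^sub>R (s - t)) \<longlongrightarrow> f') (at t within T)"
proof -
  have "(f has_vector_derivative f') (at t within T) \<longleftrightarrow>
      ((\<lambda>s. (f s - f t - (s - t) *\<^sub>R f') /\<^sub>R norm (s - t)) \<longlongrightarrow> 0) (at t within T)"
    by (simp add: has_vector_derivative_def has_derivative_at_within bounded_linear_scaleR_left)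
  also have "\<dots> \<longleftrightarrow> ((\<lambda>s. norm ((f s - f t - (s - t) *\<^sub>R f') /\<^sub>R norm (s - t))) \<longlongrightarrow> 0) (at t within T)"
    by (rule tendsto_norm_zero_iff[symmetric])
  also have "\<dots> \<longleftrightarrow> ((\<lambda>s. norm ((f s - f t) /\<^sub>R (s - t) - f')) \<longlongrightarrow> 0) (at t within T)"
  proof (rule tendsto_cong)
    have "norm ((f s - f t - (s - t) *\<^sub>R f') /\<^sub>R norm (s - t)) = norm ((f s - f t) /\<^sub>R (s - t) - f')"
      if "s \<noteq> t" for s
    proof -
      have "(f s - f t) /\<^sub>R (s - t) - f' = (f s - f t - (s - t) *\<^sub>R f') /\<^sub>R (s - t)"
        using that by (simp add: scaleR_right_diff_distrib)
      then show ?thesis by simp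
    qed
    then show "\<forall>\<^sub>F s in at t within T. norm ((f s - f t - (s - t) *\<^sub>R f') /\<^sub>R norm (s - t))
        = norm ((f s - f t) /\<^sub>R (s - t) - f')"
      by (auto simp: eventually_at_filter intro!: always_eventually)
  qed
  also have "\<dots> \<longleftrightarrow> ((\<lambda>s. (f s - f t) /\<^sub>R (s - t)) \<longlongrightarrow> f') (at t within T)"
    by (simp only: tendsto_norm_zero_iff Lim_null[symmetric])
  finally show ?thesis .
qed

context
  fixes N :: "('a \<Rightarrow> 'b::real_normed_vector) \<Rightarrow> real" and X and G :: "('a \<Rightarrow> 'b) \<Rightarrow> 'c::real_normed_vector"
  assumes emb: "seminorm_embedding N X G"
begin

lemma embedding_subspace: "linear_subspace X"
  and embedding_norm: "u \<in> X \<Longrightarrow> N u = norm (G u)"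
  and embedding_add: "u \<in> X \<Longrightarrow> v \<in> X \<Longrightarrow> G (\<lambda>x. u x + v x) = G u + G v"
  and embedding_scaleR: "u \<in> X \<Longrightarrow> G (\<lambda>x. c *\<^sub>R u x) = c *\<^sub>R G u"
  using emb by (auto simp: seminorm_embedding_def)

lemma embedding_diff:
  assumes "u \<in> X" "v \<in> X"
  shows "G (\<lambda>x. u x - v x) = G u - G v"
  using embedding_add[OF assms(1) linear_subspaceD(3)[OF embedding_subspace assms(2), of "-1"]]
    embedding_scaleR[OF assms(2), of "-1"] by simp

lemma embedding_zero: "G (\<lambda>x. 0) = 0"
  using embedding_scaleR[OF linear_subspaceD(1)[OF embedding_subspace], of 0] by simp

lemma embedding_sum:
  assumes "\<And>i. i \<in> I \<Longrightarrow> f i \<in> X"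
  shows "G (\<lambda>x. \<Sum>i\<in>I. f i x) = (\<Sum>i\<in>I. G (f i))"
  using assms
proof (induction I rule: infinite_finite_induct)
  case (insert i I)
  have "(\<lambda>x. \<Sum>i\<in>I. f i x) \<in> X"
    using insert.prems by (intro linear_subspace_sum[OF embedding_subspace]) simp
  then show ?case using insert by (simp add: embedding_add)
qed (simp_all add: embedding_zero)

lemma C0_curve_iff:
  "C0_curve N X T u \<longleftrightarrow> (\<forall>t\<in>T. u t \<in> X) \<and> continuous_on T (\<lambda>t. G (u t))"
proof (cases "\<forall>t\<in>T. u t \<in> X")
  case True
  have "((\<lambda>s. N (\<lambda>x. u s x - u t x)) \<longlongrightarrow> 0) (at t within T) \<longleftrightarrow>
      ((\<lambda>s. G (u s)) \<longlongrightarrow> G (u t)) (at t within T)" if t: "t \<in> T" for t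
  proof -
    have "\<forall>\<^sub>F s in at t within T. N (\<lambda>x. u s x - u t x) = norm (G (u s) - G (u t))"
      using True t linear_subspace_diff[OF embedding_subspace]
      by (auto simp: eventually_at_filter embedding_norm embedding_diff intro!: always_eventually)
    then have "((\<lambda>s. N (\<lambda>x. u s x - u t x)) \<longlongrightarrow> 0) (at t within T) \<longleftrightarrow>
        ((\<lambda>s. norm (G (u s) - G (u t))) \<longlongrightarrow> 0) (at t within T)"
      by (rule tendsto_cong)
    also have "\<dots> \<longleftrightarrow> ((\<lambda>s. G (u s)) \<longlongrightarrow> G (u t)) (at t within T)"
      by (simp only: tendsto_norm_zero_iff Lim_null[symmetric])
    finally show ?thesis .
  qed
  then show ?thesis using True unfolding C0_curve_def continuous_on_def by auto
qed (auto simp: C0_curve_def)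

lemma has_curve_derivative_iff:
  "has_curve_derivative N X T u u' \<longleftrightarrow> (\<forall>t\<in>T. u t \<in> X \<and> u' t \<in> X) \<and>
    (\<forall>t\<in>T. ((\<lambda>s. G (u s)) has_vector_derivative G (u' t)) (at t within T))"
proof (cases "\<forall>t\<in>T. u t \<in> X \<and> u' t \<in> X")
  case True
  have "((\<lambda>s. N (\<lambda>x. (u s x - u t x) /\<^sub>R (s - t) - u' t x)) \<longlongrightarrow> 0) (at t within T) \<longleftrightarrow>
      ((\<lambda>s. G (u s)) has_vector_derivative G (u' t)) (at t within T)" if t: "t \<in> T" for t
  proof -
    have "N (\<lambda>x. (u s x - u t x) /\<^sub>R (s - t) - u' t x) = norm ((G (u s) - G (u t)) /\<^sub>R (s - t) - G (u' t))"
      if s: "s \<in> T" for s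
    proof -
      have d: "(\<lambda>x. u s x - u t x) \<in> X"
        using True t s by (intro linear_subspace_diff[OF embedding_subspace]) auto
      note q = linear_subspaceD(3)[OF embedding_subspace d, of "inverse (s - t)"]
      have u': "u' t \<in> X" using True t by auto
      have "G (\<lambda>x. (u s x - u t x) /\<^sub>R (s - t) - u' t x) = (G (u s) - G (u t)) /\<^sub>R (s - t) - G (u' t)"
        unfolding embedding_diff[OF q u'] embedding_scaleR[OF d] using True t s by (simp add: embedding_diff)
      then show ?thesis
        using embedding_norm[OF linear_subspace_diff[OF embedding_subspace q u']] by simp
    qed
    then have "\<forall>\<^sub>F s in at t within T. N (\<lambda>x. (u s x - u t x) /\<^sub>R (s - t) - u' t x) =
        norm ((G (u s) - G (u t)) /\<^sub>R (s - t) - G (u' t))"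
      by (auto simp: eventually_at_filter intro!: always_eventually)
    then have "((\<lambda>s. N (\<lambda>x. (u s x - u t x) /\<^sub>R (s - t) - u' t x)) \<longlongrightarrow> 0) (at t within T) \<longleftrightarrow>
        ((\<lambda>s. norm ((G (u s) - G (u t)) /\<^sub>R (s - t) - G (u' t))) \<longlongrightarrow> 0) (at t within T)"
      by (rule tendsto_cong)
    also have "\<dots> \<longleftrightarrow> ((\<lambda>s. G (u s)) has_vector_derivative G (u' t)) (at t within T)"
      by (simp only: tendsto_norm_zero_iff Lim_null[symmetric] has_vector_derivative_iff_quotient)
    finally show ?thesis .
  qed
  then show ?thesis using True unfolding has_curve_derivative_def by auto
qed (auto simp: has_curve_derivative_def)

lemma curve_derivative_works:
  assumes "C1_curve N X T u"
  shows "has_curve_derivative N X T u (curve_derivative N X T u)"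
  unfolding curve_derivative_def
  using assms by (intro someI_ex[of "has_curve_derivative N X T u"]) (auto simp: C1_curve_def)

text \<open>The derivative picked by choice need not be the continuous one that witnesses
  \<open>C1_curve\<close>. Derivatives agree after \<open>G\<close> at points that are not isolated
  in \<open>T\<close>, so continuity is inherited.\<close>

lemma curve_derivative_C0:
  assumes u: "C1_curve N X T u" and T: "\<And>t. t \<in> T \<Longrightarrow> at t within T \<noteq> bot"
  shows "C0_curve N X T (curve_derivative N X T u)"
proof -
  obtain u' where u': "has_curve_derivative N X T u u'" "C0_curve N X T u'"
    using u by (auto simp: C1_curve_def)
  note d = curve_derivative_works[OF u]
  have "G (curve_derivative N X T u t) = G (u' t)" if t: "t \<in> T" for t
    using vector_derivative_unique_within[OF T[OF t]] u'(1) d t unfolding has_curve_derivative_iff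
    by blast
  then have "continuous_on T (\<lambda>t. G (curve_derivative N X T u t)) \<longleftrightarrow> continuous_on T (\<lambda>t. G (u' t))"
    by (intro continuous_on_cong) auto
  then show ?thesis using u'(2) d unfolding C0_curve_iff has_curve_derivative_iff by blast
qed

lemma curve_derivative_unique:
  assumes u: "C1_curve N X T u" and u': "has_curve_derivative N X T u u'"
    and t: "t \<in> T" "at t within T \<noteq> bot"
  shows "G (curve_derivative N X T u t) = G (u' t)"
  using vector_derivative_unique_within[OF t(2)] curve_derivative_works[OF u] u' t(1)
  unfolding has_curve_derivative_iff by blast

end

section \<open>Calculus on the time interval\<close>

lemma interval_at_within_not_bot:
  fixes T :: "real set"
  assumes "is_interval T" "interior T \<noteq> {}" "t \<in> T"
  shows "at t within T \<noteq> bot"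
proof -
  have "convex T" using assms(1) by (simp add: is_interval_convex)
  then have "closure (interior T) = closure T" using assms(2) by (rule convex_closure_interior)
  moreover have "t islimpt interior T" if "t \<in> closure (interior T)"
  proof (cases "t \<in> interior T")
    case True
    then show ?thesis by (simp add: interior_limit_point)
  next
    case False
    then show ?thesis using that by (simp add: closure_def)
  qed
  ultimately have "t islimpt T"
    using assms(3) closure_subset[of T] islimpt_subset[OF _ interior_subset] by blast
  then show ?thesis by (simp add: trivial_limit_within)
qed

text \<open>The interval may be open, half-open or unbounded. Near each \<open>t\<close> the
  fundamental theorem is applied on a compact \<open>{a..b}\<close> inside \<open>T\<close> that
  contains \<open>t0\<close> and a neighbourhood of \<open>t\<close> relative to
  \<open>T\<close>.\<close>

lemma antiderivative_on_interval:
  fixes g :: "real \<Rightarrow> 'a::banach"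
  assumes T: "is_interval T" "t0 \<in> T" and g: "continuous_on T g"
  obtains F where "F t0 = 0" "\<And>t. t \<in> T \<Longrightarrow> (F has_vector_derivative g t) (at t within T)"
proof -
  have sub: "{a..b} \<subseteq> T" if "a \<in> T" "b \<in> T" for a b
  proof
    fix x assume "x \<in> {a..b}"
    then show "x \<in> T" using mem_is_interval_1_I[OF T(1) that] by simp
  qed
  \<comment> \<open>At most one of the two integrals is over a nondegenerate interval; the
    difference is the oriented integral from \<open>t0\<close> to \<open>t\<close>.\<close>
  define F where "F t = integral {t0..t} g - integral {t..t0} g" for t
  have "(F has_vector_derivative g t) (at t within T)" if t: "t \<in> T" for t
  proof -
    \<comment> \<open>If \<open>t\<close> is the left end of \<open>T\<close>, then
      \<open>a = t\<close> and the derivative is one-sided; otherwise some point of \<open>T\<close>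
      lies to the left of \<open>t\<close>.\<close>
    have "\<exists>a\<in>T. a \<le> t0 \<and> a \<le> t \<and> (\<exists>l<t. \<forall>s\<in>T. l < s \<longrightarrow> a \<le> s)"
    proof (cases "\<exists>s\<in>T. s < t")
      case True
      then obtain s where "s \<in> T" "s < t" by blast
      then show ?thesis using T(2)
        by (intro bexI[of _ "min s t0"] conjI exI[of _ s]) (auto simp: min_def)
    next
      case False
      then show ?thesis using t T(2)
        by (intro bexI[of _ t] conjI exI[of _ "t - 1"]) (auto simp: not_less)
    qed
    then obtain a l where a: "a \<in> T" "a \<le> t0" "a \<le> t" "l < t" "\<And>s. s \<in> T \<Longrightarrow> l < s \<Longrightarrow> a \<le> s"
      by blast
    have "\<exists>b\<in>T. t0 \<le> b \<and> t \<le> b \<and> (\<exists>r>t. \<forall>s\<in>T. s < r \<longrightarrow> s \<le> b)"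
    proof (cases "\<exists>s\<in>T. t < s")
      case True
      then obtain s where "s \<in> T" "t < s" by blast
      then show ?thesis using T(2)
        by (intro bexI[of _ "max s t0"] conjI exI[of _ s]) (auto simp: max_def)
    next
      case False
      then show ?thesis using t T(2)
        by (intro bexI[of _ t] conjI exI[of _ "t + 1"]) (auto simp: not_less)
    qed
    then obtain b r where b: "b \<in> T" "t0 \<le> b" "t \<le> b" "t < r" "\<And>s. s \<in> T \<Longrightarrow> s < r \<Longrightarrow> s \<le> b"
      by blast
    have ab: "continuous_on {a..b} g" using g sub[OF a(1) b(1)] by (rule continuous_on_subset)
    have int: "g integrable_on {c..d}" if "a \<le> c" "d \<le> b" for c d
      using ab that by (intro integrable_continuous_real continuous_on_subset[OF ab]) auto
    have F_eq: "F u = integral {a..u} g - integral {a..t0} g" if "u \<in> {a..b}" for u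
    proof (cases "t0 \<le> u")
      case True
      have "integral {a..t0} g + integral {t0..u} g = integral {a..u} g"
        using True a that by (intro Henstock_Kurzweil_Integration.integral_combine int) auto
      moreover have "integral {u..t0} g = 0"
        using True by (cases "u = t0") auto
      ultimately show ?thesis unfolding F_def by (simp add: algebra_simps)
    next
      case False
      have "integral {a..u} g + integral {u..t0} g = integral {a..t0} g"
        using False b that by (intro Henstock_Kurzweil_Integration.integral_combine int) auto
      moreover have "integral {t0..u} g = 0" using False by auto
      ultimately show ?thesis unfolding F_def by (simp add: algebra_simps)
    qed
    have "((\<lambda>u. integral {a..u} g) has_vector_derivative g t) (at t within {a..b})"
      using ab a b by (intro integral_has_vector_derivative) auto
    then have "((\<lambda>u. integral {a..u} g - integral {a..t0} g) has_vector_derivative g t - 0) (at t within {a..b})"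
      by (intro has_vector_derivative_diff has_vector_derivative_const)
    then have "(F has_vector_derivative g t) (at t within {a..b})"
      using a b F_eq by (intro has_vector_derivative_transform[of t "{a..b}" F]) auto
    moreover have "at t within T = at t within {a..b}"
    proof (rule at_within_nhd[of t "{l<..<r}"])
      show "T \<inter> {l<..<r} - {t} = {a..b} \<inter> {l<..<r} - {t}"
        using sub[OF a(1) b(1)] a(5) b(5) by auto
    qed (use a b in auto)
    ultimately show ?thesis by simp
  qed
  moreover have "F t0 = 0" by (simp add: F_def)
  ultimately show thesis using that by blast
qed

lemma constant_on_interval:
  fixes f :: "real \<Rightarrow> 'a::real_normed_vector"
  assumes "is_interval T" "\<And>t. t \<in> T \<Longrightarrow> (f has_vector_derivative 0) (at t within T)" "s \<in> T" "t \<in> T"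
  shows "f s = f t"
  using has_vector_derivative_zero_constant[of T f] assms is_interval_convex[OF assms(1)] by metis

section \<open>Weak derivatives\<close>

lemma rep_l2: "rep_l2 X \<in> L2 UNIV" "l2_of UNIV (rep_l2 X) = X"
proof -
  show 1: "rep_l2 X \<in> L2 UNIV" using Quotient_rep_reflp[OF Quotient_l2, of X] by simp
  show "l2_of UNIV (rep_l2 X) = X"
    using 1 Quotient_abs_rep[OF Quotient_l2, of X] by (simp add: l2_of_def id_def)
qed

text \<open>For measurable \<open>S\<close> this is multiplication by the indicator of
  \<open>S\<close>, an orthogonal projection. It serves classes that arise as limits or integrals
  and have no distinguished representative.\<close>

definition restrict_l2 :: "'a set \<Rightarrow> ('a::euclidean_space, 'b::euclidean_space) l2 \<Rightarrow> ('a, 'b) l2" where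
  "restrict_l2 S X = l2_of S (rep_l2 X)"

lemma inner_l2_of_Int:
  assumes S: "S \<in> sets lebesgue" "S' \<in> sets lebesgue" "S' \<subseteq> S" and f: "f \<in> L2 S" "g \<in> L2 S'"
  shows "inner (l2_of S f) (l2_of S' g) = inner (l2_of S' f) (l2_of S' g)"
proof -
  let ?f = "\<lambda>x. if x \<in> S then f x else 0"
  have f': "?f \<in> L2 UNIV" using f S by (simp flip: L2_iff_extend)
  have fS': "f \<in> L2 S'" by (rule L2_subset[OF f(1) S])
  have f'S: "?f \<in> L2 S" "?f \<in> L2 S'"
    using L2_subset[OF f', of S] L2_subset[OF f', of S'] S by auto
  have eq: "l2_of UNIV ?f = l2_of S f" using f S f' by (simp add: l2_of_def id_def)
  have "inner (l2_of S f) (l2_of S' g) = inner (l2_of S' ?f) (l2_of S' g)"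
    using inner_l2_of_restrict[OF S(2) f' f(2)] by (simp add: eq)
  also have "l2_of S' ?f = l2_of S' f"
    using l2_of_eq_iff[OF S(2) f'S(2) fS'] S by (auto simp: AE_restrict_space_iff)
  finally show ?thesis .
qed

lemma restrict_l2_l2_of:
  assumes "S \<in> sets lebesgue" "f \<in> L2 UNIV"
  shows "restrict_l2 S (l2_of UNIV f) = l2_of S f"
proof -
  have "AE x in lebesgue. rep_l2 (l2_of UNIV f) x = f x"
    using l2_of_eq_iff[OF _ rep_l2(1) assms(2)] rep_l2(2)[of "l2_of UNIV f"] by (simp add: AE_restrict_space_iff)
  then have "AE x in lebesgue_on S. rep_l2 (l2_of UNIV f) x = f x"
    using assms(1) by (subst AE_restrict_space_iff) auto
  then show ?thesis
    unfolding restrict_l2_def using assms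
    by (subst l2_of_eq_iff) (auto intro: L2_subset[OF rep_l2(1)] L2_subset[OF assms(2)])
qed

lemma l2_of_UNIV_extend:
  assumes "S \<in> sets lebesgue" "f \<in> L2 S"
  shows "l2_of UNIV (\<lambda>x. if x \<in> S then f x else 0) = l2_of S f"
  using assms L2_iff_extend[OF assms(1), of f] by (simp add: l2_of_def id_def)

lemma restrict_l2_idem:
  assumes "S \<in> sets lebesgue" "f \<in> L2 S"
  shows "restrict_l2 S (l2_of S f) = l2_of S f"
proof -
  let ?f = "\<lambda>x. if x \<in> S then f x else 0"
  have f': "?f \<in> L2 UNIV" using assms by (simp flip: L2_iff_extend)
  then have "?f \<in> L2 S" by (rule L2_subset) (use assms in auto)
  then have "l2_of S ?f = l2_of S f"
    using l2_of_eq_iff[OF assms(1) _ assms(2)] assms(1) by (auto simp: AE_restrict_space_iff)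
  then show ?thesis
    using restrict_l2_l2_of[OF assms(1) f'] l2_of_UNIV_extend[OF assms] by simp
qed

lemma rep_l2_L2: "S \<in> sets lebesgue \<Longrightarrow> rep_l2 X \<in> L2 S"
  using L2_subset[OF rep_l2(1), of S] by simp

lemma inner_restrict_l2:
  assumes "S \<in> sets lebesgue" "g \<in> L2 S"
  shows "inner (restrict_l2 S X) (l2_of S g) = inner X (l2_of S g)"
  using inner_l2_of_restrict[OF assms(1) rep_l2(1) assms(2), of X] rep_l2(2)[of X]
  by (simp add: restrict_l2_def)

lemma bounded_linear_restrict_l2:
  assumes "S \<in> sets lebesgue"
  shows "bounded_linear (restrict_l2 S)"
proof (rule bounded_linear_intro[where K = 1])
  fix X Y :: "('a, 'b) l2" and c
  have "restrict_l2 S (l2_of UNIV (\<lambda>x. rep_l2 X x + rep_l2 Y x)) = restrict_l2 S X + restrict_l2 S Y"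
    using assms by (subst restrict_l2_l2_of) (auto simp: L2_add rep_l2 restrict_l2_def l2_of_add rep_l2_L2)
  then show "restrict_l2 S (X + Y) = restrict_l2 S X + restrict_l2 S Y"
    by (simp add: l2_of_add rep_l2)
  have "restrict_l2 S (l2_of UNIV (\<lambda>x. c *\<^sub>R rep_l2 X x)) = c *\<^sub>R restrict_l2 S X"
    using assms by (subst restrict_l2_l2_of) (auto simp: L2_scaleR rep_l2 restrict_l2_def l2_of_scaleR rep_l2_L2)
  then show "restrict_l2 S (c *\<^sub>R X) = c *\<^sub>R restrict_l2 S X"
    by (simp add: l2_of_scaleR rep_l2)
  \<comment> \<open>A projection \<open>P\<close> satisfies
    \<open>norm (P X) ^ 2 = inner X (P X)\<close>; Cauchy-Schwarz then gives operator norm at most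
    1.\<close>
  have "norm (restrict_l2 S X) * norm (restrict_l2 S X) = inner X (restrict_l2 S X)"
    using inner_restrict_l2[OF assms rep_l2_L2[OF assms], of X X]
    by (simp add: restrict_l2_def[symmetric] power2_eq_square flip: power2_norm_eq_inner)
  also have "\<dots> \<le> norm X * norm (restrict_l2 S X)" by (rule norm_cauchy_schwarz)
  finally show "norm (restrict_l2 S X) \<le> norm X * 1"
    by (cases "norm (restrict_l2 S X) = 0") (auto simp: mult_le_cancel_right)
qed

lemma l2_of_test_function:
  fixes h :: "'a::euclidean_space \<Rightarrow> 'b::euclidean_space"
  assumes m: "S \<in> sets lebesgue" "S' \<in> sets lebesgue" "S' \<subseteq> S" and h: "h \<in> test_functions S'"
  shows "l2_of S h = l2_of S' h"
proof -
  have "(\<lambda>x. if x \<in> S then h x else 0) = (\<lambda>x. if x \<in> S' then h x else 0)"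
    by (rule ext) (use test_function_eq_0[OF h] m(3) in auto)
  then show ?thesis
    using l2_of_UNIV_extend[OF m(1) test_function_L2[OF h m(1)]]
      l2_of_UNIV_extend[OF m(2) test_function_L2[OF h m(2)]] by simp
qed

text \<open>Weak gradient, curl and divergence are instances of one notion: \<open>g\<close> is a weak derivative of
  \<open>f\<close> if it is the image of \<open>f\<close> under the adjoint of a differential operator \<open>A\<close> on test functions.\<close>

definition has_weak_adjoint ::
  "'a::euclidean_space set \<Rightarrow> (('a \<Rightarrow> 'c::euclidean_space) \<Rightarrow> 'a \<Rightarrow> 'b::euclidean_space) \<Rightarrow>
    ('a \<Rightarrow> 'b) \<Rightarrow> ('a \<Rightarrow> 'c) \<Rightarrow> bool" where
  "has_weak_adjoint S A f g \<longleftrightarrow> f \<in> L2 S \<and> g \<in> L2 S \<and>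
    (\<forall>\<phi>\<in>test_functions S. inner (l2_of S f) (l2_of S (A \<phi>)) = inner (l2_of S g) (l2_of S \<phi>))"

lemma has_weak_adjointD:
  assumes "has_weak_adjoint S A f g"
  shows "f \<in> L2 S" "g \<in> L2 S"
    "\<phi> \<in> test_functions S \<Longrightarrow> inner (l2_of S f) (l2_of S (A \<phi>)) = inner (l2_of S g) (l2_of S \<phi>)"
  using assms by (auto simp: has_weak_adjoint_def)

text \<open>The sign is that of integration by parts: the formal adjoint of the gradient is minus
  the divergence, and conversely. The curl is its own formal adjoint and needs no such
  companion.\<close>

abbreviation grad_adjoint :: "(real^3 \<Rightarrow> real^3) \<Rightarrow> real^3 \<Rightarrow> real" where
  "grad_adjoint \<phi> \<equiv> (\<lambda>x. - cl_div \<phi> x)"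

abbreviation div_adjoint :: "(real^3 \<Rightarrow> real) \<Rightarrow> real^3 \<Rightarrow> real^3" where
  "div_adjoint \<phi> \<equiv> (\<lambda>x. - cl_grad \<phi> x)"

lemma test_function_uminus: "\<phi> \<in> test_functions S \<Longrightarrow> (\<lambda>x. - \<phi> x) \<in> test_functions S"
  using test_function_scaleR[of \<phi> S "-1"] by simp

lemma test_function_adjoint:
  "\<phi> \<in> test_functions S \<Longrightarrow> grad_adjoint \<phi> \<in> test_functions S"
  "\<psi> \<in> test_functions S \<Longrightarrow> div_adjoint \<psi> \<in> test_functions S"
  by (intro test_function_uminus test_function_cl_div test_function_cl_grad; assumption)+

lemma has_weak_grad_iff:
  assumes "open S"
  shows "has_weak_grad S \<psi> g \<longleftrightarrow> has_weak_adjoint S grad_adjoint \<psi> g"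
proof -
  have S: "S \<in> sets lebesgue" using assms by simp
  have "(LINT x|lebesgue_on S. \<psi> x * cl_div \<phi> x) = - (LINT x|lebesgue_on S. g x \<bullet> \<phi> x) \<longleftrightarrow>
      inner (l2_of S \<psi>) (l2_of S (grad_adjoint \<phi>)) = inner (l2_of S g) (l2_of S \<phi>)"
    if "\<phi> \<in> test_functions S" "\<psi> \<in> L2 S" "g \<in> L2 S" for \<phi>
  proof -
    have "inner (l2_of S \<psi>) (l2_of S (grad_adjoint \<phi>)) = - (LINT x|lebesgue_on S. \<psi> x * cl_div \<phi> x)"
      using inner_l2_of[OF S that(2) test_function_L2[OF test_function_adjoint(1)[OF that(1)] S]] by simp
    moreover have "inner (l2_of S g) (l2_of S \<phi>) = (LINT x|lebesgue_on S. g x \<bullet> \<phi> x)"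
      using inner_l2_of[OF S that(3) test_function_L2[OF that(1) S]] .
    ultimately show ?thesis by linarith
  qed
  then show ?thesis unfolding has_weak_grad_def has_weak_adjoint_def by blast
qed

lemma has_weak_curl_iff:
  assumes "open S"
  shows "has_weak_curl S u c \<longleftrightarrow> has_weak_adjoint S cl_curl u c"
proof -
  have S: "S \<in> sets lebesgue" using assms by simp
  have "(LINT x|lebesgue_on S. u x \<bullet> cl_curl \<phi> x) = (LINT x|lebesgue_on S. c x \<bullet> \<phi> x) \<longleftrightarrow>
      inner (l2_of S u) (l2_of S (cl_curl \<phi>)) = inner (l2_of S c) (l2_of S \<phi>)"
    if "\<phi> \<in> test_functions S" "u \<in> L2 S" "c \<in> L2 S" for \<phi>
    using inner_l2_of[OF S that(2) test_function_L2[OF test_function_cl_curl[OF that(1)] S]]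
      inner_l2_of[OF S that(3) test_function_L2[OF that(1) S]] by simp
  then show ?thesis unfolding has_weak_curl_def has_weak_adjoint_def by blast
qed

lemma has_weak_div_iff:
  assumes "open S"
  shows "has_weak_div S w d \<longleftrightarrow> has_weak_adjoint S div_adjoint w d"
proof -
  have S: "S \<in> sets lebesgue" using assms by simp
  have "(LINT x|lebesgue_on S. w x \<bullet> cl_grad \<phi> x) = - (LINT x|lebesgue_on S. d x * \<phi> x) \<longleftrightarrow>
      inner (l2_of S w) (l2_of S (div_adjoint \<phi>)) = inner (l2_of S d) (l2_of S \<phi>)"
    if "\<phi> \<in> test_functions S" "w \<in> L2 S" "d \<in> L2 S" for \<phi>
  proof -
    have "inner (l2_of S w) (l2_of S (div_adjoint \<phi>)) = - (LINT x|lebesgue_on S. w x \<bullet> cl_grad \<phi> x)"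
      using inner_l2_of[OF S that(2) test_function_L2[OF test_function_adjoint(2)[OF that(1)] S]] by simp
    moreover have "inner (l2_of S d) (l2_of S \<phi>) = (LINT x|lebesgue_on S. d x * \<phi> x)"
      using inner_l2_of[OF S that(3) test_function_L2[OF that(1) S]] by simp
    ultimately show ?thesis by linarith
  qed
  then show ?thesis unfolding has_weak_div_def has_weak_adjoint_def by blast
qed

context
  fixes S :: "'a::euclidean_space set"
    and A :: "('a \<Rightarrow> 'c::euclidean_space) \<Rightarrow> 'a \<Rightarrow> 'b::euclidean_space"
  assumes S: "open S"
begin

lemma weak_adjoint_add:
  assumes "has_weak_adjoint S A f g" "has_weak_adjoint S A f' g'"
  shows "has_weak_adjoint S A (\<lambda>x. f x + f' x) (\<lambda>x. g x + g' x)"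
  using assms S unfolding has_weak_adjoint_def
  by (auto simp: L2_add l2_of_add inner_add_left)

lemma weak_adjoint_scaleR:
  assumes "has_weak_adjoint S A f g"
  shows "has_weak_adjoint S A (\<lambda>x. c *\<^sub>R f x) (\<lambda>x. c *\<^sub>R g x)"
  using assms S unfolding has_weak_adjoint_def
  by (auto simp: L2_scaleR l2_of_scaleR)

lemma weak_adjoint_zero: "has_weak_adjoint S A (\<lambda>x. 0) (\<lambda>x. 0)"
  by (simp add: has_weak_adjoint_def)

lemma weak_adjoint_cong:
  assumes "has_weak_adjoint S A f g" "l2_of S f' = l2_of S f" "l2_of S g' = l2_of S g" "f' \<in> L2 S" "g' \<in> L2 S"
  shows "has_weak_adjoint S A f' g'"
  using assms unfolding has_weak_adjoint_def by simp

lemma weak_adjoint_unique: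
  assumes "has_weak_adjoint S A f g" "has_weak_adjoint S A f g'"
  shows "l2_of S g = l2_of S g'"
proof -
  note g = has_weak_adjointD(2)[OF assms(1)] and g' = has_weak_adjointD(2)[OF assms(2)]
  have Sm: "S \<in> sets lebesgue" using S by simp
  have "l2_of S (\<lambda>x. g x - g' x) = 0"
  proof (rule fundamental_lemma[OF S L2_diff[OF g g']])
    fix \<phi> :: "'a \<Rightarrow> 'c" assume "\<phi> \<in> test_functions S"
    then show "inner (l2_of S (\<lambda>x. g x - g' x)) (l2_of S \<phi>) = 0"
      using has_weak_adjointD(3)[OF assms(1)] has_weak_adjointD(3)[OF assms(2)]
      by (simp add: l2_of_diff[OF Sm g g'] inner_diff_left)
  qed
  then show ?thesis by (simp add: l2_of_diff[OF Sm g g'])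
qed

text \<open>A test function on the smaller set is also one on the larger set. The assumption on
  \<open>A\<close> says that the operator does not enlarge supports, so both pairings see only
  \<open>S'\<close>.\<close>

lemma weak_adjoint_restrict:
  assumes f: "has_weak_adjoint S A f g" and S': "open S'" "S' \<subseteq> S"
    and A: "\<And>\<phi>. \<phi> \<in> test_functions S' \<Longrightarrow> A \<phi> \<in> test_functions S'"
  shows "has_weak_adjoint S' A f g"
  unfolding has_weak_adjoint_def
proof (intro conjI ballI)
  note fg = has_weak_adjointD(1,2)[OF f]
  have m: "S \<in> sets lebesgue" "S' \<in> sets lebesgue" using S S' by auto
  show "f \<in> L2 S'" "g \<in> L2 S'" by (rule L2_subset[OF fg(1) m S'(2)], rule L2_subset[OF fg(2) m S'(2)])
  fix \<phi> :: "'a \<Rightarrow> 'c" assume \<phi>: "\<phi> \<in> test_functions S'"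
  note eq = l2_of_test_function[OF m S'(2)]
  have "inner (l2_of S' f) (l2_of S' (A \<phi>)) = inner (l2_of S f) (l2_of S (A \<phi>))"
    unfolding eq[OF A[OF \<phi>]]
    using inner_l2_of_Int[OF m S'(2) fg(1) test_function_L2[OF A[OF \<phi>] m(2)]] by simp
  also have "\<dots> = inner (l2_of S g) (l2_of S \<phi>)"
    by (rule has_weak_adjointD(3)[OF f test_functions_mono[OF \<phi> S'(2)]])
  also have "\<dots> = inner (l2_of S' g) (l2_of S' \<phi>)"
    unfolding eq[OF \<phi>] using inner_l2_of_Int[OF m S'(2) fg(2) test_function_L2[OF \<phi> m(2)]] by simp
  finally show "inner (l2_of S' f) (l2_of S' (A \<phi>)) = inner (l2_of S' g) (l2_of S' \<phi>)" .
qed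

text \<open>Meant for fields known only as classes, such as limits and time integrals. Arbitrary
  representatives may be taken, since the relation is tested through pairings on \<open>S\<close>
  alone.\<close>

lemma weak_adjoint_of_l2:
  assumes A: "\<And>\<phi>. \<phi> \<in> test_functions S \<Longrightarrow> A \<phi> \<in> L2 S"
    and XY: "\<And>\<phi>. \<phi> \<in> test_functions S \<Longrightarrow> inner X (l2_of S (A \<phi>)) = inner Y (l2_of S \<phi>)"
  shows "has_weak_adjoint S A (rep_l2 X) (rep_l2 Y)"
proof -
  have Sm: "S \<in> sets lebesgue" using S by simp
  show ?thesis
    unfolding has_weak_adjoint_def restrict_l2_def[symmetric]
    using XY A by (auto simp: rep_l2_L2[OF Sm] inner_restrict_l2[OF Sm] test_function_L2[OF _ Sm])
qed

text \<open>The graph map turns graph norms into Hilbert norms. Its linearity is not automatic,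
  because \<open>D\<close> is an arbitrary choice of derivative; it follows from uniqueness up to
  null sets.\<close>

lemma weak_adjoint_embedding:
  assumes D: "\<And>f. f \<in> X \<Longrightarrow> has_weak_adjoint S A f (D f)"
    and X: "\<And>f g. has_weak_adjoint S A f g \<Longrightarrow> f \<in> X"
    and N: "\<And>f. N f = sqrt ((L2norm S f)\<^sup>2 + (L2norm S (D f))\<^sup>2)"
  shows "seminorm_embedding N X (\<lambda>f. (l2_of S f, l2_of S (D f)))"
  unfolding seminorm_embedding_def linear_subspace_def
proof (intro conjI allI ballI)
  have Sm: "S \<in> sets lebesgue" using S by simp
  show "(\<lambda>x. 0) \<in> X" using X[OF weak_adjoint_zero] .
  fix u v c assume u: "u \<in> X" and v: "v \<in> X"
  note uv = weak_adjoint_add[OF D[OF u] D[OF v]] and cu = weak_adjoint_scaleR[OF D[OF u], of c]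
  show uv': "(\<lambda>x. u x + v x) \<in> X" by (rule X[OF uv])
  note d = has_weak_adjointD(1,2)[OF D[OF u]] has_weak_adjointD(1,2)[OF D[OF v]]
  show "N u = norm (l2_of S u, l2_of S (D u))"
    unfolding N norm_Pair using d Sm by (simp add: norm_l2_of)
  show "(l2_of S (\<lambda>x. u x + v x), l2_of S (D (\<lambda>x. u x + v x))) =
      (l2_of S u, l2_of S (D u)) + (l2_of S v, l2_of S (D v))"
    using weak_adjoint_unique[OF D[OF uv'] uv] d Sm by (simp add: l2_of_add)
next
  have Sm: "S \<in> sets lebesgue" using S by simp
  fix u c assume u: "u \<in> X"
  note cu = weak_adjoint_scaleR[OF D[OF u], of c] and d = has_weak_adjointD(1,2)[OF D[OF u]]
  show cu': "(\<lambda>x. c *\<^sub>R u x) \<in> X" by (rule X[OF cu])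
  show "(l2_of S (\<lambda>x. c *\<^sub>R u x), l2_of S (D (\<lambda>x. c *\<^sub>R u x))) = c *\<^sub>R (l2_of S u, l2_of S (D u))"
    using weak_adjoint_unique[OF D[OF cu'] cu] d Sm by (simp add: l2_of_scaleR)
qed

text \<open>The pair of field and derivative is integrated in the product Hilbert space. Each weak
  identity is a bounded linear condition that the integrand satisfies at all times and the integral
  at \<open>t0\<close>, so it persists.\<close>

lemma weak_adjoint_primitive:
  assumes A: "\<And>\<phi>. \<phi> \<in> test_functions S \<Longrightarrow> A \<phi> \<in> L2 S"
    and T: "is_interval T" "t0 \<in> T"
    and uv: "\<And>t. t \<in> T \<Longrightarrow> has_weak_adjoint S A (u t) (v t)"
    and cont: "continuous_on T (\<lambda>t. (l2_of S (u t), l2_of S (v t)))"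
  obtains U V where "\<And>t. t \<in> T \<Longrightarrow> has_weak_adjoint S A (U t) (V t)"
    "\<And>t. t \<in> T \<Longrightarrow> ((\<lambda>t. (l2_of S (U t), l2_of S (V t))) has_vector_derivative
      (l2_of S (u t), l2_of S (v t))) (at t within T)"
    "l2_of S (U t0) = 0" "l2_of S (V t0) = 0"
proof -
  have Sm: "S \<in> sets lebesgue" using S by simp
  obtain F where F0: "F t0 = 0" and F: "\<And>t. t \<in> T \<Longrightarrow>
      (F has_vector_derivative (l2_of S (u t), l2_of S (v t))) (at t within T)"
    using antiderivative_on_interval[OF T cont] by blast
  define U where "U t = rep_l2 (fst (F t))" for t
  define V where "V t = rep_l2 (snd (F t))" for t
  have eq: "l2_of S (U t) = restrict_l2 S (fst (F t))" "l2_of S (V t) = restrict_l2 S (snd (F t))" for t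
    by (simp_all add: U_def V_def restrict_l2_def)
  have "has_weak_adjoint S A (U t) (V t)" if t: "t \<in> T" for t
    unfolding U_def V_def
  proof (rule weak_adjoint_of_l2[OF A])
    fix \<phi> :: "'a \<Rightarrow> 'c" assume \<phi>: "\<phi> \<in> test_functions S"
    let ?L = "\<lambda>X. inner (fst X) (l2_of S (A \<phi>)) - inner (snd X) (l2_of S \<phi>)"
    have L: "bounded_linear ?L"
      by (intro bounded_linear_sub bounded_linear_compose[OF bounded_linear_inner_left]
          bounded_linear_fst bounded_linear_snd)
    have "((\<lambda>t. ?L (F t)) has_vector_derivative 0) (at t within T)" if "t \<in> T" for t
      using bounded_linear.has_vector_derivative[OF L F[OF that]]
        has_weak_adjointD(3)[OF uv[OF that] \<phi>] by simp
    from constant_on_interval[OF T(1) this t T(2)] have "?L (F t) = ?L (F t0)" .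
    then show "inner (fst (F t)) (l2_of S (A \<phi>)) = inner (snd (F t)) (l2_of S \<phi>)"
      by (simp add: F0)
  qed
  moreover have "((\<lambda>t. (l2_of S (U t), l2_of S (V t))) has_vector_derivative
      (l2_of S (u t), l2_of S (v t))) (at t within T)" if t: "t \<in> T" for t
  proof -
    \<comment> \<open>The integrand already vanishes outside \<open>S\<close>, so restriction to
      \<open>S\<close> leaves the derivative unchanged.\<close>
    let ?R = "\<lambda>X. (restrict_l2 S (fst X), restrict_l2 S (snd X))"
    have R: "bounded_linear ?R"
      by (intro bounded_linear_Pair bounded_linear_compose[OF bounded_linear_restrict_l2[OF Sm]]
          bounded_linear_fst bounded_linear_snd)
    have "((\<lambda>t. ?R (F t)) has_vector_derivative ?R (l2_of S (u t), l2_of S (v t))) (at t within T)"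
      by (rule bounded_linear.has_vector_derivative[OF R F[OF t]])
    then show ?thesis
      using has_weak_adjointD(1,2)[OF uv[OF t]] by (simp add: eq restrict_l2_idem[OF Sm])
  qed
  moreover have "l2_of S (U t0) = 0" "l2_of S (V t0) = 0"
    by (simp_all add: eq F0 linear_0[OF bounded_linear.linear[OF bounded_linear_restrict_l2[OF Sm]]])
  ultimately show thesis using that by blast
qed

end

section \<open>The spaces L2, H1, H(curl) and H(div)\<close>

lemma L2_embedding: "S \<in> sets lebesgue \<Longrightarrow> seminorm_embedding (L2norm S) (L2 S) (l2_of S)"
  unfolding seminorm_embedding_def linear_subspace_def
  by (simp add: norm_l2_of l2_of_add l2_of_scaleR L2_add L2_scaleR)

context
  fixes S :: "(real^3) set"
  assumes S: "open S"
begin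

lemma weak_curl_works: "u \<in> Hcurl S \<Longrightarrow> has_weak_adjoint S cl_curl u (weak_curl S u)"
  unfolding weak_curl_def Hcurl_def has_weak_curl_iff[OF S, symmetric]
  by (auto intro: someI[of "has_weak_curl S u"])

lemma weak_grad_works: "\<psi> \<in> H1 S \<Longrightarrow> has_weak_adjoint S grad_adjoint \<psi> (weak_grad S \<psi>)"
  unfolding weak_grad_def H1_def has_weak_grad_iff[OF S, symmetric]
  by (auto intro: someI[of "has_weak_grad S \<psi>"])

lemma weak_div_works: "w \<in> Hdiv S \<Longrightarrow> has_weak_adjoint S div_adjoint w (weak_div S w)"
  unfolding weak_div_def Hdiv_def has_weak_div_iff[OF S, symmetric]
  by (auto intro: someI[of "has_weak_div S w"])

lemma HcurlI: "has_weak_adjoint S cl_curl u c \<Longrightarrow> u \<in> Hcurl S"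
  by (auto simp: Hcurl_def has_weak_curl_iff[OF S])

lemma H1I: "has_weak_adjoint S grad_adjoint \<psi> g \<Longrightarrow> \<psi> \<in> H1 S"
  by (auto simp: H1_def has_weak_grad_iff[OF S])

lemma HdivI: "has_weak_adjoint S div_adjoint w d \<Longrightarrow> w \<in> Hdiv S"
  by (auto simp: Hdiv_def has_weak_div_iff[OF S])

lemma weak_curl_eq: "has_weak_adjoint S cl_curl u c \<Longrightarrow> l2_of S (weak_curl S u) = l2_of S c"
  using weak_adjoint_unique[OF S weak_curl_works[OF HcurlI]] by blast

lemma weak_grad_eq: "has_weak_adjoint S grad_adjoint \<psi> g \<Longrightarrow> l2_of S (weak_grad S \<psi>) = l2_of S g"
  using weak_adjoint_unique[OF S weak_grad_works[OF H1I]] by blast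

lemma weak_div_eq: "has_weak_adjoint S div_adjoint w d \<Longrightarrow> l2_of S (weak_div S w) = l2_of S d"
  using weak_adjoint_unique[OF S weak_div_works[OF HdivI]] by blast

lemma Hcurl_embedding:
  "seminorm_embedding (Hcurl_norm S) (Hcurl S) (\<lambda>u. (l2_of S u, l2_of S (weak_curl S u)))"
  by (rule weak_adjoint_embedding[OF S weak_curl_works HcurlI Hcurl_norm_def])

lemma Hdiv_embedding:
  "seminorm_embedding (Hdiv_norm S) (Hdiv S) (\<lambda>w. (l2_of S w, l2_of S (weak_div S w)))"
  by (rule weak_adjoint_embedding[OF S weak_div_works HdivI Hdiv_norm_def])

text \<open>With both derivatives moved to the test function, \<open>div curl = 0\<close> becomes
  the classical \<open>curl grad = 0\<close>.\<close>

lemma weak_div_of_curl: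
  assumes "has_weak_adjoint S cl_curl u c"
  shows "has_weak_adjoint S div_adjoint c (\<lambda>x. 0)"
proof -
  note uc = has_weak_adjointD[OF assms]
  have Sm: "S \<in> sets lebesgue" using S by simp
  have "inner (l2_of S c) (l2_of S (div_adjoint \<phi>)) = 0" if \<phi>: "\<phi> \<in> test_functions S" for \<phi>
  proof -
    have g: "cl_grad \<phi> \<in> test_functions S" by (rule test_function_cl_grad[OF \<phi>])
    have "inner (l2_of S c) (l2_of S (cl_grad \<phi>)) = inner (l2_of S u) (l2_of S (cl_curl (cl_grad \<phi>)))"
      using uc(3)[OF g] by simp
    also have "cl_curl (cl_grad \<phi>) = (\<lambda>x. 0)"
      using cl_curl_cl_grad[OF test_function_Ck[OF \<phi>]] by auto
    finally show ?thesis using l2_of_uminus[OF Sm test_function_L2[OF g Sm]] by simp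
  qed
  then show ?thesis using uc by (simp add: has_weak_adjoint_def)
qed

lemma weak_curl_of_grad:
  assumes "has_weak_adjoint S grad_adjoint \<psi> g"
  shows "has_weak_adjoint S cl_curl g (\<lambda>x. 0)"
proof -
  note pg = has_weak_adjointD[OF assms]
  have "inner (l2_of S g) (l2_of S (cl_curl \<phi>)) = 0" if \<phi>: "\<phi> \<in> test_functions S" for \<phi>
  proof -
    have "inner (l2_of S g) (l2_of S (cl_curl \<phi>)) = inner (l2_of S \<psi>) (l2_of S (grad_adjoint (cl_curl \<phi>)))"
      using pg(3)[OF test_function_cl_curl[OF \<phi>]] by simp
    also have "grad_adjoint (cl_curl \<phi>) = (\<lambda>x. 0)"
      using cl_div_cl_curl[OF test_function_Ck[OF \<phi>]] by auto
    finally show ?thesis by simp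
  qed
  then show ?thesis using pg by (simp add: has_weak_adjoint_def)
qed

lemma bdry_cross_eq:
  assumes "u \<in> Hcurl S" "v \<in> Hcurl S"
  shows "bdry_cross S u v = inner (l2_of S (weak_curl S u)) (l2_of S v) - inner (l2_of S u) (l2_of S (weak_curl S v))"
proof -
  have Sm: "S \<in> sets lebesgue" using S by simp
  note u = has_weak_adjointD(1,2)[OF weak_curl_works[OF assms(1)]]
    and v = has_weak_adjointD(1,2)[OF weak_curl_works[OF assms(2)]]
  show ?thesis
    unfolding bdry_cross_def inner_l2_of[OF Sm u(2) v(1)] inner_l2_of[OF Sm u(1) v(2)]
    by (rule Bochner_Integration.integral_diff[OF L2_inner_integrable[OF u(2) v(1)] L2_inner_integrable[OF u(1) v(2)]])
qed

lemma bdry_flux_eq: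
  assumes "\<psi> \<in> H1 S" "w \<in> Hdiv S"
  shows "bdry_flux S \<psi> w = inner (l2_of S (weak_grad S \<psi>)) (l2_of S w) + inner (l2_of S \<psi>) (l2_of S (weak_div S w))"
proof -
  have Sm: "S \<in> sets lebesgue" using S by simp
  note p = has_weak_adjointD(1,2)[OF weak_grad_works[OF assms(1)]]
    and w = has_weak_adjointD(1,2)[OF weak_div_works[OF assms(2)]]
  have "bdry_flux S \<psi> w = (LINT x|lebesgue_on S. weak_grad S \<psi> x \<bullet> w x) + (LINT x|lebesgue_on S. \<psi> x * weak_div S w x)"
    unfolding bdry_flux_def
    by (rule Bochner_Integration.integral_add[OF L2_inner_integrable[OF p(2) w(1)] L2_mult_integrable[OF p(1) w(2)]])
  then show ?thesis by (simp add: inner_l2_of[OF Sm p(2) w(1)] inner_l2_of[OF Sm p(1) w(2)])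
qed

end

section \<open>Polynomials and the Friedrichs inequality\<close>

lemma inner_l2_of_vec:
  fixes f g :: "'a::euclidean_space \<Rightarrow> real^'n"
  assumes S: "S \<in> sets lebesgue" and f: "f \<in> L2 S" and g: "g \<in> L2 S"
  shows "inner (l2_of S f) (l2_of S g) = (\<Sum>i\<in>UNIV. inner (l2_of S (\<lambda>x. f x $ i)) (l2_of S (\<lambda>x. g x $ i)))"
proof -
  have fi: "(\<lambda>x. f x $ i) \<in> L2 S" and gi: "(\<lambda>x. g x $ i) \<in> L2 S" for i
    by (rule L2_linear[OF f bounded_linear_vec_nth], rule L2_linear[OF g bounded_linear_vec_nth])
  have "inner (l2_of S f) (l2_of S g) = (LINT x|lebesgue_on S. (\<Sum>i\<in>UNIV. f x $ i * g x $ i))"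
    unfolding inner_l2_of[OF S f g] by (simp add: inner_vec_def)
  also have "\<dots> = (\<Sum>i\<in>UNIV. LINT x|lebesgue_on S. f x $ i * g x $ i)"
    by (rule Bochner_Integration.integral_sum) (rule L2_mult_integrable[OF fi gi])
  finally show ?thesis by (simp add: inner_l2_of[OF S fi gi])
qed

lemma l2_integration_by_parts:
  assumes S: "open S" "bounded S" and u: "Ck (Suc 0) u" and \<eta>: "\<eta> \<in> test_functions S"
  shows "inner (l2_of S u) (l2_of S (\<lambda>x. partial k \<eta> x)) = - inner (l2_of S (\<lambda>x. partial k u x)) (l2_of S (\<eta> :: real^3 \<Rightarrow> real))"
proof -
  have Sm: "S \<in> sets lebesgue" using S by simp
  have "u \<in> L2 S" "(\<lambda>x. partial k u x) \<in> L2 S"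
    by (rule L2_continuous_on_bounded[OF Sm S(2)]; rule Ck_continuous; (rule u | rule Ck_partial[OF u]))+
  then show ?thesis
    using integration_by_parts[OF u \<eta> Sm axis_Basis[of k]]
      test_function_L2[OF \<eta> Sm] test_function_L2[OF test_function_partial[OF \<eta>] Sm, of k]
    by (simp add: inner_l2_of[OF Sm] partial_def)
qed

context
  fixes S :: "(real^3) set"
  assumes S: "open S" "bounded S"
begin

lemma Ck_L2: "Ck m f \<Longrightarrow> f \<in> L2 S"
  for f :: "real^3 \<Rightarrow> 'b::euclidean_space"
  using L2_continuous_on_bounded[of S f] S Ck_continuous[of m f] by simp

lemma smooth_weak_grad:
  assumes f: "Ck (Suc 0) f"
  shows "has_weak_adjoint S grad_adjoint f (cl_grad f)"
  unfolding has_weak_adjoint_def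
proof (intro conjI ballI)
  have Sm: "S \<in> sets lebesgue" using S by simp
  show fL: "f \<in> L2 S" and gL: "cl_grad f \<in> L2 S"
    by (rule Ck_L2[OF f], rule Ck_L2[OF Ck_cl_grad[OF f]])
  fix \<phi> :: "real^3 \<Rightarrow> real^3" assume \<phi>: "\<phi> \<in> test_functions S"
  have c: "cl_div \<phi> = (\<lambda>x. \<Sum>k\<in>UNIV. partial k (\<lambda>x. \<phi> x $ k) x)"
    by (auto simp: cl_div_def partial_nth[OF test_function_Ck[OF \<phi>]])
  have pL: "(\<lambda>x. partial k (\<lambda>x. \<phi> x $ k) x) \<in> L2 S" for k
    by (rule test_function_L2[OF test_function_partial[OF test_function_nth[OF \<phi>]] Sm])
  have "inner (l2_of S f) (l2_of S (grad_adjoint \<phi>)) =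
      - (\<Sum>k\<in>UNIV. inner (l2_of S f) (l2_of S (\<lambda>x. partial k (\<lambda>x. \<phi> x $ k) x)))"
    unfolding c l2_of_uminus[OF Sm L2_sum[OF pL]] l2_of_sum[OF Sm pL] by (simp add: inner_sum_right)
  also have "\<dots> = (\<Sum>k\<in>UNIV. inner (l2_of S (\<lambda>x. cl_grad f x $ k)) (l2_of S (\<lambda>x. \<phi> x $ k)))"
    by (simp add: l2_integration_by_parts[OF S f test_function_nth[OF \<phi>]] sum_negf cl_grad_def)
  also have "\<dots> = inner (l2_of S (cl_grad f)) (l2_of S \<phi>)"
    by (rule inner_l2_of_vec[OF Sm gL test_function_L2[OF \<phi> Sm], symmetric])
  finally show "inner (l2_of S f) (l2_of S (grad_adjoint \<phi>)) = inner (l2_of S (cl_grad f)) (l2_of S \<phi>)" .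
qed

lemma smooth_weak_curl:
  assumes u: "Ck (Suc 0) u"
  shows "has_weak_adjoint S cl_curl u (cl_curl u)"
  unfolding has_weak_adjoint_def
proof (intro conjI ballI)
  have Sm: "S \<in> sets lebesgue" using S by simp
  show uL: "u \<in> L2 S" and cL: "cl_curl u \<in> L2 S"
    by (rule Ck_L2[OF u], rule Ck_L2[OF Ck_cl_curl[OF u]])
  fix \<phi> :: "real^3 \<Rightarrow> real^3" assume \<phi>: "\<phi> \<in> test_functions S"
  have ui: "Ck (Suc 0) (\<lambda>x. u x $ i)" for i by (rule Ck_vec_nth[OF u])
  have pL: "(\<lambda>x. partial k (\<lambda>x. \<phi> x $ i) x) \<in> L2 S" for k i
    by (rule test_function_L2[OF test_function_partial[OF test_function_nth[OF \<phi>]] Sm])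
  have qL: "(\<lambda>x. partial k (\<lambda>x. u x $ i) x) \<in> L2 S" for k i by (rule Ck_L2[OF Ck_partial[OF ui]])
  note n\<phi> = partial_nth[OF test_function_Ck[OF \<phi>]] and nu = partial_nth[OF u]
  note ibp = l2_integration_by_parts[OF S ui test_function_nth[OF \<phi>]]
  have "inner (l2_of S u) (l2_of S (cl_curl \<phi>)) = (\<Sum>i\<in>UNIV. inner (l2_of S (\<lambda>x. u x $ i)) (l2_of S (\<lambda>x. cl_curl \<phi> x $ i)))"
    by (rule inner_l2_of_vec[OF Sm uL test_function_L2[OF test_function_cl_curl[OF \<phi>] Sm]])
  also have "\<dots> = (\<Sum>i\<in>UNIV. inner (l2_of S (\<lambda>x. cl_curl u x $ i)) (l2_of S (\<lambda>x. \<phi> x $ i)))"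
    unfolding sum_3 cl_curl_nth n\<phi> nu
    by (simp add: l2_of_diff[OF Sm pL pL] l2_of_diff[OF Sm qL qL] inner_diff_left inner_diff_right ibp)
  also have "\<dots> = inner (l2_of S (cl_curl u)) (l2_of S \<phi>)"
    by (rule inner_l2_of_vec[OF Sm cL test_function_L2[OF \<phi> Sm], symmetric])
  finally show "inner (l2_of S u) (l2_of S (cl_curl \<phi>)) = inner (l2_of S (cl_curl u)) (l2_of S \<phi>)" .
qed

text \<open>Integration by parts with the weight \<open>x $ 1\<close>, whose derivative is 1: the
  square of the norm of \<open>\<phi>\<close> equals minus twice the integral of
  \<open>x $ 1 * \<phi> x * partial 1 \<phi> x\<close>. This factor 2 and the bound \<open>R\<close>
  on the weight give the constant.\<close>

lemma friedrichs:
  fixes \<phi> :: "real^3 \<Rightarrow> real"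
  assumes \<phi>: "\<phi> \<in> test_functions S" and R: "\<And>x. x \<in> S \<Longrightarrow> norm x \<le> R"
  shows "norm (l2_of S \<phi>) \<le> 2 * R * norm (l2_of S (cl_grad \<phi>))"
proof -
  have Sm: "S \<in> sets lebesgue" using S by simp
  let ?u = "\<lambda>x. x $ 1 * \<phi> x" and ?d = "\<lambda>x. partial 1 \<phi> x"
  have c1: "Ck m (\<lambda>x::real^3. x $ 1)" for m by (rule Ck_bounded_linear[OF bounded_linear_vec_nth])
  have u: "Ck m ?u" for m by (rule Ck_mult[OF c1 test_function_Ck[OF \<phi>]])
  have \<phi>L: "\<phi> \<in> L2 S" by (rule test_function_L2[OF \<phi> Sm])
  have uL: "?u \<in> L2 S" by (rule Ck_L2[OF u])
  have dL: "?d \<in> L2 S" by (rule test_function_L2[OF test_function_partial[OF \<phi>] Sm])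
  have xdL: "(\<lambda>x. x $ 1 * ?d x) \<in> L2 S"
    by (rule Ck_L2[OF Ck_mult[OF c1 test_function_Ck[OF test_function_partial[OF \<phi>]]]])
  have gL: "cl_grad \<phi> \<in> L2 S" by (rule test_function_L2[OF test_function_cl_grad[OF \<phi>] Sm])
  have "partial 1 ?u x = \<phi> x + x $ 1 * ?d x" for x
  proof -
    have "(?u has_derivative (\<lambda>h. x $ 1 * frechet_derivative \<phi> (at x) h + h $ 1 * \<phi> x)) (at x)"
      by (rule has_derivative_mult[OF bounded_linear_imp_has_derivative[OF bounded_linear_vec_nth]
            Ck_has_derivative[OF test_function_Ck[OF \<phi>]]])
    from partial_has_derivative[OF this, of 1] show ?thesis by (simp add: partial_def)
  qed
  then have p: "(\<lambda>x. partial 1 ?u x) = (\<lambda>x. \<phi> x + x $ 1 * ?d x)" by auto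
  have "inner (l2_of S (\<lambda>x. x $ 1 * ?d x)) (l2_of S \<phi>) = inner (l2_of S ?u) (l2_of S ?d)"
    unfolding inner_l2_of[OF Sm xdL \<phi>L] inner_l2_of[OF Sm uL dL] by (simp add: mult_ac)
  moreover have "inner (l2_of S ?u) (l2_of S ?d) =
      - inner (l2_of S \<phi>) (l2_of S \<phi>) - inner (l2_of S (\<lambda>x. x $ 1 * ?d x)) (l2_of S \<phi>)"
    using l2_integration_by_parts[OF S u \<phi>, of 1] unfolding p l2_of_add[OF Sm \<phi>L xdL]
    by (simp add: inner_add_left)
  ultimately have "(norm (l2_of S \<phi>))\<^sup>2 = - 2 * inner (l2_of S ?u) (l2_of S ?d)"
    unfolding power2_norm_eq_inner by linarith
  also have "\<dots> \<le> 2 * (norm (l2_of S ?u) * norm (l2_of S ?d))"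
    using Cauchy_Schwarz_ineq2[of "l2_of S ?u" "l2_of S ?d"] by linarith
  also have "\<dots> \<le> 2 * ((R * norm (l2_of S \<phi>)) * norm (l2_of S (cl_grad \<phi>)))"
  proof -
    have "norm (l2_of S ?u) \<le> \<bar>R\<bar> * norm (l2_of S \<phi>)"
    proof -
      have "inner (l2_of S ?u) (l2_of S ?u) \<le> (LINT x|lebesgue_on S. R\<^sup>2 * (\<phi> x * \<phi> x))"
        unfolding inner_l2_of[OF Sm uL uL]
      proof (rule integral_mono)
        show "integrable (lebesgue_on S) (\<lambda>x. ?u x \<bullet> ?u x)" by (rule L2_inner_integrable[OF uL uL])
        show "integrable (lebesgue_on S) (\<lambda>x. R\<^sup>2 * (\<phi> x * \<phi> x))"
          using L2_mult_integrable[OF \<phi>L \<phi>L] by simp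
        fix x assume "x \<in> space (lebesgue_on S)"
        then have "\<bar>x $ 1\<bar> \<le> R" using R[of x] component_le_norm_cart[of x 1] by simp
        then have "(x $ 1)\<^sup>2 \<le> R\<^sup>2" by (simp add: abs_le_square_iff[symmetric])
        then have "(x $ 1)\<^sup>2 * (\<phi> x * \<phi> x) \<le> R\<^sup>2 * (\<phi> x * \<phi> x)" by (intro mult_right_mono) auto
        then show "?u x \<bullet> ?u x \<le> R\<^sup>2 * (\<phi> x * \<phi> x)" by (simp add: power2_eq_square mult_ac)
      qed
      also have "\<dots> = R\<^sup>2 * inner (l2_of S \<phi>) (l2_of S \<phi>)"
        unfolding inner_l2_of[OF Sm \<phi>L \<phi>L] by simp
      finally have "(norm (l2_of S ?u))\<^sup>2 \<le> (\<bar>R\<bar> * norm (l2_of S \<phi>))\<^sup>2"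
        by (simp add: power2_norm_eq_inner[symmetric] power_mult_distrib)
      then show ?thesis by (rule power2_le_imp_le) simp
    qed
    moreover have "norm (l2_of S ?d) \<le> norm (l2_of S (cl_grad \<phi>))"
    proof -
      have "inner (l2_of S ?d) (l2_of S ?d) \<le> inner (l2_of S (cl_grad \<phi>)) (l2_of S (cl_grad \<phi>))"
        unfolding inner_l2_of_vec[OF Sm gL gL] sum_3 by (simp add: cl_grad_def)
      then show ?thesis unfolding norm_le by simp
    qed
    \<comment> \<open>A negative \<open>R\<close> is possible only for empty \<open>S\<close>, where
      the class of \<open>\<phi>\<close> is zero.\<close>
    moreover have "\<bar>R\<bar> * norm (l2_of S \<phi>) = R * norm (l2_of S \<phi>)"
    proof (cases "S = {}")
      case True
      then have "l2_of S \<phi> = 0" using l2_of_eq_iff[OF Sm \<phi>L L2_zero] by (simp add: AE_restrict_space_iff)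
      then show ?thesis by simp
    next
      case False
      then obtain x :: "real^3" where "norm x \<le> R" using R by blast
      then have "R \<ge> 0" using norm_ge_zero[of x] by linarith
      then show ?thesis by simp
    qed
    ultimately show ?thesis by (intro mult_left_mono mult_mono) auto
  qed
  finally have "norm (l2_of S \<phi>) * norm (l2_of S \<phi>) \<le>
      (2 * R * norm (l2_of S (cl_grad \<phi>))) * norm (l2_of S \<phi>)"
    by (simp add: power2_eq_square mult_ac)
  then show ?thesis
  proof (cases "norm (l2_of S \<phi>) = 0")
    case True
    then show ?thesis
    proof (cases "R \<ge> 0")
      case False
      have "x \<notin> S" for x using R[of x] norm_ge_zero[of x] False by linarith
      then have "S = {}" by blast
      then have "l2_of S (cl_grad \<phi>) = 0" using l2_of_eq_iff[OF Sm gL L2_zero] by (simp add: AE_restrict_space_iff)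
      then show ?thesis using True by simp
    qed simp
  qed (simp add: mult_le_cancel_right)
qed

end

section \<open>Polynomials and Nedelec fields\<close>

definition monom3 :: "nat \<times> nat \<times> nat \<Rightarrow> real^3 \<Rightarrow> real" where
  "monom3 \<alpha> x = x$1 ^ fst \<alpha> * x$2 ^ fst (snd \<alpha>) * x$3 ^ snd (snd \<alpha>)"

definition deg_le :: "nat \<Rightarrow> (nat \<times> nat \<times> nat) set" where
  "deg_le r = {(i, j, k). i + j + k \<le> r}"

lemma finite_deg_le: "finite (deg_le r)"
  by (rule finite_subset[of _ "{..r} \<times> {..r} \<times> {..r}"]) (auto simp: deg_le_def)

lemma poly_le_iff: "p \<in> poly_le r \<longleftrightarrow> (\<exists>c. \<forall>x. p x = (\<Sum>\<alpha>\<in>deg_le r. c \<alpha> * monom3 \<alpha> x))"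
proof
  assume "p \<in> poly_le r"
  then obtain c where "\<And>x. p x = (\<Sum>(i, j, k)\<in>deg_le r. c i j k * x$1 ^ i * x$2 ^ j * x$3 ^ k)"
    unfolding poly_le_def deg_le_def by blast
  then show "\<exists>c. \<forall>x. p x = (\<Sum>\<alpha>\<in>deg_le r. c \<alpha> * monom3 \<alpha> x)"
    by (intro exI[of _ "\<lambda>(i, j, k). c i j k"])
      (auto simp: monom3_def case_prod_beta mult.assoc intro!: sum.cong)
next
  assume "\<exists>c. \<forall>x. p x = (\<Sum>\<alpha>\<in>deg_le r. c \<alpha> * monom3 \<alpha> x)"
  then obtain c where "\<And>x. p x = (\<Sum>\<alpha>\<in>deg_le r. c \<alpha> * monom3 \<alpha> x)" by blast
  then show "p \<in> poly_le r"
    unfolding poly_le_def deg_le_def[symmetric]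
    by (intro CollectI exI[of _ "\<lambda>i j k. c (i, j, k)"])
      (auto simp: monom3_def case_prod_beta mult.assoc intro!: sum.cong)
qed

lemma monom3_poly_le:
  assumes "\<alpha> \<in> deg_le r"
  shows "monom3 \<alpha> \<in> poly_le r"
  unfolding poly_le_iff
proof (intro exI allI)
  show "monom3 \<alpha> x = (\<Sum>\<beta>\<in>deg_le r. (if \<beta> = \<alpha> then 1 else 0) * monom3 \<beta> x)" for x
    using assms by (simp add: if_distribR if_distrib sum.delta[OF finite_deg_le] cong: if_cong)
qed

lemma linear_subspace_poly_le: "linear_subspace (poly_le r)"
  unfolding linear_subspace_def
proof (intro conjI ballI allI)
  show "(\<lambda>x. 0) \<in> poly_le r" unfolding poly_le_iff by (intro exI[of _ "\<lambda>_. 0"]) simp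
  fix u v assume "u \<in> poly_le r" "v \<in> poly_le r"
  then obtain c d where "\<And>x. u x = (\<Sum>\<alpha>\<in>deg_le r. c \<alpha> * monom3 \<alpha> x)"
      "\<And>x. v x = (\<Sum>\<alpha>\<in>deg_le r. d \<alpha> * monom3 \<alpha> x)"
    unfolding poly_le_iff by blast
  then show "(\<lambda>x. u x + v x) \<in> poly_le r"
    unfolding poly_le_iff
    by (intro exI[of _ "\<lambda>\<alpha>. c \<alpha> + d \<alpha>"]) (simp add: distrib_right sum.distrib)
next
  fix a u assume "u \<in> poly_le r"
  then obtain c where "\<And>x. u x = (\<Sum>\<alpha>\<in>deg_le r. c \<alpha> * monom3 \<alpha> x)"
    unfolding poly_le_iff by blast
  then show "(\<lambda>x. a *\<^sub>R u x) \<in> poly_le r"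
    unfolding poly_le_iff
    by (intro exI[of _ "\<lambda>\<alpha>. a * c \<alpha>"]) (simp add: sum_distrib_left mult.assoc)
qed

lemma poly_le_const: "(\<lambda>x. a) \<in> poly_le r"
proof -
  have "(\<lambda>x. a *\<^sub>R monom3 (0, 0, 0) x) \<in> poly_le r"
    by (rule linear_subspaceD(3)[OF linear_subspace_poly_le monom3_poly_le]) (simp add: deg_le_def)
  then show ?thesis by (simp add: monom3_def)
qed

lemma Ck_power: "Ck m f \<Longrightarrow> Ck m (\<lambda>x. f x ^ n :: real)"
  by (induction n) (simp_all add: Ck_const Ck_mult)

lemma Ck_monom3: "Ck m (monom3 \<alpha>)"
  unfolding monom3_def[abs_def]
  by (intro Ck_mult Ck_power Ck_bounded_linear bounded_linear_vec_nth)

lemma Ck_poly_le: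
  assumes "p \<in> poly_le r"
  shows "Ck m p"
proof -
  obtain c where "\<And>x. p x = (\<Sum>\<alpha>\<in>deg_le r. c \<alpha> * monom3 \<alpha> x)"
    using assms unfolding poly_le_iff by blast
  then have "p = (\<lambda>x. \<Sum>\<alpha>\<in>deg_le r. c \<alpha> * monom3 \<alpha> x)" by auto
  then show ?thesis by (simp only:) (intro Ck_sum Ck_mult Ck_const Ck_monom3)
qed

lemma partial_monom3:
  assumes "\<alpha> \<in> deg_le r"
  shows "(\<lambda>x. partial l (monom3 \<alpha>) x) \<in> poly_le (r - 1)"
proof -
  obtain i j k where \<alpha>: "\<alpha> = (i, j, k)" by (metis prod_cases3)
  have ijk: "i + j + k \<le> r" using assms by (simp add: \<alpha> deg_le_def)
  have der: "(monom3 \<alpha> has_derivative (\<lambda>h. real i * h$1 * monom3 (i - 1, j, k) x +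
      real j * h$2 * monom3 (i, j - 1, k) x + real k * h$3 * monom3 (i, j, k - 1) x)) (at x)" for x
    unfolding monom3_def[abs_def] \<alpha>
    by (auto intro!: derivative_eq_intros bounded_linear_imp_has_derivative[OF bounded_linear_vec_nth]
        simp: algebra_simps)
  \<comment> \<open>If an exponent is 0, then its predecessor is again 0 and the monomial may have
    too high a degree, but then its coefficient vanishes; this is the first alternative.\<close>
  have mem: "(\<lambda>x. real n * monom3 \<beta> x) \<in> poly_le (r - 1)" if "n = 0 \<or> \<beta> \<in> deg_le (r - 1)" for n \<beta>
  proof (cases "n = 0")
    case True
    then show ?thesis using linear_subspaceD(1)[OF linear_subspace_poly_le[of "r - 1"]] by simp
  next
    case False
    then show ?thesis
      using linear_subspaceD(3)[OF linear_subspace_poly_le monom3_poly_le, of \<beta> "r - 1" "real n"] that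
      by simp
  qed
  have p: "partial l (monom3 \<alpha>) x = real i * axis l 1 $ 1 * monom3 (i - 1, j, k) x +
      real j * axis l 1 $ 2 * monom3 (i, j - 1, k) x + real k * axis l 1 $ 3 * monom3 (i, j, k - 1) x" for x
    by (rule partial_has_derivative[OF der])
  consider "l = 1" | "l = 2" | "l = 3" using exhaust_3[of l] by blast
  then show ?thesis
  proof cases
    case 1
    have "(\<lambda>x. real i * monom3 (i - 1, j, k) x) \<in> poly_le (r - 1)"
      using ijk by (intro mem) (auto simp: deg_le_def)
    moreover have "partial l (monom3 \<alpha>) = (\<lambda>x. real i * monom3 (i - 1, j, k) x)"
      by (rule ext) (simp add: p[unfolded 1] 1 axis_def)
    ultimately show ?thesis by simp
  next
    case 2
    have "(\<lambda>x. real j * monom3 (i, j - 1, k) x) \<in> poly_le (r - 1)"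
      using ijk by (intro mem) (auto simp: deg_le_def)
    moreover have "partial l (monom3 \<alpha>) = (\<lambda>x. real j * monom3 (i, j - 1, k) x)"
      by (rule ext) (simp add: p[unfolded 2] 2 axis_def)
    ultimately show ?thesis by simp
  next
    case 3
    have "(\<lambda>x. real k * monom3 (i, j, k - 1) x) \<in> poly_le (r - 1)"
      using ijk by (intro mem) (auto simp: deg_le_def)
    moreover have "partial l (monom3 \<alpha>) = (\<lambda>x. real k * monom3 (i, j, k - 1) x)"
      by (rule ext) (simp add: p[unfolded 3] 3 axis_def)
    ultimately show ?thesis by simp
  qed
qed

lemma partial_poly_le:
  assumes "p \<in> poly_le r"
  shows "(\<lambda>x. partial l p x) \<in> poly_le (r - 1)"
proof -
  obtain c where "\<And>x. p x = (\<Sum>\<alpha>\<in>deg_le r. c \<alpha> * monom3 \<alpha> x)"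
    using assms unfolding poly_le_iff by blast
  then have p: "p = (\<lambda>x. \<Sum>\<alpha>\<in>deg_le r. c \<alpha> * monom3 \<alpha> x)" by auto
  have "partial l p x = (\<Sum>\<alpha>\<in>deg_le r. c \<alpha> *\<^sub>R partial l (monom3 \<alpha>) x)" for x
  proof -
    have "(p has_derivative (\<lambda>h. \<Sum>\<alpha>\<in>deg_le r. c \<alpha> * frechet_derivative (monom3 \<alpha>) (at x) h)) (at x)"
      unfolding p by (intro has_derivative_sum has_derivative_mult_right Ck_has_derivative[OF Ck_monom3])
    from partial_has_derivative[OF this] show ?thesis by (simp add: partial_def)
  qed
  then have "(\<lambda>x. partial l p x) = (\<lambda>x. \<Sum>\<alpha>\<in>deg_le r. c \<alpha> *\<^sub>R partial l (monom3 \<alpha>) x)" by auto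
  then show ?thesis
    by (simp only:) (intro linear_subspace_sum[OF linear_subspace_poly_le]
        linear_subspaceD(3)[OF linear_subspace_poly_le] partial_monom3)
qed

text \<open>The reason for pairing these degrees: a gradient of degree \<open>r - 1\<close> belongs
  to either kind, in the first kind with zero rotational part. It lets the hybrid equations be
  tested with gradients.\<close>

lemma cl_grad_nedelec:
  assumes "p \<in> poly_le r"
  shows "cl_grad p \<in> nedelec k r"
proof -
  have g: "cl_grad p \<in> vpoly_le (r - 1)"
    using partial_poly_le[OF assms] by (simp add: vpoly_le_def cl_grad_def)
  have "\<exists>p' q. cl_grad p = (\<lambda>x. p' x + cross3 x (q x)) \<and> p' \<in> vpoly_le (r - 1) \<and> q \<in> vpoly_le (r - 1)"
    using g poly_le_const[of 0 "r - 1"]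
    by (intro exI[of _ "cl_grad p"] exI[of _ "\<lambda>x. 0"]) (simp add: vpoly_le_def)
  then show ?thesis using g by (cases k) auto
qed

lemma bounded_bilinear_cross3: "bounded_bilinear cross3"
  using bilinear_cross bilinear_conv_bounded_bilinear by blast

lemma vpoly_le_eq_sum:
  assumes "p \<in> vpoly_le r"
  obtains c where "p = (\<lambda>x. \<Sum>i\<in>UNIV. \<Sum>\<alpha>\<in>deg_le r. c i \<alpha> *\<^sub>R (monom3 \<alpha> x *\<^sub>R axis i 1))"
proof -
  have "\<forall>i. \<exists>c. \<forall>x. p x $ i = (\<Sum>\<alpha>\<in>deg_le r. c \<alpha> * monom3 \<alpha> x)"
    using assms by (simp add: vpoly_le_def poly_le_iff)
  then obtain c where c: "\<And>i x. p x $ i = (\<Sum>\<alpha>\<in>deg_le r. c i \<alpha> * monom3 \<alpha> x)" by metis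
  have "p x = (\<Sum>i\<in>UNIV. \<Sum>\<alpha>\<in>deg_le r. c i \<alpha> *\<^sub>R (monom3 \<alpha> x *\<^sub>R axis i 1))" for x
    by (subst vec_eq_sum_axis) (simp add: c scaleR_sum_left)
  then show thesis using that by blast
qed

text \<open>A common spanning family for both kinds: the Boolean switches between the polynomial
  part and the part \<open>cross3 x (q x)\<close>. For the second kind the latter receives zero
  coefficients; containment in a finite span is wanted, not a basis.\<close>

definition nedelec_gen :: "bool \<times> 3 \<times> nat \<times> nat \<times> nat \<Rightarrow> real^3 \<Rightarrow> real^3" where
  "nedelec_gen = (\<lambda>(b, i, \<alpha>) x. if b then cross3 x (monom3 \<alpha> x *\<^sub>R axis i 1) else monom3 \<alpha> x *\<^sub>R axis i 1)"

lemma Ck_nedelec_gen: "Ck m (nedelec_gen \<beta>)"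
proof -
  obtain b i \<alpha> where \<beta>: "\<beta> = (b, i, \<alpha>)" by (metis prod_cases3)
  have m: "Ck m (\<lambda>x. monom3 \<alpha> x *\<^sub>R axis i (1::real) :: real^3)"
    by (intro Ck_scaleR Ck_monom3 Ck_const)
  then show ?thesis
    using Ck_bilinear[OF bounded_bilinear_cross3 Ck_bounded_linear[OF bounded_linear_ident] m]
    by (cases b) (simp_all add: nedelec_gen_def \<beta>)
qed

lemma sum_triple:
  "(\<Sum>\<beta>\<in>A \<times> B \<times> C. f \<beta>) = (\<Sum>b\<in>A. \<Sum>i\<in>B. \<Sum>\<alpha>\<in>C. f (b, i, \<alpha>))"
  by (simp add: sum.cartesian_product split_def)

lemma nedelec_eq_sum:
  assumes "u \<in> nedelec k r"
  obtains c where "u = (\<lambda>x. \<Sum>\<beta>\<in>UNIV \<times> UNIV \<times> deg_le (r - 1). c \<beta> *\<^sub>R nedelec_gen \<beta> x)"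
proof -
  have gen: "\<exists>c. u = (\<lambda>x. \<Sum>\<beta>\<in>UNIV \<times> UNIV \<times> deg_le (r - 1). c \<beta> *\<^sub>R nedelec_gen \<beta> x)"
    if pq: "p \<in> vpoly_le (r - 1)" "q \<in> vpoly_le (r - 1)" "u = (\<lambda>x. p x + cross3 x (q x))" for p q
  proof -
    obtain c where c: "p = (\<lambda>x. \<Sum>i\<in>UNIV. \<Sum>\<alpha>\<in>deg_le (r - 1). c i \<alpha> *\<^sub>R (monom3 \<alpha> x *\<^sub>R axis i 1))"
      by (rule vpoly_le_eq_sum[OF pq(1)])
    obtain d where d: "q = (\<lambda>x. \<Sum>i\<in>UNIV. \<Sum>\<alpha>\<in>deg_le (r - 1). d i \<alpha> *\<^sub>R (monom3 \<alpha> x *\<^sub>R axis i 1))"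
      by (rule vpoly_le_eq_sum[OF pq(2)])
    interpret cross: bounded_bilinear cross3 by (rule bounded_bilinear_cross3)
    have "cross3 x (q x) = (\<Sum>i\<in>UNIV. \<Sum>\<alpha>\<in>deg_le (r - 1). d i \<alpha> *\<^sub>R cross3 x (monom3 \<alpha> x *\<^sub>R axis i 1))" for x
      by (simp only: d cross.sum_right cross.scaleR_right)
    then have "u x = (\<Sum>\<beta>\<in>UNIV \<times> UNIV \<times> deg_le (r - 1).
        (case \<beta> of (b, i, \<alpha>) \<Rightarrow> if b then d i \<alpha> else c i \<alpha>) *\<^sub>R nedelec_gen \<beta> x)" for x
      unfolding pq(3) c sum_triple by (simp add: UNIV_bool nedelec_gen_def)
    then show ?thesis by blast
  qed
  show thesis
  proof (cases k)
    case First_Kind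
    then show ?thesis using assms gen that by auto
  next
    case Second_Kind
    have "(\<lambda>x. 0) \<in> vpoly_le (r - 1)" using poly_le_const[of 0] by (simp add: vpoly_le_def)
    then show ?thesis using gen[of u "\<lambda>x. 0"] assms Second_Kind that by auto
  qed
qed

lemma Ck_nedelec: "u \<in> nedelec k r \<Longrightarrow> Ck m u"
  by (elim nedelec_eq_sum) (simp, intro Ck_sum Ck_scaleR Ck_const Ck_nedelec_gen)

lemma linear_subspace_vpoly_le: "linear_subspace (vpoly_le r)"
  using linear_subspaceD[OF linear_subspace_poly_le[of r]]
  by (auto simp: linear_subspace_def vpoly_le_def)

lemma linear_subspace_nedelec: "linear_subspace (nedelec k r)"
proof (cases k)
  case Second_Kind
  then show ?thesis by (simp add: linear_subspace_vpoly_le)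
next
  case First_Kind
  interpret cross: bounded_bilinear cross3 by (rule bounded_bilinear_cross3)
  note v = linear_subspaceD[OF linear_subspace_vpoly_le[of "r - 1"]]
  have I: "u \<in> nedelec k r"
    if "p \<in> vpoly_le (r - 1)" "q \<in> vpoly_le (r - 1)" "u = (\<lambda>x. p x + cross3 x (q x))" for u p q
    using that First_Kind by auto
  show ?thesis
    unfolding linear_subspace_def
  proof (intro conjI ballI allI)
    show "(\<lambda>x. 0) \<in> nedelec k r" by (rule I[OF v(1) v(1)]) simp
    fix u w assume "u \<in> nedelec k r" "w \<in> nedelec k r"
    then obtain p q p' q' where
      *: "p \<in> vpoly_le (r - 1)" "q \<in> vpoly_le (r - 1)" "p' \<in> vpoly_le (r - 1)" "q' \<in> vpoly_le (r - 1)"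
      "u = (\<lambda>x. p x + cross3 x (q x))" "w = (\<lambda>x. p' x + cross3 x (q' x))"
      using First_Kind by auto
    show "(\<lambda>x. u x + w x) \<in> nedelec k r"
      by (rule I[OF v(2)[OF *(1,3)] v(2)[OF *(2,4)]]) (simp add: * cross.add_right add_ac)
  next
    fix a u assume "u \<in> nedelec k r"
    then obtain p q where *: "p \<in> vpoly_le (r - 1)" "q \<in> vpoly_le (r - 1)" "u = (\<lambda>x. p x + cross3 x (q x))"
      using First_Kind by auto
    show "(\<lambda>x. a *\<^sub>R u x) \<in> nedelec k r"
      by (rule I[OF v(3)[OF *(1), of a] v(3)[OF *(2), of a]])
        (simp add: * cross.scaleR_right scaleR_add_right)
  qed
qed

section \<open>Vanishing weak gradients\<close>

lemma norm_l2_of_le: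
  fixes r :: "'a::euclidean_space \<Rightarrow> real"
  assumes S: "S \<in> sets lebesgue" "bounded S" and r: "r \<in> L2 S" "\<And>x. \<bar>r x\<bar> \<le> B"
  shows "norm (l2_of S r) \<le> B * norm (l2_of S (\<lambda>_. 1 :: real))"
proof -
  have B: "B \<ge> 0" using r(2)[of undefined] by linarith
  have oneL: "(\<lambda>_. 1 :: real) \<in> L2 S" by (rule L2_continuous_on_bounded[OF S]) simp
  have "inner (l2_of S r) (l2_of S r) \<le> (LINT x|lebesgue_on S. B\<^sup>2 * (1 \<bullet> (1::real)))"
    unfolding inner_l2_of[OF S(1) r(1) r(1)]
  proof (rule integral_mono)
    show "integrable (lebesgue_on S) (\<lambda>x. r x \<bullet> r x)" by (rule L2_inner_integrable[OF r(1) r(1)])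
    show "integrable (lebesgue_on S) (\<lambda>x. B\<^sup>2 * (1 \<bullet> (1::real)))"
      by (rule integrable_mult_right[OF L2_inner_integrable[OF oneL oneL]])
    fix x
    have "\<bar>r x\<bar>\<^sup>2 \<le> B\<^sup>2" using r(2)[of x] by (intro power_mono) auto
    then show "r x \<bullet> r x \<le> B\<^sup>2 * (1 \<bullet> (1::real))" by (simp add: power2_eq_square)
  qed
  also have "\<dots> = B\<^sup>2 * inner (l2_of S (\<lambda>_. 1 :: real)) (l2_of S (\<lambda>_. 1 :: real))"
    unfolding inner_l2_of[OF S(1) oneL oneL] by simp
  finally have "(norm (l2_of S r))\<^sup>2 \<le> (B * norm (l2_of S (\<lambda>_. 1 :: real)))\<^sup>2"
    by (simp add: power2_norm_eq_inner[symmetric] power_mult_distrib)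
  then show ?thesis by (rule power2_le_imp_le) (use B in simp)
qed

lemma test_function_bounded:
  fixes \<phi> :: "'a::euclidean_space \<Rightarrow> real"
  assumes "\<phi> \<in> test_functions S"
  obtains M where "\<And>x. \<bar>\<phi> x\<bar> \<le> M"
proof -
  obtain C where C: "compact C" "C \<subseteq> S" "\<And>x. x \<notin> C \<Longrightarrow> \<phi> x = 0"
    using test_function_support[OF assms] by blast
  have "compact (\<phi> ` C)"
    using C(1) Ck_continuous[OF test_function_Ck[OF assms, of 0]]
    by (intro compact_continuous_image) (auto intro: continuous_on_subset)
  then obtain M where M: "\<forall>x\<in>C. \<bar>\<phi> x\<bar> \<le> M"
    using compact_imp_bounded[of "\<phi> ` C"] unfolding bounded_iff by auto
  have "\<bar>\<phi> x\<bar> \<le> max M 0" for x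
    using M C(3)[of x] by (cases "x \<in> C") (auto simp: le_max_iff_disj)
  then show thesis by (rule that)
qed

text \<open>Expressed by partial derivatives, so that it is visibly a test function again and can be
  iterated.\<close>

definition dir_deriv :: "real^3 \<Rightarrow> (real^3 \<Rightarrow> real) \<Rightarrow> real^3 \<Rightarrow> real" where
  "dir_deriv h \<eta> x = (\<Sum>k\<in>UNIV. h $ k * partial k \<eta> x)"

lemma dir_deriv_eq:
  assumes "Ck (Suc 0) \<eta>"
  shows "frechet_derivative \<eta> (at x) h = dir_deriv h \<eta> x"
proof -
  interpret bounded_linear "frechet_derivative \<eta> (at x)"
    using Ck_has_derivative[OF assms] by (rule has_derivative_bounded_linear)
  have "frechet_derivative \<eta> (at x) h = frechet_derivative \<eta> (at x) (\<Sum>k\<in>UNIV. (h $ k) *\<^sub>R axis k 1)"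
    by (simp flip: vec_eq_sum_axis)
  also have "\<dots> = dir_deriv h \<eta> x" by (simp add: sum scaleR dir_deriv_def partial_def)
  finally show ?thesis .
qed

lemma test_function_dir_deriv: "\<eta> \<in> test_functions S \<Longrightarrow> dir_deriv h \<eta> \<in> test_functions S"
  unfolding dir_deriv_def[abs_def] real_scaleR_def[symmetric]
  by (intro test_function_sum test_function_scaleR test_function_partial)

text \<open>The pairing of \<open>\<psi>\<close> with the translate of \<open>\<eta>\<close> by
  \<open>t *\<^sub>R h\<close> has zero derivative in \<open>t\<close>, because the derivative of
  the translate is minus the divergence of the translate times \<open>h\<close>. Convexity keeps all
  translates supported in \<open>S\<close> for \<open>t\<close> between 0 and 1.\<close>

lemma weak_grad_zero_translation:
  fixes \<psi> :: "real^3 \<Rightarrow> real"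
  assumes S: "open S" "bounded S" "convex S"
    and \<psi>: "has_weak_adjoint S grad_adjoint \<psi> (\<lambda>x. 0)"
    and \<eta>: "\<eta> \<in> test_functions {x \<in> S. x + h \<in> S}"
  shows "inner (l2_of S \<psi>) (l2_of S (\<lambda>x. \<eta> (x - h))) = inner (l2_of S \<psi>) (l2_of S \<eta>)"
proof -
  have Sm: "S \<in> sets lebesgue" using S by simp
  let ?S' = "{x \<in> S. x + h \<in> S}"
  have shift: "(\<lambda>x. \<theta> (x + - (t *\<^sub>R h))) \<in> test_functions S"
    if "\<theta> \<in> test_functions ?S'" "t \<in> {0..1}" for \<theta> :: "real^3 \<Rightarrow> real" and t
  proof (rule test_function_translate[OF that(1)])
    fix x assume x: "x \<in> ?S'"
    then have "(1 - t) *\<^sub>R x + t *\<^sub>R (x + h) \<in> S"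
      using that(2) by (intro convexD[OF S(3)]) auto
    then show "x - - (t *\<^sub>R h) \<in> S" by (simp add: algebra_simps)
  qed
  let ?D = "dir_deriv h \<eta>" and ?D2 = "dir_deriv h (dir_deriv h \<eta>)"
  have D: "?D \<in> test_functions ?S'" by (rule test_function_dir_deriv[OF \<eta>])
  have D2: "?D2 \<in> test_functions ?S'" by (rule test_function_dir_deriv[OF D])
  obtain M where M: "\<And>x. \<bar>?D2 x\<bar> \<le> M" using test_function_bounded[OF D2] by blast
  have along: "((\<lambda>t. \<theta> (x + - (t *\<^sub>R h))) has_real_derivative - dir_deriv h \<theta> (x + - (t *\<^sub>R h))) (at t)"
    if "\<theta> \<in> test_functions ?S'" for \<theta> x t
  proof -
    have "((\<lambda>t. \<theta> (x + t *\<^sub>R (- h))) has_real_derivative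
        frechet_derivative \<theta> (at (x + t *\<^sub>R (- h))) (- h)) (at t)"
      by (rule directional_derivative[OF Ck_has_derivative[OF test_function_Ck[OF that]]])
    then show ?thesis
      by (simp add: dir_deriv_eq[OF test_function_Ck[OF that]] dir_deriv_def sum_negf)
  qed
  \<comment> \<open>Two applications of the mean value theorem give a quadratic remainder that is
    uniform in \<open>x\<close>. It replaces differentiation under the integral sign.\<close>
  have rem: "\<bar>\<eta> (x + - (t *\<^sub>R h)) - \<eta> (x + - (s *\<^sub>R h)) + (t - s) * ?D (x + - (s *\<^sub>R h))\<bar> \<le> M * (t - s)\<^sup>2"
    if st: "s < t" for x s t
  proof -
    obtain z where z: "s < z" "z < t"
      "\<eta> (x + - (t *\<^sub>R h)) - \<eta> (x + - (s *\<^sub>R h)) = (t - s) * - ?D (x + - (z *\<^sub>R h))"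
      using MVT2[OF st, of "\<lambda>t. \<eta> (x + - (t *\<^sub>R h))", OF along[OF \<eta>]] by blast
    obtain y where y: "s < y" "y < z"
      "?D (x + - (z *\<^sub>R h)) - ?D (x + - (s *\<^sub>R h)) = (z - s) * - ?D2 (x + - (y *\<^sub>R h))"
      using MVT2[OF z(1), of "\<lambda>t. ?D (x + - (t *\<^sub>R h))", OF along[OF D]] by blast
    have "\<eta> (x + - (t *\<^sub>R h)) - \<eta> (x + - (s *\<^sub>R h)) + (t - s) * ?D (x + - (s *\<^sub>R h))
        = - (t - s) * (?D (x + - (z *\<^sub>R h)) - ?D (x + - (s *\<^sub>R h)))"
      unfolding z(3) by (simp add: algebra_simps)
    also have "\<dots> = (t - s) * (z - s) * ?D2 (x + - (y *\<^sub>R h))"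
      unfolding y(3) by (simp only: mult_minus_left mult_minus_right minus_minus mult.assoc)
    finally have "\<bar>\<eta> (x + - (t *\<^sub>R h)) - \<eta> (x + - (s *\<^sub>R h)) + (t - s) * ?D (x + - (s *\<^sub>R h))\<bar>
        = ((t - s) * (z - s)) * \<bar>?D2 (x + - (y *\<^sub>R h))\<bar>"
      using st z by (simp add: abs_mult)
    also have "\<dots> \<le> ((t - s) * (t - s)) * M"
      using st z M by (intro mult_mono mult_left_mono) auto
    finally show ?thesis by (simp add: power2_eq_square mult_ac)
  qed
  define f where "f t = inner (l2_of S \<psi>) (l2_of S (\<lambda>x. \<eta> (x + - (t *\<^sub>R h))))" for t
  \<comment> \<open>The directional derivative is the divergence of the translated
    \<open>\<eta>\<close> times the constant vector \<open>h\<close>; its pairing with a function of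
    zero weak gradient is 0.\<close>
  have flux: "inner (l2_of S \<psi>) (l2_of S (\<lambda>x. ?D (x + - (s *\<^sub>R h)))) = 0" if s: "s \<in> {0..1}" for s
  proof -
    let ?e = "\<lambda>x. \<eta> (x + - (s *\<^sub>R h))"
    have e: "?e \<in> test_functions S" by (rule shift[OF \<eta> s])
    have v: "(\<lambda>x. ?e x *\<^sub>R h) \<in> test_functions S" by (rule test_function_scaleR_const[OF e])
    have De: "(\<lambda>x. ?D (x + - (s *\<^sub>R h))) \<in> test_functions S" by (rule shift[OF D s])
    have "cl_div (\<lambda>x. ?e x *\<^sub>R h) x = ?D (x + - (s *\<^sub>R h))" for x
    proof -
      have "partial k (\<lambda>x. ?e x *\<^sub>R h) x $ k = h $ k * partial k \<eta> (x + - (s *\<^sub>R h))" for k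
      proof -
        have "(?e has_derivative frechet_derivative \<eta> (at (x + - (s *\<^sub>R h)))) (at x)"
          by (rule has_derivative_translate[OF Ck_has_derivative[OF test_function_Ck[OF \<eta>]]])
        then have "((\<lambda>x. ?e x *\<^sub>R h) has_derivative
            (\<lambda>y. frechet_derivative \<eta> (at (x + - (s *\<^sub>R h))) y *\<^sub>R h)) (at x)"
          by (rule has_derivative_scaleR_left)
        from partial_has_derivative[OF this, of k] show ?thesis by (simp add: partial_def)
      qed
      then show ?thesis by (simp add: cl_div_def dir_deriv_def)
    qed
    then have "grad_adjoint (\<lambda>x. ?e x *\<^sub>R h) = (\<lambda>x. - ?D (x + - (s *\<^sub>R h)))" by auto
    then show ?thesis
      using has_weak_adjointD(3)[OF \<psi> v] l2_of_uminus[OF Sm test_function_L2[OF De Sm]] by simp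
  qed
  define K where "K = norm (l2_of S \<psi>) * (M * norm (l2_of S (\<lambda>_. 1 :: real) :: (real^3, real) l2))"
  \<comment> \<open>With the linear term gone only the quadratic remainder is left, and a quadratic
    modulus of continuity forces a zero derivative.\<close>
  have lip: "\<bar>f t - f s\<bar> \<le> K * (t - s)\<^sup>2" if st: "s \<in> {0..1}" "t \<in> {0..1}" "s < t" for s t
  proof -
    let ?a = "\<lambda>x. \<eta> (x + - (t *\<^sub>R h))" and ?b = "\<lambda>x. \<eta> (x + - (s *\<^sub>R h))" and ?c = "\<lambda>x. ?D (x + - (s *\<^sub>R h))"
    have L: "?a \<in> L2 S" "?b \<in> L2 S" "?c \<in> L2 S"
      by (rule test_function_L2[OF shift[OF \<eta> st(2)] Sm] test_function_L2[OF shift[OF \<eta> st(1)] Sm]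
          test_function_L2[OF shift[OF D st(1)] Sm])+
    let ?r = "\<lambda>x. ?a x - ?b x + (t - s) *\<^sub>R ?c x"
    have rL: "?r \<in> L2 S" by (intro L2_add L2_diff L2_scaleR L)
    have rem': "\<bar>?r x\<bar> \<le> M * (t - s)\<^sup>2" for x
      using rem[OF st(3), of x] unfolding real_scaleR_def .
    have "l2_of S ?r = l2_of S ?a - l2_of S ?b + (t - s) *\<^sub>R l2_of S ?c"
      by (simp only: l2_of_add[OF Sm L2_diff[OF L(1,2)] L2_scaleR[OF L(3)]] l2_of_diff[OF Sm L(1,2)]
          l2_of_scaleR[OF Sm L(3)])
    then have eq: "f t - f s = inner (l2_of S \<psi>) (l2_of S ?r)"
      using flux[OF st(1)] by (simp add: f_def inner_add_right inner_diff_right)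
    have "\<bar>f t - f s\<bar> \<le> norm (l2_of S \<psi>) * norm (l2_of S ?r)"
      unfolding eq by (rule Cauchy_Schwarz_ineq2)
    also have "\<dots> \<le> norm (l2_of S \<psi>) * ((M * (t - s)\<^sup>2) * norm (l2_of S (\<lambda>_. 1 :: real) :: (real^3, real) l2))"
    proof (rule mult_left_mono)
      show "norm (l2_of S ?r) \<le> (M * (t - s)\<^sup>2) * norm (l2_of S (\<lambda>_. 1 :: real) :: (real^3, real) l2)"
        by (rule norm_l2_of_le[OF Sm S(2) rL rem'])
    qed simp
    also have "\<dots> = K * (t - s)\<^sup>2" unfolding K_def by (simp only: mult_ac)
    finally show ?thesis .
  qed
  have "(f has_vector_derivative 0) (at t within {0..1})" if t: "t \<in> {0..1}" for t
  proof -
    have b: "\<bar>f s - f t\<bar> \<le> K * (s - t)\<^sup>2" if "s \<in> {0..1}" for s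
    proof (cases s t rule: linorder_cases)
      case less
      then show ?thesis using lip[OF that t] by (simp add: abs_minus_commute power2_commute)
    qed (use lip[OF t that] in auto)
    have "((\<lambda>s. (f s - f t) /\<^sub>R (s - t)) \<longlongrightarrow> 0) (at t within {0..1})"
    proof (rule Lim_null_comparison)
      show "\<forall>\<^sub>F s in at t within {0..1}. norm ((f s - f t) /\<^sub>R (s - t)) \<le> K * \<bar>s - t\<bar>"
        unfolding eventually_at_filter
      proof (rule always_eventually, intro allI impI)
        fix s assume s: "s \<noteq> t" "s \<in> {0..1}"
        have "norm ((f s - f t) /\<^sub>R (s - t)) = \<bar>f s - f t\<bar> / \<bar>s - t\<bar>"
          by (simp add: abs_mult divide_inverse mult.commute)
        also have "\<dots> \<le> K * (s - t)\<^sup>2 / \<bar>s - t\<bar>" using b[OF s(2)] by (rule divide_right_mono) simp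
        also have "\<dots> = K * (\<bar>s - t\<bar> * \<bar>s - t\<bar>) / \<bar>s - t\<bar>" by (simp add: power2_eq_square)
        also have "\<dots> = K * \<bar>s - t\<bar>" using s by (simp del: abs_mult_self_eq)
        finally show "norm ((f s - f t) /\<^sub>R (s - t)) \<le> K * \<bar>s - t\<bar>" .
      qed
      have "((\<lambda>s. K * \<bar>s - t\<bar>) \<longlongrightarrow> K * \<bar>t - t\<bar>) (at t within {0..1})" by (intro tendsto_intros)
      then show "((\<lambda>s. K * \<bar>s - t\<bar>) \<longlongrightarrow> 0) (at t within {0..1})" by simp
    qed
    then show ?thesis by (simp only: has_vector_derivative_iff_quotient)
  qed
  from constant_on_interval[OF _ this, of 1 0] have "f 1 = f 0" by simp
  then show ?thesis by (simp add: f_def)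
qed

lemma integrable_lborel_translate:
  fixes f :: "'a::euclidean_space \<Rightarrow> real"
  assumes "integrable lborel f"
  shows "integrable lborel (\<lambda>x. f (x + c))"
proof -
  have f: "f \<in> borel_measurable borel" using borel_measurable_integrable[OF assms] by simp
  have "integrable (distr lborel borel ((+) c)) f" using assms by (simp only: lborel_distr_plus)
  then have "integrable lborel (\<lambda>x. f (c + x))"
    using integrable_distr_eq[of "(+) c" lborel borel f] f by simp
  then show ?thesis by (simp add: add.commute)
qed

text \<open>For each fixed \<open>h\<close> the translation lemma gives
  \<open>\<Psi> (x + h) = \<Psi> x\<close> for almost all admissible \<open>x\<close>. Exchanging
  the two almost-everywhere quantifiers by Fubini yields a single base point \<open>x0\<close> that
  serves almost all \<open>h\<close>. Convexity is what allows \<open>h\<close> to be large.\<close>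

lemma weak_grad_zero_imp_constant:
  fixes \<psi> :: "real^3 \<Rightarrow> real"
  assumes S: "open S" "bounded S" "convex S"
    and \<psi>: "has_weak_adjoint S grad_adjoint \<psi> (\<lambda>x. 0)"
  obtains c where "AE x in lebesgue_on S. \<psi> x = c"
proof (cases "S = {}")
  case True
  then have "AE x in lebesgue_on S. \<psi> x = 0" by (simp add: AE_restrict_space_iff)
  then show thesis by (rule that)
next
  case False
  have Sm: "S \<in> sets lebesgue" and Sb [measurable]: "S \<in> sets borel" using S by auto
  note \<psi>L = has_weak_adjointD(1)[OF \<psi>]
  let ?e = "\<lambda>x. if x \<in> S then \<psi> x else 0"
  have eL: "?e \<in> L2 UNIV" using \<psi>L Sm by (simp flip: L2_iff_extend)
  then have "?e \<in> borel_measurable (completion lborel)" by (simp add: L2_def lebesgue_on_UNIV_eq)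
  \<comment> \<open>A Borel version provides the joint measurability in \<open>x\<close> and
    \<open>h\<close> that the exchange of quantifiers requires.\<close>
  then obtain \<Psi> where \<Psi>: "\<Psi> \<in> borel_measurable lborel" "AE x in lborel. ?e x = \<Psi> x"
    using completion_ex_borel_measurable_real by blast
  then have \<Psi>_borel [measurable]: "\<Psi> \<in> borel_measurable borel" by simp
  have \<Psi>_ae: "AE x in lebesgue. ?e x = \<Psi> x" using \<Psi>(2) by (rule AE_completion)
  have \<Psi>_int2: "integrable lborel (\<lambda>x. (\<Psi> x)\<^sup>2)"
  proof -
    have "integrable lebesgue (\<lambda>x. (?e x)\<^sup>2)" using eL by (simp add: L2_def lebesgue_on_UNIV_eq)
    then have "integrable lebesgue (\<lambda>x. (\<Psi> x)\<^sup>2)"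
      by (rule integrable_cong_AE_imp)
        (use \<Psi>_ae in \<open>auto intro!: measurable_completion elim: eventually_mono\<close>)
    then show ?thesis using integrable_completion[of "\<lambda>x. (\<Psi> x)\<^sup>2" lborel] by simp
  qed
  have LI: "f \<in> L2 UNIV" if "f \<in> borel_measurable borel" "integrable lborel (\<lambda>x. (f x)\<^sup>2)" for f :: "real^3 \<Rightarrow> real"
    using that integrable_completion[of "\<lambda>x. (f x)\<^sup>2" lborel] unfolding L2_def lebesgue_on_UNIV_eq
    by (auto intro!: measurable_completion)
  have \<Psi>L: "\<Psi> \<in> L2 UNIV" by (rule LI[OF \<Psi>_borel \<Psi>_int2])
  have \<Psi>hL: "(\<lambda>x. \<Psi> (x + h)) \<in> L2 UNIV" for h
    by (rule LI) (use integrable_lborel_translate[OF \<Psi>_int2] in auto)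
  have \<Psi>S: "l2_of S \<psi> = l2_of S \<Psi>"
  proof -
    have "\<Psi> \<in> L2 S" by (rule L2_subset[OF \<Psi>L]) (use Sm in auto)
    moreover have "AE x in lebesgue_on S. \<psi> x = \<Psi> x"
      using \<Psi>_ae Sm by (auto simp: AE_restrict_space_iff elim!: eventually_mono)
    ultimately show ?thesis using l2_of_eq_iff[OF Sm \<psi>L] by blast
  qed
  have transl: "AE x in lborel. x \<in> S \<longrightarrow> x + h \<in> S \<longrightarrow> \<Psi> (x + h) = \<Psi> x" for h
  proof -
    let ?S' = "{x \<in> S. x + h \<in> S}"
    have S': "open ?S'"
    proof -
      have "open ((\<lambda>x. x + h) -` S)" by (intro continuous_open_vimage S) (auto intro!: continuous_intros)
      then have "open (S \<inter> (\<lambda>x. x + h) -` S)" using S(1) by (rule open_Int[rotated])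
      moreover have "?S' = S \<inter> (\<lambda>x. x + h) -` S" by auto
      ultimately show ?thesis by simp
    qed
    then have S'm: "?S' \<in> sets lebesgue" by simp
    have gL: "(\<lambda>x. \<Psi> (x + h) - \<Psi> x) \<in> L2 UNIV" by (rule L2_diff[OF \<Psi>hL \<Psi>L])
    have "AE x in lebesgue_on ?S'. \<Psi> (x + h) - \<Psi> x = 0"
    proof (rule fundamental_lemma_real[OF S'])
      show "(\<lambda>x. \<Psi> (x + h) - \<Psi> x) \<in> L2 ?S'" by (rule L2_subset[OF gL]) (use S'm in auto)
      fix \<eta> :: "real^3 \<Rightarrow> real" assume \<eta>: "\<eta> \<in> test_functions ?S'"
      have \<eta>b [measurable]: "\<eta> \<in> borel_measurable borel"
        using Ck_continuous[OF test_function_Ck[OF \<eta>, of 0]] by (rule borel_measurable_continuous_onI)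
      have \<eta>h: "(\<lambda>x. \<eta> (x + - h)) \<in> test_functions S" by (rule test_function_translate[OF \<eta>]) auto
      have \<eta>S: "\<eta> \<in> test_functions S" using test_functions_mono[OF \<eta>] by auto
      have \<Psi>LS: "\<Psi> \<in> L2 S" by (rule L2_subset[OF \<Psi>L]) (use Sm in auto)
      have \<eta>L: "\<eta> \<in> L2 UNIV" by (rule test_function_L2[OF \<eta>]) simp
      have tolb: "inner (l2_of S \<Psi>) (l2_of S \<theta>) = (LINT x|lborel. \<Psi> x * \<theta> x)"
        if \<theta>: "\<theta> \<in> test_functions S" for \<theta>
      proof -
        have \<theta>b: "\<theta> \<in> borel_measurable borel"
          using Ck_continuous[OF test_function_Ck[OF \<theta>, of 0]] by (rule borel_measurable_continuous_onI)
        have "inner (l2_of S \<Psi>) (l2_of S \<theta>) = (LINT x|lebesgue_on S. \<Psi> x * \<theta> x)"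
          using inner_l2_of[OF Sm \<Psi>LS test_function_L2[OF \<theta> Sm]] by simp
        also have "\<dots> = (LINT x|lebesgue. \<Psi> x * \<theta> x)"
          by (rule integral_lebesgue_on_eq[OF Sm]) (simp add: test_function_eq_0[OF \<theta>])
        also have "\<dots> = (LINT x|lborel. \<Psi> x * \<theta> x)"
          by (rule integral_completion) (use \<theta>b in measurable)
        finally show ?thesis .
      qed
      \<comment> \<open>Translation invariance of Lebesgue measure moves the shift from
        \<open>\<Psi>\<close> to the test function, where the translation lemma applies.\<close>
      have "(LINT x|lborel. \<Psi> (x + h) * \<eta> x) = (LINT x|lborel. \<Psi> x * \<eta> (x + - h))"
        using integral_lborel_translate[of "\<lambda>x. \<Psi> x * \<eta> (x + - h)" h] by simp
      also have "\<dots> = inner (l2_of S \<psi>) (l2_of S (\<lambda>x. \<eta> (x - h)))"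
        using tolb[OF \<eta>h] by (simp add: \<Psi>S)
      also have "\<dots> = (LINT x|lborel. \<Psi> x * \<eta> x)"
        unfolding weak_grad_zero_translation[OF S \<psi> \<eta>] using tolb[OF \<eta>S] by (simp add: \<Psi>S)
      finally have eq: "(LINT x|lborel. \<Psi> (x + h) * \<eta> x) = (LINT x|lborel. \<Psi> x * \<eta> x)" .
      have i: "integrable lebesgue (\<lambda>x. \<Psi> (x + h) * \<eta> x)" "integrable lebesgue (\<lambda>x. \<Psi> x * \<eta> x)"
        using L2_mult_integrable[OF \<Psi>hL \<eta>L] L2_mult_integrable[OF \<Psi>L \<eta>L] by (simp_all add: lebesgue_on_UNIV_eq)
      have "(LINT x|lebesgue_on ?S'. (\<Psi> (x + h) - \<Psi> x) * \<eta> x) = (LINT x|lebesgue. (\<Psi> (x + h) - \<Psi> x) * \<eta> x)"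
        by (rule integral_lebesgue_on_eq[OF S'm]) (simp add: test_function_eq_0[OF \<eta>])
      also have "\<dots> = (LINT x|lebesgue. \<Psi> (x + h) * \<eta> x) - (LINT x|lebesgue. \<Psi> x * \<eta> x)"
        unfolding left_diff_distrib by (rule Bochner_Integration.integral_diff[OF i])
      also have "\<dots> = 0"
        using eq integral_completion[of "\<lambda>x. \<Psi> (x + h) * \<eta> x" lborel] integral_completion[of "\<lambda>x. \<Psi> x * \<eta> x" lborel]
        by simp
      finally show "(LINT x|lebesgue_on ?S'. (\<Psi> (x + h) - \<Psi> x) * \<eta> x) = 0" .
    qed
    then have "AE x in lebesgue. x \<in> S \<longrightarrow> x + h \<in> S \<longrightarrow> \<Psi> (x + h) = \<Psi> x"
      using S'm by (auto simp: AE_restrict_space_iff elim!: eventually_mono)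
    then show ?thesis by (simp add: AE_completion_iff)
  qed
  have comm: "(AE x in lborel. AE h in lborel. x \<in> S \<longrightarrow> x + h \<in> S \<longrightarrow> \<Psi> (x + h) = \<Psi> x) \<longleftrightarrow>
      (AE h in lborel. AE x in lborel. x \<in> S \<longrightarrow> x + h \<in> S \<longrightarrow> \<Psi> (x + h) = \<Psi> x)"
    by (rule lborel_pair.AE_commute) measurable
  have "AE x in lborel. AE h in lborel. x \<in> S \<longrightarrow> x + h \<in> S \<longrightarrow> \<Psi> (x + h) = \<Psi> x"
    unfolding comm using transl by simp
  then have ae: "AE x in lebesgue. AE h in lborel. x \<in> S \<longrightarrow> x + h \<in> S \<longrightarrow> \<Psi> (x + h) = \<Psi> x"
    by (rule AE_completion)
  \<comment> \<open>A nonempty open set is not negligible, so it contains a point outside the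
    exceptional null set.\<close>
  have "\<exists>x0\<in>S. AE h in lborel. x0 \<in> S \<longrightarrow> x0 + h \<in> S \<longrightarrow> \<Psi> (x0 + h) = \<Psi> x0"
  proof (rule ccontr)
    assume "\<not> ?thesis"
    then have "AE x in lebesgue. x \<notin> S" using ae by (auto elim!: eventually_mono)
    then have "negligible S" using Sm by (simp add: negligible_iff_null_sets AE_iff_null_sets)
    then show False using open_not_negligible[OF S(1) False] by blast
  qed
  then obtain x0 where x0: "x0 \<in> S" "AE h in lborel. x0 + h \<in> S \<longrightarrow> \<Psi> (x0 + h) = \<Psi> x0" by auto
  have "AE y in distr lborel borel ((+) x0). y \<in> S \<longrightarrow> \<Psi> y = \<Psi> x0"
    by (subst AE_distr_iff) (use x0(2) in auto)
  then have "AE y in lborel. y \<in> S \<longrightarrow> \<Psi> y = \<Psi> x0" by (simp only: lborel_distr_plus)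
  then have "AE y in lebesgue. y \<in> S \<longrightarrow> \<Psi> y = \<Psi> x0" by (rule AE_completion)
  then have "AE y in lebesgue. y \<in> S \<longrightarrow> \<psi> y = \<Psi> x0"
    using \<Psi>_ae by eventually_elim auto
  then have "AE y in lebesgue_on S. \<psi> y = \<Psi> x0" using Sm by (simp add: AE_restrict_space_iff)
  then show thesis by (rule that)
qed

section \<open>Meshes\<close>

text \<open>The mesh covers the closure, so interiors of elements are a priori contained only in
  \<open>interior (closure \<Omega>)\<close>. The Lipschitz condition excludes slits, where this set
  is larger than \<open>\<Omega>\<close>: near a boundary point the domain lies on one side of a
  graph, and points strictly on the other side are not in the closure.\<close>

lemma lipschitz_domain_interior_closure:
  assumes "lipschitz_domain \<Omega>"
  shows "interior (closure \<Omega>) \<subseteq> \<Omega>"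
proof (rule ccontr)
  assume "\<not> ?thesis"
  then obtain p where p: "p \<in> interior (closure \<Omega>)" "p \<notin> \<Omega>" by blast
  have \<Omega>: "open \<Omega>" using assms by (simp add: lipschitz_domain_def)
  have "p \<in> frontier \<Omega>"
    using p interior_subset[of "closure \<Omega>"] interior_subset[of \<Omega>] by (auto simp: frontier_def)
  then obtain \<nu> g L U where g: "norm \<nu> = 1" "lipschitz_on L UNIV (g :: real^3 \<Rightarrow> real)"
      "open U" "p \<in> U" "\<Omega> \<inter> U = {x \<in> U. g (x - (x \<bullet> \<nu>) *\<^sub>R \<nu>) < x \<bullet> \<nu>}"
    using assms unfolding lipschitz_domain_def by blast
  have gc: "continuous_on UNIV g" by (rule lipschitz_on_continuous_on[OF g(2)])
  have pU: "g (p - (p \<bullet> \<nu>) *\<^sub>R \<nu>) \<ge> p \<bullet> \<nu>"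
    using p(2) g(4,5) by (metis (mono_tags, lifting) IntI Int_iff mem_Collect_eq not_le)
  have "open (interior (closure \<Omega>) \<inter> U)" using g(3) by (intro open_Int) auto
  then obtain e where e: "e > 0" "ball p e \<subseteq> interior (closure \<Omega>) \<inter> U"
    using p(1) g(4) by (metis IntI open_contains_ball)
  \<comment> \<open>Stepping from \<open>p\<close> against \<open>\<nu>\<close> leads strictly below
    the graph, since moving along \<open>\<nu>\<close> does not change the argument of
    \<open>g\<close>.\<close>
  define y where "y = p - (e / 2) *\<^sub>R \<nu>"
  have "dist p y = e / 2" using e(1) g(1) by (simp add: y_def dist_norm)
  then have "y \<in> ball p e" using e(1) by simp
  then have y: "y \<in> closure \<Omega>" "y \<in> U" using e(2) interior_subset[of "closure \<Omega>"] by auto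
  have \<nu>\<nu>: "\<nu> \<bullet> \<nu> = 1" using g(1) by (simp add: norm_eq_1)
  have y\<nu>: "y \<bullet> \<nu> = p \<bullet> \<nu> - e / 2" by (simp add: y_def inner_diff_left \<nu>\<nu>)
  have "y - (y \<bullet> \<nu>) *\<^sub>R \<nu> = p - (p \<bullet> \<nu>) *\<^sub>R \<nu>"
    unfolding y\<nu> by (simp add: y_def scaleR_left_diff_distrib)
  then have lt: "y \<bullet> \<nu> < g (y - (y \<bullet> \<nu>) *\<^sub>R \<nu>)" using pU y\<nu> e(1) by simp
  define V where "V = U \<inter> {z. z \<bullet> \<nu> < g (z - (z \<bullet> \<nu>) *\<^sub>R \<nu>)}"
  have "open {z. z \<bullet> \<nu> < g (z - (z \<bullet> \<nu>) *\<^sub>R \<nu>)}"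
    by (intro open_Collect_less continuous_intros continuous_on_compose2[OF gc]) auto
  then have V: "open V" unfolding V_def by (intro open_Int g(3))
  have "y \<in> V" using y lt by (simp add: V_def)
  moreover have "x \<notin> V" if "x \<in> \<Omega>" for x
  proof
    assume x: "x \<in> V"
    then have "x \<in> {x \<in> U. g (x - (x \<bullet> \<nu>) *\<^sub>R \<nu>) < x \<bullet> \<nu>}"
      using that unfolding g(5)[symmetric] by (simp add: V_def)
    then show False using x by (simp add: V_def)
  qed
  then have "V \<inter> \<Omega> = {}" by blast
  ultimately show False using open_Int_closure_eq_empty[OF V] y(1) by blast
qed

lemma l2_of_cong:
  fixes f g :: "'a::euclidean_space \<Rightarrow> 'b::euclidean_space"
  assumes "S \<in> sets lebesgue" "g \<in> L2 S" "\<And>x. x \<in> S \<Longrightarrow> f x = g x"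
  shows "f \<in> L2 S" "l2_of S f = l2_of S g"
proof -
  have eq: "(\<lambda>x. if x \<in> S then f x else 0) = (\<lambda>x. if x \<in> S then g x else 0)" using assms(3) by auto
  then show fL: "f \<in> L2 S" using assms(1,2) L2_iff_extend[of S f] L2_iff_extend[of S g] by simp
  show "l2_of S f = l2_of S g"
    using l2_of_UNIV_extend[OF assms(1) fL] l2_of_UNIV_extend[OF assms(1,2)] eq by simp
qed

text \<open>By completeness of Lebesgue measure every function on a null set is measurable. This
  disposes of the faces of the mesh, where broken fields have arbitrary values.\<close>

lemma L2_negligible:
  fixes f :: "'a::euclidean_space \<Rightarrow> 'b::euclidean_space"
  assumes "negligible Z"
  shows "f \<in> L2 Z" "l2_of Z f = 0"
proof -
  have Z: "Z \<in> sets lebesgue" using assms by (rule negligible_imp_sets)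
  have meas: "f \<in> borel_measurable (lebesgue_on Z)"
  proof (rule measurableI)
    fix A :: "'b set"
    have "negligible (f -` A \<inter> Z)" using negligible_subset[OF assms] by blast
    then have "f -` A \<inter> Z \<in> sets lebesgue" by (rule negligible_imp_sets)
    then show "f -` A \<inter> space (lebesgue_on Z) \<in> sets (lebesgue_on Z)"
      using Z by (simp add: sets_restrict_space_iff)
  qed simp
  have ae: "AE x in lebesgue_on Z. P x" for P
    using assms Z by (subst AE_restrict_space_iff)
      (auto simp: negligible_iff_null_sets intro: AE_not_in[THEN eventually_mono])
  have "integrable (lebesgue_on Z) (\<lambda>x. (norm (f x))\<^sup>2)"
    by (rule integrable_cong_AE_imp[of _ "\<lambda>_. 0"]) (use meas ae in auto)
  with meas show fL: "f \<in> L2 Z" by (simp add: L2_def)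
  show "l2_of Z f = 0" using l2_of_eq_iff[OF Z fL L2_zero] ae by simp
qed


section \<open>Decomposition into elements\<close>

locale mesh_domain =
  fixes \<Omega> :: "(real^3) set" and \<T> :: "(real^3) set set"
  assumes lip: "lipschitz_domain \<Omega>" and bdd: "bounded \<Omega>" and mesh: "tetrahedral_mesh \<Omega> \<T>"
begin

lemma open_domain: "open \<Omega>"
  using lip by (simp add: lipschitz_domain_def)

lemma domain_measurable: "\<Omega> \<in> sets lebesgue"
  using open_domain by simp

lemma mesh_finite: "finite \<T>"
  using mesh by (simp add: tetrahedral_mesh_def triangulation_def)

lemma mesh_element:
  assumes "K \<in> \<T>"
  shows "convex (interior K)" "bounded (interior K)" "interior K \<subseteq> \<Omega>" "negligible (frontier K)"
    "interior K \<in> sets lebesgue" "closed K"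
proof -
  have s: "3 simplex K" using assms mesh by (simp add: tetrahedral_mesh_def)
  show "convex (interior K)" using convex_simplex[OF s] by (rule convex_interior)
  show "bounded (interior K)"
    using compact_imp_bounded[OF compact_simplex[OF s]] interior_subset bounded_subset by blast
  show "negligible (frontier K)" using convex_simplex[OF s] by (rule negligible_convex_frontier)
  show "closed K" using compact_simplex[OF s] by (rule compact_imp_closed)
  have "K \<subseteq> closure \<Omega>" using assms mesh by (auto simp: tetrahedral_mesh_def)
  then show "interior K \<subseteq> \<Omega>"
    using lipschitz_domain_interior_closure[OF lip] interior_mono by blast
  show "interior K \<in> sets lebesgue" by simp
qed

text \<open>Elements of a triangulation meet in a common face, and a face that meets the interior is
  the whole simplex.\<close>

lemma mesh_disjoint:
  assumes K: "K \<in> \<T>" "K' \<in> \<T>" and x: "x \<in> interior K" "x \<in> interior K'"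
  shows "K = K'"
proof -
  have "(K \<inter> K') face_of K" "(K' \<inter> K) face_of K'"
    using K mesh unfolding tetrahedral_mesh_def triangulation_def by blast+
  moreover have "x \<in> K" "x \<in> K'" using x interior_subset by blast+
  ultimately have "K \<inter> K' = K" "K' \<inter> K = K'"
    using face_of_disjoint_interior[of "K \<inter> K'" K] face_of_disjoint_interior[of "K' \<inter> K" K'] x by blast+
  then show ?thesis by blast
qed

lemma mesh_cover: "negligible (\<Omega> - (\<Union>K\<in>\<T>. interior K))"
proof -
  have "\<Omega> - (\<Union>K\<in>\<T>. interior K) \<subseteq> (\<Union>K\<in>\<T>. frontier K)"
  proof
    fix x assume x: "x \<in> \<Omega> - (\<Union>K\<in>\<T>. interior K)"
    then have "x \<in> \<Union>\<T>" using mesh closure_subset[of \<Omega>] by (auto simp: tetrahedral_mesh_def)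
    then obtain K where "K \<in> \<T>" "x \<in> K" by blast
    then show "x \<in> (\<Union>K\<in>\<T>. frontier K)" using x closure_subset[of K] by (auto simp: frontier_def)
  qed
  moreover have "negligible (\<Union>K\<in>\<T>. frontier K)"
    using mesh_finite mesh_element(4) by (intro negligible_Union) auto
  ultimately show ?thesis using negligible_subset by blast
qed

lemma sum_over_elements:
  fixes f :: "(real^3) set \<Rightarrow> 'b::comm_monoid_add"
  assumes "K \<in> \<T>" "x \<in> interior K"
  shows "(\<Sum>K'\<in>\<T>. if x \<in> interior K' then f K' else 0) = f K"
proof -
  have "(\<Sum>K'\<in>\<T>. if x \<in> interior K' then f K' else 0) = (\<Sum>K'\<in>\<T>. if K' = K then f K' else 0)"
    using mesh_disjoint assms by (intro sum.cong) auto
  also have "\<dots> = f K" using mesh_finite assms(1) by simp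
  finally show ?thesis .
qed

lemma mesh_extend:
  fixes f :: "real^3 \<Rightarrow> 'b::euclidean_space"
  shows "(\<lambda>x. if x \<in> \<Omega> then f x else 0) = (\<lambda>x. (\<Sum>K\<in>\<T>. if x \<in> interior K then f x else 0) +
    (if x \<in> \<Omega> - (\<Union>K\<in>\<T>. interior K) then f x else 0))"
proof
  fix x
  show "(if x \<in> \<Omega> then f x else 0) = (\<Sum>K\<in>\<T>. if x \<in> interior K then f x else 0) +
    (if x \<in> \<Omega> - (\<Union>K\<in>\<T>. interior K) then f x else 0)"
  proof (cases "x \<in> (\<Union>K\<in>\<T>. interior K)")
    case True
    then obtain K where K: "K \<in> \<T>" "x \<in> interior K" by blast
    then have "x \<in> \<Omega>" using mesh_element(3) by blast
    then show ?thesis using True sum_over_elements[OF K, of "\<lambda>_. f x"] by simp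
  next
    case False
    then have "(\<Sum>K\<in>\<T>. if x \<in> interior K then f x else 0) = 0" by (intro sum.neutral) auto
    then show ?thesis using False by simp
  qed
qed

lemma mesh_L2:
  fixes f :: "real^3 \<Rightarrow> 'b::euclidean_space"
  assumes "\<And>K. K \<in> \<T> \<Longrightarrow> f \<in> L2 (interior K)"
  shows "f \<in> L2 \<Omega>" "l2_of \<Omega> f = (\<Sum>K\<in>\<T>. l2_of (interior K) f)"
proof -
  let ?Z = "\<Omega> - (\<Union>K\<in>\<T>. interior K)"
  have Z: "?Z \<in> sets lebesgue" using mesh_cover by (rule negligible_imp_sets)
  have e: "(\<lambda>x. if x \<in> interior K then f x else 0) \<in> L2 UNIV" if "K \<in> \<T>" for K
    using assms[OF that] mesh_element(5)[OF that] L2_iff_extend by blast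
  have z: "(\<lambda>x. if x \<in> ?Z then f x else 0) \<in> L2 UNIV"
    using L2_negligible(1)[OF mesh_cover, of f] L2_iff_extend[OF Z, of f] by blast
  have s: "(\<lambda>x. \<Sum>K\<in>\<T>. if x \<in> interior K then f x else 0) \<in> L2 UNIV" using e by (rule L2_sum)
  have "(\<lambda>x. if x \<in> \<Omega> then f x else 0) \<in> L2 UNIV"
    unfolding mesh_extend by (rule L2_add[OF s z])
  then show fL: "f \<in> L2 \<Omega>" using L2_iff_extend[OF domain_measurable, of f] by blast
  have "l2_of \<Omega> f = l2_of UNIV (\<lambda>x. \<Sum>K\<in>\<T>. if x \<in> interior K then f x else 0) +
      l2_of UNIV (\<lambda>x. if x \<in> ?Z then f x else 0)"
    unfolding l2_of_UNIV_extend[OF domain_measurable fL, symmetric] mesh_extend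
    by (rule l2_of_add[OF _ s z]) simp
  also have "l2_of UNIV (\<lambda>x. if x \<in> ?Z then f x else 0) = 0"
    unfolding l2_of_UNIV_extend[OF Z L2_negligible(1)[OF mesh_cover]] by (rule L2_negligible(2)[OF mesh_cover])
  also have "l2_of UNIV (\<lambda>x. \<Sum>K\<in>\<T>. if x \<in> interior K then f x else 0) =
      (\<Sum>K\<in>\<T>. l2_of UNIV (\<lambda>x. if x \<in> interior K then f x else 0))"
    using e by (intro l2_of_sum) auto
  also have "\<dots> = (\<Sum>K\<in>\<T>. l2_of (interior K) f)"
    using assms mesh_element(5) by (intro sum.cong refl l2_of_UNIV_extend)
  finally show "l2_of \<Omega> f = (\<Sum>K\<in>\<T>. l2_of (interior K) f)" by simp
qed

lemma L2_element: "f \<in> L2 \<Omega> \<Longrightarrow> K \<in> \<T> \<Longrightarrow> f \<in> L2 (interior K)"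
  for f :: "real^3 \<Rightarrow> 'b::euclidean_space"
  by (rule L2_subset[OF _ domain_measurable mesh_element(5) mesh_element(3)])

lemma inner_l2_of_mesh:
  fixes f g :: "real^3 \<Rightarrow> 'b::euclidean_space"
  assumes f: "f \<in> L2 \<Omega>" and g: "g \<in> L2 \<Omega>"
  shows "inner (l2_of \<Omega> f) (l2_of \<Omega> g) = (\<Sum>K\<in>\<T>. inner (l2_of (interior K) f) (l2_of (interior K) g))"
proof -
  have "inner (l2_of \<Omega> f) (l2_of \<Omega> g) = (\<Sum>K\<in>\<T>. inner (l2_of \<Omega> f) (l2_of (interior K) g))"
    using mesh_L2(2)[of g] L2_element[OF g] by (simp add: inner_sum_right)
  also have "\<dots> = (\<Sum>K\<in>\<T>. inner (l2_of (interior K) f) (l2_of (interior K) g))"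
    by (intro sum.cong refl inner_l2_of_Int[OF domain_measurable mesh_element(5) mesh_element(3) f L2_element[OF g]])
  finally show ?thesis .
qed

lemma broken_curl_element:
  assumes u: "\<And>K. K \<in> \<T> \<Longrightarrow> u \<in> Hcurl (interior K)" and K: "K \<in> \<T>"
  shows "broken_curl \<T> u \<in> L2 (interior K)"
    "l2_of (interior K) (broken_curl \<T> u) = l2_of (interior K) (weak_curl (interior K) u)"
proof -
  have "weak_curl (interior K) u \<in> L2 (interior K)"
    by (rule has_weak_adjointD(2)[OF weak_curl_works[OF open_interior u[OF K]]])
  moreover have "broken_curl \<T> u x = weak_curl (interior K) u x" if "x \<in> interior K" for x
  proof -
    have "broken_curl \<T> u x = (\<Sum>K'\<in>\<T>. if x \<in> interior K' then weak_curl (interior K') u x else 0)"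
      unfolding broken_curl_def by (intro sum.cong) auto
    then show ?thesis using sum_over_elements[OF K that] by simp
  qed
  ultimately show "broken_curl \<T> u \<in> L2 (interior K)"
    "l2_of (interior K) (broken_curl \<T> u) = l2_of (interior K) (weak_curl (interior K) u)"
    using l2_of_cong[OF mesh_element(5)[OF K]] by blast+
qed

end

section \<open>The hybrid method\<close>

lemma restrict_l2_Int:
  assumes S: "S \<in> sets lebesgue" "S' \<in> sets lebesgue" "S' \<subseteq> S" and f: "f \<in> L2 S"
  shows "restrict_l2 S' (l2_of S f) = l2_of S' f"
proof -
  let ?f = "\<lambda>x. if x \<in> S then f x else 0"
  have f': "?f \<in> L2 UNIV" using f S by (simp flip: L2_iff_extend)
  have "restrict_l2 S' (l2_of S f) = l2_of S' ?f"
    using restrict_l2_l2_of[OF S(2) f'] l2_of_UNIV_extend[OF S(1) f] by simp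
  also have "\<dots> = l2_of S' f"
    by (rule l2_of_cong(2)[OF S(2) L2_subset[OF f S]]) (use S(3) in auto)
  finally show ?thesis .
qed

lemma Hcurl_cong:
  assumes S: "open S" and v: "v \<in> Hcurl S" and eq: "\<And>x. x \<in> S \<Longrightarrow> u x = v x"
  shows "u \<in> Hcurl S" "l2_of S u = l2_of S v" "l2_of S (weak_curl S u) = l2_of S (weak_curl S v)"
proof -
  have Sm: "S \<in> sets lebesgue" using S by simp
  note w = weak_curl_works[OF S v]
  note uv = l2_of_cong[OF Sm has_weak_adjointD(1)[OF w] eq]
  have u: "has_weak_adjoint S cl_curl u (weak_curl S v)"
    by (rule weak_adjoint_cong[OF S w uv(2) refl uv(1) has_weak_adjointD(2)[OF w]])
  show "u \<in> Hcurl S" by (rule HcurlI[OF S u])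
  show "l2_of S u = l2_of S v" by (rule uv(2))
  show "l2_of S (weak_curl S u) = l2_of S (weak_curl S v)" by (rule weak_curl_eq[OF S u])
qed

context mesh_domain
begin

definition elem_graph :: "(real^3) set \<Rightarrow> (real^3 \<Rightarrow> real^3) \<Rightarrow> (real^3, real^3) l2 \<times> (real^3, real^3) l2" where
  "elem_graph K u = (l2_of (interior K) u, l2_of (interior K) (weak_curl (interior K) u))"

text \<open>The element parts have disjoint supports, so for a broken field this sum is the pair of
  the field and its elementwise curl, and its norm is the broken H(curl) norm.\<close>

definition graph :: "(real^3 \<Rightarrow> real^3) \<Rightarrow> (real^3, real^3) l2 \<times> (real^3, real^3) l2" where
  "graph u = (\<Sum>K\<in>\<T>. elem_graph K u)"

definition broken_Hcurl :: "(real^3 \<Rightarrow> real^3) set" where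
  "broken_Hcurl = {u. \<forall>K\<in>\<T>. u \<in> Hcurl (interior K)}"

text \<open>The sum over the elements of the boundary terms \<open>(u \<times> v) \<cdot> n\<close> is the inner product
  of \<open>graph u\<close> and \<open>trace_vec v\<close>.\<close>

definition trace_vec :: "(real^3 \<Rightarrow> real^3) \<Rightarrow> (real^3, real^3) l2 \<times> (real^3, real^3) l2" where
  "trace_vec v = (- l2_of \<Omega> (weak_curl \<Omega> v), l2_of \<Omega> v)"

lemma broken_HcurlD: "u \<in> broken_Hcurl \<Longrightarrow> K \<in> \<T> \<Longrightarrow> u \<in> Hcurl (interior K)"
  by (simp add: broken_Hcurl_def)

lemma graph_eq:
  assumes u: "u \<in> broken_Hcurl"
  shows "u \<in> L2 \<Omega>" "broken_curl \<T> u \<in> L2 \<Omega>" "graph u = (l2_of \<Omega> u, l2_of \<Omega> (broken_curl \<T> u))"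
proof -
  have uL: "u \<in> L2 (interior K)" if "K \<in> \<T>" for K
    by (rule has_weak_adjointD(1)[OF weak_curl_works[OF open_interior broken_HcurlD[OF u that]]])
  note c = broken_curl_element[OF broken_HcurlD[OF u]]
  show "u \<in> L2 \<Omega>" by (rule mesh_L2(1)[OF uL])
  show "broken_curl \<T> u \<in> L2 \<Omega>" by (rule mesh_L2(1)[OF c(1)])
  have "fst (graph u) = l2_of \<Omega> u"
    unfolding graph_def elem_graph_def fst_sum using mesh_L2(2)[OF uL] by simp
  moreover have "snd (graph u) = l2_of \<Omega> (broken_curl \<T> u)"
    unfolding graph_def elem_graph_def snd_sum using mesh_L2(2)[OF c(1)] c(2) by simp
  ultimately show "graph u = (l2_of \<Omega> u, l2_of \<Omega> (broken_curl \<T> u))" by (simp add: prod_eq_iff)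
qed

lemma elem_embedding: "seminorm_embedding (Hcurl_norm (interior K)) (Hcurl (interior K)) (elem_graph K)"
  unfolding elem_graph_def[abs_def] by (rule Hcurl_embedding[OF open_interior])

lemma linear_subspace_Hcurl: "open S \<Longrightarrow> linear_subspace (Hcurl S)"
  by (rule embedding_subspace[OF Hcurl_embedding])

lemma graph_embedding:
  assumes X: "linear_subspace X" "X \<subseteq> broken_Hcurl"
  shows "seminorm_embedding (broken_Hcurl_norm \<T>) X graph"
  unfolding seminorm_embedding_def
proof (intro conjI ballI allI)
  show "linear_subspace X" by (rule X(1))
  fix u v assume "u \<in> X" "v \<in> X"
  then have u: "u \<in> broken_Hcurl" and v: "v \<in> broken_Hcurl" using X(2) by auto
  show "graph (\<lambda>x. u x + v x) = graph u + graph v"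
    unfolding graph_def sum.distrib[symmetric]
    by (intro sum.cong refl embedding_add[OF elem_embedding] broken_HcurlD[OF u] broken_HcurlD[OF v])
next
  fix c u assume "u \<in> X"
  then have u: "u \<in> broken_Hcurl" using X(2) by auto
  show "graph (\<lambda>x. c *\<^sub>R u x) = c *\<^sub>R graph u"
    unfolding graph_def scaleR_sum_right
    by (intro sum.cong refl embedding_scaleR[OF elem_embedding] broken_HcurlD[OF u])
next
  fix u assume "u \<in> X"
  then have u: "u \<in> broken_Hcurl" using X(2) by auto
  note c = broken_curl_element[OF broken_HcurlD[OF u]]
  have "(norm (graph u))\<^sup>2 = inner (l2_of \<Omega> u) (l2_of \<Omega> u) +
      inner (l2_of \<Omega> (broken_curl \<T> u)) (l2_of \<Omega> (broken_curl \<T> u))"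
    unfolding graph_eq(3)[OF u] power2_norm_eq_inner by simp
  also have "\<dots> = (\<Sum>K\<in>\<T>. inner (elem_graph K u) (elem_graph K u))"
    unfolding inner_l2_of_mesh[OF graph_eq(1)[OF u] graph_eq(1)[OF u]]
      inner_l2_of_mesh[OF graph_eq(2)[OF u] graph_eq(2)[OF u]]
    by (simp add: c(2) elem_graph_def sum.distrib)
  also have "\<dots> = (\<Sum>K\<in>\<T>. (Hcurl_norm (interior K) u)\<^sup>2)"
    by (intro sum.cong refl)
      (simp add: embedding_norm[OF elem_embedding broken_HcurlD[OF u]] power2_norm_eq_inner)
  finally show "broken_Hcurl_norm \<T> u = norm (graph u)"
    unfolding broken_Hcurl_norm_def by (metis norm_ge_zero real_sqrt_abs abs_of_nonneg)
qed

lemma Hcurl_element: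
  assumes "v \<in> Hcurl \<Omega>" "K \<in> \<T>"
  shows "v \<in> Hcurl (interior K)"
    "l2_of (interior K) (weak_curl (interior K) v) = l2_of (interior K) (weak_curl \<Omega> v)"
proof -
  have w: "has_weak_adjoint (interior K) cl_curl v (weak_curl \<Omega> v)"
    by (rule weak_adjoint_restrict[OF open_domain weak_curl_works[OF open_domain assms(1)] open_interior
          mesh_element(3)[OF assms(2)] test_function_cl_curl])
  show "v \<in> Hcurl (interior K)" by (rule HcurlI[OF open_interior w])
  show "l2_of (interior K) (weak_curl (interior K) v) = l2_of (interior K) (weak_curl \<Omega> v)"
    by (rule weak_curl_eq[OF open_interior w])
qed

lemma inner_elem_l2:
  fixes f g :: "real^3 \<Rightarrow> 'b::euclidean_space"
  assumes "K \<in> \<T>" "f \<in> L2 (interior K)" "g \<in> L2 \<Omega>"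
  shows "inner (l2_of (interior K) f) (l2_of \<Omega> g) = inner (l2_of (interior K) f) (l2_of (interior K) g)"
  using inner_l2_of_Int[OF domain_measurable mesh_element(5) mesh_element(3) assms(3,2), OF assms(1,1)]
  by (simp add: inner_commute)

text \<open>Since \<open>v\<close> has a curl on the whole domain, its curl on an element is the
  restriction of that curl; the boundary pairings of all elements therefore use the same vector
  \<open>trace_vec v\<close>.\<close>

lemma bdry_cross_element:
  assumes K: "K \<in> \<T>" and u: "u \<in> Hcurl (interior K)" and v: "v \<in> Hcurl \<Omega>"
  shows "bdry_cross (interior K) u v = inner (elem_graph K u) (trace_vec v)"
proof -
  note vw = has_weak_adjointD(1,2)[OF weak_curl_works[OF open_domain v]]
  note uw = has_weak_adjointD(1,2)[OF weak_curl_works[OF open_interior u]]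
  show ?thesis
    unfolding bdry_cross_eq[OF open_interior u Hcurl_element(1)[OF v K]] Hcurl_element(2)[OF v K]
      elem_graph_def trace_vec_def
    by (simp add: inner_elem_l2[OF K uw(1) vw(2)] inner_elem_l2[OF K uw(2) vw(1)])
qed

lemma sum_bdry_cross:
  assumes u: "u \<in> broken_Hcurl" and v: "v \<in> Hcurl \<Omega>"
  shows "(\<Sum>K\<in>\<T>. bdry_cross (interior K) u v) = inner (graph u) (trace_vec v)"
  unfolding graph_def inner_sum_left
  by (intro sum.cong refl bdry_cross_element broken_HcurlD[OF u] v)

lemma Hcurl_0_iff:
  assumes u: "u \<in> broken_Hcurl"
  shows "u \<in> Hcurl_0 \<Omega> \<longleftrightarrow> (\<forall>v\<in>Hcurl \<Omega>. inner (graph u) (trace_vec v) = 0)"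
proof
  assume u0: "u \<in> Hcurl_0 \<Omega>"
  then have uH: "u \<in> Hcurl \<Omega>" by (simp add: Hcurl_0_def)
  show "\<forall>v\<in>Hcurl \<Omega>. inner (graph u) (trace_vec v) = 0"
  proof
    fix v assume v: "v \<in> Hcurl \<Omega>"
    note uw = has_weak_adjointD(1,2)[OF weak_curl_works[OF open_domain uH]]
    have "snd (graph u) = l2_of \<Omega> (weak_curl \<Omega> u)"
      unfolding graph_def elem_graph_def snd_sum
      using mesh_L2(2)[OF L2_element[OF uw(2)]] Hcurl_element(2)[OF uH] by simp
    then have "graph u = (l2_of \<Omega> u, l2_of \<Omega> (weak_curl \<Omega> u))"
      using graph_eq(3)[OF u] by (simp add: prod_eq_iff)
    then have "inner (graph u) (trace_vec v) = bdry_cross \<Omega> u v"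
      by (simp add: trace_vec_def bdry_cross_eq[OF open_domain uH v])
    then show "inner (graph u) (trace_vec v) = 0" using u0 v by (simp add: Hcurl_0_def)
  qed
next
  assume *: "\<forall>v\<in>Hcurl \<Omega>. inner (graph u) (trace_vec v) = 0"
  \<comment> \<open>Test functions are admissible \<open>v\<close>. Orthogonality to their traces is
    the weak formulation saying that the elementwise curl is the curl on \<open>\<Omega>\<close>;
    the other \<open>v\<close> then express the zero trace.\<close>
  have w: "has_weak_adjoint \<Omega> cl_curl u (broken_curl \<T> u)"
    unfolding has_weak_adjoint_def
  proof (intro conjI ballI graph_eq(1,2)[OF u])
    fix \<phi> :: "real^3 \<Rightarrow> real^3" assume \<phi>: "\<phi> \<in> test_functions \<Omega>"
    have c: "has_weak_adjoint \<Omega> cl_curl \<phi> (cl_curl \<phi>)"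
      by (rule smooth_weak_curl[OF open_domain bdd test_function_Ck[OF \<phi>]])
    have "inner (graph u) (trace_vec \<phi>) = 0" using * HcurlI[OF open_domain c] by blast
    then show "inner (l2_of \<Omega> u) (l2_of \<Omega> (cl_curl \<phi>)) = inner (l2_of \<Omega> (broken_curl \<T> u)) (l2_of \<Omega> \<phi>)"
      unfolding graph_eq(3)[OF u] trace_vec_def weak_curl_eq[OF open_domain c] by simp
  qed
  have uH: "u \<in> Hcurl \<Omega>" by (rule HcurlI[OF open_domain w])
  have "bdry_cross \<Omega> u v = 0" if v: "v \<in> Hcurl \<Omega>" for v
  proof -
    have "inner (graph u) (trace_vec v) = 0" using * v by blast
    then show ?thesis
      unfolding graph_eq(3)[OF u] trace_vec_def bdry_cross_eq[OF open_domain uH v] weak_curl_eq[OF open_domain w]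
      by simp
  qed
  then show "u \<in> Hcurl_0 \<Omega>" using uH by (simp add: Hcurl_0_def)
qed

lemma trace_vec_sum:
  assumes "\<And>i. i \<in> I \<Longrightarrow> H i \<in> Hcurl \<Omega>"
  shows "trace_vec (\<lambda>x. \<Sum>i\<in>I. c i *\<^sub>R H i x) = (\<Sum>i\<in>I. c i *\<^sub>R trace_vec (H i))"
proof -
  note e = Hcurl_embedding[OF open_domain]
  have "(\<lambda>x. c i *\<^sub>R H i x) \<in> Hcurl \<Omega>" if "i \<in> I" for i
    by (rule linear_subspaceD(3)[OF linear_subspace_Hcurl[OF open_domain] assms[OF that]])
  from embedding_sum[OF e this] have
    "(l2_of \<Omega> (\<lambda>x. \<Sum>i\<in>I. c i *\<^sub>R H i x), l2_of \<Omega> (weak_curl \<Omega> (\<lambda>x. \<Sum>i\<in>I. c i *\<^sub>R H i x))) =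
      (\<Sum>i\<in>I. (l2_of \<Omega> (\<lambda>x. c i *\<^sub>R H i x), l2_of \<Omega> (weak_curl \<Omega> (\<lambda>x. c i *\<^sub>R H i x))))" .
  also have "\<dots> = (\<Sum>i\<in>I. c i *\<^sub>R (l2_of \<Omega> (H i), l2_of \<Omega> (weak_curl \<Omega> (H i))))"
    by (intro sum.cong refl embedding_scaleR[OF e] assms)
  finally show ?thesis
    unfolding trace_vec_def by (simp add: prod_eq_iff fst_sum snd_sum sum_negf)
qed

lemma subspace_trace_vec: "subspace (trace_vec ` Hcurl \<Omega>)"
proof -
  note s = linear_subspaceD[OF linear_subspace_Hcurl[OF open_domain]]
  note e = Hcurl_embedding[OF open_domain]
  have z: "trace_vec (\<lambda>x. 0) = 0" using trace_vec_sum[of "{}"] by simp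
  have a: "trace_vec (\<lambda>x. u x + v x) = trace_vec u + trace_vec v" if "u \<in> Hcurl \<Omega>" "v \<in> Hcurl \<Omega>" for u v
    using embedding_add[OF e that] by (simp add: trace_vec_def)
  have c: "trace_vec (\<lambda>x. c *\<^sub>R u x) = c *\<^sub>R trace_vec u" if "u \<in> Hcurl \<Omega>" for c u
    using embedding_scaleR[OF e that] by (simp add: trace_vec_def)
  show ?thesis
    unfolding subspace_def
  proof (intro conjI ballI allI)
    show "0 \<in> trace_vec ` Hcurl \<Omega>" using z s(1) by (metis image_eqI)
    fix x y assume "x \<in> trace_vec ` Hcurl \<Omega>" "y \<in> trace_vec ` Hcurl \<Omega>"
    then obtain u v where uv: "u \<in> Hcurl \<Omega>" "x = trace_vec u" "v \<in> Hcurl \<Omega>" "y = trace_vec v" by blast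
    show "x + y \<in> trace_vec ` Hcurl \<Omega>"
      unfolding uv a[OF uv(1,3), symmetric] by (rule imageI[OF s(2)[OF uv(1,3)]])
  next
    fix c x assume "x \<in> trace_vec ` Hcurl \<Omega>"
    then obtain u where u: "u \<in> Hcurl \<Omega>" "x = trace_vec u" by blast
    show "c *\<^sub>R x \<in> trace_vec ` Hcurl \<Omega>"
      unfolding u(2) c[OF u(1), symmetric] by (rule imageI[OF s(3)[OF u(1)]])
  qed
qed

lemma nedelec_Hcurl:
  assumes "u \<in> nedelec k r" "K \<in> \<T>"
  shows "u \<in> Hcurl (interior K)"
  by (rule HcurlI[OF open_interior smooth_weak_curl[OF open_interior mesh_element(2)[OF assms(2)]
        Ck_nedelec[OF assms(1)]]])

lemma Vh1_element:
  assumes "u \<in> Vh1 \<T> k r" "K \<in> \<T>"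
  obtains p where "p \<in> nedelec k r" "\<And>x. x \<in> interior K \<Longrightarrow> u x = p x" "elem_graph K u = elem_graph K p"
    "u \<in> Hcurl (interior K)"
proof -
  obtain p where p: "p \<in> nedelec k r" "\<And>x. x \<in> interior K \<Longrightarrow> u x = p x"
    using assms unfolding Vh1_def broken_def by blast
  note c = Hcurl_cong[OF open_interior nedelec_Hcurl[OF p(1) assms(2)] p(2)]
  have "elem_graph K u = elem_graph K p" unfolding elem_graph_def using c(2,3) by simp
  then show thesis using that[OF p] c(1) by blast
qed

lemma Vh1_broken_Hcurl: "Vh1 \<T> k r \<subseteq> broken_Hcurl"
  unfolding broken_Hcurl_def using Vh1_element by blast

lemma linear_subspace_broken:
  assumes "linear_subspace P"
  shows "linear_subspace (broken \<T> P)"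
  unfolding linear_subspace_def
proof (intro conjI ballI allI)
  show "(\<lambda>x. 0) \<in> broken \<T> P" using linear_subspaceD(1)[OF assms] by (auto simp: broken_def)
  fix u v assume uv: "u \<in> broken \<T> P" "v \<in> broken \<T> P"
  show "(\<lambda>x. u x + v x) \<in> broken \<T> P"
    unfolding broken_def
  proof (intro CollectI ballI)
    fix K assume "K \<in> \<T>"
    then obtain p q where pq: "p \<in> P" "\<And>x. x \<in> interior K \<Longrightarrow> u x = p x" "q \<in> P" "\<And>x. x \<in> interior K \<Longrightarrow> v x = q x"
      using uv unfolding broken_def by blast
    then show "\<exists>p\<in>P. \<forall>x\<in>interior K. u x + v x = p x"
      by (intro bexI[OF _ linear_subspaceD(2)[OF assms pq(1,3)]]) simp
  qed
next
  fix c u assume u: "u \<in> broken \<T> P"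
  show "(\<lambda>x. c *\<^sub>R u x) \<in> broken \<T> P"
    unfolding broken_def
  proof (intro CollectI ballI)
    fix K assume "K \<in> \<T>"
    then obtain p where p: "p \<in> P" "\<And>x. x \<in> interior K \<Longrightarrow> u x = p x"
      using u unfolding broken_def by blast
    then show "\<exists>p\<in>P. \<forall>x\<in>interior K. c *\<^sub>R u x = p x"
      by (intro bexI[OF _ linear_subspaceD(3)[OF assms p(1), of c]]) simp
  qed
qed

lemma linear_subspace_Vh1: "linear_subspace (Vh1 \<T> k r)"
  unfolding Vh1_def by (rule linear_subspace_broken[OF linear_subspace_nedelec])

lemmas Vh1_embedding = graph_embedding[OF linear_subspace_Vh1 Vh1_broken_Hcurl]

text \<open>No continuity across faces is demanded, so a polynomial field cut off outside one
  element is admissible. This makes the element equations equivalent to one equation on the broken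
  space.\<close>

lemma cut_Vh1:
  assumes p: "p \<in> nedelec k r" and K: "K \<in> \<T>"
  shows "(\<lambda>x. if x \<in> interior K then p x else 0) \<in> Vh1 \<T> k r"
    "graph (\<lambda>x. if x \<in> interior K then p x else 0) = elem_graph K p"
proof -
  let ?u = "\<lambda>x. if x \<in> interior K then p x else 0"
  have zero: "?u x = (\<lambda>x. 0) x" if "K' \<in> \<T>" "K' \<noteq> K" "x \<in> interior K'" for K' x
    using mesh_disjoint[OF K that(1), of x] that by auto
  show "?u \<in> Vh1 \<T> k r"
    unfolding Vh1_def broken_def
  proof (intro CollectI ballI)
    fix K' assume K': "K' \<in> \<T>"
    show "\<exists>q\<in>nedelec k r. \<forall>x\<in>interior K'. ?u x = q x"
    proof (cases "K' = K")
      case True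
      then show ?thesis using p by auto
    next
      case False
      then show ?thesis
        using linear_subspaceD(1)[OF linear_subspace_nedelec] zero[OF K' False]
        by (intro bexI[of _ "\<lambda>x. 0"]) blast+
    qed
  qed
  have "elem_graph K' ?u = (if K' = K then elem_graph K p else 0)" if K': "K' \<in> \<T>" for K'
  proof (cases "K' = K")
    case True
    have "elem_graph K ?u = elem_graph K p"
      using Hcurl_cong[OF open_interior nedelec_Hcurl[OF p K], of ?u] by (simp add: elem_graph_def)
    then show ?thesis using True by simp
  next
    case False
    have "elem_graph K' ?u = elem_graph K' (\<lambda>x. 0)"
      using Hcurl_cong(2,3)[OF open_interior linear_subspaceD(1)[OF linear_subspace_Hcurl[OF open_interior]] zero[OF K' False]]
      unfolding elem_graph_def by simp
    then show ?thesis using False embedding_zero[OF elem_embedding] by simp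
  qed
  then have "graph ?u = (\<Sum>K'\<in>\<T>. if K' = K then elem_graph K p else 0)"
    unfolding graph_def by (intro sum.cong) auto
  then show "graph ?u = elem_graph K p" using mesh_finite K by simp
qed

lemma subspace_graph_Vh1: "subspace (graph ` Vh1 \<T> k r)"
proof -
  note e = Vh1_embedding[of k r] and s = linear_subspaceD[OF linear_subspace_Vh1[of k r]]
  show ?thesis
    unfolding subspace_def
  proof (intro conjI ballI allI)
    show "0 \<in> graph ` Vh1 \<T> k r" using embedding_zero[OF e] s(1) by (metis image_eqI)
    fix x y assume "x \<in> graph ` Vh1 \<T> k r" "y \<in> graph ` Vh1 \<T> k r"
    then obtain u v where uv: "u \<in> Vh1 \<T> k r" "x = graph u" "v \<in> Vh1 \<T> k r" "y = graph v" by blast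
    show "x + y \<in> graph ` Vh1 \<T> k r"
      unfolding uv embedding_add[OF e uv(1,3), symmetric] by (rule imageI[OF s(2)[OF uv(1,3)]])
  next
    fix c x assume "x \<in> graph ` Vh1 \<T> k r"
    then obtain u where u: "u \<in> Vh1 \<T> k r" "x = graph u" by blast
    show "c *\<^sub>R x \<in> graph ` Vh1 \<T> k r"
      unfolding u(2) embedding_scaleR[OF e u(1), symmetric] by (rule imageI[OF s(3)[OF u(1)]])
  qed
qed

text \<open>Finite dimension holds only after passing to classes: \<open>Vh1\<close> itself contains
  every function that vanishes in the interiors of the elements, whatever its values
  elsewhere.\<close>

lemma graph_Vh1_finite_span:
  obtains B where "finite B" "span B = graph ` Vh1 \<T> k r"
proof (rule subspace_finite_basis[OF subspace_graph_Vh1])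
  let ?I = "(UNIV :: bool set) \<times> (UNIV :: 3 set) \<times> deg_le (r - 1)"
  let ?G = "(\<lambda>(K, \<beta>). elem_graph K (nedelec_gen \<beta>)) ` (\<T> \<times> ?I)"
  show "finite ?G" by (intro finite_imageI finite_cartesian_product mesh_finite finite_deg_le) auto
  show "graph ` Vh1 \<T> k r \<subseteq> span ?G"
  proof
    fix x assume "x \<in> graph ` Vh1 \<T> k r"
    then obtain u where u: "u \<in> Vh1 \<T> k r" "x = graph u" by blast
    have "elem_graph K u \<in> span ?G" if K: "K \<in> \<T>" for K
    proof -
      obtain p where p: "p \<in> nedelec k r" "elem_graph K u = elem_graph K p"
        using Vh1_element[OF u(1) K] by blast
      obtain c where c: "p = (\<lambda>x. \<Sum>\<beta>\<in>?I. c \<beta> *\<^sub>R nedelec_gen \<beta> x)"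
        by (rule nedelec_eq_sum[OF p(1)])
      have g: "nedelec_gen \<beta> \<in> Hcurl (interior K)" for \<beta>
        by (rule HcurlI[OF open_interior smooth_weak_curl[OF open_interior mesh_element(2)[OF K] Ck_nedelec_gen]])
      have "elem_graph K p = (\<Sum>\<beta>\<in>?I. elem_graph K (\<lambda>x. c \<beta> *\<^sub>R nedelec_gen \<beta> x))"
        unfolding c
        by (rule embedding_sum[OF elem_embedding])
          (rule linear_subspaceD(3)[OF linear_subspace_Hcurl[OF open_interior] g])
      also have "\<dots> = (\<Sum>\<beta>\<in>?I. c \<beta> *\<^sub>R elem_graph K (nedelec_gen \<beta>))"
        by (intro sum.cong refl embedding_scaleR[OF elem_embedding g])
      also have "\<dots> \<in> span ?G"
      proof (intro span_sum span_scale span_base)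
        fix \<beta> assume "\<beta> \<in> ?I"
        then show "elem_graph K (nedelec_gen \<beta>) \<in> ?G" using K by (intro image_eqI[of _ _ "(K, \<beta>)"]) auto
      qed
      finally show ?thesis by (simp add: p(2))
    qed
    then show "x \<in> span ?G" unfolding u(2) graph_def by (intro span_sum)
  qed
qed

end

section \<open>Residuals of the two methods\<close>

context mesh_domain
begin

text \<open>Represents the residual on graphs: the field is paired with \<open>D' + J\<close> and
  its curl with \<open>- H\<close>. Nedelec's equation says that this vector is orthogonal to
  conforming graphs, the hybrid equation that \<open>trace_vec\<close> of \<open>Hhat\<close>
  cancels it on all broken graphs.\<close>

definition source ::
  "(real^3 \<Rightarrow> real^3) \<Rightarrow> (real^3 \<Rightarrow> real^3) \<Rightarrow> (real^3 \<Rightarrow> real^3) \<Rightarrow> (real^3, real^3) l2 \<times> (real^3, real^3) l2" where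
  "source D' J H = (l2_of \<Omega> (\<lambda>x. D' x + J x), - l2_of \<Omega> H)"

lemma element_residual:
  assumes K: "K \<in> \<T>" and p: "p \<in> nedelec k r"
    and L: "D' \<in> L2 \<Omega>" "J \<in> L2 \<Omega>" "H \<in> L2 \<Omega>" and v: "v \<in> Hcurl \<Omega>"
  shows "(LINT x|lebesgue_on (interior K). p x \<bullet> (D' x + J x) - weak_curl (interior K) p x \<bullet> H x)
    + bdry_cross (interior K) p v = inner (elem_graph K p) (source D' J H + trace_vec v)"
proof -
  note pH = nedelec_Hcurl[OF p K]
  note pw = has_weak_adjointD(1,2)[OF weak_curl_works[OF open_interior pH]]
  have DJ: "(\<lambda>x. D' x + J x) \<in> L2 \<Omega>" by (rule L2_add[OF L(1,2)])
  note Km = mesh_element(5)[OF K] and DJK = L2_element[OF DJ K] and HK = L2_element[OF L(3) K]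
  have "(LINT x|lebesgue_on (interior K). p x \<bullet> (D' x + J x) - weak_curl (interior K) p x \<bullet> H x) =
      (LINT x|lebesgue_on (interior K). p x \<bullet> (D' x + J x)) - (LINT x|lebesgue_on (interior K). weak_curl (interior K) p x \<bullet> H x)"
    by (rule Bochner_Integration.integral_diff[OF L2_inner_integrable[OF pw(1) DJK] L2_inner_integrable[OF pw(2) HK]])
  also have "\<dots> = inner (l2_of (interior K) p) (l2_of (interior K) (\<lambda>x. D' x + J x))
      - inner (l2_of (interior K) (weak_curl (interior K) p)) (l2_of (interior K) H)"
    by (simp add: inner_l2_of[OF Km pw(1) DJK] inner_l2_of[OF Km pw(2) HK])
  also have "\<dots> = inner (elem_graph K p) (source D' J H)"
    by (simp add: elem_graph_def source_def inner_elem_l2[OF K pw(1) DJ] inner_elem_l2[OF K pw(2) L(3)])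
  finally show ?thesis
    using bdry_cross_element[OF K pH v] by (simp only: inner_add_right)
qed

lemma graph_Hcurl:
  assumes u: "u \<in> broken_Hcurl" and uH: "u \<in> Hcurl \<Omega>"
  shows "graph u = (l2_of \<Omega> u, l2_of \<Omega> (weak_curl \<Omega> u))"
proof -
  note uw = has_weak_adjointD(1,2)[OF weak_curl_works[OF open_domain uH]]
  have "snd (graph u) = l2_of \<Omega> (weak_curl \<Omega> u)"
    unfolding graph_def elem_graph_def snd_sum
    using mesh_L2(2)[OF L2_element[OF uw(2)]] Hcurl_element(2)[OF uH] by simp
  then show ?thesis using graph_eq(3)[OF u] by (simp add: prod_eq_iff)
qed

lemma conforming_residual:
  assumes u: "u \<in> broken_Hcurl" "u \<in> Hcurl \<Omega>"
    and L: "D' \<in> L2 \<Omega>" "J \<in> L2 \<Omega>" "H \<in> L2 \<Omega>"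
  shows "(LINT x|lebesgue_on \<Omega>. u x \<bullet> (D' x + J x) - weak_curl \<Omega> u x \<bullet> H x) = inner (graph u) (source D' J H)"
proof -
  note uw = has_weak_adjointD(1,2)[OF weak_curl_works[OF open_domain u(2)]]
  have DJ: "(\<lambda>x. D' x + J x) \<in> L2 \<Omega>" by (rule L2_add[OF L(1,2)])
  have "(LINT x|lebesgue_on \<Omega>. u x \<bullet> (D' x + J x) - weak_curl \<Omega> u x \<bullet> H x) =
      (LINT x|lebesgue_on \<Omega>. u x \<bullet> (D' x + J x)) - (LINT x|lebesgue_on \<Omega>. weak_curl \<Omega> u x \<bullet> H x)"
    by (rule Bochner_Integration.integral_diff[OF L2_inner_integrable[OF uw(1) DJ] L2_inner_integrable[OF uw(2) L(3)]])
  also have "\<dots> = inner (graph u) (source D' J H)"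
    unfolding graph_Hcurl[OF u] source_def
    by (simp add: inner_l2_of[OF domain_measurable uw(1) DJ] inner_l2_of[OF domain_measurable uw(2) L(3)])
  finally show ?thesis .
qed

lemma element_equations_iff:
  "(\<forall>K\<in>\<T>. \<forall>p\<in>nedelec k r. inner (elem_graph K p) X = 0) \<longleftrightarrow> (\<forall>u\<in>Vh1 \<T> k r. inner (graph u) X = 0)"
proof
  assume *: "\<forall>K\<in>\<T>. \<forall>p\<in>nedelec k r. inner (elem_graph K p) X = 0"
  show "\<forall>u\<in>Vh1 \<T> k r. inner (graph u) X = 0"
  proof
    fix u assume u: "u \<in> Vh1 \<T> k r"
    have "inner (elem_graph K u) X = 0" if K: "K \<in> \<T>" for K
    proof -
      obtain p where "p \<in> nedelec k r" "elem_graph K u = elem_graph K p"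
        using Vh1_element[OF u K] by blast
      then show ?thesis using * K by simp
    qed
    then show "inner (graph u) X = 0" by (simp add: graph_def inner_sum_left)
  qed
next
  assume *: "\<forall>u\<in>Vh1 \<T> k r. inner (graph u) X = 0"
  show "\<forall>K\<in>\<T>. \<forall>p\<in>nedelec k r. inner (elem_graph K p) X = 0"
  proof (intro ballI)
    fix K p assume "K \<in> \<T>" "p \<in> nedelec k r"
    note c = cut_Vh1[OF this(2,1)]
    show "inner (elem_graph K p) X = 0" using bspec[OF * c(1)] by (simp only: c(2))
  qed
qed

end

section \<open>Equivalence of the two methods\<close>

locale maxwell_problem = mesh_domain +
  fixes T :: "real set" and t0 :: real and \<epsilon> \<mu> :: "real \<Rightarrow> real^3 \<Rightarrow> real^3^3"
    and J :: "real \<Rightarrow> real^3 \<Rightarrow> real^3" and \<rho> :: "real \<Rightarrow> real^3 \<Rightarrow> real"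
    and k :: nedelec_kind and r :: nat
  assumes data: "maxwell_data \<Omega> T t0 \<epsilon> \<mu> J \<rho>"
begin

lemma interval: "is_interval T" "t0 \<in> T"
  using data by (auto simp: maxwell_data_def)

lemma not_bot: "t \<in> T \<Longrightarrow> at t within T \<noteq> bot"
  using interval_at_within_not_bot data by (auto simp: maxwell_data_def)

lemmas L2_emb = L2_embedding[OF domain_measurable]
  and Hdiv_emb = Hdiv_embedding[OF open_domain]
  and Hcurl_emb = Hcurl_embedding[OF open_domain]

lemma J_C0: "C0_curve (Hdiv_norm \<Omega>) (Hdiv \<Omega>) T J"
  using data by (simp add: maxwell_data_def)

lemma J_Hdiv: "t \<in> T \<Longrightarrow> J t \<in> Hdiv \<Omega>"
  using J_C0 by (simp add: C0_curve_def)

lemma J_L2: "t \<in> T \<Longrightarrow> J t \<in> L2 \<Omega>" "t \<in> T \<Longrightarrow> weak_div \<Omega> (J t) \<in> L2 \<Omega>"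
  using has_weak_adjointD(1,2)[OF weak_div_works[OF open_domain J_Hdiv]] by blast+

lemma J_continuous:
  "continuous_on T (\<lambda>t. l2_of \<Omega> (J t))" "continuous_on T (\<lambda>t. l2_of \<Omega> (weak_div \<Omega> (J t)))"
proof -
  have c: "continuous_on T (\<lambda>t. (l2_of \<Omega> (J t), l2_of \<Omega> (weak_div \<Omega> (J t))))"
    using J_C0 by (simp add: C0_curve_iff[OF Hdiv_emb])
  show "continuous_on T (\<lambda>t. l2_of \<Omega> (J t))" "continuous_on T (\<lambda>t. l2_of \<Omega> (weak_div \<Omega> (J t)))"
    using continuous_on_fst[OF c] continuous_on_snd[OF c] by simp_all
qed

context
  fixes A :: "real \<Rightarrow> real^3 \<Rightarrow> real^3"
  assumes reg: "regular_fields \<Omega> \<T> k r T \<epsilon> \<mu> A"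
begin

abbreviation "D \<equiv> Dh \<T> k r T \<epsilon> A"
abbreviation "D' \<equiv> Dh_dot \<Omega> \<T> k r T \<epsilon> A"
abbreviation "H \<equiv> Hh \<T> \<mu> A"

lemma D_derivative:
  assumes t: "t \<in> T"
  shows "D t \<in> L2 \<Omega>" "D' t \<in> L2 \<Omega>"
    "((\<lambda>t. l2_of \<Omega> (D t)) has_vector_derivative l2_of \<Omega> (D' t)) (at t within T)"
  using curve_derivative_works[OF L2_emb, of T D] reg t
  unfolding regular_fields_def has_curve_derivative_iff[OF L2_emb] Dh_dot_def by blast+

lemma D'_continuous: "continuous_on T (\<lambda>t. l2_of \<Omega> (D' t))"
  using curve_derivative_C0[OF L2_emb _ not_bot, of D] reg
  unfolding regular_fields_def C0_curve_iff[OF L2_emb] Dh_dot_def by blast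

lemma H_L2: "t \<in> T \<Longrightarrow> H t \<in> L2 \<Omega>"
  and H_continuous: "continuous_on T (\<lambda>t. l2_of \<Omega> (H t))"
  using reg unfolding regular_fields_def C0_curve_iff[OF L2_emb] by blast+

lemma source_continuous: "continuous_on T (\<lambda>t. source (D' t) (J t) (H t))"
proof -
  have "continuous_on T (\<lambda>t. (l2_of \<Omega> (D' t) + l2_of \<Omega> (J t), - l2_of \<Omega> (H t)))"
    by (intro continuous_intros D'_continuous J_continuous H_continuous)
  then show ?thesis
    by (rule continuous_on_eq)
      (simp add: source_def l2_of_add[OF domain_measurable D_derivative(2) J_L2(1)])
qed

lemma nedelec_equation_iff:
  assumes t: "t \<in> T"
  shows "(\<forall>A' \<in> Vh1 \<T> k r \<inter> Hcurl_0 \<Omega>.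
        (LINT x|lebesgue_on \<Omega>. A' x \<bullet> (D' t x + J t x) - weak_curl \<Omega> A' x \<bullet> H t x) = 0) \<longleftrightarrow>
    (\<forall>A' \<in> Vh1 \<T> k r \<inter> Hcurl_0 \<Omega>. inner (graph A') (source (D' t) (J t) (H t)) = 0)"
proof -
  have "(LINT x|lebesgue_on \<Omega>. A' x \<bullet> (D' t x + J t x) - weak_curl \<Omega> A' x \<bullet> H t x) =
      inner (graph A') (source (D' t) (J t) (H t))" if "A' \<in> Vh1 \<T> k r \<inter> Hcurl_0 \<Omega>" for A'
    using that Vh1_broken_Hcurl[of k r]
    by (intro conforming_residual D_derivative(2)[OF t] J_L2(1)[OF t] H_L2[OF t]) (auto simp: Hcurl_0_def)
  then show ?thesis by simp
qed

lemma hybrid_equation_iff: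
  assumes t: "t \<in> T" and v: "v \<in> Hcurl \<Omega>"
  shows "(\<forall>K\<in>\<T>. \<forall>A' \<in> nedelec k r.
        (LINT x|lebesgue_on (interior K). A' x \<bullet> (D' t x + J t x) - weak_curl (interior K) A' x \<bullet> H t x)
        + bdry_cross (interior K) A' v = 0) \<longleftrightarrow>
    (\<forall>A' \<in> Vh1 \<T> k r. inner (graph A') (source (D' t) (J t) (H t) + trace_vec v) = 0)"
  unfolding element_equations_iff[symmetric]
  using element_residual[OF _ _ D_derivative(2)[OF t] J_L2(1)[OF t] H_L2[OF t] v] by simp

end

lemma nedelec_imp_hybrid:
  assumes A: "nedelec_solution \<Omega> \<T> k r T \<epsilon> \<mu> J A"
  shows "\<exists>Hhat. hybrid_solution \<Omega> \<T> k r T \<epsilon> \<mu> J (Hcurl \<Omega>) A Hhat"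
proof -
  have reg: "regular_fields \<Omega> \<T> k r T \<epsilon> \<mu> A" using A by (simp add: nedelec_solution_def)
  let ?f = "\<lambda>t. source (Dh_dot \<Omega> \<T> k r T \<epsilon> A t) (J t) (Hh \<T> \<mu> A t)"
  obtain B where B: "finite B" "span B = graph ` Vh1 \<T> k r" by (rule graph_Vh1_finite_span)
  obtain n q m where qm: "\<forall>i<n. q i \<in> span B \<and> m i \<in> trace_vec ` Hcurl \<Omega>" and
    rep: "\<forall>f. (\<forall>x\<in>span B. (\<forall>y\<in>trace_vec ` Hcurl \<Omega>. inner y x = 0) \<longrightarrow> inner f x = 0) \<longrightarrow>
      (\<forall>x\<in>span B. inner f x = (\<Sum>i<(n::nat). inner f (q i) * inner (m i) x))"
    using finite_dim_solvability[OF B(1) subspace_trace_vec] by blast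
  have "\<exists>h. h \<in> Hcurl \<Omega> \<and> m i = trace_vec h" if "i < n" for i using qm that by blast
  then obtain h where h: "\<And>i. i < n \<Longrightarrow> h i \<in> Hcurl \<Omega>" "\<And>i. i < n \<Longrightarrow> m i = trace_vec (h i)"
    by metis
  \<comment> \<open>The coefficients in the representation of the residual, with the sign that makes
    the trace cancel it. The fields \<open>h i\<close> are fixed once and for all, so time enters
    through these numbers only.\<close>
  define c where "c t i = - inner (?f t) (q i)" for t i
  define Hhat where "Hhat t = (\<lambda>x. \<Sum>i<n. c t i *\<^sub>R h i x)" for t
  have ch: "(\<lambda>x. c t i *\<^sub>R h i x) \<in> Hcurl \<Omega>" if "i \<in> {..<n}" for t i
    using that h(1) linear_subspaceD(3)[OF linear_subspace_Hcurl[OF open_domain]] by simp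
  have Hhat: "Hhat t \<in> Hcurl \<Omega>" for t
    unfolding Hhat_def by (rule linear_subspace_sum[OF linear_subspace_Hcurl[OF open_domain] ch])
  have trace: "trace_vec (Hhat t) = (\<Sum>i<n. c t i *\<^sub>R m i)" for t
    unfolding Hhat_def using trace_vec_sum[of "{..<n}" h "c t"] h by simp
  have eq: "\<forall>A' \<in> Vh1 \<T> k r. inner (graph A') (?f t + trace_vec (Hhat t)) = 0" if t: "t \<in> T" for t
  proof
    fix A' assume A': "A' \<in> Vh1 \<T> k r"
    have N: "\<forall>A' \<in> Vh1 \<T> k r \<inter> Hcurl_0 \<Omega>. inner (graph A') (?f t) = 0"
      using A t nedelec_equation_iff[OF reg t] by (simp add: nedelec_solution_def)
    \<comment> \<open>A graph that all traces annihilate belongs to a conforming field, for which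
      Nedelec's equation is the required solvability condition.\<close>
    have "inner (?f t) x = 0" if x: "x \<in> span B" "\<forall>y\<in>trace_vec ` Hcurl \<Omega>. inner y x = 0" for x
    proof -
      obtain u where u: "u \<in> Vh1 \<T> k r" "x = graph u" using x(1) B(2) by blast
      have "u \<in> broken_Hcurl" using u(1) Vh1_broken_Hcurl by blast
      moreover have "\<forall>v\<in>Hcurl \<Omega>. inner (graph u) (trace_vec v) = 0"
        using x(2) by (simp add: u(2) inner_commute)
      ultimately have "u \<in> Hcurl_0 \<Omega>" using Hcurl_0_iff by blast
      then show ?thesis using N u by (simp add: inner_commute)
    qed
    then have "inner (?f t) (graph A') = (\<Sum>i<n. inner (?f t) (q i) * inner (m i) (graph A'))"
      using rep A' B(2) by blast
    moreover have "inner (graph A') (trace_vec (Hhat t)) = (\<Sum>i<n. c t i * inner (m i) (graph A'))"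
      unfolding trace inner_sum_right inner_scaleR_right by (simp only: inner_commute)
    ultimately have "inner (graph A') (trace_vec (Hhat t)) = - inner (?f t) (graph A')"
      by (simp add: c_def sum_negf)
    then show "inner (graph A') (?f t + trace_vec (Hhat t)) = 0"
      unfolding inner_add_right using inner_commute[of "graph A'" "?f t"] by linarith
  qed
  have cont: "continuous_on T (\<lambda>t. (l2_of \<Omega> (Hhat t), l2_of \<Omega> (weak_curl \<Omega> (Hhat t))))"
  proof -
    have "(l2_of \<Omega> (Hhat t), l2_of \<Omega> (weak_curl \<Omega> (Hhat t))) =
        (\<Sum>i<n. c t i *\<^sub>R (l2_of \<Omega> (h i), l2_of \<Omega> (weak_curl \<Omega> (h i))))" for t
    proof -
      have "(l2_of \<Omega> (Hhat t), l2_of \<Omega> (weak_curl \<Omega> (Hhat t))) =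
          (\<Sum>i<n. (l2_of \<Omega> (\<lambda>x. c t i *\<^sub>R h i x), l2_of \<Omega> (weak_curl \<Omega> (\<lambda>x. c t i *\<^sub>R h i x))))"
        unfolding Hhat_def
        by (rule embedding_sum[OF Hcurl_emb, of "{..<n}" "\<lambda>i x. c t i *\<^sub>R h i x", OF ch])
      also have "\<dots> = (\<Sum>i<n. c t i *\<^sub>R (l2_of \<Omega> (h i), l2_of \<Omega> (weak_curl \<Omega> (h i))))"
        by (intro sum.cong refl embedding_scaleR[OF Hcurl_emb h(1)]) simp
      finally show ?thesis .
    qed
    moreover have "continuous_on T (\<lambda>t. \<Sum>i<n. c t i *\<^sub>R (l2_of \<Omega> (h i), l2_of \<Omega> (weak_curl \<Omega> (h i))))"
      unfolding c_def by (intro continuous_intros source_continuous[OF reg])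
    ultimately show ?thesis by simp
  qed
  have "hybrid_solution \<Omega> \<T> k r T \<epsilon> \<mu> J (Hcurl \<Omega>) A Hhat"
    unfolding hybrid_solution_def
  proof (intro conjI)
    have AV: "A t \<in> Vh1 \<T> k r" "A t \<in> Hcurl_0 \<Omega>" if "t \<in> T" for t
      using A that by (auto simp: nedelec_solution_def C1_curve_def has_curve_derivative_def)
    show "C1_curve (broken_Hcurl_norm \<T>) (Vh1 \<T> k r) T A"
      using A unfolding nedelec_solution_def C1_curve_def has_curve_derivative_def C0_curve_def by blast
    show "regular_fields \<Omega> \<T> k r T \<epsilon> \<mu> A" by (rule reg)
    show "C0_curve (Hcurl_norm \<Omega>) (Hcurl \<Omega>) T Hhat"
      unfolding C0_curve_iff[OF Hcurl_emb] using Hhat cont by blast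
    show "\<forall>t\<in>T. \<forall>K\<in>\<T>. \<forall>A' \<in> nedelec k r.
        (LINT x|lebesgue_on (interior K). A' x \<bullet> (Dh_dot \<Omega> \<T> k r T \<epsilon> A t x + J t x)
                              - weak_curl (interior K) A' x \<bullet> Hh \<T> \<mu> A t x)
        + bdry_cross (interior K) A' (Hhat t) = 0"
      using hybrid_equation_iff[OF reg _ Hhat] eq by blast
    show "\<forall>t\<in>T. \<forall>H' \<in> Hcurl \<Omega>. (\<Sum>K\<in>\<T>. bdry_cross (interior K) (A t) H') = 0"
    proof (intro ballI)
      fix t H' assume t: "t \<in> T" and H': "H' \<in> Hcurl \<Omega>"
      have u: "A t \<in> broken_Hcurl" using AV(1)[OF t] Vh1_broken_Hcurl by blast
      show "(\<Sum>K\<in>\<T>. bdry_cross (interior K) (A t) H') = 0"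
        unfolding sum_bdry_cross[OF u H'] using Hcurl_0_iff[OF u] AV(2)[OF t] H' by blast
    qed
  qed
  then show ?thesis by blast
qed

text \<open>Boundary terms vanish for conforming test fields. The delicate point is that Nedelec's
  method asks for a C1 curve in the conforming space, so the time derivative must be conforming
  too.\<close>

lemma hybrid_imp_nedelec:
  assumes A: "hybrid_solution \<Omega> \<T> k r T \<epsilon> \<mu> J (Hcurl \<Omega>) A Hhat"
  shows "nedelec_solution \<Omega> \<T> k r T \<epsilon> \<mu> J A"
proof -
  have reg: "regular_fields \<Omega> \<T> k r T \<epsilon> \<mu> A" using A by (simp add: hybrid_solution_def)
  note e = Vh1_embedding[of k r]
  obtain A1 where A1: "has_curve_derivative (broken_Hcurl_norm \<T>) (Vh1 \<T> k r) T A A1"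
      "C0_curve (broken_Hcurl_norm \<T>) (Vh1 \<T> k r) T A1"
    using A unfolding hybrid_solution_def C1_curve_def by blast
  have AV: "A t \<in> Vh1 \<T> k r" "A1 t \<in> Vh1 \<T> k r" if "t \<in> T" for t
    using A1(1) that by (auto simp: has_curve_derivative_def)
  have brk: "A t \<in> broken_Hcurl" "A1 t \<in> broken_Hcurl" if "t \<in> T" for t
    using AV[OF that] Vh1_broken_Hcurl by blast+
  have orth: "inner (graph (A t)) (trace_vec v) = 0" if "t \<in> T" "v \<in> Hcurl \<Omega>" for t v
  proof -
    have "(\<Sum>K\<in>\<T>. bdry_cross (interior K) (A t) v) = 0"
      using A that unfolding hybrid_solution_def by blast
    then show ?thesis by (simp only: sum_bdry_cross[OF brk(1)[OF that(1)] that(2)])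
  qed
  have A0: "A t \<in> Hcurl_0 \<Omega>" if "t \<in> T" for t
    using Hcurl_0_iff[OF brk(1)[OF that]] orth[OF that] by blast
  \<comment> \<open>The pairing of \<open>A s\<close> with each trace is zero at all times, so its
    time derivative is zero; by uniqueness of derivatives \<open>A1 t\<close> is orthogonal to the
    trace as well.\<close>
  have A10: "A1 t \<in> Hcurl_0 \<Omega>" if t: "t \<in> T" for t
    unfolding Hcurl_0_iff[OF brk(2)[OF t]]
  proof
    fix v assume v: "v \<in> Hcurl \<Omega>"
    have "((\<lambda>s. graph (A s)) has_vector_derivative graph (A1 t)) (at t within T)"
      using A1(1) t unfolding has_curve_derivative_iff[OF e] by blast
    from bounded_linear.has_vector_derivative[OF bounded_linear_inner_left this]
    have d: "((\<lambda>s. inner (graph (A s)) (trace_vec v)) has_vector_derivative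
        inner (graph (A1 t)) (trace_vec v)) (at t within T)" .
    have "((\<lambda>s. 0 :: real) has_vector_derivative 0) (at t within T)" by (rule has_vector_derivative_const)
    then have "((\<lambda>s. inner (graph (A s)) (trace_vec v)) has_vector_derivative 0) (at t within T)"
      by (rule has_vector_derivative_transform[OF t, rotated]) (simp add: orth v)
    then show "inner (graph (A1 t)) (trace_vec v) = 0"
      using vector_derivative_unique_within[OF not_bot[OF t] d] by blast
  qed
  have "C1_curve (broken_Hcurl_norm \<T>) (Vh1 \<T> k r \<inter> Hcurl_0 \<Omega>) T A"
    unfolding C1_curve_def
  proof (intro exI conjI)
    show "has_curve_derivative (broken_Hcurl_norm \<T>) (Vh1 \<T> k r \<inter> Hcurl_0 \<Omega>) T A A1"
      using A1(1) A0 A10 unfolding has_curve_derivative_def by blast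
    show "C0_curve (broken_Hcurl_norm \<T>) (Vh1 \<T> k r \<inter> Hcurl_0 \<Omega>) T A1"
      using A1(2) A10 unfolding C0_curve_def by blast
  qed
  moreover have "\<forall>A' \<in> Vh1 \<T> k r \<inter> Hcurl_0 \<Omega>.
      (LINT x|lebesgue_on \<Omega>. A' x \<bullet> (Dh_dot \<Omega> \<T> k r T \<epsilon> A t x + J t x) - weak_curl \<Omega> A' x \<bullet> Hh \<T> \<mu> A t x) = 0"
    if t: "t \<in> T" for t
    unfolding nedelec_equation_iff[OF reg t]
  proof
    fix A' assume A': "A' \<in> Vh1 \<T> k r \<inter> Hcurl_0 \<Omega>"
    have v: "Hhat t \<in> Hcurl \<Omega>" using A t by (simp add: hybrid_solution_def C0_curve_def)
    have "\<forall>A' \<in> Vh1 \<T> k r. inner (graph A') (source (Dh_dot \<Omega> \<T> k r T \<epsilon> A t) (J t) (Hh \<T> \<mu> A t) + trace_vec (Hhat t)) = 0"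
      using A t hybrid_equation_iff[OF reg t v] unfolding hybrid_solution_def by blast
    then have "inner (graph A') (source (Dh_dot \<Omega> \<T> k r T \<epsilon> A t) (J t) (Hh \<T> \<mu> A t)) + inner (graph A') (trace_vec (Hhat t)) = 0"
      using A' by (simp add: inner_add_right)
    moreover have "inner (graph A') (trace_vec (Hhat t)) = 0"
      using A' Vh1_broken_Hcurl[of k r] Hcurl_0_iff[of A'] v by blast
    ultimately show "inner (graph A') (source (Dh_dot \<Omega> \<T> k r T \<epsilon> A t) (J t) (Hh \<T> \<mu> A t)) = 0" by simp
  qed
  ultimately show ?thesis using reg unfolding nedelec_solution_def by blast
qed

section \<open>Charge conservation\<close>

text \<open>Ampere's law is integrated from an arbitrary initial field \<open>w0\<close>. The
  integrand, the curl of \<open>Hhat\<close> minus \<open>J\<close>, has weak divergence minus that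
  of \<open>J\<close>, which makes the primitive a curve in H(div) rather than only in L2.\<close>

lemma ampere_flux_exists:
  assumes Hhat: "C0_curve (Hcurl_norm \<Omega>) (Hcurl \<Omega>) T Hhat" and w0: "w0 \<in> Hdiv \<Omega>"
  obtains Dhat where "ampere_flux \<Omega> T J Hhat Dhat" "l2_of \<Omega> (Dhat t0) = l2_of \<Omega> w0"
    "l2_of \<Omega> (weak_div \<Omega> (Dhat t0)) = l2_of \<Omega> (weak_div \<Omega> w0)"
proof -
  have HH: "Hhat t \<in> Hcurl \<Omega>" if "t \<in> T" for t using Hhat that by (simp add: C0_curve_def)
  note Hw = weak_curl_works[OF open_domain HH] and Jw = weak_div_works[OF open_domain J_Hdiv]
  note cL = has_weak_adjointD(2)[OF Hw]
  let ?u = "\<lambda>t x. weak_curl \<Omega> (Hhat t) x - J t x" and ?v = "\<lambda>t x. - weak_div \<Omega> (J t) x"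
  have uv: "has_weak_adjoint \<Omega> div_adjoint (?u t) (?v t)" if t: "t \<in> T" for t
    using weak_adjoint_add[OF open_domain weak_div_of_curl[OF open_domain Hw[OF t]]
        weak_adjoint_scaleR[OF open_domain Jw[OF t], of "-1"]] by simp
  have eq: "l2_of \<Omega> (?u t) = l2_of \<Omega> (weak_curl \<Omega> (Hhat t)) - l2_of \<Omega> (J t)"
      "l2_of \<Omega> (?v t) = - l2_of \<Omega> (weak_div \<Omega> (J t))" if t: "t \<in> T" for t
    by (rule l2_of_diff[OF domain_measurable cL[OF t] J_L2(1)[OF t]],
        rule l2_of_uminus[OF domain_measurable J_L2(2)[OF t]])
  have "continuous_on T (\<lambda>t. (l2_of \<Omega> (Hhat t), l2_of \<Omega> (weak_curl \<Omega> (Hhat t))))"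
    using Hhat by (simp add: C0_curve_iff[OF Hcurl_emb])
  from continuous_on_snd[OF this] have cc: "continuous_on T (\<lambda>t. l2_of \<Omega> (weak_curl \<Omega> (Hhat t)))" by simp
  have "continuous_on T (\<lambda>t. (l2_of \<Omega> (weak_curl \<Omega> (Hhat t)) - l2_of \<Omega> (J t), - l2_of \<Omega> (weak_div \<Omega> (J t))))"
    by (intro continuous_intros cc J_continuous)
  then have cont: "continuous_on T (\<lambda>t. (l2_of \<Omega> (?u t), l2_of \<Omega> (?v t)))"
    by (rule continuous_on_eq) (simp add: eq)
  have divL2: "div_adjoint \<phi> \<in> L2 \<Omega>" if "\<phi> \<in> test_functions \<Omega>" for \<phi>
    by (rule test_function_L2[OF test_function_adjoint(2)[OF that] domain_measurable])
  obtain U V where UV: "\<And>t. t \<in> T \<Longrightarrow> has_weak_adjoint \<Omega> div_adjoint (U t) (V t)"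
    "\<And>t. t \<in> T \<Longrightarrow> ((\<lambda>t. (l2_of \<Omega> (U t), l2_of \<Omega> (V t))) has_vector_derivative
      (l2_of \<Omega> (?u t), l2_of \<Omega> (?v t))) (at t within T)"
    "l2_of \<Omega> (U t0) = 0" "l2_of \<Omega> (V t0) = 0"
    using weak_adjoint_primitive[OF open_domain divL2 interval uv cont] by blast
  define Dhat where "Dhat t = (\<lambda>x. w0 x + U t x)" for t
  note w0w = weak_div_works[OF open_domain w0]
  have Dw: "has_weak_adjoint \<Omega> div_adjoint (Dhat t) (\<lambda>x. weak_div \<Omega> w0 x + V t x)" if t: "t \<in> T" for t
    unfolding Dhat_def by (rule weak_adjoint_add[OF open_domain w0w UV(1)[OF t]])
  have Deq: "l2_of \<Omega> (Dhat t) = l2_of \<Omega> w0 + l2_of \<Omega> (U t)"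
      "l2_of \<Omega> (weak_div \<Omega> (Dhat t)) = l2_of \<Omega> (weak_div \<Omega> w0) + l2_of \<Omega> (V t)" if t: "t \<in> T" for t
    using l2_of_add[OF domain_measurable has_weak_adjointD(1)[OF w0w] has_weak_adjointD(1)[OF UV(1)[OF t]]]
      l2_of_add[OF domain_measurable has_weak_adjointD(2)[OF w0w] has_weak_adjointD(2)[OF UV(1)[OF t]]]
      weak_div_eq[OF open_domain Dw[OF t]]
    by (simp_all add: Dhat_def)
  have der: "has_curve_derivative (Hdiv_norm \<Omega>) (Hdiv \<Omega>) T Dhat ?u"
    unfolding has_curve_derivative_iff[OF Hdiv_emb]
  proof (intro conjI ballI)
    fix t assume t: "t \<in> T"
    show "Dhat t \<in> Hdiv \<Omega>" by (rule HdivI[OF open_domain Dw[OF t]])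
    show "?u t \<in> Hdiv \<Omega>" by (rule HdivI[OF open_domain uv[OF t]])
    have "((\<lambda>t. (l2_of \<Omega> w0, l2_of \<Omega> (weak_div \<Omega> w0)) + (l2_of \<Omega> (U t), l2_of \<Omega> (V t))) has_vector_derivative
        0 + (l2_of \<Omega> (?u t), l2_of \<Omega> (?v t))) (at t within T)"
      by (intro has_vector_derivative_add has_vector_derivative_const UV(2)[OF t])
    then have "((\<lambda>t. (l2_of \<Omega> (Dhat t), l2_of \<Omega> (weak_div \<Omega> (Dhat t)))) has_vector_derivative
        0 + (l2_of \<Omega> (?u t), l2_of \<Omega> (?v t))) (at t within T)"
      by (rule has_vector_derivative_transform[OF t, rotated]) (simp add: Deq)
    then show "((\<lambda>t. (l2_of \<Omega> (Dhat t), l2_of \<Omega> (weak_div \<Omega> (Dhat t)))) has_vector_derivative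
        (l2_of \<Omega> (?u t), l2_of \<Omega> (weak_div \<Omega> (?u t)))) (at t within T)"
      using weak_div_eq[OF open_domain uv[OF t]] by simp
  qed
  have C0: "C0_curve (Hdiv_norm \<Omega>) (Hdiv \<Omega>) T ?u"
    unfolding C0_curve_iff[OF Hdiv_emb]
  proof (intro conjI ballI)
    show "?u t \<in> Hdiv \<Omega>" if "t \<in> T" for t by (rule HdivI[OF open_domain uv[OF that]])
    show "continuous_on T (\<lambda>t. (l2_of \<Omega> (?u t), l2_of \<Omega> (weak_div \<Omega> (?u t))))"
      using cont by (rule continuous_on_eq) (simp add: weak_div_eq[OF open_domain uv])
  qed
  have C1: "C1_curve (Hdiv_norm \<Omega>) (Hdiv \<Omega>) T Dhat"
    unfolding C1_curve_def using der C0 by blast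
  have "ampere_flux \<Omega> T J Hhat Dhat"
    unfolding ampere_flux_def
  proof (intro conjI ballI C1)
    fix t assume t: "t \<in> T"
    let ?d = "curve_derivative (Hdiv_norm \<Omega>) (Hdiv \<Omega>) T Dhat t"
    have "?d \<in> Hdiv \<Omega>"
      using curve_derivative_works[OF Hdiv_emb C1] t by (simp add: has_curve_derivative_def)
    then have dL: "?d \<in> L2 \<Omega>" by (rule has_weak_adjointD(1)[OF weak_div_works[OF open_domain]])
    have "l2_of \<Omega> ?d = l2_of \<Omega> (?u t)"
      using curve_derivative_unique[OF Hdiv_emb C1 der t not_bot[OF t]] by simp
    then have "AE x in lebesgue_on \<Omega>. ?d x = ?u t x"
      using l2_of_eq_iff[OF domain_measurable dL has_weak_adjointD(1)[OF uv[OF t]]] by simp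
    then show "AE x in lebesgue_on \<Omega>. ?d x + J t x = weak_curl \<Omega> (Hhat t) x"
      by eventually_elim simp
  qed
  moreover have "l2_of \<Omega> (Dhat t0) = l2_of \<Omega> w0"
    "l2_of \<Omega> (weak_div \<Omega> (Dhat t0)) = l2_of \<Omega> (weak_div \<Omega> w0)"
    using Deq[OF interval(2)] UV(3,4) by simp_all
  ultimately show thesis by (rule that)
qed

text \<open>Conservation is claimed for every flux obeying Ampere's law, not only for the
  constructed one. The law is an identity almost everywhere; since the weak divergence depends only
  on the class of a field, it also determines the divergence of the time derivative.\<close>

lemma ampere_flux_derivative:
  assumes Hhat: "C0_curve (Hcurl_norm \<Omega>) (Hcurl \<Omega>) T Hhat" and D: "ampere_flux \<Omega> T J Hhat Dhat" and t: "t \<in> T"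
  shows "Dhat t \<in> Hdiv \<Omega>"
    "((\<lambda>t. l2_of \<Omega> (Dhat t)) has_vector_derivative
      (l2_of \<Omega> (weak_curl \<Omega> (Hhat t)) - l2_of \<Omega> (J t))) (at t within T)"
    "((\<lambda>t. l2_of \<Omega> (weak_div \<Omega> (Dhat t))) has_vector_derivative
      (- l2_of \<Omega> (weak_div \<Omega> (J t)))) (at t within T)"
proof -
  have HH: "Hhat t \<in> Hcurl \<Omega>" using Hhat t by (simp add: C0_curve_def)
  note Hw = weak_curl_works[OF open_domain HH] and Jw = weak_div_works[OF open_domain J_Hdiv[OF t]]
  let ?u = "\<lambda>x. weak_curl \<Omega> (Hhat t) x - J t x" and ?v = "\<lambda>x. - weak_div \<Omega> (J t) x"
  let ?d = "curve_derivative (Hdiv_norm \<Omega>) (Hdiv \<Omega>) T Dhat t"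
  have uv: "has_weak_adjoint \<Omega> div_adjoint ?u ?v"
    using weak_adjoint_add[OF open_domain weak_div_of_curl[OF open_domain Hw]
        weak_adjoint_scaleR[OF open_domain Jw, of "-1"]] by simp
  have C1: "C1_curve (Hdiv_norm \<Omega>) (Hdiv \<Omega>) T Dhat" using D by (simp add: ampere_flux_def)
  note w = curve_derivative_works[OF Hdiv_emb C1, unfolded has_curve_derivative_iff[OF Hdiv_emb]]
  show "Dhat t \<in> Hdiv \<Omega>" using w t by blast
  have dH: "?d \<in> Hdiv \<Omega>" using w t by blast
  note dw = weak_div_works[OF open_domain dH]
  have "AE x in lebesgue_on \<Omega>. ?d x + J t x = weak_curl \<Omega> (Hhat t) x"
    using D t by (simp add: ampere_flux_def)
  then have "AE x in lebesgue_on \<Omega>. ?d x = ?u x" by eventually_elim (simp add: algebra_simps)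
  then have du: "l2_of \<Omega> ?d = l2_of \<Omega> ?u"
    using l2_of_eq_iff[OF domain_measurable has_weak_adjointD(1)[OF dw] has_weak_adjointD(1)[OF uv]] by simp
  have "has_weak_adjoint \<Omega> div_adjoint ?d ?v"
    by (rule weak_adjoint_cong[OF open_domain uv du refl has_weak_adjointD(1)[OF dw] has_weak_adjointD(2)[OF uv]])
  then have dv: "l2_of \<Omega> (weak_div \<Omega> ?d) = l2_of \<Omega> ?v" by (rule weak_div_eq[OF open_domain])
  have d: "((\<lambda>t. (l2_of \<Omega> (Dhat t), l2_of \<Omega> (weak_div \<Omega> (Dhat t)))) has_vector_derivative
      (l2_of \<Omega> ?d, l2_of \<Omega> (weak_div \<Omega> ?d))) (at t within T)"
    using w t by blast
  show "((\<lambda>t. l2_of \<Omega> (Dhat t)) has_vector_derivative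
      (l2_of \<Omega> (weak_curl \<Omega> (Hhat t)) - l2_of \<Omega> (J t))) (at t within T)"
    using bounded_linear.has_vector_derivative[OF bounded_linear_fst d]
    by (simp add: du l2_of_diff[OF domain_measurable has_weak_adjointD(2)[OF Hw] J_L2(1)[OF t]])
  show "((\<lambda>t. l2_of \<Omega> (weak_div \<Omega> (Dhat t))) has_vector_derivative
      (- l2_of \<Omega> (weak_div \<Omega> (J t)))) (at t within T)"
    using bounded_linear.has_vector_derivative[OF bounded_linear_snd d]
    by (simp add: dv l2_of_uminus[OF domain_measurable J_L2(2)[OF t]])
qed

lemma \<rho>_derivative:
  assumes t: "t \<in> T"
  shows "\<rho> t \<in> L2 \<Omega>"
    "((\<lambda>t. l2_of \<Omega> (\<rho> t)) has_vector_derivative (- l2_of \<Omega> (weak_div \<Omega> (J t)))) (at t within T)"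
proof -
  let ?d = "curve_derivative (L2norm \<Omega>) (L2 \<Omega>) T \<rho> t"
  have "C1_curve (L2norm \<Omega>) (L2 \<Omega>) T \<rho>" using data by (simp add: maxwell_data_def)
  note w = curve_derivative_works[OF L2_emb this, unfolded has_curve_derivative_iff[OF L2_emb]]
  show "\<rho> t \<in> L2 \<Omega>" using w t by blast
  have dL: "?d \<in> L2 \<Omega>" using w t by blast
  have "AE x in lebesgue_on \<Omega>. ?d x + weak_div \<Omega> (J t) x = 0"
    using data t by (simp add: maxwell_data_def)
  then have "AE x in lebesgue_on \<Omega>. ?d x = - weak_div \<Omega> (J t) x" by eventually_elim simp
  then have "l2_of \<Omega> ?d = - l2_of \<Omega> (weak_div \<Omega> (J t))"
    using l2_of_eq_iff[OF domain_measurable dL L2_uminus[OF J_L2(2)[OF t]]]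
      l2_of_uminus[OF domain_measurable J_L2(2)[OF t]] by simp
  moreover have "((\<lambda>t. l2_of \<Omega> (\<rho> t)) has_vector_derivative l2_of \<Omega> ?d) (at t within T)" using w t by blast
  ultimately show "((\<lambda>t. l2_of \<Omega> (\<rho> t)) has_vector_derivative (- l2_of \<Omega> (weak_div \<Omega> (J t)))) (at t within T)"
    by simp
qed

end

context mesh_domain
begin

lemma poly_le_weak_grad: "\<phi> \<in> poly_le r \<Longrightarrow> K \<in> \<T> \<Longrightarrow> has_weak_adjoint (interior K) grad_adjoint \<phi> (cl_grad \<phi>)"
  by (rule smooth_weak_grad[OF open_interior mesh_element(2) Ck_poly_le])

text \<open>The constraint sees the fields only through the differences \<open>D - w\<close> and
  \<open>\<rho> - div w\<close>, the first tested with the gradient, the second with the polynomial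
  itself; their evolution can be controlled separately.\<close>

lemma element_charge_constraint_iff:
  assumes L: "D \<in> L2 \<Omega>" "\<rho> \<in> L2 \<Omega>" and w: "w \<in> Hdiv \<Omega>"
  shows "element_charge_constraint \<T> r D w \<rho> \<longleftrightarrow>
    (\<forall>K\<in>\<T>. \<forall>\<phi>\<in>poly_le r. inner (l2_of (interior K) (cl_grad \<phi>)) (l2_of \<Omega> D - l2_of \<Omega> w)
      + inner (l2_of (interior K) \<phi>) (l2_of \<Omega> \<rho> - l2_of \<Omega> (weak_div \<Omega> w)) = 0)"
proof -
  note ww = weak_div_works[OF open_domain w]
  note wL = has_weak_adjointD(1,2)[OF ww]
  have "(LINT x|lebesgue_on (interior K). weak_grad (interior K) \<phi> x \<bullet> D x + \<phi> x * \<rho> x) - bdry_flux (interior K) \<phi> w =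
      inner (l2_of (interior K) (cl_grad \<phi>)) (l2_of \<Omega> D - l2_of \<Omega> w)
      + inner (l2_of (interior K) \<phi>) (l2_of \<Omega> \<rho> - l2_of \<Omega> (weak_div \<Omega> w))"
    if K: "K \<in> \<T>" and \<phi>: "\<phi> \<in> poly_le r" for K \<phi>
  proof -
    note g = poly_le_weak_grad[OF \<phi> K]
    note gL = has_weak_adjointD(1,2)[OF g]
    note gw = has_weak_adjointD(2)[OF weak_grad_works[OF open_interior H1I[OF open_interior g]]]
    note ge = weak_grad_eq[OF open_interior g]
    note Km = mesh_element(5)[OF K]
    have wK: "has_weak_adjoint (interior K) div_adjoint w (weak_div \<Omega> w)"
      by (rule weak_adjoint_restrict[OF open_domain ww open_interior mesh_element(3)[OF K] test_function_adjoint(2)])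
    have "(LINT x|lebesgue_on (interior K). weak_grad (interior K) \<phi> x \<bullet> D x + \<phi> x * \<rho> x) =
        (LINT x|lebesgue_on (interior K). weak_grad (interior K) \<phi> x \<bullet> D x) + (LINT x|lebesgue_on (interior K). \<phi> x * \<rho> x)"
      by (rule Bochner_Integration.integral_add[OF L2_inner_integrable[OF gw L2_element[OF L(1) K]]
            L2_mult_integrable[OF gL(1) L2_element[OF L(2) K]]])
    also have "\<dots> = inner (l2_of (interior K) (weak_grad (interior K) \<phi>)) (l2_of (interior K) D)
        + inner (l2_of (interior K) \<phi>) (l2_of (interior K) \<rho>)"
      by (simp add: inner_l2_of[OF Km gw L2_element[OF L(1) K]] inner_l2_of[OF Km gL(1) L2_element[OF L(2) K]])
    also have "\<dots> = inner (l2_of (interior K) (cl_grad \<phi>)) (l2_of \<Omega> D) + inner (l2_of (interior K) \<phi>) (l2_of \<Omega> \<rho>)"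
      by (simp add: ge inner_elem_l2[OF K gL(2) L(1)] inner_elem_l2[OF K gL(1) L(2)])
    finally have 1: "(LINT x|lebesgue_on (interior K). weak_grad (interior K) \<phi> x \<bullet> D x + \<phi> x * \<rho> x) =
        inner (l2_of (interior K) (cl_grad \<phi>)) (l2_of \<Omega> D) + inner (l2_of (interior K) \<phi>) (l2_of \<Omega> \<rho>)" .
    have 2: "bdry_flux (interior K) \<phi> w = inner (l2_of (interior K) (cl_grad \<phi>)) (l2_of \<Omega> w)
        + inner (l2_of (interior K) \<phi>) (l2_of \<Omega> (weak_div \<Omega> w))"
      unfolding bdry_flux_eq[OF open_interior H1I[OF open_interior g] HdivI[OF open_interior wK]]
        ge weak_div_eq[OF open_interior wK]
      by (simp add: inner_elem_l2[OF K gL(2) wL(1)] inner_elem_l2[OF K gL(1) wL(2)])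
    show ?thesis unfolding 1 2 by (simp add: inner_diff_right)
  qed
  then show ?thesis unfolding element_charge_constraint_def by simp
qed

lemma div_charge_constraint_iff:
  assumes "\<rho> \<in> L2 \<Omega>" "w \<in> Hdiv \<Omega>"
  shows "div_charge_constraint \<Omega> w \<rho> \<longleftrightarrow> l2_of \<Omega> (weak_div \<Omega> w) = l2_of \<Omega> \<rho>"
  unfolding div_charge_constraint_def
  using l2_of_eq_iff[OF domain_measurable has_weak_adjointD(2)[OF weak_div_works[OF open_domain assms(2)]] assms(1)]
  by simp

end

context maxwell_problem
begin

lemma charge_conservation:
  assumes A: "hybrid_solution \<Omega> \<T> k r T \<epsilon> \<mu> J (Hcurl \<Omega>) A Hhat" and D: "ampere_flux \<Omega> T J Hhat Dhat" and t: "t \<in> T"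
  shows "element_charge_constraint \<T> r (Dh \<T> k r T \<epsilon> A t0) (Dhat t0) (\<rho> t0) \<Longrightarrow>
      element_charge_constraint \<T> r (Dh \<T> k r T \<epsilon> A t) (Dhat t) (\<rho> t)"
    and "div_charge_constraint \<Omega> (Dhat t0) (\<rho> t0) \<Longrightarrow> div_charge_constraint \<Omega> (Dhat t) (\<rho> t)"
proof -
  have reg: "regular_fields \<Omega> \<T> k r T \<epsilon> \<mu> A" using A by (simp add: hybrid_solution_def)
  have Hhat: "C0_curve (Hcurl_norm \<Omega>) (Hcurl \<Omega>) T Hhat" using A by (simp add: hybrid_solution_def)
  have HH: "Hhat s \<in> Hcurl \<Omega>" if "s \<in> T" for s using Hhat that by (simp add: C0_curve_def)
  let ?D = "Dh \<T> k r T \<epsilon> A" and ?D' = "Dh_dot \<Omega> \<T> k r T \<epsilon> A"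
  \<comment> \<open>\<open>Y\<close> is constant as a class, by conservation of charge. For
    \<open>X\<close> only the moments against gradients of polynomials are shown to be constant,
    which is all that the constraint uses.\<close>
  define X where "X s = l2_of \<Omega> (?D s) - l2_of \<Omega> (Dhat s)" for s
  define Y where "Y s = l2_of \<Omega> (\<rho> s) - l2_of \<Omega> (weak_div \<Omega> (Dhat s))" for s
  note dD = D_derivative[OF reg] and d\<rho> = \<rho>_derivative and dF = ampere_flux_derivative[OF Hhat D]
  have X: "(X has_vector_derivative l2_of \<Omega> (?D' s) - (l2_of \<Omega> (weak_curl \<Omega> (Hhat s)) - l2_of \<Omega> (J s))) (at s within T)"
    if "s \<in> T" for s
    unfolding X_def[abs_def] by (intro has_vector_derivative_diff dD(3) dF(2) that)
  have Y: "(Y has_vector_derivative 0) (at s within T)" if "s \<in> T" for s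
    using has_vector_derivative_diff[OF d\<rho>(2)[OF that] dF(3)[OF that]] unfolding Y_def[abs_def] by simp
  have Y_const: "Y t = Y t0" by (rule constant_on_interval[OF interval(1) Y t interval(2)])
  show "div_charge_constraint \<Omega> (Dhat t0) (\<rho> t0) \<Longrightarrow> div_charge_constraint \<Omega> (Dhat t) (\<rho> t)"
    using Y_const
    by (simp add: div_charge_constraint_iff[OF d\<rho>(1)[OF t] dF(1)[OF t]] Y_def
        div_charge_constraint_iff[OF d\<rho>(1)[OF interval(2)] dF(1)[OF interval(2)]])
  have const: "inner (l2_of (interior K) (cl_grad \<phi>)) (X t) = inner (l2_of (interior K) (cl_grad \<phi>)) (X t0)"
    if K: "K \<in> \<T>" and \<phi>: "\<phi> \<in> poly_le r" for K \<phi>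
  proof (rule constant_on_interval[OF interval(1) _ t interval(2)])
    fix s assume s: "s \<in> T"
    let ?f = "source (?D' s) (J s) (Hh \<T> \<mu> A s)"
    have gn: "cl_grad \<phi> \<in> nedelec k r" by (rule cl_grad_nedelec[OF \<phi>])
    have "\<forall>A' \<in> Vh1 \<T> k r. inner (graph A') (?f + trace_vec (Hhat s)) = 0"
      using A s hybrid_equation_iff[OF reg s HH[OF s]] unfolding hybrid_solution_def by blast
    then have "inner (elem_graph K (cl_grad \<phi>)) (?f + trace_vec (Hhat s)) = 0"
      unfolding element_equations_iff[symmetric] using K gn by blast
    \<comment> \<open>The test field is curl free, so the terms with \<open>Hh\<close> and with
      \<open>Hhat\<close> itself drop out. Only the curl of \<open>Hhat\<close> remains, and it
      equals the time derivative of \<open>Dhat\<close> plus \<open>J\<close>.\<close>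
    moreover have "l2_of (interior K) (weak_curl (interior K) (cl_grad \<phi>)) = 0"
      using weak_curl_eq[OF open_interior weak_curl_of_grad[OF open_interior poly_le_weak_grad[OF \<phi> K]]] by simp
    ultimately have zero: "inner (l2_of (interior K) (cl_grad \<phi>))
        (l2_of \<Omega> (?D' s) - (l2_of \<Omega> (weak_curl \<Omega> (Hhat s)) - l2_of \<Omega> (J s))) = 0"
      by (simp add: elem_graph_def source_def trace_vec_def inner_add_right inner_diff_right
          l2_of_add[OF domain_measurable dD(2)[OF s] J_L2(1)[OF s]])
    show "((\<lambda>s. inner (l2_of (interior K) (cl_grad \<phi>)) (X s)) has_vector_derivative 0) (at s within T)"
      unfolding zero[symmetric]
      by (rule bounded_linear.has_vector_derivative[OF bounded_linear_inner_right X[OF s]])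
  qed
  show "element_charge_constraint \<T> r (?D t0) (Dhat t0) (\<rho> t0) \<Longrightarrow> element_charge_constraint \<T> r (?D t) (Dhat t) (\<rho> t)"
    unfolding element_charge_constraint_iff[OF dD(1)[OF t] d\<rho>(1)[OF t] dF(1)[OF t]]
      element_charge_constraint_iff[OF dD(1)[OF interval(2)] d\<rho>(1)[OF interval(2)] dF(1)[OF interval(2)]]
      X_def[symmetric] Y_def[symmetric]
    using const Y_const by simp
qed

end

section \<open>The initial flux\<close>

lemma H1_embedding:
  assumes "open S"
  shows "seminorm_embedding (\<lambda>f. sqrt ((L2norm S f)\<^sup>2 + (L2norm S (weak_grad S f))\<^sup>2)) (H1 S)
    (\<lambda>f. (l2_of S f, l2_of S (weak_grad S f)))"
  by (rule weak_adjoint_embedding[OF assms weak_grad_works[OF assms] H1I[OF assms] refl])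

context mesh_domain
begin

text \<open>Its orthogonal complement consists of the classes that are weakly divergence free on the
  domain, its closure of the gradients of limits of test functions.\<close>

definition grads :: "(real^3, real^3) l2 set" where
  "grads = (\<lambda>\<phi>. l2_of \<Omega> (cl_grad \<phi>)) ` test_functions \<Omega>"

lemma test_function_weak_grad:
  fixes \<phi> :: "real^3 \<Rightarrow> real"
  shows "\<phi> \<in> test_functions \<Omega> \<Longrightarrow> has_weak_adjoint \<Omega> grad_adjoint \<phi> (cl_grad \<phi>)"
  by (rule smooth_weak_grad[OF open_domain bdd test_function_Ck])

lemma grads_add:
  fixes \<phi> \<psi> :: "real^3 \<Rightarrow> real"
  assumes "\<phi> \<in> test_functions \<Omega>" "\<psi> \<in> test_functions \<Omega>"
  shows "l2_of \<Omega> (cl_grad (\<lambda>x. \<phi> x + \<psi> x)) = l2_of \<Omega> (cl_grad \<phi>) + l2_of \<Omega> (cl_grad \<psi>)"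
proof -
  note g = test_function_weak_grad[OF assms(1)] test_function_weak_grad[OF assms(2)]
  show ?thesis
    using weak_adjoint_unique[OF open_domain test_function_weak_grad[OF test_function_add[OF assms]]
        weak_adjoint_add[OF open_domain g]]
    by (simp add: l2_of_add[OF domain_measurable has_weak_adjointD(2)[OF g(1)] has_weak_adjointD(2)[OF g(2)]])
qed

lemma grads_scaleR:
  fixes \<phi> :: "real^3 \<Rightarrow> real"
  assumes "\<phi> \<in> test_functions \<Omega>"
  shows "l2_of \<Omega> (cl_grad (\<lambda>x. c *\<^sub>R \<phi> x)) = c *\<^sub>R l2_of \<Omega> (cl_grad \<phi>)"
proof -
  note g = test_function_weak_grad[OF assms]
  show ?thesis
    using weak_adjoint_unique[OF open_domain test_function_weak_grad[OF test_function_scaleR[OF assms, of c]]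
        weak_adjoint_scaleR[OF open_domain g, of c]]
    by (simp add: l2_of_scaleR[OF domain_measurable has_weak_adjointD(2)[OF g]])
qed

lemma subspace_grads: "subspace grads"
  unfolding subspace_def
proof (intro conjI ballI allI)
  have "l2_of \<Omega> (cl_grad (\<lambda>x. 0 :: real)) = 0"
    using grads_scaleR[OF test_function_zero, of 0] by simp
  then show "0 \<in> grads" unfolding grads_def using test_function_zero by (metis image_eqI)
  fix x y assume "x \<in> grads" "y \<in> grads"
  then obtain \<phi> \<psi> where p: "\<phi> \<in> test_functions \<Omega>" "x = l2_of \<Omega> (cl_grad \<phi>)"
    "\<psi> \<in> test_functions \<Omega>" "y = l2_of \<Omega> (cl_grad \<psi>)" unfolding grads_def by blast
  show "x + y \<in> grads"
    unfolding p(2,4) grads_add[OF p(1,3), symmetric] grads_def by (rule imageI[OF test_function_add[OF p(1,3)]])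
next
  fix c x assume "x \<in> grads"
  then obtain \<phi> where p: "\<phi> \<in> test_functions \<Omega>" "x = l2_of \<Omega> (cl_grad \<phi>)" unfolding grads_def by blast
  show "c *\<^sub>R x \<in> grads"
    unfolding p(2) grads_scaleR[OF p(1), symmetric] grads_def by (rule imageI[OF test_function_scaleR[OF p(1)]])
qed

text \<open>In this form the inequality says that a potential is determined by its gradient, and
  that potentials form a Cauchy sequence if their gradients do. Truncation at 0 keeps the constant
  nonnegative.\<close>

lemma friedrichs_diff:
  obtains C where "C \<ge> 0" "\<And>\<phi> \<psi>. \<phi> \<in> test_functions \<Omega> \<Longrightarrow> \<psi> \<in> test_functions \<Omega> \<Longrightarrow>
    norm (l2_of \<Omega> \<phi> - l2_of \<Omega> \<psi> :: (real^3, real) l2) \<le> C * norm (l2_of \<Omega> (cl_grad \<phi>) - l2_of \<Omega> (cl_grad \<psi>))"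
proof -
  obtain R where R: "\<And>x. x \<in> \<Omega> \<Longrightarrow> norm x \<le> R" using bdd unfolding bounded_iff by blast
  have "norm (l2_of \<Omega> \<phi> - l2_of \<Omega> \<psi>) \<le> max 0 (2 * R) * norm (l2_of \<Omega> (cl_grad \<phi>) - l2_of \<Omega> (cl_grad \<psi>))"
    if p: "\<phi> \<in> test_functions \<Omega>" "\<psi> \<in> test_functions \<Omega>" for \<phi> \<psi> :: "real^3 \<Rightarrow> real"
  proof -
    have m: "(\<lambda>x. (- 1) *\<^sub>R \<psi> x) \<in> test_functions \<Omega>" by (rule test_function_scaleR[OF p(2)])
    let ?d = "\<lambda>x. \<phi> x + (- 1) *\<^sub>R \<psi> x"
    have d: "?d \<in> test_functions \<Omega>" by (rule test_function_add[OF p(1) m])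
    have L: "\<phi> \<in> L2 \<Omega>" "\<psi> \<in> L2 \<Omega>" by (rule test_function_L2[OF p(1) domain_measurable], rule test_function_L2[OF p(2) domain_measurable])
    have "l2_of \<Omega> ?d = l2_of \<Omega> \<phi> - l2_of \<Omega> \<psi>"
      using l2_of_diff[OF domain_measurable L] by simp
    moreover have "l2_of \<Omega> (cl_grad ?d) = l2_of \<Omega> (cl_grad \<phi>) - l2_of \<Omega> (cl_grad \<psi>)"
      unfolding grads_add[OF p(1) m] grads_scaleR[OF p(2)] by simp
    moreover have "norm (l2_of \<Omega> ?d) \<le> 2 * R * norm (l2_of \<Omega> (cl_grad ?d))"
      by (rule friedrichs[OF open_domain bdd d R])
    moreover have "2 * R * norm (l2_of \<Omega> (cl_grad ?d)) \<le> max 0 (2 * R) * norm (l2_of \<Omega> (cl_grad ?d))"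
      by (intro mult_right_mono) auto
    ultimately show ?thesis by simp
  qed
  then show thesis by (intro that[of "max 0 (2 * R)"]) auto
qed

text \<open>The weak equation prescribes a functional on the gradients of test functions. The
  Friedrichs inequality makes it well defined and bounded, so it has a Riesz representative.\<close>

lemma divergence_solution:
  assumes \<rho>: "\<rho> \<in> L2 \<Omega>"
  obtains v where "v \<in> closure grads"
    "\<And>\<phi>. \<phi> \<in> test_functions \<Omega> \<Longrightarrow> inner v (l2_of \<Omega> (cl_grad \<phi>)) = - inner (l2_of \<Omega> \<rho>) (l2_of \<Omega> \<phi>)"
proof -
  obtain C where C: "C \<ge> 0" "\<And>\<phi> \<psi>. \<phi> \<in> test_functions \<Omega> \<Longrightarrow> \<psi> \<in> test_functions \<Omega> \<Longrightarrow>
    norm (l2_of \<Omega> \<phi> - l2_of \<Omega> \<psi> :: (real^3, real) l2) \<le> C * norm (l2_of \<Omega> (cl_grad \<phi>) - l2_of \<Omega> (cl_grad \<psi>))"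
    using friedrichs_diff by blast
  \<comment> \<open>Some potential is selected for each gradient; the Friedrichs inequality shows
    that its class does not depend on the selection.\<close>
  define P where "P y = (SOME \<phi>. \<phi> \<in> test_functions \<Omega> \<and> y = l2_of \<Omega> (cl_grad \<phi>))" for y
  have P: "P y \<in> test_functions \<Omega>" "y = l2_of \<Omega> (cl_grad (P y))" if "y \<in> grads" for y
  proof -
    have "\<exists>\<phi>. \<phi> \<in> test_functions \<Omega> \<and> y = l2_of \<Omega> (cl_grad \<phi>)" using that unfolding grads_def by blast
    from someI_ex[OF this] show "P y \<in> test_functions \<Omega>" "y = l2_of \<Omega> (cl_grad (P y))"
      unfolding P_def by blast+
  qed
  have Puniq: "l2_of \<Omega> (P (l2_of \<Omega> (cl_grad \<phi>))) = l2_of \<Omega> \<phi>" if \<phi>: "\<phi> \<in> test_functions \<Omega>" for \<phi>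
  proof -
    have y: "l2_of \<Omega> (cl_grad \<phi>) \<in> grads" unfolding grads_def using \<phi> by (rule imageI)
    have "norm (l2_of \<Omega> (P (l2_of \<Omega> (cl_grad \<phi>))) - l2_of \<Omega> \<phi>) \<le>
        C * norm (l2_of \<Omega> (cl_grad (P (l2_of \<Omega> (cl_grad \<phi>)))) - l2_of \<Omega> (cl_grad \<phi>))"
      by (rule C(2)[OF P(1)[OF y] \<phi>])
    then show ?thesis using P(2)[OF y] by simp
  qed
  define f where "f y = - inner (l2_of \<Omega> \<rho>) (l2_of \<Omega> (P y))" for y
  have f: "f (l2_of \<Omega> (cl_grad \<phi>)) = - inner (l2_of \<Omega> \<rho>) (l2_of \<Omega> \<phi>)" if "\<phi> \<in> test_functions \<Omega>" for \<phi>
    unfolding f_def Puniq[OF that] ..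
  have L: "\<phi> \<in> L2 \<Omega>" if "\<phi> \<in> test_functions \<Omega>" for \<phi> :: "real^3 \<Rightarrow> real"
    by (rule test_function_L2[OF that domain_measurable])
  obtain v where v: "v \<in> closure grads" "\<And>y. y \<in> grads \<Longrightarrow> inner v y = f y"
  proof (rule riesz_on_subspace[OF subspace_grads, of f "norm (l2_of \<Omega> \<rho>) * C"])
    fix x y assume "x \<in> grads" "y \<in> grads"
    then obtain \<phi> \<psi> where p: "\<phi> \<in> test_functions \<Omega>" "x = l2_of \<Omega> (cl_grad \<phi>)"
      "\<psi> \<in> test_functions \<Omega>" "y = l2_of \<Omega> (cl_grad \<psi>)" unfolding grads_def by blast
    show "f (x + y) = f x + f y"
      unfolding p(2,4) grads_add[OF p(1,3), symmetric] f[OF p(1)] f[OF p(3)] f[OF test_function_add[OF p(1,3)]]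
        l2_of_add[OF domain_measurable L[OF p(1)] L[OF p(3)]]
      by (simp add: inner_add_right)
  next
    fix c x assume "x \<in> grads"
    then obtain \<phi> where p: "\<phi> \<in> test_functions \<Omega>" "x = l2_of \<Omega> (cl_grad \<phi>)" unfolding grads_def by blast
    show "f (c *\<^sub>R x) = c * f x"
      unfolding p(2) grads_scaleR[OF p(1), symmetric] f[OF p(1)] f[OF test_function_scaleR[OF p(1)]]
        l2_of_scaleR[OF domain_measurable L[OF p(1)]]
      by simp
  next
    fix x assume x: "x \<in> grads"
    have z: "l2_of \<Omega> (cl_grad (\<lambda>x. 0 :: real)) = 0"
      using grads_scaleR[OF test_function_zero, of 0] by simp
    have "norm (l2_of \<Omega> (P x)) \<le> C * norm x"
      using C(2)[OF P(1)[OF x] test_function_zero] P(2)[OF x] by (simp add: z)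
    then have "norm (l2_of \<Omega> \<rho>) * norm (l2_of \<Omega> (P x)) \<le> norm (l2_of \<Omega> \<rho>) * (C * norm x)"
      by (intro mult_left_mono) auto
    moreover have "\<bar>f x\<bar> \<le> norm (l2_of \<Omega> \<rho>) * norm (l2_of \<Omega> (P x))"
      unfolding f_def abs_minus_cancel by (rule Cauchy_Schwarz_ineq2)
    ultimately show "\<bar>f x\<bar> \<le> norm (l2_of \<Omega> \<rho>) * C * norm x" by (simp add: mult.assoc)
  qed (use that in blast)
  show thesis
  proof (rule that[OF v(1)])
    fix \<phi> :: "real^3 \<Rightarrow> real" assume \<phi>: "\<phi> \<in> test_functions \<Omega>"
    have "l2_of \<Omega> (cl_grad \<phi>) \<in> grads" unfolding grads_def using \<phi> by (rule imageI)
    then show "inner v (l2_of \<Omega> (cl_grad \<phi>)) = - inner (l2_of \<Omega> \<rho>) (l2_of \<Omega> \<phi>)"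
      using v(2) f[OF \<phi>] by simp
  qed
qed

text \<open>The Friedrichs inequality makes the potentials converge along with their gradients, and
  weak identities pass to the limit. The limits are classes on the whole space; continuity of the
  restriction shows that they vanish outside the domain.\<close>

lemma closure_grads:
  assumes q: "q \<in> closure grads"
  obtains \<phi> \<psi> g where "\<And>n. \<phi> n \<in> test_functions \<Omega>" "(\<lambda>n. l2_of \<Omega> (cl_grad (\<phi> n))) \<longlonglongrightarrow> q"
    "(\<lambda>n. l2_of \<Omega> (\<phi> n)) \<longlonglongrightarrow> l2_of \<Omega> \<psi>" "has_weak_adjoint \<Omega> grad_adjoint \<psi> g" "l2_of \<Omega> g = q"
proof -
  obtain C where C: "C \<ge> 0" "\<And>\<phi> \<psi>. \<phi> \<in> test_functions \<Omega> \<Longrightarrow> \<psi> \<in> test_functions \<Omega> \<Longrightarrow>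
    norm (l2_of \<Omega> \<phi> - l2_of \<Omega> \<psi> :: (real^3, real) l2) \<le> C * norm (l2_of \<Omega> (cl_grad \<phi>) - l2_of \<Omega> (cl_grad \<psi>))"
    using friedrichs_diff by blast
  obtain y where y: "\<And>n. y n \<in> grads" "y \<longlonglongrightarrow> q" using q unfolding closure_sequential by blast
  have "\<forall>n. \<exists>\<phi>. \<phi> \<in> test_functions \<Omega> \<and> y n = l2_of \<Omega> (cl_grad \<phi>)" using y(1) unfolding grads_def by blast
  from choice[OF this] obtain \<phi> where \<phi>: "\<And>n. \<phi> n \<in> test_functions \<Omega>" "\<And>n. y n = l2_of \<Omega> (cl_grad (\<phi> n))"
    by blast
  have gq: "(\<lambda>n. l2_of \<Omega> (cl_grad (\<phi> n))) \<longlonglongrightarrow> q" using y(2) unfolding \<phi>(2)[symmetric] .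
  have "Cauchy (\<lambda>n. l2_of \<Omega> (\<phi> n))"
  proof (rule metric_CauchyI)
    fix e :: real assume e: "e > 0"
    have "Cauchy y" using y(2) by (rule LIMSEQ_imp_Cauchy)
    \<comment> \<open>\<open>C + 1\<close> in place of \<open>C\<close> avoids a division by
      zero.\<close>
    then obtain M where M: "\<And>m n. m \<ge> M \<Longrightarrow> n \<ge> M \<Longrightarrow> dist (y m) (y n) < e / (C + 1)"
      using metric_CauchyD[of y "e / (C + 1)"] e C(1) by auto
    have "dist (l2_of \<Omega> (\<phi> m)) (l2_of \<Omega> (\<phi> n)) < e" if "m \<ge> M" "n \<ge> M" for m n
    proof -
      have "dist (l2_of \<Omega> (\<phi> m)) (l2_of \<Omega> (\<phi> n)) \<le> C * dist (y m) (y n)"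
        unfolding dist_norm \<phi>(2) by (rule C(2)[OF \<phi>(1) \<phi>(1)])
      also have "\<dots> \<le> (C + 1) * dist (y m) (y n)" by (intro mult_right_mono) auto
      also have "\<dots> < (C + 1) * (e / (C + 1))" using M[OF that] C(1) by (intro mult_strict_left_mono) auto
      also have "\<dots> = e" using C(1) by simp
      finally show ?thesis .
    qed
    then show "\<exists>M. \<forall>m\<ge>M. \<forall>n\<ge>M. dist (l2_of \<Omega> (\<phi> m)) (l2_of \<Omega> (\<phi> n)) < e" by blast
  qed
  then obtain X where X: "(\<lambda>n. l2_of \<Omega> (\<phi> n)) \<longlonglongrightarrow> X"
    using Cauchy_convergent convergent_def by blast
  have restr: "restrict_l2 \<Omega> Z = Z" if "(\<lambda>n. l2_of \<Omega> (h n)) \<longlonglongrightarrow> Z" "\<And>n. h n \<in> L2 \<Omega>"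
    for h :: "nat \<Rightarrow> real^3 \<Rightarrow> 'b::euclidean_space" and Z
  proof -
    have "(\<lambda>n. restrict_l2 \<Omega> (l2_of \<Omega> (h n))) \<longlonglongrightarrow> restrict_l2 \<Omega> Z"
      by (rule bounded_linear.tendsto[OF bounded_linear_restrict_l2[OF domain_measurable] that(1)])
    then have "(\<lambda>n. l2_of \<Omega> (h n)) \<longlonglongrightarrow> restrict_l2 \<Omega> Z"
      by (simp add: restrict_l2_idem[OF domain_measurable that(2)])
    then show ?thesis using that(1) by (rule LIMSEQ_unique)
  qed
  have \<phi>L: "\<phi> n \<in> L2 \<Omega>" "cl_grad (\<phi> n) \<in> L2 \<Omega>" for n
    using has_weak_adjointD(1,2)[OF test_function_weak_grad[OF \<phi>(1)]] by blast+
  have Xr: "l2_of \<Omega> (rep_l2 X) = X" "l2_of \<Omega> (rep_l2 q) = q"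
    using restr[OF X \<phi>L(1)] restr[OF gq \<phi>L(2)] by (simp_all add: restrict_l2_def)
  have "has_weak_adjoint \<Omega> grad_adjoint (rep_l2 X) (rep_l2 q)"
  proof (rule weak_adjoint_of_l2[OF open_domain])
    fix \<theta> :: "real^3 \<Rightarrow> real^3" assume \<theta>: "\<theta> \<in> test_functions \<Omega>"
    show "grad_adjoint \<theta> \<in> L2 \<Omega>" by (rule test_function_L2[OF test_function_adjoint(1)[OF \<theta>] domain_measurable])
    have "(\<lambda>n. inner (l2_of \<Omega> (\<phi> n)) (l2_of \<Omega> (grad_adjoint \<theta>))) \<longlonglongrightarrow> inner X (l2_of \<Omega> (grad_adjoint \<theta>))"
      by (intro tendsto_inner X tendsto_const)
    moreover have "(\<lambda>n. inner (l2_of \<Omega> (cl_grad (\<phi> n))) (l2_of \<Omega> \<theta>)) \<longlonglongrightarrow> inner q (l2_of \<Omega> \<theta>)"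
      by (intro tendsto_inner gq tendsto_const)
    moreover have "inner (l2_of \<Omega> (\<phi> n)) (l2_of \<Omega> (grad_adjoint \<theta>)) = inner (l2_of \<Omega> (cl_grad (\<phi> n))) (l2_of \<Omega> \<theta>)" for n
      by (rule has_weak_adjointD(3)[OF test_function_weak_grad[OF \<phi>(1)] \<theta>])
    ultimately show "inner X (l2_of \<Omega> (grad_adjoint \<theta>)) = inner q (l2_of \<Omega> \<theta>)"
      using LIMSEQ_unique by simp
  qed
  moreover have "(\<lambda>n. l2_of \<Omega> (\<phi> n)) \<longlonglongrightarrow> l2_of \<Omega> (rep_l2 X)" using X unfolding Xr .
  ultimately show thesis using that[OF \<phi>(1) gq] Xr(2) by blast
qed

section \<open>Gradients of piecewise polynomials\<close>

definition elem_grad :: "(real^3) set \<Rightarrow> (real^3 \<Rightarrow> real) \<Rightarrow> (real^3, real^3) l2" where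
  "elem_grad K p = l2_of (interior K) (weak_grad (interior K) p)"

lemma elem_grad_eq: "p \<in> poly_le r \<Longrightarrow> K \<in> \<T> \<Longrightarrow> elem_grad K p = l2_of (interior K) (cl_grad p)"
  unfolding elem_grad_def by (rule weak_grad_eq[OF open_interior poly_le_weak_grad])

lemma poly_le_H1: "p \<in> poly_le r \<Longrightarrow> K \<in> \<T> \<Longrightarrow> p \<in> H1 (interior K)"
  by (rule H1I[OF open_interior poly_le_weak_grad])

lemma elem_grad_add: "p \<in> H1 (interior K) \<Longrightarrow> p' \<in> H1 (interior K) \<Longrightarrow> elem_grad K (\<lambda>x. p x + p' x) = elem_grad K p + elem_grad K p'"
  using embedding_add[OF H1_embedding[OF open_interior]] by (simp add: elem_grad_def)

lemma elem_grad_scaleR: "p \<in> H1 (interior K) \<Longrightarrow> elem_grad K (\<lambda>x. c *\<^sub>R p x) = c *\<^sub>R elem_grad K p"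
  using embedding_scaleR[OF H1_embedding[OF open_interior]] by (simp add: elem_grad_def)

lemma elem_grad_sum:
  assumes "\<And>i. i \<in> I \<Longrightarrow> f i \<in> H1 (interior K)"
  shows "elem_grad K (\<lambda>x. \<Sum>i\<in>I. f i x) = (\<Sum>i\<in>I. elem_grad K (f i))"
  using arg_cong[where f = snd, OF embedding_sum[OF H1_embedding[OF open_interior] assms, of I]]
  by (simp add: elem_grad_def snd_sum)

definition poly_grads :: "nat \<Rightarrow> (real^3, real^3) l2 set" where
  "poly_grads r = (\<lambda>p. \<Sum>K\<in>\<T>. elem_grad K (p K)) ` {p. \<forall>K\<in>\<T>. p K \<in> poly_le r}"

lemma subspace_poly_grads: "subspace (poly_grads r)"
  unfolding subspace_def
proof (intro conjI ballI allI)
  note s = linear_subspaceD[OF linear_subspace_poly_le[of r]]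
  have z: "elem_grad K (\<lambda>x. 0) = 0" for K
    using embedding_zero[OF H1_embedding[OF open_interior, of K]] by (simp add: elem_grad_def prod_eq_iff)
  show "0 \<in> poly_grads r"
    unfolding poly_grads_def by (rule image_eqI[of _ _ "\<lambda>K x. 0"]) (simp_all add: z s(1))
  fix x y assume "x \<in> poly_grads r" "y \<in> poly_grads r"
  then obtain p p' where p: "\<forall>K\<in>\<T>. p K \<in> poly_le r" "x = (\<Sum>K\<in>\<T>. elem_grad K (p K))"
    "\<forall>K\<in>\<T>. p' K \<in> poly_le r" "y = (\<Sum>K\<in>\<T>. elem_grad K (p' K))" unfolding poly_grads_def by blast
  have "x + y = (\<Sum>K\<in>\<T>. elem_grad K (\<lambda>x. p K x + p' K x))"
    unfolding p(2,4) sum.distrib[symmetric]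
    using p(1,3) by (intro sum.cong refl elem_grad_add[symmetric] poly_le_H1) auto
  then show "x + y \<in> poly_grads r"
    unfolding poly_grads_def using p(1,3) s(2)
    by (intro image_eqI[where x = "\<lambda>K x. p K x + p' K x"]) simp_all
next
  note s = linear_subspaceD[OF linear_subspace_poly_le[of r]]
  fix c x assume "x \<in> poly_grads r"
  then obtain p where p: "\<forall>K\<in>\<T>. p K \<in> poly_le r" "x = (\<Sum>K\<in>\<T>. elem_grad K (p K))" unfolding poly_grads_def by blast
  have "c *\<^sub>R x = (\<Sum>K\<in>\<T>. elem_grad K (\<lambda>x. c *\<^sub>R p K x))"
    unfolding p(2) scaleR_sum_right
    using p(1) by (intro sum.cong refl elem_grad_scaleR[symmetric] poly_le_H1) auto
  then show "c *\<^sub>R x \<in> poly_grads r"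
    unfolding poly_grads_def using p(1) s(3)
    by (intro image_eqI[where x = "\<lambda>K x. c *\<^sub>R p K x"]) simp_all
qed

lemma elem_grad_poly_grads:
  assumes "K \<in> \<T>" "p \<in> poly_le r"
  shows "elem_grad K p \<in> poly_grads r"
proof -
  note s = linear_subspaceD[OF linear_subspace_poly_le[of r]]
  have z: "elem_grad K (\<lambda>x. 0) = 0" for K
    using embedding_zero[OF H1_embedding[OF open_interior, of K]] by (simp add: elem_grad_def prod_eq_iff)
  have "elem_grad K p = (\<Sum>K'\<in>\<T>. if K' = K then elem_grad K' p else 0)"
    using mesh_finite assms(1) by simp
  also have "\<dots> = (\<Sum>K'\<in>\<T>. elem_grad K' (if K' = K then p else (\<lambda>x. 0)))"
    by (intro sum.cong refl) (simp add: z)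
  finally show ?thesis
    unfolding poly_grads_def using assms(2) s(1)
    by (intro image_eqI[where x = "\<lambda>K'. if K' = K then p else (\<lambda>x. 0)"]) simp_all
qed

lemma poly_grads_finite_span:
  obtains B where "finite B" "span B = poly_grads r"
proof (rule subspace_finite_basis[OF subspace_poly_grads])
  let ?G = "(\<lambda>(K, \<alpha>). elem_grad K (monom3 \<alpha>)) ` (\<T> \<times> deg_le r)"
  show "finite ?G" by (intro finite_imageI finite_cartesian_product mesh_finite finite_deg_le)
  show "poly_grads r \<subseteq> span ?G"
  proof
    fix x assume "x \<in> poly_grads r"
    then obtain p where p: "\<forall>K\<in>\<T>. p K \<in> poly_le r" "x = (\<Sum>K\<in>\<T>. elem_grad K (p K))" unfolding poly_grads_def by blast
    have "elem_grad K (p K) \<in> span ?G" if K: "K \<in> \<T>" for K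
    proof -
      obtain c where "\<And>x. p K x = (\<Sum>\<alpha>\<in>deg_le r. c \<alpha> * monom3 \<alpha> x)"
        using p(1) K unfolding poly_le_iff by blast
      then have c: "p K = (\<lambda>x. \<Sum>\<alpha>\<in>deg_le r. c \<alpha> *\<^sub>R monom3 \<alpha> x)" by auto
      have m: "monom3 \<alpha> \<in> H1 (interior K)" "(\<lambda>x. c \<alpha> *\<^sub>R monom3 \<alpha> x) \<in> H1 (interior K)" if "\<alpha> \<in> deg_le r" for \<alpha>
        by (rule poly_le_H1[OF monom3_poly_le[OF that] K],
            rule poly_le_H1[OF linear_subspaceD(3)[OF linear_subspace_poly_le monom3_poly_le[OF that]] K])
      have "elem_grad K (p K) = (\<Sum>\<alpha>\<in>deg_le r. elem_grad K (\<lambda>x. c \<alpha> *\<^sub>R monom3 \<alpha> x))"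
        unfolding c by (rule elem_grad_sum[OF m(2)])
      also have "\<dots> = (\<Sum>\<alpha>\<in>deg_le r. c \<alpha> *\<^sub>R elem_grad K (monom3 \<alpha>))"
        by (intro sum.cong refl elem_grad_scaleR m)
      also have "\<dots> \<in> span ?G"
      proof (intro span_sum span_scale span_base)
        fix \<alpha> assume "\<alpha> \<in> deg_le r"
        then show "elem_grad K (monom3 \<alpha>) \<in> ?G" using K by (intro image_eqI[of _ _ "(K, \<alpha>)"]) auto
      qed
      finally show ?thesis .
    qed
    then show "x \<in> span ?G" unfolding p(2) by (intro span_sum)
  qed
qed

lemma conforming_potential:
  assumes q: "q \<in> closure grads" "q \<in> poly_grads r"
  obtains \<phi> \<xi> where "\<And>n. \<phi> n \<in> test_functions \<Omega>" "(\<lambda>n. l2_of \<Omega> (cl_grad (\<phi> n))) \<longlonglongrightarrow> q"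
    "(\<lambda>n. l2_of \<Omega> (\<phi> n)) \<longlonglongrightarrow> l2_of \<Omega> \<xi>" "\<xi> \<in> Vh0 \<T> r \<inter> H1_0 \<Omega>" "l2_of \<Omega> (weak_grad \<Omega> \<xi>) = q"
proof -
  obtain \<phi> \<psi> g where \<phi>: "\<And>n. \<phi> n \<in> test_functions \<Omega>" "(\<lambda>n. l2_of \<Omega> (cl_grad (\<phi> n))) \<longlonglongrightarrow> q"
    "(\<lambda>n. l2_of \<Omega> (\<phi> n)) \<longlonglongrightarrow> l2_of \<Omega> \<psi>" and \<psi>: "has_weak_adjoint \<Omega> grad_adjoint \<psi> g" "l2_of \<Omega> g = q"
    using closure_grads[OF q(1)] by blast
  note \<psi>g = has_weak_adjointD(1,2)[OF \<psi>(1)]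
  obtain p where p: "\<forall>K\<in>\<T>. p K \<in> poly_le r" "q = (\<Sum>K\<in>\<T>. elem_grad K (p K))"
    using q(2) unfolding poly_grads_def by blast
  have const: "\<exists>c. AE x in lebesgue_on (interior K). \<psi> x - p K x = c" if K: "K \<in> \<T>" for K
  proof -
    note Km = mesh_element(5)[OF K]
    have pK: "p K \<in> poly_le r" using p(1) K by blast
    note pw = poly_le_weak_grad[OF pK K]
    have gK: "l2_of (interior K) g = l2_of (interior K) (cl_grad (p K))"
    proof -
      \<comment> \<open>Gluing the polynomial gradients gives a representative of \<open>q\<close>;
        restriction to one element then identifies \<open>g\<close> with the gradient of
        \<open>p K\<close> there.\<close>
      let ?G = "\<lambda>x. \<Sum>K'\<in>\<T>. if x \<in> interior K' then cl_grad (p K') x else 0"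
      have G: "?G x = cl_grad (p K') x" if "K' \<in> \<T>" "x \<in> interior K'" for K' x
        using sum_over_elements[OF that, of "\<lambda>K'. cl_grad (p K') x"] by simp
      have cL: "cl_grad (p K') \<in> L2 (interior K')" if "K' \<in> \<T>" for K'
        using has_weak_adjointD(2)[OF poly_le_weak_grad] p(1) that by blast
      note GK = l2_of_cong[OF mesh_element(5) cL G]
      have GL: "?G \<in> L2 \<Omega>" by (rule mesh_L2(1)[OF GK(1)])
      have "l2_of \<Omega> ?G = (\<Sum>K'\<in>\<T>. l2_of (interior K') ?G)" by (rule mesh_L2(2)[OF GK(1)])
      also have "\<dots> = (\<Sum>K'\<in>\<T>. l2_of (interior K') (cl_grad (p K')))" by (intro sum.cong refl GK(2))
      also have "\<dots> = q" unfolding p(2) using p(1) by (intro sum.cong refl elem_grad_eq[symmetric]) auto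
      finally have "l2_of \<Omega> g = l2_of \<Omega> ?G" by (simp add: \<psi>(2))
      then have "restrict_l2 (interior K) (l2_of \<Omega> g) = restrict_l2 (interior K) (l2_of \<Omega> ?G)" by simp
      then have "l2_of (interior K) g = l2_of (interior K) ?G"
        unfolding restrict_l2_Int[OF domain_measurable Km mesh_element(3)[OF K] \<psi>g(2)]
          restrict_l2_Int[OF domain_measurable Km mesh_element(3)[OF K] GL] .
      also have "\<dots> = l2_of (interior K) (cl_grad (p K))" by (rule GK(2)[OF K K K])
      finally show ?thesis .
    qed
    have \<psi>K: "has_weak_adjoint (interior K) grad_adjoint \<psi> g"
      by (rule weak_adjoint_restrict[OF open_domain \<psi>(1) open_interior mesh_element(3)[OF K] test_function_adjoint(1)])
    have "has_weak_adjoint (interior K) grad_adjoint (\<lambda>x. \<psi> x + (- 1) *\<^sub>R p K x) (\<lambda>x. g x + (- 1) *\<^sub>R cl_grad (p K) x)"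
      by (rule weak_adjoint_add[OF open_interior \<psi>K weak_adjoint_scaleR[OF open_interior pw]])
    then have d: "has_weak_adjoint (interior K) grad_adjoint (\<lambda>x. \<psi> x - p K x) (\<lambda>x. g x - cl_grad (p K) x)"
      by simp
    have "l2_of (interior K) (\<lambda>x. g x - cl_grad (p K) x) = 0"
      using l2_of_diff[OF Km has_weak_adjointD(2)[OF \<psi>K] has_weak_adjointD(2)[OF pw]] gK by simp
    then have "has_weak_adjoint (interior K) grad_adjoint (\<lambda>x. \<psi> x - p K x) (\<lambda>x. 0)"
      by (intro weak_adjoint_cong[OF open_interior d refl _ has_weak_adjointD(1)[OF d]]) simp_all
    from weak_grad_zero_imp_constant[OF open_interior mesh_element(2)[OF K] mesh_element(1)[OF K] this]
    show ?thesis by blast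
  qed
  then have "\<exists>c. \<forall>K\<in>\<T>. AE x in lebesgue_on (interior K). \<psi> x - p K x = c K" by (intro bchoice) blast
  then obtain c where c: "\<And>K. K \<in> \<T> \<Longrightarrow> AE x in lebesgue_on (interior K). \<psi> x - p K x = c K" by blast
  \<comment> \<open>The constants are absorbed into the polynomials. Since \<open>Vh0\<close> asks
    for pointwise equality with a polynomial, \<open>\<psi>\<close> will be replaced by the glued
    polynomials, which agree with it almost everywhere.\<close>
  define P where "P K = (\<lambda>x. p K x + c K)" for K
  have P: "P K \<in> poly_le r" if "K \<in> \<T>" for K
    unfolding P_def by (rule linear_subspaceD(2)[OF linear_subspace_poly_le _ poly_le_const]) (use p(1) that in blast)
  define \<xi> where "\<xi> x = (\<Sum>K\<in>\<T>. if x \<in> interior K then P K x else 0)" for x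
  have \<xi>P: "\<xi> x = P K x" if "K \<in> \<T>" "x \<in> interior K" for K x
    unfolding \<xi>_def using sum_over_elements[OF that, of "\<lambda>K. P K x"] by simp
  have \<xi>V: "\<xi> \<in> Vh0 \<T> r" unfolding Vh0_def broken_def using \<xi>P P by blast
  have PL: "P K \<in> L2 (interior K)" if "K \<in> \<T>" for K
    by (rule has_weak_adjointD(1)[OF poly_le_weak_grad[OF P[OF that] that]])
  note \<xi>K = l2_of_cong[OF mesh_element(5) PL \<xi>P]
  have \<xi>L: "\<xi> \<in> L2 \<Omega>" by (rule mesh_L2(1)[OF \<xi>K(1)])
  have "l2_of (interior K) \<xi> = l2_of (interior K) \<psi>" if K: "K \<in> \<T>" for K
  proof -
    have "AE x in lebesgue_on (interior K). P K x = \<psi> x"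
      using c[OF K] by eventually_elim (simp add: P_def)
    then have "l2_of (interior K) (P K) = l2_of (interior K) \<psi>"
      using l2_of_eq_iff[OF mesh_element(5)[OF K] PL[OF K] L2_element[OF \<psi>g(1) K]] by simp
    then show ?thesis using \<xi>K(2)[OF K K K] by simp
  qed
  then have \<xi>\<psi>: "l2_of \<Omega> \<xi> = l2_of \<Omega> \<psi>"
    using mesh_L2(2)[OF L2_element[OF \<xi>L]] mesh_L2(2)[OF L2_element[OF \<psi>g(1)]] by simp
  have \<xi>g: "has_weak_adjoint \<Omega> grad_adjoint \<xi> g"
    by (rule weak_adjoint_cong[OF open_domain \<psi>(1) \<xi>\<psi> refl \<xi>L \<psi>g(2)])
  have \<xi>H1: "\<xi> \<in> H1 \<Omega>" by (rule H1I[OF open_domain \<xi>g])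
  have \<xi>q: "l2_of \<Omega> (weak_grad \<Omega> \<xi>) = q" unfolding weak_grad_eq[OF open_domain \<xi>g] by (rule \<psi>(2))
  have \<xi>lim: "(\<lambda>n. l2_of \<Omega> (\<phi> n)) \<longlonglongrightarrow> l2_of \<Omega> \<xi>" unfolding \<xi>\<psi> by (rule \<phi>(3))
  \<comment> \<open>For test functions the boundary flux vanishes by the definition of the weak
    divergence, and it passes to the limit along the converging potentials and gradients.\<close>
  have "bdry_flux \<Omega> \<xi> w = 0" if w: "w \<in> Hdiv \<Omega>" for w
  proof -
    note ww = weak_div_works[OF open_domain w]
    have "(\<lambda>n. inner (l2_of \<Omega> (cl_grad (\<phi> n))) (l2_of \<Omega> w) + inner (l2_of \<Omega> (\<phi> n)) (l2_of \<Omega> (weak_div \<Omega> w)))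
        \<longlonglongrightarrow> inner q (l2_of \<Omega> w) + inner (l2_of \<Omega> \<xi>) (l2_of \<Omega> (weak_div \<Omega> w))"
      by (intro tendsto_intros \<phi>(2) \<xi>lim)
    moreover have "inner (l2_of \<Omega> (cl_grad (\<phi> n))) (l2_of \<Omega> w) + inner (l2_of \<Omega> (\<phi> n)) (l2_of \<Omega> (weak_div \<Omega> w)) = 0" for n
    proof -
      have "inner (l2_of \<Omega> w) (l2_of \<Omega> (div_adjoint (\<phi> n))) = inner (l2_of \<Omega> (weak_div \<Omega> w)) (l2_of \<Omega> (\<phi> n))"
        by (rule has_weak_adjointD(3)[OF ww \<phi>(1)])
      moreover have "l2_of \<Omega> (div_adjoint (\<phi> n)) = - l2_of \<Omega> (cl_grad (\<phi> n))"
        by (rule l2_of_uminus[OF domain_measurable has_weak_adjointD(2)[OF test_function_weak_grad[OF \<phi>(1)]]])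
      ultimately show ?thesis by (simp add: inner_commute)
    qed
    ultimately have "inner q (l2_of \<Omega> w) + inner (l2_of \<Omega> \<xi>) (l2_of \<Omega> (weak_div \<Omega> w)) = 0"
      by (simp add: LIMSEQ_const_iff)
    then show ?thesis by (simp add: bdry_flux_eq[OF open_domain \<xi>H1 w] \<xi>q)
  qed
  then have "\<xi> \<in> Vh0 \<T> r \<inter> H1_0 \<Omega>" using \<xi>V \<xi>H1 by (simp add: H1_0_def)
  from that[OF \<phi>(1,2) \<xi>lim this \<xi>q] show thesis .
qed

lemma initial_flux:
  assumes L: "D \<in> L2 \<Omega>" "\<rho> \<in> L2 \<Omega>" and conf: "conforming_charge_constraint \<Omega> \<T> r D \<rho>"
  obtains w where "w \<in> Hdiv \<Omega>" "element_charge_constraint \<T> r D w \<rho>" "div_charge_constraint \<Omega> w \<rho>"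
proof -
  obtain v where v: "v \<in> closure grads"
    "\<And>\<phi>. \<phi> \<in> test_functions \<Omega> \<Longrightarrow> inner v (l2_of \<Omega> (cl_grad \<phi>)) = - inner (l2_of \<Omega> \<rho>) (l2_of \<Omega> \<phi>)"
    using divergence_solution[OF L(2)] by blast
  \<comment> \<open>Weakly divergence free fields: adding one of them to \<open>v\<close> leaves the
    divergence unchanged.\<close>
  define M where "M = {z. \<forall>y\<in>grads. inner z y = 0}"
  have M: "subspace M" unfolding M_def subspace_def by (auto simp: inner_add_left)
  obtain B where B: "finite B" "span B = poly_grads r" by (rule poly_grads_finite_span)
  obtain n b m where bm: "\<forall>i<n. b i \<in> span B \<and> m i \<in> M" and
    rep: "\<forall>f. (\<forall>x\<in>span B. (\<forall>y\<in>M. inner y x = 0) \<longrightarrow> inner f x = 0) \<longrightarrow>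
      (\<forall>x\<in>span B. inner f x = (\<Sum>i<(n::nat). inner f (b i) * inner (m i) x))"
    using finite_dim_solvability[OF B(1) M] by blast
  let ?f = "l2_of \<Omega> D - v"
  have ok: "inner ?f q = 0" if q: "q \<in> poly_grads r" "\<And>y. y \<in> M \<Longrightarrow> inner y q = 0" for q
  proof -
    \<comment> \<open>\<open>u\<close> is the orthogonal projection of \<open>q\<close> onto the
      closure of \<open>grads\<close>. The difference \<open>q - u\<close> lies in \<open>M\<close>,
      so it is orthogonal to \<open>q\<close> as well as to \<open>u\<close>, and therefore
      zero.\<close>
    obtain u where u: "u \<in> closure grads" "\<And>y. y \<in> grads \<Longrightarrow> inner u y = inner q y"
      using riesz_on_subspace[OF subspace_grads, of "inner q" "norm q"]
      by (auto simp: inner_add_right Cauchy_Schwarz_ineq2)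
    have "q - u \<in> M" using u(2) by (simp add: M_def inner_diff_left)
    then have 1: "inner (q - u) q = 0" by (rule q(2))
    have "closed {y. inner (q - u) y = 0}" by (intro closed_Collect_eq continuous_intros)
    then have "closure grads \<subseteq> {y. inner (q - u) y = 0}"
      using u(2) by (intro closure_minimal) (auto simp: inner_diff_left)
    then have "inner (q - u) u = 0" using u(1) by blast
    then have "inner (q - u) (q - u) = 0" using 1 by (simp only: inner_diff_right)
    then have "q \<in> closure grads" using u(1) by simp
    then obtain \<phi> \<xi> where \<phi>: "\<And>n. \<phi> n \<in> test_functions \<Omega>" "(\<lambda>n. l2_of \<Omega> (cl_grad (\<phi> n))) \<longlonglongrightarrow> q"
      "(\<lambda>n. l2_of \<Omega> (\<phi> n)) \<longlonglongrightarrow> l2_of \<Omega> \<xi>" and \<xi>: "\<xi> \<in> Vh0 \<T> r \<inter> H1_0 \<Omega>" "l2_of \<Omega> (weak_grad \<Omega> \<xi>) = q"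
      using conforming_potential[OF _ q(1)] by blast
    \<comment> \<open>The divergence equation for \<open>v\<close> extends from test functions to
      the limit \<open>\<xi>\<close>; the conforming constraint then says precisely that
      \<open>q\<close> has the same pairing with \<open>D\<close> as with \<open>v\<close>.\<close>
    have "(\<lambda>n. inner v (l2_of \<Omega> (cl_grad (\<phi> n)))) \<longlonglongrightarrow> inner v q" by (intro tendsto_intros \<phi>(2))
    moreover have "(\<lambda>n. - inner (l2_of \<Omega> \<rho>) (l2_of \<Omega> (\<phi> n))) \<longlonglongrightarrow> - inner (l2_of \<Omega> \<rho>) (l2_of \<Omega> \<xi>)"
      by (intro tendsto_intros \<phi>(3))
    ultimately have vq: "inner v q = - inner (l2_of \<Omega> \<rho>) (l2_of \<Omega> \<xi>)"
      unfolding v(2)[OF \<phi>(1)] by (rule LIMSEQ_unique)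
    have "\<xi> \<in> H1 \<Omega>" using \<xi>(1) by (simp add: H1_0_def)
    note \<xi>L = has_weak_adjointD(1,2)[OF weak_grad_works[OF open_domain this]]
    have "(LINT x|lebesgue_on \<Omega>. weak_grad \<Omega> \<xi> x \<bullet> D x + \<xi> x * \<rho> x) =
        (LINT x|lebesgue_on \<Omega>. weak_grad \<Omega> \<xi> x \<bullet> D x) + (LINT x|lebesgue_on \<Omega>. \<xi> x * \<rho> x)"
      by (rule Bochner_Integration.integral_add[OF L2_inner_integrable[OF \<xi>L(2) L(1)] L2_mult_integrable[OF \<xi>L(1) L(2)]])
    also have "\<dots> = inner q (l2_of \<Omega> D) + inner (l2_of \<Omega> \<xi>) (l2_of \<Omega> \<rho>)"
      using inner_l2_of[OF domain_measurable \<xi>L(2) L(1)] inner_l2_of[OF domain_measurable \<xi>L(1) L(2)]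
      by (simp add: \<xi>(2))
    finally have "inner q (l2_of \<Omega> D) + inner (l2_of \<Omega> \<xi>) (l2_of \<Omega> \<rho>) = 0"
      using conf \<xi>(1) unfolding conforming_charge_constraint_def by simp
    then show ?thesis using vq by (simp add: inner_diff_left inner_diff_right inner_commute)
  qed
  have sol: "inner ?f q = (\<Sum>i<n. inner ?f (b i) * inner (m i) q)" if "q \<in> poly_grads r" for q
    using rep ok that unfolding B(2) by blast
  \<comment> \<open>The correction reproduces all moments of \<open>l2_of \<Omega> D - v\<close>
    against piecewise gradients without disturbing the divergence.\<close>
  define z where "z = (\<Sum>i<n. inner ?f (b i) *\<^sub>R m i)"
  have zM: "z \<in> M" unfolding z_def using bm M by (intro subspace_sum subspace_scale) auto
  define W where "W = v + z"
  define w where "w = rep_l2 W"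
  have ww: "has_weak_adjoint \<Omega> div_adjoint w (rep_l2 (l2_of \<Omega> \<rho>))"
    unfolding w_def
  proof (rule weak_adjoint_of_l2[OF open_domain])
    fix \<phi> :: "real^3 \<Rightarrow> real" assume \<phi>: "\<phi> \<in> test_functions \<Omega>"
    show "div_adjoint \<phi> \<in> L2 \<Omega>" by (rule test_function_L2[OF test_function_adjoint(2)[OF \<phi>] domain_measurable])
    have "l2_of \<Omega> (cl_grad \<phi>) \<in> grads" unfolding grads_def using \<phi> by (rule imageI)
    then have "inner z (l2_of \<Omega> (cl_grad \<phi>)) = 0" using zM by (simp add: M_def)
    then have "inner W (l2_of \<Omega> (cl_grad \<phi>)) = - inner (l2_of \<Omega> \<rho>) (l2_of \<Omega> \<phi>)"
      using v(2)[OF \<phi>] by (simp add: W_def inner_add_left)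
    moreover have "l2_of \<Omega> (div_adjoint \<phi>) = - l2_of \<Omega> (cl_grad \<phi>)"
      by (rule l2_of_uminus[OF domain_measurable has_weak_adjointD(2)[OF test_function_weak_grad[OF \<phi>]]])
    ultimately show "inner W (l2_of \<Omega> (div_adjoint \<phi>)) = inner (l2_of \<Omega> \<rho>) (l2_of \<Omega> \<phi>)" by simp
  qed
  have w: "w \<in> Hdiv \<Omega>" by (rule HdivI[OF open_domain ww])
  have div: "l2_of \<Omega> (weak_div \<Omega> w) = l2_of \<Omega> \<rho>"
    unfolding weak_div_eq[OF open_domain ww] using restrict_l2_idem[OF domain_measurable L(2)]
    by (simp add: restrict_l2_def)
  have "inner (l2_of (interior K) (cl_grad p)) (l2_of \<Omega> D - l2_of \<Omega> w) = 0" if K: "K \<in> \<T>" and p: "p \<in> poly_le r" for K p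
  proof -
    note gL = has_weak_adjointD(2)[OF poly_le_weak_grad[OF p K]]
    let ?q = "l2_of (interior K) (cl_grad p)"
    have q: "?q \<in> poly_grads r" using elem_grad_poly_grads[OF K p] by (simp only: elem_grad_eq[OF p K])
    have wL: "w \<in> L2 UNIV" unfolding w_def by (rule rep_l2)
    \<comment> \<open>\<open>W\<close> is a class on the whole space and need not vanish outside the
      domain; pairing with a class supported in one element ignores the difference.\<close>
    have "inner (l2_of \<Omega> w) ?q = inner (l2_of (interior K) w) ?q"
      by (rule inner_l2_of_Int[OF domain_measurable mesh_element(5)[OF K] mesh_element(3)[OF K]
            has_weak_adjointD(1)[OF ww] gL])
    also have "\<dots> = inner (l2_of UNIV w) ?q"
      by (rule inner_l2_of_restrict[OF mesh_element(5)[OF K] wL gL, symmetric])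
    also have "l2_of UNIV w = W" unfolding w_def by (rule rep_l2)
    finally have "inner (l2_of \<Omega> D - l2_of \<Omega> w) ?q = inner ?f ?q - inner z ?q"
      by (simp add: inner_diff_left W_def inner_add_left)
    also have "inner z ?q = inner ?f ?q" unfolding sol[OF q] z_def by (simp add: inner_sum_left)
    finally show ?thesis by (simp add: inner_commute)
  qed
  \<comment> \<open>As the divergence of \<open>w\<close> is \<open>\<rho>\<close>, the zeroth order
    terms cancel and only the moments against gradients remain.\<close>
  then have "element_charge_constraint \<T> r D w \<rho>"
    unfolding element_charge_constraint_iff[OF L w] by (simp add: div)
  moreover have "div_charge_constraint \<Omega> w \<rho>" unfolding div_charge_constraint_iff[OF L(2) w] by (rule div)
  ultimately show thesis using that[OF w] by blast
qed

end

theorem corollary4p6: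
  fixes \<Omega> :: "(real^3) set" and \<T> :: "(real^3) set set"
    and k :: nedelec_kind and r :: nat
  assumes "lipschitz_domain \<Omega>" and "bounded \<Omega>"
    and "tetrahedral_mesh \<Omega> \<T>"
    and "admissible_order k r"
  shows "\<exists>V. linear_subspace V \<and> V \<subseteq> Hcurl \<Omega> \<and>
    (\<forall>T t0 \<epsilon> \<mu> J \<rho>. maxwell_data \<Omega> T t0 \<epsilon> \<mu> J \<rho> \<longrightarrow>
      (\<forall>A. nedelec_solution \<Omega> \<T> k r T \<epsilon> \<mu> J A \<longleftrightarrow>
           (\<exists>Hhat. hybrid_solution \<Omega> \<T> k r T \<epsilon> \<mu> J V A Hhat)) \<and>
      (\<forall>A. nedelec_solution \<Omega> \<T> k r T \<epsilon> \<mu> J A \<longrightarrow>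
        (\<exists>Hhat. hybrid_solution \<Omega> \<T> k r T \<epsilon> \<mu> J V A Hhat \<and>
          (\<exists>Dhat. ampere_flux \<Omega> T J Hhat Dhat) \<and>
          (\<forall>Dhat. ampere_flux \<Omega> T J Hhat Dhat \<longrightarrow>
            (element_charge_constraint \<T> r (Dh \<T> k r T \<epsilon> A t0) (Dhat t0) (\<rho> t0) \<longrightarrow>
              (\<forall>t\<in>T. element_charge_constraint \<T> r (Dh \<T> k r T \<epsilon> A t) (Dhat t) (\<rho> t))) \<and>
            (div_charge_constraint \<Omega> (Dhat t0) (\<rho> t0) \<longrightarrow>
              (\<forall>t\<in>T. div_charge_constraint \<Omega> (Dhat t) (\<rho> t)))) \<and>
          (conforming_charge_constraint \<Omega> \<T> r (Dh \<T> k r T \<epsilon> A t0) (\<rho> t0) \<longrightarrow>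
            (\<exists>Dhat. ampere_flux \<Omega> T J Hhat Dhat \<and>
              element_charge_constraint \<T> r (Dh \<T> k r T \<epsilon> A t0) (Dhat t0) (\<rho> t0) \<and>
              div_charge_constraint \<Omega> (Dhat t0) (\<rho> t0) \<and>
              (\<forall>t\<in>T. element_charge_constraint \<T> r (Dh \<T> k r T \<epsilon> A t) (Dhat t) (\<rho> t) \<and>
                       div_charge_constraint \<Omega> (Dhat t) (\<rho> t)))))))"
proof -
  interpret mesh_domain \<Omega> \<T> by unfold_locales (fact assms)+
  show ?thesis
  \<comment> \<open>The hybrid space has to be chosen before the time interval and the data;
    \<open>Hcurl \<Omega>\<close> depends on the domain only.\<close>
  proof (rule exI[of _ "Hcurl \<Omega>"], intro conjI allI impI)
    show "linear_subspace (Hcurl \<Omega>)" by (rule linear_subspace_Hcurl[OF open_domain])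
  next
    fix T t0 \<epsilon> \<mu> J \<rho> A
    assume data: "maxwell_data \<Omega> T t0 \<epsilon> \<mu> J \<rho>"
    interpret maxwell_problem \<Omega> \<T> T t0 \<epsilon> \<mu> J \<rho> k r by unfold_locales (rule data)
    show "nedelec_solution \<Omega> \<T> k r T \<epsilon> \<mu> J A \<longleftrightarrow>
        (\<exists>Hhat. hybrid_solution \<Omega> \<T> k r T \<epsilon> \<mu> J (Hcurl \<Omega>) A Hhat)"
      using nedelec_imp_hybrid hybrid_imp_nedelec by blast
    assume "nedelec_solution \<Omega> \<T> k r T \<epsilon> \<mu> J A"
    then obtain Hhat where hyb: "hybrid_solution \<Omega> \<T> k r T \<epsilon> \<mu> J (Hcurl \<Omega>) A Hhat"
      using nedelec_imp_hybrid by blast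
    then have Hhat: "C0_curve (Hcurl_norm \<Omega>) (Hcurl \<Omega>) T Hhat" and reg: "regular_fields \<Omega> \<T> k r T \<epsilon> \<mu> A"
      by (simp_all add: hybrid_solution_def)
    note cons = charge_conservation[OF hyb]
    \<comment> \<open>For mere existence of a flux any initial value will do.\<close>
    have "(\<lambda>x. 0) \<in> Hdiv \<Omega>" by (rule HdivI[OF open_domain weak_adjoint_zero[OF open_domain]])
    then obtain Dhat where Dhat: "ampere_flux \<Omega> T J Hhat Dhat" by (rule ampere_flux_exists[OF Hhat])
    have init: "\<exists>Dhat. ampere_flux \<Omega> T J Hhat Dhat \<and>
          element_charge_constraint \<T> r (Dh \<T> k r T \<epsilon> A t0) (Dhat t0) (\<rho> t0) \<and>
          div_charge_constraint \<Omega> (Dhat t0) (\<rho> t0) \<and>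
          (\<forall>t\<in>T. element_charge_constraint \<T> r (Dh \<T> k r T \<epsilon> A t) (Dhat t) (\<rho> t) \<and>
                   div_charge_constraint \<Omega> (Dhat t) (\<rho> t))"
      if conf: "conforming_charge_constraint \<Omega> \<T> r (Dh \<T> k r T \<epsilon> A t0) (\<rho> t0)"
    proof -
      note D0 = D_derivative(1)[OF reg interval(2)] and \<rho>0 = \<rho>_derivative(1)[OF interval(2)]
      obtain w where w: "w \<in> Hdiv \<Omega>" "element_charge_constraint \<T> r (Dh \<T> k r T \<epsilon> A t0) w (\<rho> t0)"
          "div_charge_constraint \<Omega> w (\<rho> t0)"
        by (rule initial_flux[OF D0 \<rho>0 conf])
      obtain E where E: "ampere_flux \<Omega> T J Hhat E" "l2_of \<Omega> (E t0) = l2_of \<Omega> w"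
          "l2_of \<Omega> (weak_div \<Omega> (E t0)) = l2_of \<Omega> (weak_div \<Omega> w)"
        by (rule ampere_flux_exists[OF Hhat w(1)])
      \<comment> \<open>\<open>E t0\<close> agrees with \<open>w\<close> only as a class, so the
        constraints are transferred through their characterisations by classes.\<close>
      note E0 = ampere_flux_derivative(1)[OF Hhat E(1) interval(2)]
      have "element_charge_constraint \<T> r (Dh \<T> k r T \<epsilon> A t0) (E t0) (\<rho> t0)"
        using w(2) unfolding element_charge_constraint_iff[OF D0 \<rho>0 w(1)] element_charge_constraint_iff[OF D0 \<rho>0 E0] E(2,3) .
      moreover have "div_charge_constraint \<Omega> (E t0) (\<rho> t0)"
        using w(3) unfolding div_charge_constraint_iff[OF \<rho>0 w(1)] div_charge_constraint_iff[OF \<rho>0 E0] E(3) .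
      ultimately show ?thesis using E(1) cons[OF E(1)] by blast
    qed
    show "\<exists>Hhat. hybrid_solution \<Omega> \<T> k r T \<epsilon> \<mu> J (Hcurl \<Omega>) A Hhat \<and>
          (\<exists>Dhat. ampere_flux \<Omega> T J Hhat Dhat) \<and>
          (\<forall>Dhat. ampere_flux \<Omega> T J Hhat Dhat \<longrightarrow>
            (element_charge_constraint \<T> r (Dh \<T> k r T \<epsilon> A t0) (Dhat t0) (\<rho> t0) \<longrightarrow>
              (\<forall>t\<in>T. element_charge_constraint \<T> r (Dh \<T> k r T \<epsilon> A t) (Dhat t) (\<rho> t))) \<and>
            (div_charge_constraint \<Omega> (Dhat t0) (\<rho> t0) \<longrightarrow>
              (\<forall>t\<in>T. div_charge_constraint \<Omega> (Dhat t) (\<rho> t)))) \<and>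
          (conforming_charge_constraint \<Omega> \<T> r (Dh \<T> k r T \<epsilon> A t0) (\<rho> t0) \<longrightarrow>
            (\<exists>Dhat. ampere_flux \<Omega> T J Hhat Dhat \<and>
              element_charge_constraint \<T> r (Dh \<T> k r T \<epsilon> A t0) (Dhat t0) (\<rho> t0) \<and>
              div_charge_constraint \<Omega> (Dhat t0) (\<rho> t0) \<and>
              (\<forall>t\<in>T. element_charge_constraint \<T> r (Dh \<T> k r T \<epsilon> A t) (Dhat t) (\<rho> t) \<and>
                       div_charge_constraint \<Omega> (Dhat t) (\<rho> t))))"
      using hyb Dhat cons init by (intro exI[of _ Hhat]) blast
  qed simp
qed

end
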